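(* Let $k$ be a field, $R$ a $k$-algebra and $(\mathbb H,A,C)$ a right Doi-Koppinen datum, i.e. $\mathbb H$ is a right $R$-bialgebroid, $A$ is a right $\mathbb H$-comodule algebra and $C$ is a right $\mathbb H$-module coalgebra. Let $i:R\to A$, $i(r)=r\cdot1_A=1_A\cdot r$. Then: (i) $(A,C)$ is a cowreath in the monoidal category ${}_R\mathcal M_R$ of $R$-bimodules, via $\psi:C\otimes_RA\to A\otimes_RC$, $\psi(c\otimes_Ra)=a_{\langle0\rangle}\otimes_Rc\cdot a_{\langle1\rangle}$, and $\delta:C\to A\otimes_RC\otimes_RC$, $\delta=i\otimes_R\Delta_C$ (that is, $\delta(c)=1_A\otimes_R c_1\otimes_R c_2$), and $f=i\circ\varepsilon_C:C\to A$. (ii) The bifunctor $\otimes_R$ defines a right ${}_R\mathcal M_R$-category structure on the category $\mathcal M_R$ of right $R$-modules, and the category of right corepresentations in $\mathcal M_R$ over the $A$-coring $\mathfrak C=A\otimes_RC$ corresponding to the cowreath $(A,C)$ of (i) can be identified with the category of right corepresentations over the $A$-coring $\mathfrak C$ viewed in ${}_k\mathcal M$ (i.e. right comodules over $\mathfrak C$ as an ordinary $A$-coring), and is isomorphic to the category $\mathcal{DK}(\mathbb H)_A^C$ of right $(\mathbb H,A,C)$-modules.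
   Context: Right $R$-bialgebroid $\mathbb H$: a $k$-algebra $\mathbb H$ with algebra maps $s:R\to\mathbb H$, $t:R^{op}\to\mathbb H$ with commuting images; with the $R$-bimodule structure $r\cdot h\cdot r'=h\,t(r)s(r')$, $\mathbb H$ is an $R$-coring $(\mathbb H,\widetilde\Delta,\widetilde\varepsilon)$, $\widetilde\Delta(h)=h_1\otimes_Rh_2$, such that $\widetilde\Delta$ takes values in $\mathbb H\times_R\mathbb H=\{\sum x_i\otimes_Ry_i\mid\sum s(r)x_i\otimes_Ry_i=\sum x_i\otimes_Rt(r)y_i\ \forall r\in R\}$ (an algebra under componentwise multiplication), $\widetilde\Delta:\mathbb H\to\mathbb H\times_R\mathbb H$ is an algebra map, $\widetilde\varepsilon(1)=1_R$ and $\widetilde\varepsilon(t(\widetilde\varepsilon(h))h')=\widetilde\varepsilon(hh')=\widetilde\varepsilon(s(\widetilde\varepsilon(h))h')$. A right $\mathbb H$-comodule is a right $R$-module $M$ with a coassociative counital right $R$-linear map $\rho_M:M\to M\otimes_R\mathbb H$, $m\mapsto m_{\langle0\rangle}\otimes_Rm_{\langle1\rangle}$. It becomes an $R$-bimodule via $r\cdot m=m_{\langle0\rangle}\cdot\widetilde\varepsilon(s(r)m_{\langle1\rangle})$; then $\rho_M$ is $R$-bilinear (where $r\cdot(m\otimes_Rh)=m\otimes_Rs(r)h$) and has image in $\{\sum x_i\otimes_Ry_i\mid\sum r\cdot x_i\otimes_Ry_i=\sum x_i\otimes_Rt(r)y_i\}$. The category $\mathcal M^{\mathbb H}$ is monoidal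 with $\otimes_R$, coaction $m\otimes_Rn\mapsto m_{\langle0\rangle}\otimes_Rn_{\langle0\rangle}\otimes_Rm_{\langle1\rangle}n_{\langle1\rangle}$, and unit $R$ with coaction $r\mapsto1_R\otimes_Rs(r)$. A right $\mathbb H$-comodule algebra is an algebra in $\mathcal M^{\mathbb H}$. The category $\mathcal M_{\mathbb H}$ of right $\mathbb H$-modules is monoidal with $\otimes_R$ (bimodule structure $r\cdot c\cdot r'=c\cdot t(r)s(r')$), action via $\widetilde\Delta$, and unit $R$ with action $r\cdot h=\widetilde\varepsilon(s(r)h)=\widetilde\varepsilon(t(r)h)$. A right $\mathbb H$-module coalgebra is a coalgebra $(C,\Delta_C,\varepsilon_C)$ in $\mathcal M_{\mathbb H}$. A right $(\mathbb H,A,C)$-module is a vector space $M$ that is a right $A$-module (hence a right $R$-module via $i$) and a right $C$-comodule with coaction $M\to M\otimes_RC$, $m\mapsto m_{(0)}\otimes_Rm_{(1)}$ ($C$ viewed as an $R$-coring), such that $(m\cdot a)_{(0)}\otimes_R(m\cdot a)_{(1)}=m_{(0)}\cdot a_{\langle0\rangle}\otimes_Rm_{(1)}\cdot a_{\langle1\rangle}$. $\mathcal{DK}(\mathbb H)_A^C$ is their category, with right $A$-linear right $C$-colinear maps. A cowreath $(A,X)$ in a monoidal category $(\mathcal C,\otimes)$ (identities denoted by objects): an algebra $(A,m_A,\eta_A)$, an object $X$, and morphisms $\psi:X\otimes A\to A\otimes X$, $\delta:X\to A\otimes X\otimes X$, $f:X\to A$ satisfying $\psi(X\otimes m_A)=(m_A\otimes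 X)(A\otimes\psi)(\psi\otimes A)$, $\psi(X\otimes\eta_A)=\eta_A\otimes X$; $(m_A\otimes X\otimes X)(A\otimes\delta)\psi=(m_A\otimes X\otimes X)(A\otimes\psi\otimes X)(A\otimes X\otimes\psi)(\delta\otimes A)$; $(m_A\otimes X^{\otimes3})(A\otimes\psi\otimes X^{\otimes2})(A\otimes X\otimes\delta)\delta=(m_A\otimes X^{\otimes3})(A\otimes\delta\otimes X)\delta$; $m_A(A\otimes f)\psi=m_A(f\otimes A)$; $(m_A\otimes X)(A\otimes f\otimes X)\delta=\eta_A\otimes X=(m_A\otimes X)(A\otimes\psi)(A\otimes X\otimes f)\delta$. The corresponding $A$-coring is $\mathfrak C=A\otimes X$, a coalgebra in the monoidal category of $A$-bimodules in $\mathcal C$ under $\otimes_A$, with left action $m_A\otimes X$, right action $(m_A\otimes X)(A\otimes\psi)$, comultiplication $\Upsilon^{-1}(m_A\otimes X\otimes X)(A\otimes\delta)$ with $\Upsilon:\mathfrak C\otimes_A\mathfrak C\cong\mathfrak C\otimes X$ canonical, and counit $m_A(A\otimes f)$. A right $\mathcal C$-category is a category $\mathcal D$ with an associative and unital (up to coherent isomorphism) action functor $\mathcal D\times\mathcal C\to\mathcal D$. For $\mathcal D=\mathcal M_R$, $\mathcal C={}_R\mathcal M_R$: a right corepresentation in $\mathcal M_R$ over $\mathfrak C$ is a right $R$-module $M$ with an associative unital right $R$-linear action $M\otimes_RA\to M$ and a coassociative counital right $A$-linear coaction $M\to M\otimes_A\mathfrak C$ in $\mathcal M_R$. *)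

theory Defs
  imports "HOL-Algebra.Module"
begin

section \<open>Categories, monoidal categories and their actions\<close>

record ('o, 'a) cat =
  Ob :: "'o set"
  Ar :: "'a set"
  Dom :: "'a \<Rightarrow> 'o"
  Cod :: "'a \<Rightarrow> 'o"
  Idn :: "'o \<Rightarrow> 'a" (\<open>\<I>\<index>\<close>)
  Cmp :: "'a \<Rightarrow> 'a \<Rightarrow> 'a" (infixr \<open>\<cdot>\<index>\<close> 55)

definition Hom :: "('o, 'a, 'z) cat_scheme \<Rightarrow> 'o \<Rightarrow> 'o \<Rightarrow> 'a set" where
  "Hom C x y = {f \<in> Ar C. Dom C f = x \<and> Cod C f = y}"

locale category =
  fixes C :: "('o, 'a, 'z) cat_scheme" (structure)
  assumes dom_ob: "f \<in> Ar C \<Longrightarrow> Dom C f \<in> Ob C"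
    and cod_ob: "f \<in> Ar C \<Longrightarrow> Cod C f \<in> Ob C"
    and id_hom: "x \<in> Ob C \<Longrightarrow> \<I> x \<in> Hom C x x"
    and cmp_hom: "\<lbrakk>f \<in> Hom C x y; g \<in> Hom C y z\<rbrakk> \<Longrightarrow> g \<cdot> f \<in> Hom C x z"
    and id_right: "f \<in> Hom C x y \<Longrightarrow> f \<cdot> \<I> x = f"
    and id_left: "f \<in> Hom C x y \<Longrightarrow> \<I> y \<cdot> f = f"
    and cmp_assoc: "\<lbrakk>f \<in> Hom C w x; g \<in> Hom C x y; h \<in> Hom C y z\<rbrakk> \<Longrightarrow> (h \<cdot> g) \<cdot> f = h \<cdot> (g \<cdot> f)"

definition is_inverse :: "('o, 'a, 'z) cat_scheme \<Rightarrow> 'a \<Rightarrow> 'a \<Rightarrow> bool" where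
  "is_inverse C f g \<longleftrightarrow> f \<in> Ar C \<and> g \<in> Hom C (Cod C f) (Dom C f) \<and>
     g \<cdot>\<^bsub>C\<^esub> f = \<I>\<^bsub>C\<^esub> (Dom C f) \<and> f \<cdot>\<^bsub>C\<^esub> g = \<I>\<^bsub>C\<^esub> (Cod C f)"

definition iso_arrow :: "('o, 'a, 'z) cat_scheme \<Rightarrow> 'a \<Rightarrow> bool" where
  "iso_arrow C f \<longleftrightarrow> (\<exists>g. is_inverse C f g)"

definition inv_arrow :: "('o, 'a, 'z) cat_scheme \<Rightarrow> 'a \<Rightarrow> 'a" where
  "inv_arrow C f = (THE g. is_inverse C f g)"

definition functor_on ::
  "('o, 'a, 'y) cat_scheme \<Rightarrow> ('p, 'b, 'z) cat_scheme \<Rightarrow> ('o \<Rightarrow> 'p) \<Rightarrow> ('a \<Rightarrow> 'b) \<Rightarrow> bool" where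
  "functor_on C D Fo Fa \<longleftrightarrow> category C \<and> category D \<and>
     (\<forall>x \<in> Ob C. Fo x \<in> Ob D) \<and>
     (\<forall>f \<in> Ar C. Fa f \<in> Hom D (Fo (Dom C f)) (Fo (Cod C f))) \<and>
     (\<forall>x \<in> Ob C. Fa (\<I>\<^bsub>C\<^esub> x) = \<I>\<^bsub>D\<^esub> (Fo x)) \<and>
     (\<forall>f \<in> Ar C. \<forall>g \<in> Ar C. Cod C f = Dom C g \<longrightarrow> Fa (g \<cdot>\<^bsub>C\<^esub> f) = Fa g \<cdot>\<^bsub>D\<^esub> Fa f)"

definition category_isomorphism ::
  "('o, 'a, 'y) cat_scheme \<Rightarrow> ('p, 'b, 'z) cat_scheme \<Rightarrow> ('o \<Rightarrow> 'p) \<Rightarrow> ('a \<Rightarrow> 'b) \<Rightarrow> bool" where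
  "category_isomorphism C D Fo Fa \<longleftrightarrow> functor_on C D Fo Fa \<and>
     bij_betw Fo (Ob C) (Ob D) \<and> bij_betw Fa (Ar C) (Ar D)"

text \<open>The category whose arrows \<open>x \<rightarrow> y\<close> are the arrows \<open>U x \<rightarrow> U y\<close> of \<open>D\<close> that satisfy \<open>P\<close>
  (objects of \<open>D\<close> with additional structure).\<close>

definition structured_cat ::
  "('p, 'b, 'z) cat_scheme \<Rightarrow> 'o set \<Rightarrow> ('o \<Rightarrow> 'p) \<Rightarrow> ('o \<Rightarrow> 'b \<Rightarrow> 'o \<Rightarrow> bool) \<Rightarrow> ('o, 'o \<times> 'b \<times> 'o) cat" where
  "structured_cat D Obs U P =
     \<lparr>Ob = Obs,
      Ar = {(x, f, y). x \<in> Obs \<and> y \<in> Obs \<and> f \<in> Hom D (U x) (U y) \<and> P x f y},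
      Dom = (\<lambda>(x, f, y). x),
      Cod = (\<lambda>(x, f, y). y),
      Idn = (\<lambda>x. (x, \<I>\<^bsub>D\<^esub> (U x), x)),
      Cmp = (\<lambda>(x', g, y) (x, f, y'). (x, g \<cdot>\<^bsub>D\<^esub> f, y))\<rparr>"

record ('o, 'a) moncat = "('o, 'a) cat" +
  TenO :: "'o \<Rightarrow> 'o \<Rightarrow> 'o" (infixr \<open>\<boxtimes>\<index>\<close> 70)
  TenA :: "'a \<Rightarrow> 'a \<Rightarrow> 'a" (infixr \<open>\<boxdot>\<index>\<close> 70)
  UnitO :: "'o"
  Assoc :: "'o \<Rightarrow> 'o \<Rightarrow> 'o \<Rightarrow> 'a"
  LUnit :: "'o \<Rightarrow> 'a"
  RUnit :: "'o \<Rightarrow> 'a"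

text \<open>\<open>Assoc x y z : (x \<boxtimes> y) \<boxtimes> z \<rightarrow> x \<boxtimes> (y \<boxtimes> z)\<close>, \<open>LUnit x : I \<boxtimes> x \<rightarrow> x\<close> and \<open>RUnit x : x \<boxtimes> I \<rightarrow> x\<close>.\<close>

locale monoidal_category = category C for C :: "('o, 'a, 'z) moncat_scheme" (structure) +
  assumes unit_ob: "UnitO C \<in> Ob C"
    and ten_ob: "\<lbrakk>x \<in> Ob C; y \<in> Ob C\<rbrakk> \<Longrightarrow> x \<boxtimes> y \<in> Ob C"
    and ten_hom: "\<lbrakk>f \<in> Hom C x x'; g \<in> Hom C y y'\<rbrakk> \<Longrightarrow> f \<boxdot> g \<in> Hom C (x \<boxtimes> y) (x' \<boxtimes> y')"
    and ten_id: "\<lbrakk>x \<in> Ob C; y \<in> Ob C\<rbrakk> \<Longrightarrow> \<I> x \<boxdot> \<I> y = \<I> (x \<boxtimes> y)"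
    and ten_cmp: "\<lbrakk>f \<in> Hom C x x'; f' \<in> Hom C x' x''; g \<in> Hom C y y'; g' \<in> Hom C y' y''\<rbrakk> \<Longrightarrow>
          (f' \<cdot> f) \<boxdot> (g' \<cdot> g) = (f' \<boxdot> g') \<cdot> (f \<boxdot> g)"
    and assoc_hom: "\<lbrakk>x \<in> Ob C; y \<in> Ob C; z \<in> Ob C\<rbrakk> \<Longrightarrow>
          Assoc C x y z \<in> Hom C ((x \<boxtimes> y) \<boxtimes> z) (x \<boxtimes> (y \<boxtimes> z))"
    and assoc_iso: "\<lbrakk>x \<in> Ob C; y \<in> Ob C; z \<in> Ob C\<rbrakk> \<Longrightarrow> iso_arrow C (Assoc C x y z)"
    and assoc_natural: "\<lbrakk>f \<in> Hom C x x'; g \<in> Hom C y y'; h \<in> Hom C z z'\<rbrakk> \<Longrightarrow>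
          Assoc C x' y' z' \<cdot> ((f \<boxdot> g) \<boxdot> h) = (f \<boxdot> (g \<boxdot> h)) \<cdot> Assoc C x y z"
    and lunit_hom: "x \<in> Ob C \<Longrightarrow> LUnit C x \<in> Hom C (UnitO C \<boxtimes> x) x"
    and lunit_iso: "x \<in> Ob C \<Longrightarrow> iso_arrow C (LUnit C x)"
    and lunit_natural: "f \<in> Hom C x x' \<Longrightarrow> LUnit C x' \<cdot> (\<I> (UnitO C) \<boxdot> f) = f \<cdot> LUnit C x"
    and runit_hom: "x \<in> Ob C \<Longrightarrow> RUnit C x \<in> Hom C (x \<boxtimes> UnitO C) x"
    and runit_iso: "x \<in> Ob C \<Longrightarrow> iso_arrow C (RUnit C x)"
    and runit_natural: "f \<in> Hom C x x' \<Longrightarrow> RUnit C x' \<cdot> (f \<boxdot> \<I> (UnitO C)) = f \<cdot> RUnit C x"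
    and pentagon: "\<lbrakk>w \<in> Ob C; x \<in> Ob C; y \<in> Ob C; z \<in> Ob C\<rbrakk> \<Longrightarrow>
          Assoc C w x (y \<boxtimes> z) \<cdot> Assoc C (w \<boxtimes> x) y z
            = (\<I> w \<boxdot> Assoc C x y z) \<cdot> Assoc C w (x \<boxtimes> y) z \<cdot> (Assoc C w x y \<boxdot> \<I> z)"
    and triangle: "\<lbrakk>x \<in> Ob C; y \<in> Ob C\<rbrakk> \<Longrightarrow>
          (\<I> x \<boxdot> LUnit C y) \<cdot> Assoc C x (UnitO C) y = RUnit C x \<boxdot> \<I> y"

record ('p, 'b, 'o, 'a) actcat = "('p, 'b) cat" +
  ActO :: "'p \<Rightarrow> 'o \<Rightarrow> 'p" (infixl \<open>\<triangleleft>\<index>\<close> 70)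
  ActA :: "'b \<Rightarrow> 'a \<Rightarrow> 'b" (infixl \<open>\<unlhd>\<index>\<close> 70)
  ActAssoc :: "'p \<Rightarrow> 'o \<Rightarrow> 'o \<Rightarrow> 'b"
  ActUnit :: "'p \<Rightarrow> 'b"

text \<open>\<open>ActAssoc p x y : (p \<triangleleft> x) \<triangleleft> y \<rightarrow> p \<triangleleft> (x \<boxtimes> y)\<close> and \<open>ActUnit p : p \<triangleleft> I \<rightarrow> p\<close>.\<close>

locale right_category = C: monoidal_category C + D: category D
  for C :: "('o, 'a, 'y) moncat_scheme" (structure)
    and D :: "('p, 'b, 'o, 'a, 'z) actcat_scheme" (structure) +
  assumes act_ob: "\<lbrakk>p \<in> Ob D; x \<in> Ob C\<rbrakk> \<Longrightarrow> p \<triangleleft>\<^bsub>D\<^esub> x \<in> Ob D"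
    and act_hom: "\<lbrakk>f \<in> Hom D p p'; g \<in> Hom C x x'\<rbrakk> \<Longrightarrow> f \<unlhd>\<^bsub>D\<^esub> g \<in> Hom D (p \<triangleleft>\<^bsub>D\<^esub> x) (p' \<triangleleft>\<^bsub>D\<^esub> x')"
    and act_id: "\<lbrakk>p \<in> Ob D; x \<in> Ob C\<rbrakk> \<Longrightarrow> \<I>\<^bsub>D\<^esub> p \<unlhd>\<^bsub>D\<^esub> \<I>\<^bsub>C\<^esub> x = \<I>\<^bsub>D\<^esub> (p \<triangleleft>\<^bsub>D\<^esub> x)"
    and act_cmp: "\<lbrakk>f \<in> Hom D p p'; f' \<in> Hom D p' p''; g \<in> Hom C x x'; g' \<in> Hom C x' x''\<rbrakk> \<Longrightarrow>
          (f' \<cdot>\<^bsub>D\<^esub> f) \<unlhd>\<^bsub>D\<^esub> (g' \<cdot>\<^bsub>C\<^esub> g) = (f' \<unlhd>\<^bsub>D\<^esub> g') \<cdot>\<^bsub>D\<^esub> (f \<unlhd>\<^bsub>D\<^esub> g)"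
    and act_assoc_hom: "\<lbrakk>p \<in> Ob D; x \<in> Ob C; y \<in> Ob C\<rbrakk> \<Longrightarrow>
          ActAssoc D p x y \<in> Hom D ((p \<triangleleft>\<^bsub>D\<^esub> x) \<triangleleft>\<^bsub>D\<^esub> y) (p \<triangleleft>\<^bsub>D\<^esub> (x \<boxtimes>\<^bsub>C\<^esub> y))"
    and act_assoc_iso: "\<lbrakk>p \<in> Ob D; x \<in> Ob C; y \<in> Ob C\<rbrakk> \<Longrightarrow> iso_arrow D (ActAssoc D p x y)"
    and act_assoc_natural: "\<lbrakk>f \<in> Hom D p p'; g \<in> Hom C x x'; h \<in> Hom C y y'\<rbrakk> \<Longrightarrow>
          ActAssoc D p' x' y' \<cdot>\<^bsub>D\<^esub> ((f \<unlhd>\<^bsub>D\<^esub> g) \<unlhd>\<^bsub>D\<^esub> h) = (f \<unlhd>\<^bsub>D\<^esub> (g \<boxdot>\<^bsub>C\<^esub> h)) \<cdot>\<^bsub>D\<^esub> ActAssoc D p x y"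
    and act_unit_hom: "p \<in> Ob D \<Longrightarrow> ActUnit D p \<in> Hom D (p \<triangleleft>\<^bsub>D\<^esub> UnitO C) p"
    and act_unit_iso: "p \<in> Ob D \<Longrightarrow> iso_arrow D (ActUnit D p)"
    and act_unit_natural: "f \<in> Hom D p p' \<Longrightarrow>
          ActUnit D p' \<cdot>\<^bsub>D\<^esub> (f \<unlhd>\<^bsub>D\<^esub> \<I>\<^bsub>C\<^esub> (UnitO C)) = f \<cdot>\<^bsub>D\<^esub> ActUnit D p"
    and act_pentagon: "\<lbrakk>p \<in> Ob D; x \<in> Ob C; y \<in> Ob C; z \<in> Ob C\<rbrakk> \<Longrightarrow>
          ActAssoc D p x (y \<boxtimes>\<^bsub>C\<^esub> z) \<cdot>\<^bsub>D\<^esub> ActAssoc D (p \<triangleleft>\<^bsub>D\<^esub> x) y z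
            = (\<I>\<^bsub>D\<^esub> p \<unlhd>\<^bsub>D\<^esub> Assoc C x y z) \<cdot>\<^bsub>D\<^esub> ActAssoc D p (x \<boxtimes>\<^bsub>C\<^esub> y) z \<cdot>\<^bsub>D\<^esub> (ActAssoc D p x y \<unlhd>\<^bsub>D\<^esub> \<I>\<^bsub>C\<^esub> z)"
    and act_triangle_left: "\<lbrakk>p \<in> Ob D; x \<in> Ob C\<rbrakk> \<Longrightarrow>
          (\<I>\<^bsub>D\<^esub> p \<unlhd>\<^bsub>D\<^esub> LUnit C x) \<cdot>\<^bsub>D\<^esub> ActAssoc D p (UnitO C) x = ActUnit D p \<unlhd>\<^bsub>D\<^esub> \<I>\<^bsub>C\<^esub> x"
    and act_triangle_right: "\<lbrakk>p \<in> Ob D; x \<in> Ob C\<rbrakk> \<Longrightarrow>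
          (\<I>\<^bsub>D\<^esub> p \<unlhd>\<^bsub>D\<^esub> RUnit C x) \<cdot>\<^bsub>D\<^esub> ActAssoc D p x (UnitO C) = ActUnit D (p \<triangleleft>\<^bsub>D\<^esub> x)"

definition self_action :: "('o, 'a, 'z) moncat_scheme \<Rightarrow> ('o, 'a, 'o, 'a) actcat" where
  "self_action C = cat.extend (cat.truncate C)
     (actcat.fields (TenO C) (TenA C) (Assoc C) (RUnit C))"


section \<open>Algebras, coalgebras, comodules and cowreaths\<close>

definition algebra_in :: "('o, 'a, 'z) moncat_scheme \<Rightarrow> 'o \<Rightarrow> 'a \<Rightarrow> 'a \<Rightarrow> bool" where
  "algebra_in C A m \<eta> \<longleftrightarrow> A \<in> Ob C \<and> m \<in> Hom C (A \<boxtimes>\<^bsub>C\<^esub> A) A \<and> \<eta> \<in> Hom C (UnitO C) A \<and>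
     m \<cdot>\<^bsub>C\<^esub> (m \<boxdot>\<^bsub>C\<^esub> \<I>\<^bsub>C\<^esub> A) = m \<cdot>\<^bsub>C\<^esub> (\<I>\<^bsub>C\<^esub> A \<boxdot>\<^bsub>C\<^esub> m) \<cdot>\<^bsub>C\<^esub> Assoc C A A A \<and>
     m \<cdot>\<^bsub>C\<^esub> (\<eta> \<boxdot>\<^bsub>C\<^esub> \<I>\<^bsub>C\<^esub> A) = LUnit C A \<and>
     m \<cdot>\<^bsub>C\<^esub> (\<I>\<^bsub>C\<^esub> A \<boxdot>\<^bsub>C\<^esub> \<eta>) = RUnit C A"

definition coalgebra_in :: "('o, 'a, 'z) moncat_scheme \<Rightarrow> 'o \<Rightarrow> 'a \<Rightarrow> 'a \<Rightarrow> bool" where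
  "coalgebra_in C X \<Delta> \<epsilon> \<longleftrightarrow> X \<in> Ob C \<and> \<Delta> \<in> Hom C X (X \<boxtimes>\<^bsub>C\<^esub> X) \<and> \<epsilon> \<in> Hom C X (UnitO C) \<and>
     Assoc C X X X \<cdot>\<^bsub>C\<^esub> (\<Delta> \<boxdot>\<^bsub>C\<^esub> \<I>\<^bsub>C\<^esub> X) \<cdot>\<^bsub>C\<^esub> \<Delta> = (\<I>\<^bsub>C\<^esub> X \<boxdot>\<^bsub>C\<^esub> \<Delta>) \<cdot>\<^bsub>C\<^esub> \<Delta> \<and>
     LUnit C X \<cdot>\<^bsub>C\<^esub> (\<epsilon> \<boxdot>\<^bsub>C\<^esub> \<I>\<^bsub>C\<^esub> X) \<cdot>\<^bsub>C\<^esub> \<Delta> = \<I>\<^bsub>C\<^esub> X \<and>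
     RUnit C X \<cdot>\<^bsub>C\<^esub> (\<I>\<^bsub>C\<^esub> X \<boxdot>\<^bsub>C\<^esub> \<epsilon>) \<cdot>\<^bsub>C\<^esub> \<Delta> = \<I>\<^bsub>C\<^esub> X"

definition right_comodule_in ::
  "('o, 'a, 'y) moncat_scheme \<Rightarrow> ('p, 'b, 'o, 'a, 'z) actcat_scheme \<Rightarrow> 'o \<Rightarrow> 'a \<Rightarrow> 'a \<Rightarrow> 'p \<times> 'b \<Rightarrow> bool" where
  "right_comodule_in C D X \<Delta> \<epsilon> = (\<lambda>(M, \<rho>). M \<in> Ob D \<and> \<rho> \<in> Hom D M (M \<triangleleft>\<^bsub>D\<^esub> X) \<and>
     ActAssoc D M X X \<cdot>\<^bsub>D\<^esub> (\<rho> \<unlhd>\<^bsub>D\<^esub> \<I>\<^bsub>C\<^esub> X) \<cdot>\<^bsub>D\<^esub> \<rho> = (\<I>\<^bsub>D\<^esub> M \<unlhd>\<^bsub>D\<^esub> \<Delta>) \<cdot>\<^bsub>D\<^esub> \<rho> \<and>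
     ActUnit D M \<cdot>\<^bsub>D\<^esub> (\<I>\<^bsub>D\<^esub> M \<unlhd>\<^bsub>D\<^esub> \<epsilon>) \<cdot>\<^bsub>D\<^esub> \<rho> = \<I>\<^bsub>D\<^esub> M)"

definition comodule_cat ::
  "('o, 'a, 'y) moncat_scheme \<Rightarrow> ('p, 'b, 'o, 'a, 'z) actcat_scheme \<Rightarrow> 'o \<Rightarrow> 'a \<Rightarrow> 'a \<Rightarrow>
   ('p \<times> 'b, ('p \<times> 'b) \<times> 'b \<times> ('p \<times> 'b)) cat" where
  "comodule_cat C D X \<Delta> \<epsilon> = structured_cat D {M\<rho>. right_comodule_in C D X \<Delta> \<epsilon> M\<rho>} fst
     (\<lambda>(M, \<rho>) f (N, \<sigma>). \<sigma> \<cdot>\<^bsub>D\<^esub> f = (f \<unlhd>\<^bsub>D\<^esub> \<I>\<^bsub>C\<^esub> X) \<cdot>\<^bsub>D\<^esub> \<rho>)"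

text \<open>Iterated tensor products are bracketed to the right, and the associativity and unit
  constraints are written out.\<close>

locale cowreath = monoidal_category C for C :: "('o, 'a, 'z) moncat_scheme" (structure) +
  fixes A :: 'o and m \<eta> :: 'a and X :: 'o and \<psi> \<delta> f :: 'a
  assumes alg: "algebra_in C A m \<eta>"
    and X_ob: "X \<in> Ob C"
    and psi_hom: "\<psi> \<in> Hom C (X \<boxtimes> A) (A \<boxtimes> X)"
    and delta_hom: "\<delta> \<in> Hom C X (A \<boxtimes> X \<boxtimes> X)"
    and f_hom: "f \<in> Hom C X A"
    and psi_mult:
      "\<psi> \<cdot> (\<I> X \<boxdot> m)
        = (m \<boxdot> \<I> X) \<cdot> inv_arrow C (Assoc C A A X) \<cdot> (\<I> A \<boxdot> \<psi>) \<cdot> Assoc C A X A \<cdot> (\<psi> \<boxdot> \<I> A)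
            \<cdot> inv_arrow C (Assoc C X A A)"
    and psi_unit:
      "\<psi> \<cdot> (\<I> X \<boxdot> \<eta>) = (\<eta> \<boxdot> \<I> X) \<cdot> inv_arrow C (LUnit C X) \<cdot> RUnit C X"
    and delta_psi:
      "(m \<boxdot> \<I> (X \<boxtimes> X)) \<cdot> inv_arrow C (Assoc C A A (X \<boxtimes> X)) \<cdot> (\<I> A \<boxdot> \<delta>) \<cdot> \<psi>
        = (m \<boxdot> \<I> (X \<boxtimes> X)) \<cdot> inv_arrow C (Assoc C A A (X \<boxtimes> X))
            \<cdot> (\<I> A \<boxdot> (Assoc C A X X \<cdot> (\<psi> \<boxdot> \<I> X) \<cdot> inv_arrow C (Assoc C X A X)))
            \<cdot> (\<I> A \<boxdot> ((\<I> X \<boxdot> \<psi>) \<cdot> Assoc C X X A))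
            \<cdot> Assoc C A (X \<boxtimes> X) A \<cdot> (\<delta> \<boxdot> \<I> A)"
    and delta_coassoc:
      "(m \<boxdot> \<I> (X \<boxtimes> X \<boxtimes> X)) \<cdot> inv_arrow C (Assoc C A A (X \<boxtimes> X \<boxtimes> X))
          \<cdot> (\<I> A \<boxdot> (Assoc C A X (X \<boxtimes> X) \<cdot> (\<psi> \<boxdot> \<I> (X \<boxtimes> X)) \<cdot> inv_arrow C (Assoc C X A (X \<boxtimes> X))))
          \<cdot> (\<I> A \<boxdot> (\<I> X \<boxdot> \<delta>)) \<cdot> \<delta>
        = (m \<boxdot> \<I> (X \<boxtimes> X \<boxtimes> X)) \<cdot> inv_arrow C (Assoc C A A (X \<boxtimes> X \<boxtimes> X))
          \<cdot> (\<I> A \<boxdot> ((\<I> A \<boxdot> Assoc C X X X) \<cdot> Assoc C A (X \<boxtimes> X) X \<cdot> (\<delta> \<boxdot> \<I> X))) \<cdot> \<delta>"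
    and f_psi: "m \<cdot> (\<I> A \<boxdot> f) \<cdot> \<psi> = m \<cdot> (f \<boxdot> \<I> A)"
    and counit_left:
      "(m \<boxdot> \<I> X) \<cdot> inv_arrow C (Assoc C A A X) \<cdot> (\<I> A \<boxdot> (f \<boxdot> \<I> X)) \<cdot> \<delta>
        = (\<eta> \<boxdot> \<I> X) \<cdot> inv_arrow C (LUnit C X)"
    and counit_right:
      "(m \<boxdot> \<I> X) \<cdot> inv_arrow C (Assoc C A A X) \<cdot> (\<I> A \<boxdot> \<psi>) \<cdot> (\<I> A \<boxdot> (\<I> X \<boxdot> f)) \<cdot> \<delta>
        = (\<eta> \<boxdot> \<I> X) \<cdot> inv_arrow C (LUnit C X)"


section \<open>Tensor products over an algebra in a category, and corepresentations\<close>

definition is_coequalizer :: "('p, 'b, 'z) cat_scheme \<Rightarrow> 'b \<Rightarrow> 'b \<Rightarrow> 'b \<Rightarrow> bool" where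
  "is_coequalizer D f g q \<longleftrightarrow> q \<in> Ar D \<and> Dom D q = Cod D f \<and> q \<cdot>\<^bsub>D\<^esub> f = q \<cdot>\<^bsub>D\<^esub> g \<and>
     (\<forall>h \<in> Ar D. Dom D h = Cod D f \<and> h \<cdot>\<^bsub>D\<^esub> f = h \<cdot>\<^bsub>D\<^esub> g \<longrightarrow>
        (\<exists>!u. u \<in> Hom D (Cod D q) (Cod D h) \<and> u \<cdot>\<^bsub>D\<^esub> q = h))"

text \<open>\<open>balq C D A M \<mu> Y l\<close> is a chosen projection \<open>M \<triangleleft> Y \<rightarrow> M \<otimes>\<^sub>A Y\<close>, for a right action
  \<open>\<mu> : M \<triangleleft> A \<rightarrow> M\<close> in \<open>D\<close> and a left action \<open>l : A \<boxtimes> Y \<rightarrow> Y\<close> in \<open>C\<close>.\<close>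

definition balq ::
  "('o, 'a, 'y) moncat_scheme \<Rightarrow> ('p, 'b, 'o, 'a, 'z) actcat_scheme \<Rightarrow> 'o \<Rightarrow> 'p \<Rightarrow> 'b \<Rightarrow> 'o \<Rightarrow> 'a \<Rightarrow> 'b" where
  "balq C D A M \<mu> Y l = (SOME q. is_coequalizer D
     (\<mu> \<unlhd>\<^bsub>D\<^esub> \<I>\<^bsub>C\<^esub> Y) ((\<I>\<^bsub>D\<^esub> M \<unlhd>\<^bsub>D\<^esub> l) \<cdot>\<^bsub>D\<^esub> ActAssoc D M A Y) q)"

abbreviation balten ::
  "('o, 'a, 'y) moncat_scheme \<Rightarrow> ('p, 'b, 'o, 'a, 'z) actcat_scheme \<Rightarrow> 'o \<Rightarrow> 'p \<Rightarrow> 'b \<Rightarrow> 'o \<Rightarrow> 'a \<Rightarrow> 'p" where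
  "balten C D A M \<mu> Y l \<equiv> Cod D (balq C D A M \<mu> Y l)"

definition factor_through :: "('p, 'b, 'z) cat_scheme \<Rightarrow> 'b \<Rightarrow> 'b \<Rightarrow> 'b" where
  "factor_through D q g = (THE u. u \<in> Hom D (Cod D q) (Cod D g) \<and> u \<cdot>\<^bsub>D\<^esub> q = g)"

definition right_module_in ::
  "('o, 'a, 'y) moncat_scheme \<Rightarrow> ('p, 'b, 'o, 'a, 'z) actcat_scheme \<Rightarrow> 'o \<Rightarrow> 'a \<Rightarrow> 'a \<Rightarrow> 'p \<Rightarrow> 'b \<Rightarrow> bool" where
  "right_module_in C D A m \<eta> M \<mu> \<longleftrightarrow> M \<in> Ob D \<and> \<mu> \<in> Hom D (M \<triangleleft>\<^bsub>D\<^esub> A) M \<and>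
     \<mu> \<cdot>\<^bsub>D\<^esub> (\<mu> \<unlhd>\<^bsub>D\<^esub> \<I>\<^bsub>C\<^esub> A) = \<mu> \<cdot>\<^bsub>D\<^esub> (\<I>\<^bsub>D\<^esub> M \<unlhd>\<^bsub>D\<^esub> m) \<cdot>\<^bsub>D\<^esub> ActAssoc D M A A \<and>
     \<mu> \<cdot>\<^bsub>D\<^esub> (\<I>\<^bsub>D\<^esub> M \<unlhd>\<^bsub>D\<^esub> \<eta>) = ActUnit D M"

text \<open>\<open>M \<otimes>\<^sub>A Y\<close> inherits a right \<open>A\<close>-action from a right action \<open>r\<close> on \<open>Y\<close>, and, when \<open>M\<close> lies in \<open>C\<close>,
  a left \<open>A\<close>-action from a left action \<open>k\<close> on \<open>M\<close>.\<close>

definition bal_ract where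
  "bal_ract C D A M \<mu> Y l r =
     factor_through D (balq C D A M \<mu> Y l \<unlhd>\<^bsub>D\<^esub> \<I>\<^bsub>C\<^esub> A)
       (balq C D A M \<mu> Y l \<cdot>\<^bsub>D\<^esub> (\<I>\<^bsub>D\<^esub> M \<unlhd>\<^bsub>D\<^esub> r) \<cdot>\<^bsub>D\<^esub> ActAssoc D M Y A)"

definition bal_lact where
  "bal_lact C A M k \<mu> Y l =
     factor_through C (\<I>\<^bsub>C\<^esub> A \<boxdot>\<^bsub>C\<^esub> balq C (self_action C) A M \<mu> Y l)
       (balq C (self_action C) A M \<mu> Y l \<cdot>\<^bsub>C\<^esub> (k \<boxdot>\<^bsub>C\<^esub> \<I>\<^bsub>C\<^esub> Y) \<cdot>\<^bsub>C\<^esub> inv_arrow C (Assoc C A M Y))"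

text \<open>\<open>bal_map\<close> is \<open>f \<otimes>\<^sub>A g : M \<otimes>\<^sub>A Y \<rightarrow> N \<otimes>\<^sub>A Z\<close>.\<close>

definition bal_map where
  "bal_map C D A M \<mu> Y l f N \<nu> Z k g =
     factor_through D (balq C D A M \<mu> Y l) (balq C D A N \<nu> Z k \<cdot>\<^bsub>D\<^esub> (f \<unlhd>\<^bsub>D\<^esub> g))"

record ('o, 'a) coring =
  cor_ob :: 'o
  cor_lact :: 'a
  cor_ract :: 'a
  cor_comult :: 'a
  cor_counit :: 'a

definition cor_sq :: "('o, 'a, 'y) moncat_scheme \<Rightarrow> 'o \<Rightarrow> ('o, 'a) coring \<Rightarrow> 'a" where
  "cor_sq C A Y = balq C (self_action C) A (cor_ob Y) (cor_ract Y) (cor_ob Y) (cor_lact Y)"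

text \<open>The \<open>A\<close>-coring \<open>A \<boxtimes> X\<close> of a cowreath; \<open>cowreath_upsilon\<close> is the canonical isomorphism
  \<open>M \<otimes>\<^sub>A (A \<boxtimes> X) \<cong> M \<triangleleft> X\<close>.\<close>

definition free_lact where
  "free_lact C A m X = (m \<boxdot>\<^bsub>C\<^esub> \<I>\<^bsub>C\<^esub> X) \<cdot>\<^bsub>C\<^esub> inv_arrow C (Assoc C A A X)"

definition cowreath_ract where
  "cowreath_ract C A m X \<psi> =
     (m \<boxdot>\<^bsub>C\<^esub> \<I>\<^bsub>C\<^esub> X) \<cdot>\<^bsub>C\<^esub> inv_arrow C (Assoc C A A X) \<cdot>\<^bsub>C\<^esub> (\<I>\<^bsub>C\<^esub> A \<boxdot>\<^bsub>C\<^esub> \<psi>) \<cdot>\<^bsub>C\<^esub> Assoc C A X A"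

definition cowreath_upsilon where
  "cowreath_upsilon C D A m X M \<mu> =
     factor_through D (balq C D A M \<mu> (A \<boxtimes>\<^bsub>C\<^esub> X) (free_lact C A m X))
       ((\<mu> \<unlhd>\<^bsub>D\<^esub> \<I>\<^bsub>C\<^esub> X) \<cdot>\<^bsub>D\<^esub> inv_arrow D (ActAssoc D M A X))"

definition cowreath_coring ::
  "('o, 'a, 'y) moncat_scheme \<Rightarrow> 'o \<Rightarrow> 'a \<Rightarrow> 'o \<Rightarrow> 'a \<Rightarrow> 'a \<Rightarrow> 'a \<Rightarrow> ('o, 'a) coring" where
  "cowreath_coring C A m X \<psi> \<delta> f =
     \<lparr>cor_ob = A \<boxtimes>\<^bsub>C\<^esub> X,
      cor_lact = free_lact C A m X,
      cor_ract = cowreath_ract C A m X \<psi>,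
      cor_comult =
        inv_arrow C (cowreath_upsilon C (self_action C) A m X (A \<boxtimes>\<^bsub>C\<^esub> X) (cowreath_ract C A m X \<psi>))
          \<cdot>\<^bsub>C\<^esub> inv_arrow C (Assoc C A X X)
          \<cdot>\<^bsub>C\<^esub> (m \<boxdot>\<^bsub>C\<^esub> \<I>\<^bsub>C\<^esub> (X \<boxtimes>\<^bsub>C\<^esub> X)) \<cdot>\<^bsub>C\<^esub> inv_arrow C (Assoc C A A (X \<boxtimes>\<^bsub>C\<^esub> X)) \<cdot>\<^bsub>C\<^esub> (\<I>\<^bsub>C\<^esub> A \<boxdot>\<^bsub>C\<^esub> \<delta>),
      cor_counit = m \<cdot>\<^bsub>C\<^esub> (\<I>\<^bsub>C\<^esub> A \<boxdot>\<^bsub>C\<^esub> f)\<rparr>"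

text \<open>Right corepresentations \<open>(M, \<mu>, \<rho>)\<close> in \<open>D\<close> over an \<open>A\<close>-coring \<open>Y\<close> in \<open>C\<close>: the conditions on
  \<open>\<rho> : M \<rightarrow> M \<otimes>\<^sub>A Y\<close> are right \<open>A\<close>-linearity, coassociativity (along the canonical
  \<open>bal_assoc : (M \<otimes>\<^sub>A Y) \<otimes>\<^sub>A Y \<rightarrow> M \<otimes>\<^sub>A (Y \<otimes>\<^sub>A Y)\<close>) and counitality (along \<open>M \<otimes>\<^sub>A A \<rightarrow> M\<close>).\<close>

definition cor_act where
  "cor_act C D A Y M \<mu> = bal_ract C D A M \<mu> (cor_ob Y) (cor_lact Y) (cor_ract Y)"

definition cor_sq_lact where
  "cor_sq_lact C A Y = bal_lact C A (cor_ob Y) (cor_lact Y) (cor_ract Y) (cor_ob Y) (cor_lact Y)"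

definition bal_assoc where
  "bal_assoc C D A Y M \<mu> =
     (let q = balq C D A M \<mu> (cor_ob Y) (cor_lact Y);
          q' = balq C D A (Cod D q) (cor_act C D A Y M \<mu>) (cor_ob Y) (cor_lact Y);
          q'' = balq C D A M \<mu> (Cod C (cor_sq C A Y)) (cor_sq_lact C A Y)
      in factor_through D (q' \<cdot>\<^bsub>D\<^esub> (q \<unlhd>\<^bsub>D\<^esub> \<I>\<^bsub>C\<^esub> (cor_ob Y)))
           (q'' \<cdot>\<^bsub>D\<^esub> (\<I>\<^bsub>D\<^esub> M \<unlhd>\<^bsub>D\<^esub> cor_sq C A Y) \<cdot>\<^bsub>D\<^esub> ActAssoc D M (cor_ob Y) (cor_ob Y)))"

definition right_corep_in ::
  "('o, 'a, 'y) moncat_scheme \<Rightarrow> ('p, 'b, 'o, 'a, 'z) actcat_scheme \<Rightarrow> 'o \<Rightarrow> 'a \<Rightarrow> 'a \<Rightarrow> ('o, 'a) coring \<Rightarrow>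
   'p \<times> 'b \<times> 'b \<Rightarrow> bool" where
  "right_corep_in C D A m \<eta> Y = (\<lambda>(M, \<mu>, \<rho>).
     let T = balten C D A M \<mu> (cor_ob Y) (cor_lact Y);
         \<tau> = cor_act C D A Y M \<mu>
     in right_module_in C D A m \<eta> M \<mu> \<and> \<rho> \<in> Hom D M T \<and>
        \<rho> \<cdot>\<^bsub>D\<^esub> \<mu> = \<tau> \<cdot>\<^bsub>D\<^esub> (\<rho> \<unlhd>\<^bsub>D\<^esub> \<I>\<^bsub>C\<^esub> A) \<and>
        bal_assoc C D A Y M \<mu>
          \<cdot>\<^bsub>D\<^esub> bal_map C D A M \<mu> (cor_ob Y) (cor_lact Y) \<rho> T \<tau> (cor_ob Y) (cor_lact Y) (\<I>\<^bsub>C\<^esub> (cor_ob Y)) \<cdot>\<^bsub>D\<^esub> \<rho>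
        = bal_map C D A M \<mu> (cor_ob Y) (cor_lact Y) (\<I>\<^bsub>D\<^esub> M) M \<mu> (Cod C (cor_sq C A Y)) (cor_sq_lact C A Y) (cor_comult Y)
            \<cdot>\<^bsub>D\<^esub> \<rho> \<and>
        factor_through D (balq C D A M \<mu> A m) \<mu>
          \<cdot>\<^bsub>D\<^esub> bal_map C D A M \<mu> (cor_ob Y) (cor_lact Y) (\<I>\<^bsub>D\<^esub> M) M \<mu> A m (cor_counit Y) \<cdot>\<^bsub>D\<^esub> \<rho>
        = \<I>\<^bsub>D\<^esub> M)"

definition corep_cat ::
  "('o, 'a, 'y) moncat_scheme \<Rightarrow> ('p, 'b, 'o, 'a, 'z) actcat_scheme \<Rightarrow> 'o \<Rightarrow> 'a \<Rightarrow> 'a \<Rightarrow> ('o, 'a) coring \<Rightarrow>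
   ('p \<times> 'b \<times> 'b, ('p \<times> 'b \<times> 'b) \<times> 'b \<times> ('p \<times> 'b \<times> 'b)) cat" where
  "corep_cat C D A m \<eta> Y = structured_cat D {M. right_corep_in C D A m \<eta> Y M} fst
     (\<lambda>(M, \<mu>, \<rho>) f (N, \<nu>, \<sigma>).
        f \<cdot>\<^bsub>D\<^esub> \<mu> = \<nu> \<cdot>\<^bsub>D\<^esub> (f \<unlhd>\<^bsub>D\<^esub> \<I>\<^bsub>C\<^esub> A) \<and>
        \<sigma> \<cdot>\<^bsub>D\<^esub> f =
          bal_map C D A M \<mu> (cor_ob Y) (cor_lact Y) f N \<nu> (cor_ob Y) (cor_lact Y) (\<I>\<^bsub>C\<^esub> (cor_ob Y)) \<cdot>\<^bsub>D\<^esub> \<rho>)"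


section \<open>Modules and tensor products over a noncommutative algebra\<close>

text \<open>All carriers are subsets of one type that is closed under tensor products: an element of a
  tensor product is \<open>Tens\<close> of a list of pairs, which stands for a sum of pure tensors. Since every
  set over \<open>'a\<close> embeds along \<open>Atom\<close>, algebras and modules of arbitrary size are covered.\<close>

datatype 'a univ = Atom 'a | Tens "('a univ \<times> 'a univ) list"

primrec terms :: "'a univ \<Rightarrow> ('a univ \<times> 'a univ) list" where
  "terms (Atom a) = []"
| "terms (Tens xs) = xs"

text \<open>The vector space structure over the field is the \<open>module\<close> part of a record; \<open>mult\<close> and \<open>one\<close>
  are only meaningful for algebras. Actions are required to be \<open>undefined\<close> off the carriers, so
  that they are determined by their restriction to the carriers.\<close>

record ('k, 'u) rmod = "('k, 'u) module" +
  ract :: "'u \<Rightarrow> 'u \<Rightarrow> 'u"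

record ('k, 'u) bimod = "('k, 'u) rmod" +
  lact :: "'u \<Rightarrow> 'u \<Rightarrow> 'u"

definition on_carriers :: "'b set \<Rightarrow> 'c set \<Rightarrow> ('b \<Rightarrow> 'c \<Rightarrow> 'd) \<Rightarrow> 'b \<Rightarrow> 'c \<Rightarrow> 'd" where
  "on_carriers S T g = (\<lambda>x y. if x \<in> S \<and> y \<in> T then g x y else undefined)"

definition rmod_of :: "('k, 'u, 'z) module_scheme \<Rightarrow> ('u \<Rightarrow> 'u \<Rightarrow> 'u) \<Rightarrow> ('k, 'u) rmod" where
  "rmod_of V g = module.extend (module.truncate V) (rmod.fields g)"

definition bimod_of ::
  "('k, 'u, 'z) module_scheme \<Rightarrow> ('u \<Rightarrow> 'u \<Rightarrow> 'u) \<Rightarrow> ('u \<Rightarrow> 'u \<Rightarrow> 'u) \<Rightarrow> ('k, 'u) bimod" where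
  "bimod_of V g h = rmod.extend (rmod_of V g) (bimod.fields h)"

definition k_algebra :: "('k, 'x) ring_scheme \<Rightarrow> ('k, 'u, 'z) module_scheme \<Rightarrow> bool" where
  "k_algebra K B \<longleftrightarrow> ring B \<and> module K B \<and>
     (\<forall>\<kappa> \<in> carrier K. \<forall>x \<in> carrier B. \<forall>y \<in> carrier B.
        (\<kappa> \<odot>\<^bsub>B\<^esub> x) \<otimes>\<^bsub>B\<^esub> y = \<kappa> \<odot>\<^bsub>B\<^esub> (x \<otimes>\<^bsub>B\<^esub> y) \<and>
        x \<otimes>\<^bsub>B\<^esub> (\<kappa> \<odot>\<^bsub>B\<^esub> y) = \<kappa> \<odot>\<^bsub>B\<^esub> (x \<otimes>\<^bsub>B\<^esub> y))"

definition right_module ::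
  "('k, 'x) ring_scheme \<Rightarrow> ('k, 'u, 'y) module_scheme \<Rightarrow> ('k, 'u, 'z) rmod_scheme \<Rightarrow> bool" where
  "right_module K B M \<longleftrightarrow> module K M \<and>
     ract M = on_carriers (carrier M) (carrier B) (ract M) \<and>
     (\<forall>x \<in> carrier M. \<forall>b \<in> carrier B. ract M x b \<in> carrier M) \<and>
     (\<forall>x \<in> carrier M. \<forall>y \<in> carrier M. \<forall>b \<in> carrier B.
        ract M (x \<oplus>\<^bsub>M\<^esub> y) b = ract M x b \<oplus>\<^bsub>M\<^esub> ract M y b) \<and>
     (\<forall>x \<in> carrier M. \<forall>b \<in> carrier B. \<forall>c \<in> carrier B.
        ract M x (b \<oplus>\<^bsub>B\<^esub> c) = ract M x b \<oplus>\<^bsub>M\<^esub> ract M x c \<and>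
        ract M x (b \<otimes>\<^bsub>B\<^esub> c) = ract M (ract M x b) c) \<and>
     (\<forall>x \<in> carrier M. ract M x \<one>\<^bsub>B\<^esub> = x) \<and>
     (\<forall>\<kappa> \<in> carrier K. \<forall>x \<in> carrier M. \<forall>b \<in> carrier B.
        ract M (\<kappa> \<odot>\<^bsub>M\<^esub> x) b = \<kappa> \<odot>\<^bsub>M\<^esub> ract M x b \<and> ract M x (\<kappa> \<odot>\<^bsub>B\<^esub> b) = \<kappa> \<odot>\<^bsub>M\<^esub> ract M x b)"

definition bimodule ::
  "('k, 'x) ring_scheme \<Rightarrow> ('k, 'u, 'y) module_scheme \<Rightarrow> ('k, 'u, 'z) bimod_scheme \<Rightarrow> bool" where
  "bimodule K B M \<longleftrightarrow> right_module K B M \<and>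
     lact M = on_carriers (carrier B) (carrier M) (lact M) \<and>
     (\<forall>b \<in> carrier B. \<forall>x \<in> carrier M. lact M b x \<in> carrier M) \<and>
     (\<forall>b \<in> carrier B. \<forall>x \<in> carrier M. \<forall>y \<in> carrier M.
        lact M b (x \<oplus>\<^bsub>M\<^esub> y) = lact M b x \<oplus>\<^bsub>M\<^esub> lact M b y) \<and>
     (\<forall>b \<in> carrier B. \<forall>c \<in> carrier B. \<forall>x \<in> carrier M.
        lact M (b \<oplus>\<^bsub>B\<^esub> c) x = lact M b x \<oplus>\<^bsub>M\<^esub> lact M c x \<and>
        lact M (b \<otimes>\<^bsub>B\<^esub> c) x = lact M b (lact M c x)) \<and>
     (\<forall>x \<in> carrier M. lact M \<one>\<^bsub>B\<^esub> x = x) \<and>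
     (\<forall>\<kappa> \<in> carrier K. \<forall>b \<in> carrier B. \<forall>x \<in> carrier M.
        lact M b (\<kappa> \<odot>\<^bsub>M\<^esub> x) = \<kappa> \<odot>\<^bsub>M\<^esub> lact M b x \<and> lact M (\<kappa> \<odot>\<^bsub>B\<^esub> b) x = \<kappa> \<odot>\<^bsub>M\<^esub> lact M b x) \<and>
     (\<forall>b \<in> carrier B. \<forall>x \<in> carrier M. \<forall>c \<in> carrier B. ract M (lact M b x) c = lact M b (ract M x c))"

definition linear_maps ::
  "('k, 'x) ring_scheme \<Rightarrow> ('k, 'u, 'y) module_scheme \<Rightarrow> ('k, 'u, 'z) module_scheme \<Rightarrow> ('u \<Rightarrow> 'u) set" where
  "linear_maps K M N = {f \<in> carrier M \<rightarrow> carrier N.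
     (\<forall>x \<in> carrier M. \<forall>y \<in> carrier M. f (x \<oplus>\<^bsub>M\<^esub> y) = f x \<oplus>\<^bsub>N\<^esub> f y) \<and>
     (\<forall>\<kappa> \<in> carrier K. \<forall>x \<in> carrier M. f (\<kappa> \<odot>\<^bsub>M\<^esub> x) = \<kappa> \<odot>\<^bsub>N\<^esub> f x)}"

definition right_linear_maps ::
  "('k, 'x) ring_scheme \<Rightarrow> ('k, 'u, 'w) module_scheme \<Rightarrow> ('k, 'u, 'y) rmod_scheme \<Rightarrow> ('k, 'u, 'z) rmod_scheme \<Rightarrow>
   ('u \<Rightarrow> 'u) set" where
  "right_linear_maps K B M N = {f \<in> linear_maps K M N.
     \<forall>x \<in> carrier M. \<forall>b \<in> carrier B. f (ract M x b) = ract N (f x) b}"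

definition bilinear_maps ::
  "('k, 'x) ring_scheme \<Rightarrow> ('k, 'u, 'w) module_scheme \<Rightarrow> ('k, 'u, 'y) bimod_scheme \<Rightarrow> ('k, 'u, 'z) bimod_scheme \<Rightarrow>
   ('u \<Rightarrow> 'u) set" where
  "bilinear_maps K B M N = {f \<in> right_linear_maps K B M N.
     \<forall>b \<in> carrier B. \<forall>x \<in> carrier M. f (lact M b x) = lact N b (f x)}"

text \<open>\<open>teq B M N\<close>: two formal sums of pure tensors are equal in \<open>M \<otimes>\<^sub>B N\<close>. This presents \<open>M \<otimes>\<^sub>B N\<close>
  as a commutative monoid by generators and relations; it is a group, since \<open>(- m) \<otimes> n\<close> is
  opposite to \<open>m \<otimes> n\<close> by \<open>teq_zero\<close>.\<close>

inductive teq ::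
  "('k, 'u, 'x) module_scheme \<Rightarrow> ('k, 'u, 'y) rmod_scheme \<Rightarrow> ('k, 'u, 'z) bimod_scheme \<Rightarrow>
   ('u \<times> 'u) list \<Rightarrow> ('u \<times> 'u) list \<Rightarrow> bool"
  for B M N where
  teq_refl: "xs \<in> lists (carrier M \<times> carrier N) \<Longrightarrow> teq B M N xs xs"
| teq_sym: "teq B M N xs ys \<Longrightarrow> teq B M N ys xs"
| teq_trans: "\<lbrakk>teq B M N xs ys; teq B M N ys zs\<rbrakk> \<Longrightarrow> teq B M N xs zs"
| teq_append: "\<lbrakk>teq B M N xs ys; teq B M N us vs\<rbrakk> \<Longrightarrow> teq B M N (xs @ us) (ys @ vs)"
| teq_commute: "\<lbrakk>xs \<in> lists (carrier M \<times> carrier N); ys \<in> lists (carrier M \<times> carrier N)\<rbrakk> \<Longrightarrow>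
    teq B M N (xs @ ys) (ys @ xs)"
| teq_zero: "n \<in> carrier N \<Longrightarrow> teq B M N [(\<zero>\<^bsub>M\<^esub>, n)] []"
| teq_add_left: "\<lbrakk>m \<in> carrier M; m' \<in> carrier M; n \<in> carrier N\<rbrakk> \<Longrightarrow>
    teq B M N [(m \<oplus>\<^bsub>M\<^esub> m', n)] [(m, n), (m', n)]"
| teq_add_right: "\<lbrakk>m \<in> carrier M; n \<in> carrier N; n' \<in> carrier N\<rbrakk> \<Longrightarrow>
    teq B M N [(m, n \<oplus>\<^bsub>N\<^esub> n')] [(m, n), (m, n')]"
| teq_balanced: "\<lbrakk>m \<in> carrier M; b \<in> carrier B; n \<in> carrier N\<rbrakk> \<Longrightarrow>
    teq B M N [(ract M m b, n)] [(m, lact N b n)]"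

text \<open>The element of the tensor product given by a formal sum is a chosen representative.\<close>

definition tsum ::
  "('k, 'a univ, 'x) module_scheme \<Rightarrow> ('k, 'a univ, 'y) rmod_scheme \<Rightarrow> ('k, 'a univ, 'z) bimod_scheme \<Rightarrow>
   ('a univ \<times> 'a univ) list \<Rightarrow> 'a univ" where
  "tsum B M N xs = Tens (SOME ys. teq B M N xs ys)"

definition ptens ::
  "('k, 'a univ, 'x) module_scheme \<Rightarrow> ('k, 'a univ, 'y) rmod_scheme \<Rightarrow> ('k, 'a univ, 'z) bimod_scheme \<Rightarrow>
   'a univ \<Rightarrow> 'a univ \<Rightarrow> 'a univ" where
  "ptens B M N m n = tsum B M N [(m, n)]"

definition tens ::
  "('k, 'a univ, 'x) module_scheme \<Rightarrow> ('k, 'a univ, 'y) rmod_scheme \<Rightarrow> ('k, 'a univ, 'z) bimod_scheme \<Rightarrow>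
   ('k, 'a univ) module" where
  "tens B M N =
     \<lparr>carrier = tsum B M N ` lists (carrier M \<times> carrier N),
      mult = undefined,
      one = undefined,
      zero = tsum B M N [],
      add = (\<lambda>u v. tsum B M N (terms u @ terms v)),
      smult = (\<lambda>\<kappa> u. tsum B M N (map (\<lambda>(m, n). (m, \<kappa> \<odot>\<^bsub>N\<^esub> n)) (terms u)))\<rparr>"

definition rtens ::
  "('k, 'a univ, 'x) module_scheme \<Rightarrow> ('k, 'a univ, 'y) rmod_scheme \<Rightarrow> ('k, 'a univ, 'z) bimod_scheme \<Rightarrow>
   ('k, 'a univ) rmod" where
  "rtens B M N = rmod_of (tens B M N) (on_carriers (carrier (tens B M N)) (carrier B)
     (\<lambda>u b. tsum B M N (map (\<lambda>(m, n). (m, ract N n b)) (terms u))))"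

definition btens ::
  "('k, 'a univ, 'x) module_scheme \<Rightarrow> ('k, 'a univ, 'y) bimod_scheme \<Rightarrow> ('k, 'a univ, 'z) bimod_scheme \<Rightarrow>
   ('k, 'a univ) bimod" where
  "btens B M N = bimod_of (tens B M N) (ract (rtens B M N)) (on_carriers (carrier B) (carrier (tens B M N))
     (\<lambda>b u. tsum B M N (map (\<lambda>(m, n). (lact M b m, n)) (terms u))))"

text \<open>The additive extension \<open>\<Sum> m\<^sub>i \<otimes> n\<^sub>i \<mapsto> \<Sum> F m\<^sub>i n\<^sub>i\<close> with values in \<open>P\<close>; it does not depend on the
  chosen representatives if \<open>F\<close> is biadditive and balanced.\<close>

definition tlift :: "('a univ, 'z) ring_scheme \<Rightarrow> ('a univ \<Rightarrow> 'a univ \<Rightarrow> 'a univ) \<Rightarrow> 'a univ \<Rightarrow> 'a univ" where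
  "tlift P F u = foldr (\<lambda>(m, n) z. F m n \<oplus>\<^bsub>P\<^esub> z) (terms u) \<zero>\<^bsub>P\<^esub>"

definition tmap where
  "tmap B M N M' N' f g = (\<lambda>u \<in> carrier (tens B M N). tlift (tens B M' N') (\<lambda>m n. ptens B M' N' (f m) (g n)) u)"

definition tassoc where
  "tassoc B L M N = (\<lambda>u \<in> carrier (tens B (rtens B L M) N).
     tlift (tens B L (btens B M N))
       (\<lambda>v n. tlift (tens B L (btens B M N)) (\<lambda>l m. ptens B L (btens B M N) l (ptens B M N m n)) v) u)"


section \<open>The categories of right modules and of bimodules\<close>

definition afun :: "'o \<times> 'f \<times> 'o \<Rightarrow> 'f" where
  "afun = (\<lambda>(x, f, y). f)"

definition concrete_cat ::
  "'o set \<Rightarrow> ('o \<Rightarrow> 'u set) \<Rightarrow> ('o \<Rightarrow> 'o \<Rightarrow> ('u \<Rightarrow> 'u) set) \<Rightarrow> ('o, 'o \<times> ('u \<Rightarrow> 'u) \<times> 'o) cat" where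
  "concrete_cat Obs car H =
     \<lparr>Ob = Obs,
      Ar = {(x, f, y). x \<in> Obs \<and> y \<in> Obs \<and> f \<in> H x y \<inter> extensional (car x)},
      Dom = (\<lambda>(x, f, y). x),
      Cod = (\<lambda>(x, f, y). y),
      Idn = (\<lambda>x. (x, \<lambda>u \<in> car x. u, x)),
      Cmp = (\<lambda>(x', g, y) (x, f, y'). (x, compose (car x) g f, y))\<rparr>"

type_synonym ('k, 'u) rarr = "('k, 'u) rmod \<times> ('u \<Rightarrow> 'u) \<times> ('k, 'u) rmod"
type_synonym ('k, 'u) barr = "('k, 'u) bimod \<times> ('u \<Rightarrow> 'u) \<times> ('k, 'u) bimod"

definition mod_cat ::
  "('k, 'x) ring_scheme \<Rightarrow> ('k, 'u, 'z) module_scheme \<Rightarrow> (('k, 'u) rmod, ('k, 'u) rarr) cat" where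
  "mod_cat K B = concrete_cat {M. right_module K B M} carrier (right_linear_maps K B)"

definition reg_bimod :: "('k, 'u, 'z) module_scheme \<Rightarrow> ('k, 'u) bimod" where
  "reg_bimod B = bimod_of B (on_carriers (carrier B) (carrier B) (mult B))
     (on_carriers (carrier B) (carrier B) (mult B))"

definition bimod_moncat ::
  "('k, 'x) ring_scheme \<Rightarrow> ('k, 'a univ, 'z) module_scheme \<Rightarrow> (('k, 'a univ) bimod, ('k, 'a univ) barr) moncat" where
  "bimod_moncat K B =
     cat.extend (concrete_cat {M. bimodule K B M} carrier (bilinear_maps K B))
       (moncat.fields
         (btens B)
         (\<lambda>(M, f, M') (N, g, N'). (btens B M N, tmap B M N M' N' f g, btens B M' N'))
         (reg_bimod B)
         (\<lambda>L M N. (btens B (btens B L M) N, tassoc B L M N, btens B L (btens B M N)))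
         (\<lambda>M. (btens B (reg_bimod B) M, \<lambda>u \<in> carrier (tens B (reg_bimod B) M). tlift M (lact M) u, M))
         (\<lambda>M. (btens B M (reg_bimod B), \<lambda>u \<in> carrier (tens B M (reg_bimod B)). tlift M (ract M) u, M)))"

definition mod_actcat ::
  "('k, 'x) ring_scheme \<Rightarrow> ('k, 'a univ, 'z) module_scheme \<Rightarrow>
   (('k, 'a univ) rmod, ('k, 'a univ) rarr, ('k, 'a univ) bimod, ('k, 'a univ) barr) actcat" where
  "mod_actcat K B =
     cat.extend (mod_cat K B)
       (actcat.fields
         (rtens B)
         (\<lambda>(M, f, M') (X, g, X'). (rtens B M X, tmap B M X M' X' f g, rtens B M' X'))
         (\<lambda>M X Y. (rtens B (rtens B M X) Y, tassoc B M X Y, rtens B M (btens B X Y)))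
         (\<lambda>M. (rtens B M (reg_bimod B), \<lambda>u \<in> carrier (tens B M (reg_bimod B)). tlift M (ract M) u, M)))"


section \<open>Right bialgebroids, their comodules and modules\<close>

record ('k, 'u) bialgebroid = "('k, 'u) module" +
  src :: "'u \<Rightarrow> 'u"
  tgt :: "'u \<Rightarrow> 'u"
  comult :: "'u \<Rightarrow> 'u"
  counit :: "'u \<Rightarrow> 'u"

definition bgd_bimod :: "('k, 'u, 'y) module_scheme \<Rightarrow> ('k, 'u) bialgebroid \<Rightarrow> ('k, 'u) bimod" where
  "bgd_bimod R H = bimod_of H
     (on_carriers (carrier H) (carrier R) (\<lambda>h r. h \<otimes>\<^bsub>H\<^esub> src H r))
     (on_carriers (carrier R) (carrier H) (\<lambda>r h. h \<otimes>\<^bsub>H\<^esub> tgt H r))"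

abbreviation bgd_sq :: "('k, 'a univ) module \<Rightarrow> ('k, 'a univ) bialgebroid \<Rightarrow> ('k, 'a univ) bimod" where
  "bgd_sq R H \<equiv> btens R (bgd_bimod R H) (bgd_bimod R H)"

definition bgd_comult :: "('k, 'a univ) module \<Rightarrow> ('k, 'a univ) bialgebroid \<Rightarrow> ('k, 'a univ) barr" where
  "bgd_comult R H = (bgd_bimod R H, comult H, bgd_sq R H)"

definition bgd_counit :: "('k, 'a univ) module \<Rightarrow> ('k, 'a univ) bialgebroid \<Rightarrow> ('k, 'a univ) barr" where
  "bgd_counit R H = (bgd_bimod R H, counit H, reg_bimod R)"

definition takeuchi :: "('k, 'a univ) module \<Rightarrow> ('k, 'a univ) bialgebroid \<Rightarrow> 'a univ set" where
  "takeuchi R H = {u \<in> carrier (bgd_sq R H). \<forall>r \<in> carrier R.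
     tlift (bgd_sq R H) (\<lambda>x y. ptens R (bgd_bimod R H) (bgd_bimod R H) (src H r \<otimes>\<^bsub>H\<^esub> x) y) u
       = tlift (bgd_sq R H) (\<lambda>x y. ptens R (bgd_bimod R H) (bgd_bimod R H) x (tgt H r \<otimes>\<^bsub>H\<^esub> y)) u}"

definition takeuchi_mult ::
  "('k, 'a univ) module \<Rightarrow> ('k, 'a univ) bialgebroid \<Rightarrow> 'a univ \<Rightarrow> 'a univ \<Rightarrow> 'a univ" where
  "takeuchi_mult R H u v =
     tlift (bgd_sq R H) (\<lambda>x y. tlift (bgd_sq R H)
       (\<lambda>x' y'. ptens R (bgd_bimod R H) (bgd_bimod R H) (x \<otimes>\<^bsub>H\<^esub> x') (y \<otimes>\<^bsub>H\<^esub> y')) v) u"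

definition right_bialgebroid ::
  "('k, 'x) ring_scheme \<Rightarrow> ('k, 'a univ) module \<Rightarrow> ('k, 'a univ) bialgebroid \<Rightarrow> bool" where
  "right_bialgebroid K R H \<longleftrightarrow> k_algebra K H \<and>
     src H \<in> ring_hom R H \<inter> linear_maps K R H \<and>
     tgt H \<in> linear_maps K R H \<and> tgt H \<one>\<^bsub>R\<^esub> = \<one>\<^bsub>H\<^esub> \<and>
     (\<forall>r \<in> carrier R. \<forall>r' \<in> carrier R.
        tgt H (r \<otimes>\<^bsub>R\<^esub> r') = tgt H r' \<otimes>\<^bsub>H\<^esub> tgt H r \<and>
        src H r \<otimes>\<^bsub>H\<^esub> tgt H r' = tgt H r' \<otimes>\<^bsub>H\<^esub> src H r) \<and>
     coalgebra_in (bimod_moncat K R) (bgd_bimod R H) (bgd_comult R H) (bgd_counit R H) \<and>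
     (\<forall>h \<in> carrier H. comult H h \<in> takeuchi R H) \<and>
     comult H \<one>\<^bsub>H\<^esub> = ptens R (bgd_bimod R H) (bgd_bimod R H) \<one>\<^bsub>H\<^esub> \<one>\<^bsub>H\<^esub> \<and>
     (\<forall>h \<in> carrier H. \<forall>h' \<in> carrier H.
        comult H (h \<otimes>\<^bsub>H\<^esub> h') = takeuchi_mult R H (comult H h) (comult H h')) \<and>
     counit H \<one>\<^bsub>H\<^esub> = \<one>\<^bsub>R\<^esub> \<and>
     (\<forall>h \<in> carrier H. \<forall>h' \<in> carrier H.
        counit H (tgt H (counit H h) \<otimes>\<^bsub>H\<^esub> h') = counit H (h \<otimes>\<^bsub>H\<^esub> h') \<and>
        counit H (src H (counit H h) \<otimes>\<^bsub>H\<^esub> h') = counit H (h \<otimes>\<^bsub>H\<^esub> h'))"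

type_synonym ('k, 'u) rcomod = "('k, 'u) rmod \<times> ('k, 'u) rarr"
type_synonym ('k, 'u) carr = "('k, 'u) rcomod \<times> ('k, 'u) rarr \<times> ('k, 'u) rcomod"

text \<open>The bimodule underlying an \<open>H\<close>-comodule: \<open>r \<cdot> m = m\<^sub>0 \<cdot> \<epsilon>(s(r) m\<^sub>1)\<close>.\<close>

definition comod_bimod ::
  "('k, 'a univ) module \<Rightarrow> ('k, 'a univ) bialgebroid \<Rightarrow> ('k, 'a univ) rcomod \<Rightarrow> ('k, 'a univ) bimod" where
  "comod_bimod R H = (\<lambda>(M, \<rho>). bimod_of M (ract M) (on_carriers (carrier R) (carrier M)
     (\<lambda>r m. tlift M (\<lambda>m0 m1. ract M m0 (counit H (src H r \<otimes>\<^bsub>H\<^esub> m1))) (afun \<rho> m))))"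

definition comod_tens ::
  "('k, 'a univ) module \<Rightarrow> ('k, 'a univ) bialgebroid \<Rightarrow>
   ('k, 'a univ) rcomod \<Rightarrow> ('k, 'a univ) rcomod \<Rightarrow> ('k, 'a univ) rcomod" where
  "comod_tens R H = (\<lambda>(M, \<rho>) (N, \<sigma>).
     let N' = comod_bimod R H (N, \<sigma>); P = rtens R M N'; Q = rtens R P (bgd_bimod R H)
     in (P, (P, \<lambda>u \<in> carrier P. tlift Q (\<lambda>m n.
               tlift Q (\<lambda>m0 m1.
                 tlift Q (\<lambda>n0 n1. ptens R P (bgd_bimod R H) (ptens R M N' m0 n0) (m1 \<otimes>\<^bsub>H\<^esub> n1))
                   (afun \<sigma> n)) (afun \<rho> m)) u, Q)))"

definition comod_unit ::
  "('k, 'a univ) module \<Rightarrow> ('k, 'a univ) bialgebroid \<Rightarrow> ('k, 'a univ) rcomod" where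
  "comod_unit R H =
     (let I = rmod_of R (ract (reg_bimod R))
      in (I, (I, \<lambda>r \<in> carrier R. ptens R I (bgd_bimod R H) \<one>\<^bsub>R\<^esub> (src H r), rtens R I (bgd_bimod R H))))"

definition comod_moncat ::
  "('k, 'x) ring_scheme \<Rightarrow> ('k, 'a univ) module \<Rightarrow> ('k, 'a univ) bialgebroid \<Rightarrow>
   (('k, 'a univ) rcomod, ('k, 'a univ) carr) moncat" where
  "comod_moncat K R H =
     (let T = comod_tens R H; b = comod_bimod R H; I = comod_unit R H;
          arr = (\<lambda>x f y. (x, (fst x, f, fst y), y))
      in cat.extend
           (comodule_cat (bimod_moncat K R) (mod_actcat K R) (bgd_bimod R H) (bgd_comult R H) (bgd_counit R H))
           (moncat.fields T
             (\<lambda>(x, f, x') (y, g, y'). arr (T x y) (tmap R (fst x) (b y) (fst x') (b y') (afun f) (afun g)) (T x' y'))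
             I
             (\<lambda>x y z. arr (T (T x y) z) (tassoc R (fst x) (b y) (b z)) (T x (T y z)))
             (\<lambda>x. arr (T I x) (\<lambda>u \<in> carrier (fst (T I x)). tlift (fst x) (lact (b x)) u) x)
             (\<lambda>x. arr (T x I) (\<lambda>u \<in> carrier (fst (T x I)). tlift (fst x) (ract (fst x)) u) x)))"

text \<open>Right \<open>H\<close>-modules are right modules over the underlying algebra of \<open>H\<close>; the underlying
  \<open>R\<close>-bimodule has \<open>r \<cdot> c \<cdot> r' = c \<cdot> (t(r) s(r'))\<close>.\<close>

definition hmod_bimod ::
  "('k, 'u) module \<Rightarrow> ('k, 'u) bialgebroid \<Rightarrow> ('k, 'u) rmod \<Rightarrow> ('k, 'u) bimod" where
  "hmod_bimod R H C = bimod_of C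
     (on_carriers (carrier C) (carrier R) (\<lambda>c r. ract C c (src H r)))
     (on_carriers (carrier R) (carrier C) (\<lambda>r c. ract C c (tgt H r)))"

definition hmod_tens ::
  "('k, 'a univ) module \<Rightarrow> ('k, 'a univ) bialgebroid \<Rightarrow>
   ('k, 'a univ) rmod \<Rightarrow> ('k, 'a univ) rmod \<Rightarrow> ('k, 'a univ) rmod" where
  "hmod_tens R H C D =
     (let C' = hmod_bimod R H C; D' = hmod_bimod R H D; P = tens R C' D'
      in rmod_of P (on_carriers (carrier P) (carrier H)
           (\<lambda>u h. tlift P (\<lambda>c d. tlift P (\<lambda>h1 h2. ptens R C' D' (ract C c h1) (ract D d h2)) (comult H h)) u)))"

definition hmod_unit :: "('k, 'u) module \<Rightarrow> ('k, 'u) bialgebroid \<Rightarrow> ('k, 'u) rmod" where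
  "hmod_unit R H = rmod_of R (on_carriers (carrier R) (carrier H) (\<lambda>r h. counit H (src H r \<otimes>\<^bsub>H\<^esub> h)))"

definition hmod_moncat ::
  "('k, 'x) ring_scheme \<Rightarrow> ('k, 'a univ) module \<Rightarrow> ('k, 'a univ) bialgebroid \<Rightarrow>
   (('k, 'a univ) rmod, ('k, 'a univ) rarr) moncat" where
  "hmod_moncat K R H =
     (let T = hmod_tens R H; b = hmod_bimod R H; I = hmod_unit R H
      in cat.extend (mod_cat K H)
           (moncat.fields T
             (\<lambda>(C, f, C') (D, g, D'). (T C D, tmap R (b C) (b D) (b C') (b D') f g, T C' D'))
             I
             (\<lambda>C D E. (T (T C D) E, tassoc R (b C) (b D) (b E), T C (T D E)))
             (\<lambda>C. (T I C, \<lambda>u \<in> carrier (T I C). tlift C (lact (b C)) u, C))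
             (\<lambda>C. (T C I, \<lambda>u \<in> carrier (T C I). tlift C (ract (b C)) u, C))))"


section \<open>Doi-Koppinen data and their modules\<close>

locale doi_koppinen_datum =
  fixes K :: "('k, 'x) ring_scheme"
    and R :: "('k, 'a univ) module"
    and H :: "('k, 'a univ) bialgebroid"
    and A :: "('k, 'a univ) rcomod" and mA uA :: "('k, 'a univ) carr"
    and C :: "('k, 'a univ) rmod" and dC eC :: "('k, 'a univ) rarr"
  assumes base_field: "field K"
    and base_algebra: "k_algebra K R"
    and bialgebroid: "right_bialgebroid K R H"
    and comodule_algebra: "algebra_in (comod_moncat K R H) A mA uA"
    and module_coalgebra: "coalgebra_in (hmod_moncat K R H) C dC eC"

definition dk_mult where
  "dk_mult R H A mA = (let A' = comod_bimod R H A in (btens R A' A', afun (afun mA), A'))"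

definition dk_unit where
  "dk_unit R H A uA = (reg_bimod R, afun (afun uA), comod_bimod R H A)"

definition dk_comult where
  "dk_comult R H C dC = (let C' = hmod_bimod R H C in (C', afun dC, btens R C' C'))"

definition dk_counit where
  "dk_counit R H C eC = (hmod_bimod R H C, afun eC, reg_bimod R)"

definition dk_one where
  "dk_one R uA = afun (afun uA) \<one>\<^bsub>R\<^esub>"

definition dk_i where
  "dk_i R H A uA = (\<lambda>r \<in> carrier R. lact (comod_bimod R H A) r (dk_one R uA))"

definition dk_psi where
  "dk_psi R H A C =
     (let A' = comod_bimod R H A; C' = hmod_bimod R H C
      in (btens R C' A',
          \<lambda>u \<in> carrier (btens R C' A').
            tlift (btens R A' C') (\<lambda>c a.
              tlift (btens R A' C') (\<lambda>a0 a1. ptens R A' C' a0 (ract C c a1)) (afun (snd A) a)) u,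
          btens R A' C'))"

definition dk_delta where
  "dk_delta R H A uA C dC =
     (let A' = comod_bimod R H A; C' = hmod_bimod R H C
      in (C', \<lambda>c \<in> carrier C. ptens R A' (btens R C' C') (dk_one R uA) (afun dC c), btens R A' (btens R C' C')))"

definition dk_f where
  "dk_f R H A uA C eC =
     (hmod_bimod R H C, compose (carrier C) (dk_i R H A uA) (afun eC), comod_bimod R H A)"

definition ord_algebra ::
  "('k, 'a univ) module \<Rightarrow> ('k, 'a univ) bimod \<Rightarrow> ('k, 'a univ) barr \<Rightarrow> ('k, 'a univ) barr \<Rightarrow> ('k, 'a univ) module" where
  "ord_algebra R A m \<eta> =
     \<lparr>carrier = carrier A, mult = (\<lambda>a b. afun m (ptens R A A a b)), one = afun \<eta> \<one>\<^bsub>R\<^esub>,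
      zero = zero A, add = add A, smult = smult A\<rparr>"

definition restrict_scalars ::
  "('k, 'u) module \<Rightarrow> ('u \<Rightarrow> 'u) \<Rightarrow> ('k, 'u) rmod \<Rightarrow> ('k, 'u) rmod" where
  "restrict_scalars R i M = rmod_of M (on_carriers (carrier M) (carrier R) (\<lambda>m r. ract M m (i r)))"

text \<open>Objects are pairs \<open>(M, \<rho>)\<close> with \<open>M\<close> a right module over the algebra \<open>A\<close>, and \<open>\<rho>\<close> a
  \<open>C\<close>-coaction on the right \<open>R\<close>-module obtained from \<open>M\<close> by restriction along \<open>i\<close>.\<close>

definition dk_module_cat ::
  "('k, 'x) ring_scheme \<Rightarrow> ('k, 'a univ) module \<Rightarrow> ('k, 'a univ) bialgebroid \<Rightarrow>
   ('k, 'a univ) rcomod \<Rightarrow> ('k, 'a univ) carr \<Rightarrow> ('k, 'a univ) carr \<Rightarrow>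
   ('k, 'a univ) rmod \<Rightarrow> ('k, 'a univ) rarr \<Rightarrow> ('k, 'a univ) rarr \<Rightarrow>
   (('k, 'a univ) rcomod, ('k, 'a univ) carr) cat" where
  "dk_module_cat K R H A mA uA C dC eC =
     (let B = ord_algebra R (comod_bimod R H A) (dk_mult R H A mA) (dk_unit R H A uA);
          C' = hmod_bimod R H C;
          res = restrict_scalars R (dk_i R H A uA);
          M_C = comodule_cat (bimod_moncat K R) (mod_actcat K R) C' (dk_comult R H C dC) (dk_counit R H C eC)
      in structured_cat (mod_cat K B)
           {(M, \<rho>). M \<in> Ob (mod_cat K B) \<and> (res M, \<rho>) \<in> Ob M_C \<and>
              (\<forall>m \<in> carrier M. \<forall>a \<in> carrier B.
                 afun \<rho> (ract M m a) =
                   tlift (tens R (res M) C') (\<lambda>m0 m1.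
                     tlift (tens R (res M) C') (\<lambda>a0 a1. ptens R (res M) C' (ract M m0 a0) (ract C m1 a1))
                       (afun (snd A) a)) (afun \<rho> m))}
           fst
           (\<lambda>(M, \<rho>) f (N, \<sigma>). ((res M, \<rho>), (res M, afun f, res N), (res N, \<sigma>)) \<in> Ar M_C))"


section \<open>The comparison functors\<close>

definition ord_rmod ::
  "('k, 'a univ) module \<Rightarrow> ('k, 'a univ) bimod \<Rightarrow> ('k, 'a univ) rmod \<Rightarrow> ('k, 'a univ) rarr \<Rightarrow> ('k, 'a univ) rmod" where
  "ord_rmod R A M \<mu> = rmod_of M (on_carriers (carrier M) (carrier A) (\<lambda>m a. afun \<mu> (ptens R M A m a)))"

definition ord_bimod ::
  "('k, 'a univ) module \<Rightarrow> ('k, 'a univ) bimod \<Rightarrow> ('k, 'a univ) bimod \<Rightarrow> ('k, 'a univ) barr \<Rightarrow> ('k, 'a univ) barr \<Rightarrow>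
   ('k, 'a univ) bimod" where
  "ord_bimod R A Y l r = bimod_of Y
     (on_carriers (carrier Y) (carrier A) (\<lambda>y a. afun r (ptens R Y A y a)))
     (on_carriers (carrier A) (carrier Y) (\<lambda>a y. afun l (ptens R A Y a y)))"

text \<open>Given the coequalizer \<open>q\<close> of functions on \<open>M \<otimes>\<^sub>R Y\<close>, the identification of its codomain
  with the ordinary tensor product \<open>M' \<otimes>\<^sub>B Y'\<close>, which maps \<open>q (m \<otimes>\<^sub>R y)\<close> to \<open>m \<otimes>\<^sub>B y\<close>.\<close>

definition to_ord where
  "to_ord R M Y q B M' Y' z = tlift (tens B M' Y') (ptens B M' Y') (inv_into (carrier (tens R M Y)) q z)"

text \<open>The \<open>A\<close>-coring \<open>Y\<close> of the category of \<open>R\<close>-bimodules viewed as an ordinary coring over the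
  \<open>k\<close>-algebra underlying \<open>A\<close>.\<close>

definition ord_cor_ob where
  "ord_cor_ob R A Y = ord_bimod R A (cor_ob Y) (cor_lact Y) (cor_ract Y)"

definition ord_cor_comult where
  "ord_cor_comult K R A m \<eta> Y =
     (let B = ord_algebra R A m \<eta>; Y' = ord_cor_ob R A Y
      in (Y', compose (carrier Y')
                (to_ord R (cor_ob Y) (cor_ob Y) (afun (cor_sq (bimod_moncat K R) A Y)) B Y' Y')
                (afun (cor_comult Y)), btens B Y' Y'))"

definition ord_cor_counit where
  "ord_cor_counit R A m \<eta> Y =
     (ord_cor_ob R A Y, afun (cor_counit Y), reg_bimod (ord_algebra R A m \<eta>))"

definition ord_comodule_cat ::
  "('k, 'x) ring_scheme \<Rightarrow> ('k, 'a univ) module \<Rightarrow> ('k, 'a univ) bimod \<Rightarrow> ('k, 'a univ) barr \<Rightarrow> ('k, 'a univ) barr \<Rightarrow>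
   (('k, 'a univ) bimod, ('k, 'a univ) barr) coring \<Rightarrow> (('k, 'a univ) rcomod, ('k, 'a univ) carr) cat" where
  "ord_comodule_cat K R A m \<eta> Y =
     (let B = ord_algebra R A m \<eta>
      in comodule_cat (bimod_moncat K B) (mod_actcat K B) (ord_cor_ob R A Y)
           (ord_cor_comult K R A m \<eta> Y) (ord_cor_counit R A m \<eta> Y))"

text \<open>The functor that keeps the vector space and the \<open>A\<close>-action and forgets the \<open>R\<close>-module
  structure of \<open>M\<close>.\<close>

definition forget_R_ob where
  "forget_R_ob K R A m \<eta> Y = (\<lambda>(M, \<mu>, \<rho>).
     let B = ord_algebra R A m \<eta>; M' = ord_rmod R A M \<mu>; Y' = ord_cor_ob R A Y;
         q = balq (bimod_moncat K R) (mod_actcat K R) A M \<mu> (cor_ob Y) (cor_lact Y)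
     in (M', (M', compose (carrier M') (to_ord R M (cor_ob Y) (afun q) B M' Y') (afun \<rho>), rtens B M' Y')))"

text \<open>The functor that carries \<open>\<rho> : M \<rightarrow> M \<otimes>\<^sub>A (A \<otimes>\<^sub>R X)\<close> to the coaction \<open>M \<rightarrow> M \<otimes>\<^sub>R X\<close>.\<close>

definition to_dk_ob where
  "to_dk_ob K R A m X = (\<lambda>(M, \<mu>, \<rho>).
     (ord_rmod R A M \<mu>,
      Cmp (mod_actcat K R) (cowreath_upsilon (bimod_moncat K R) (mod_actcat K R) A m X M \<mu>) \<rho>))"

definition same_map ::
  "(('k, 'u) rmod \<times> 'c \<Rightarrow> ('k, 'u) rcomod) \<Rightarrow>
   ('k, 'u) rmod \<times> 'c \<Rightarrow> ('k, 'u) rarr \<Rightarrow> ('k, 'u) rmod \<times> 'c \<Rightarrow> ('k, 'u) carr" where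
  "same_map F x f y = (F x, (fst (F x), afun f, fst (F y)), F y)"

end

theory Submission
  imports Defs
begin

text \<open>
  Everything is computed on pure tensors. For a right module \<open>M\<close> and a left module \<open>Y\<close> over the algebra \<open>A\<close> in the
  category of bimodules, the universal property of the formal tensor product identifies the coequalizer
  \<open>M \<otimes>\<^sub>A Y\<close> with the tensor product \<open>M' \<otimes>\<^sub>B Y'\<close> over the ordinary \<open>k\<close>-algebra \<open>B\<close> underlying \<open>A\<close>.
  Through this identification the structure maps of a corepresentation become those of an ordinary comodule
  over the coring \<open>A \<otimes>\<^sub>R X\<close>. The mutually inverse maps \<open>m \<otimes>\<^sub>B (a \<otimes> x) \<mapsto> ma \<otimes> x\<close> and
  \<open>m \<otimes> x \<mapsto> m \<otimes>\<^sub>B (1 \<otimes> x)\<close> then turn comodules into Doi-Koppinen modules: linearity over \<open>A\<close> of the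
  coaction is the compatibility condition, and coassociativity and the counit law correspond to each other.
\<close>

text \<open>The obstacle is choice. An element of a tensor product is a chosen list of pairs, and
  \<open>balq\<close>, \<open>factor_through\<close> and \<open>inv_arrow\<close> are choice or
  description operators, so each has to be characterised before anything can be computed. Elements
  are handled in Sweedler style: an identity between tensors is tested against an arbitrary balanced
  or trilinear function, and linear maps pass under such sums. For the chosen quotients, an
  injective coordinate map \<open>th\<close> into an ordinary tensor product turns every induced map
  into an explicit one. Many well-definedness arguments rest on one fact about right comodules, r
  m_0 \<otimes> m_1 = m_0 \<otimes> t(r) m_1, which comes from coassociativity and the counit of the
  bialgebroid. The cowreath law that relates \<delta> and \<psi> and the right linearity of the
  comultiplication of A \<otimes> X are the same identity of elements.\<close>

abbreviation (input) in_carrier (infix "IN" 50) where "x IN M \<equiv> x \<in> carrier M"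
abbreviation (input) "cod f \<equiv> snd (snd f)"
abbreviation (input) "pt \<equiv> ptens"
abbreviation (input) "tf \<equiv> tlift"
abbreviation (input) "rg \<equiv> reg_bimod"
abbreviation (input) "rm \<equiv> right_module"
abbreviation (input) "bm \<equiv> bimodule"
abbreviation (input) "lm \<equiv> linear_maps"
abbreviation (input) "rlm \<equiv> right_linear_maps"
abbreviation (input) "blm \<equiv> bilinear_maps"
abbreviation (input) "idc M \<equiv> (\<lambda>x \<in> carrier M. x)"

lemma rmod_of_simps [simp]:
 "carrier (rmod_of V g) = carrier V" "add (rmod_of V g) = add V" "zero (rmod_of V g) = zero V"
 "smult (rmod_of V g) = smult V" "mult (rmod_of V g) = mult V" "one (rmod_of V g) = one V"
 "ract (rmod_of V g) = g"
 by (simp_all add: rmod_of_def module.extend_def module.truncate_def rmod.fields_def)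

lemma bimod_of_simps [simp]:
 "carrier (bimod_of V g h) = carrier V" "add (bimod_of V g h) = add V" "zero (bimod_of V g h) = zero V"
 "smult (bimod_of V g h) = smult V" "mult (bimod_of V g h) = mult V" "one (bimod_of V g h) = one V"
 "ract (bimod_of V g h) = g" "lact (bimod_of V g h) = h"
 by (simp_all add: bimod_of_def rmod.extend_def bimod.fields_def)

lemma on_carriers_apply [simp]: "x \<in> S ==> y \<in> T ==> on_carriers S T g x y = g x y"
 by (simp add: on_carriers_def)

lemma on_carriers_idem [simp]: "on_carriers S T (on_carriers S T g) = on_carriers S T g"
 by (auto simp: on_carriers_def fun_eq_iff)

lemma on_carriers_cong:
 "(!!x y. x \<in> S ==> y \<in> T ==> g x y = h x y) ==> on_carriers S T g = on_carriers S T h"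
 by (auto simp: on_carriers_def fun_eq_iff)

text \<open>The axioms of an abelian group read only carrier, addition and zero. Records are
  constantly rebuilt with other actions or with undefined \<open>mult\<close> and
  \<open>one\<close>, and this carries the group structure over.\<close>

lemma abelian_group_fields_cong:
 assumes "abelian_group M" "carrier N = carrier M" "add N = add M" "zero N = zero M"
 shows "abelian_group N"
proof -
 interpret abelian_group M by fact
 show ?thesis
 by (rule abelian_groupI) (use assms l_neg a_inv_closed in "auto simp: a_ac")
qed

lemma mod_cong:
 assumes "module K M" "carrier N = carrier M" "add N = add M" "zero N = zero M" "smult N = smult M"
 shows "module K N"
 using assms abelian_group_fields_cong[OF _ assms(2-4)] by (simp add: module_def module_axioms_def)

section \<open>Linear maps\<close>

context
 fixes K :: "('k, 'x) ring_scheme" and M :: "('k, 'u, 'y) module_scheme"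
 assumes M: "module K M"
begin

interpretation module K M by (rule M)

text \<open>The locale facts are restated with \<open>module K M\<close> as an explicit premise,
  because the modules that occur are terms built on the fly rather than fixed parameters.\<close>

lemma m_add_closed: "x IN M ==> y IN M ==> x \<oplus>\<^bsub>M\<^esub> y IN M"
 and m_zero_closed: "\<zero>\<^bsub>M\<^esub> IN M"
 and m_smult_closed: "kk IN K ==> x IN M ==> kk \<odot>\<^bsub>M\<^esub> x IN M"
 and m_l_zero: "x IN M ==> \<zero>\<^bsub>M\<^esub> \<oplus>\<^bsub>M\<^esub> x = x"
 and m_r_zero: "x IN M ==> x \<oplus>\<^bsub>M\<^esub> \<zero>\<^bsub>M\<^esub> = x"
 and m_a_assoc: "x IN M ==> y IN M ==> z IN M ==>
 (x \<oplus>\<^bsub>M\<^esub> y) \<oplus>\<^bsub>M\<^esub> z = x \<oplus>\<^bsub>M\<^esub> (y \<oplus>\<^bsub>M\<^esub> z)"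
 and m_a_comm: "x IN M ==> y IN M ==> x \<oplus>\<^bsub>M\<^esub> y = y \<oplus>\<^bsub>M\<^esub> x"
 and m_smult_add: "kk IN K ==> x IN M ==> y IN M ==>
 kk \<odot>\<^bsub>M\<^esub> (x \<oplus>\<^bsub>M\<^esub> y) = kk \<odot>\<^bsub>M\<^esub> x \<oplus>\<^bsub>M\<^esub> kk \<odot>\<^bsub>M\<^esub> y"
 and m_add_smult: "kk IN K ==> kk' IN K ==> x IN M ==>
 (kk \<oplus>\<^bsub>K\<^esub> kk') \<odot>\<^bsub>M\<^esub> x = kk \<odot>\<^bsub>M\<^esub> x \<oplus>\<^bsub>M\<^esub> kk' \<odot>\<^bsub>M\<^esub> x"
 and m_mult_smult: "kk IN K ==> kk' IN K ==> x IN M ==>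
 (kk \<otimes>\<^bsub>K\<^esub> kk') \<odot>\<^bsub>M\<^esub> x = kk \<odot>\<^bsub>M\<^esub> (kk' \<odot>\<^bsub>M\<^esub> x)"
 and m_one_smult: "x IN M ==> \<one>\<^bsub>K\<^esub> \<odot>\<^bsub>M\<^esub> x = x"
 and m_smult_zero: "kk IN K ==> kk \<odot>\<^bsub>M\<^esub> \<zero>\<^bsub>M\<^esub> = \<zero>\<^bsub>M\<^esub>"
 and m_abelian: "abelian_group M"
 and m_cring: "cring K"
 by (simp_all only: smult_r_distr smult_l_distr smult_assoc1 M.a_assoc M.abelian_group_axioms R.cring_axioms
 M.add.m_closed M.zero_closed smult_closed M.l_zero M.r_zero smult_one smult_r_null)
 (rule M.a_comm)

lemma m_neg: "x IN M ==> EX y:carrier M. x \<oplus>\<^bsub>M\<^esub> y = \<zero>\<^bsub>M\<^esub>"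
 using M.r_neg M.a_inv_closed by blast

text \<open>This is how an additive map is seen to preserve zero: f(0) = f(0) + f(0).\<close>

lemma m_idem_zero: "x IN M ==> x = x \<oplus>\<^bsub>M\<^esub> x ==> x = \<zero>\<^bsub>M\<^esub>"
 by (metis M.add.r_cancel_one)

lemma m_a_4: "a IN M ==> b IN M ==> c IN M ==> d IN M ==>
 (a \<oplus>\<^bsub>M\<^esub> b) \<oplus>\<^bsub>M\<^esub> (c \<oplus>\<^bsub>M\<^esub> d) = (a \<oplus>\<^bsub>M\<^esub> c) \<oplus>\<^bsub>M\<^esub> (b \<oplus>\<^bsub>M\<^esub> d)"
 by (simp add: M.a_ac)

end

lemma lmI:
 assumes "!!x. x IN M ==> f x IN N"
 "!!x y. x IN M ==> y IN M ==> f (x \<oplus>\<^bsub>M\<^esub> y) = f x \<oplus>\<^bsub>N\<^esub> f y"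
 "!!kk x. kk IN K ==> x IN M ==> f (kk \<odot>\<^bsub>M\<^esub> x) = kk \<odot>\<^bsub>N\<^esub> f x"
 shows "f : lm K M N"
 using assms by (auto simp: linear_maps_def)

lemma
 assumes "f : lm K M N"
 shows lin_closed: "x IN M ==> f x IN N"
 and lin_add: "x IN M ==> y IN M ==> f (x \<oplus>\<^bsub>M\<^esub> y) = f x \<oplus>\<^bsub>N\<^esub> f y"
 and lin_smult: "kk IN K ==> x IN M ==> f (kk \<odot>\<^bsub>M\<^esub> x) = kk \<odot>\<^bsub>N\<^esub> f x"
 using assms by (auto simp: linear_maps_def)

lemma lin_zero:
 assumes "f : lm K M N" "module K M" "module K N"
 shows "f \<zero>\<^bsub>M\<^esub> = \<zero>\<^bsub>N\<^esub>"
 using lin_add[OF assms(1), of "\<zero>\<^bsub>M\<^esub>" "\<zero>\<^bsub>M\<^esub>"] lin_closed[OF assms(1)] m_l_zero[OF assms(2)]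
 m_zero_closed[OF assms(2)] m_idem_zero[OF assms(3)] by metis

lemma lin_cong:
 assumes "f : lm K M N" "!!x. x IN M ==> f x = g x" "module K M"
 shows "g : lm K M N"
 by (rule lmI)
 (simp_all add: assms(2)[symmetric] m_add_closed[OF assms(3)] m_smult_closed[OF assms(3)]
 lin_closed[OF assms(1)] lin_add[OF assms(1)] lin_smult[OF assms(1)])

lemma lin_id: "(%x. x) : lm K M M"
 by (simp add: linear_maps_def)

lemma lin_comp:
 assumes "f : lm K M N" "g : lm K N P"
 shows "(%x. g (f x)) : lm K M P"
 using assms by (auto simp: linear_maps_def Pi_iff)

lemma lin_restrict: "f : lm K M N ==> module K M ==> (\<lambda>x \<in> carrier M. f x) : lm K M N"
 by (rule lin_cong) auto

section \<open>Sums over formal tensors\<close>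

text \<open>\<open>tlift\<close> with the list of pairs in place of the tensor, so that induction on
  lists applies before any choice of representative enters.\<close>

definition psum where "psum P F xs = foldr (%(m, n) z. F m n \<oplus>\<^bsub>P\<^esub> z) xs \<zero>\<^bsub>P\<^esub>"

lemma psum_simps [simp]:
 "psum P F [] = \<zero>\<^bsub>P\<^esub>" "psum P F ((m, n) # xs) = F m n \<oplus>\<^bsub>P\<^esub> psum P F xs"
 by (simp_all add: psum_def)

lemma tlift_psum: "tf P F u = psum P F (terms u)"
 by (simp add: tlift_def psum_def)

lemma pl_induct [consumes 1, case_names Nil Cons]:
 assumes "xs \<in> lists (S \<times> T)" "Q []"
 "!!m n xs. m \<in> S ==> n \<in> T ==> xs \<in> lists (S \<times> T) ==> Q xs ==> Q ((m, n) # xs)"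
 shows "Q xs"
 using assms(1) by (induction xs) (auto intro: assms)

lemma psum_closed:
 assumes "module K P" "xs \<in> lists (S \<times> T)" "!!m n. m \<in> S ==> n \<in> T ==> F m n IN P"
 shows "psum P F xs IN P"
 using assms(2) by (induction xs rule: pl_induct) (simp_all add: assms m_zero_closed[OF assms(1)] m_add_closed[OF assms(1)])

lemma psum_append:
 assumes "module K P" "!!m n. m \<in> S ==> n \<in> T ==> F m n IN P" "xs \<in> lists (S \<times> T)" "ys \<in> lists (S \<times> T)"
 shows "psum P F (xs @ ys) = psum P F xs \<oplus>\<^bsub>P\<^esub> psum P F ys"
 using assms(3)
proof (induction xs rule: pl_induct)
 case Nil
 show ?case
 using psum_closed[where K = K and P = P and xs = ys and S = S and T = T and F = F] assms by (simp add: m_l_zero[OF assms(1)])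
next
 case (Cons m n xs)
 then show ?case
 using psum_closed[where K = K and P = P and xs = xs and S = S and T = T and F = F] psum_closed[where K = K and P = P and xs = ys and S = S and T = T and F = F] assms
 by (simp add: m_a_assoc[OF assms(1)] del: in_lists_conv_set)
qed

lemma psum_cong:
 assumes "xs \<in> lists (S \<times> T)" "!!m n. m \<in> S ==> n \<in> T ==> F m n = G m n" "add P = add Q" "zero P = zero Q"
 shows "psum P F xs = psum Q G xs"
 using assms(1) by (induction xs rule: pl_induct) (simp_all add: assms)

lemma psum_map:
 "psum P F (map (%(m, n). (g m n, h m n)) xs) = psum P (%m n. F (g m n) (h m n)) xs"
 by (induction xs) auto

lemma psum_lin:
 assumes "L : lm K P Q" "module K P" "module K Q"
 "xs \<in> lists (S \<times> T)" "!!m n. m \<in> S ==> n \<in> T ==> F m n IN P"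
 shows "L (psum P F xs) = psum Q (%m n. L (F m n)) xs"
 using assms(4) by (induction xs rule: pl_induct)
 (simp_all add: lin_zero[OF assms(1-3)] lin_add[OF assms(1)] assms psum_closed[OF assms(2) _ assms(5)])

lemma psum_add:
 assumes "module K P" "xs \<in> lists (S \<times> T)" "!!m n. m \<in> S ==> n \<in> T ==> F m n IN P"
 "!!m n. m \<in> S ==> n \<in> T ==> G m n IN P"
 shows "psum P (%m n. F m n \<oplus>\<^bsub>P\<^esub> G m n) xs = psum P F xs \<oplus>\<^bsub>P\<^esub> psum P G xs"
 using assms(2) by (induction xs rule: pl_induct)
 (simp_all add: m_l_zero[OF assms(1)] m_zero_closed[OF assms(1)] m_a_4[OF assms(1)] assms
 psum_closed[OF assms(1) _ assms(3)] psum_closed[OF assms(1) _ assms(4)])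

lemma psum_smult:
 assumes "module K P" "xs \<in> lists (S \<times> T)" "!!m n. m \<in> S ==> n \<in> T ==> F m n IN P" "kk IN K"
 shows "psum P (%m n. kk \<odot>\<^bsub>P\<^esub> F m n) xs = kk \<odot>\<^bsub>P\<^esub> psum P F xs"
 using assms(2) by (induction xs rule: pl_induct)
 (simp_all add: m_smult_zero[OF assms(1)] m_smult_add[OF assms(1)] assms
 psum_closed[OF assms(1) _ assms(3)])

section \<open>Tensor products over an algebra\<close>

text \<open>Matches the generating relations of \<open>teq\<close>, which do not mention scalars
  from \<open>K\<close>.\<close>

definition biadditive where
 "biadditive B M N P F \<longleftrightarrow>
 (ALL m:carrier M. ALL n:carrier N. F m n IN P) &
 (ALL m:carrier M. ALL m':carrier M. ALL n:carrier N. F (m \<oplus>\<^bsub>M\<^esub> m') n = F m n \<oplus>\<^bsub>P\<^esub> F m' n) &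
 (ALL m:carrier M. ALL n:carrier N. ALL n':carrier N. F m (n \<oplus>\<^bsub>N\<^esub> n') = F m n \<oplus>\<^bsub>P\<^esub> F m n') &
 (ALL m:carrier M. ALL b:carrier B. ALL n:carrier N. F (ract M m b) n = F m (lact N b n))"

text \<open>Linearity over \<open>K\<close> is asked in the right variable only. In the left one it
  follows by balancing with the scalar multiples of the unit of \<open>B\<close>.\<close>

definition balanced where
 "balanced K B M N P F \<longleftrightarrow> biadditive B M N P F &
 (ALL kk:carrier K. ALL m:carrier M. ALL n:carrier N. F m (kk \<odot>\<^bsub>N\<^esub> n) = kk \<odot>\<^bsub>P\<^esub> F m n)"

lemma balancedI:
 assumes "!!m n. m IN M ==> n IN N ==> F m n IN P"
 "!!m m' n. m IN M ==> m' IN M ==> n IN N ==> F (m \<oplus>\<^bsub>M\<^esub> m') n = F m n \<oplus>\<^bsub>P\<^esub> F m' n"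
 "!!m n n'. m IN M ==> n IN N ==> n' IN N ==> F m (n \<oplus>\<^bsub>N\<^esub> n') = F m n \<oplus>\<^bsub>P\<^esub> F m n'"
 "!!m b n. m IN M ==> b IN B ==> n IN N ==> F (ract M m b) n = F m (lact N b n)"
 "!!kk m n. kk IN K ==> m IN M ==> n IN N ==> F m (kk \<odot>\<^bsub>N\<^esub> n) = kk \<odot>\<^bsub>P\<^esub> F m n"
 shows "balanced K B M N P F"
 using assms by (simp add: balanced_def biadditive_def)

lemma
 assumes "balanced K B M N P F"
 shows bal_closed: "m IN M ==> n IN N ==> F m n IN P"
 and bal_addl: "m IN M ==> m' IN M ==> n IN N ==> F (m \<oplus>\<^bsub>M\<^esub> m') n = F m n \<oplus>\<^bsub>P\<^esub> F m' n"
 and bal_addr: "m IN M ==> n IN N ==> n' IN N ==> F m (n \<oplus>\<^bsub>N\<^esub> n') = F m n \<oplus>\<^bsub>P\<^esub> F m n'"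
 and bal_bal: "m IN M ==> b IN B ==> n IN N ==> F (ract M m b) n = F m (lact N b n)"
 and bal_smult: "kk IN K ==> m IN M ==> n IN N ==> F m (kk \<odot>\<^bsub>N\<^esub> n) = kk \<odot>\<^bsub>P\<^esub> F m n"
 using assms by (simp_all add: balanced_def biadditive_def)

lemma bal_biadditive: "balanced K B M N P F ==> biadditive B M N P F"
 by (simp add: balanced_def)

lemma
 assumes "rm K B M"
 shows rm_module: "module K M"
 and rm_on_carriers: "on_carriers (carrier M) (carrier B) (ract M) = ract M"
 and rm_closed: "!!x b. x IN M ==> b IN B ==> ract M x b IN M"
 and rm_addl: "!!x y b. x IN M ==> y IN M ==> b IN B ==>
 ract M (x \<oplus>\<^bsub>M\<^esub> y) b = ract M x b \<oplus>\<^bsub>M\<^esub> ract M y b"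
 and rm_addr: "!!x b c. x IN M ==> b IN B ==> c IN B ==>
 ract M x (b \<oplus>\<^bsub>B\<^esub> c) = ract M x b \<oplus>\<^bsub>M\<^esub> ract M x c"
 and rm_mult: "!!x b c. x IN M ==> b IN B ==> c IN B ==>
 ract M x (b \<otimes>\<^bsub>B\<^esub> c) = ract M (ract M x b) c"
 and rm_one: "!!x. x IN M ==> ract M x \<one>\<^bsub>B\<^esub> = x"
 and rm_smultl: "!!kk x b. kk IN K ==> x IN M ==> b IN B ==>
 ract M (kk \<odot>\<^bsub>M\<^esub> x) b = kk \<odot>\<^bsub>M\<^esub> ract M x b"
 and rm_smultr: "!!kk x b. kk IN K ==> x IN M ==> b IN B ==>
 ract M x (kk \<odot>\<^bsub>B\<^esub> b) = kk \<odot>\<^bsub>M\<^esub> ract M x b"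
 by (use assms in "simp add: right_module_def"; fail | use assms[unfolded right_module_def] in metis; fail)+

lemma right_moduleI:
 assumes "module K M" "on_carriers (carrier M) (carrier B) (ract M) = ract M"
 "!!x b. x IN M ==> b IN B ==> ract M x b IN M"
 "!!x y b. x IN M ==> y IN M ==> b IN B ==>
 ract M (x \<oplus>\<^bsub>M\<^esub> y) b = ract M x b \<oplus>\<^bsub>M\<^esub> ract M y b"
 "!!x b c. x IN M ==> b IN B ==> c IN B ==>
 ract M x (b \<oplus>\<^bsub>B\<^esub> c) = ract M x b \<oplus>\<^bsub>M\<^esub> ract M x c"
 "!!x b c. x IN M ==> b IN B ==> c IN B ==>
 ract M x (b \<otimes>\<^bsub>B\<^esub> c) = ract M (ract M x b) c"
 "!!x. x IN M ==> ract M x \<one>\<^bsub>B\<^esub> = x"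
 "!!kk x b. kk IN K ==> x IN M ==> b IN B ==>
 ract M (kk \<odot>\<^bsub>M\<^esub> x) b = kk \<odot>\<^bsub>M\<^esub> ract M x b"
 "!!kk x b. kk IN K ==> x IN M ==> b IN B ==>
 ract M x (kk \<odot>\<^bsub>B\<^esub> b) = kk \<odot>\<^bsub>M\<^esub> ract M x b"
 shows "rm K B M"
 unfolding right_module_def using assms by simp

lemma
 assumes "bm K B M"
 shows bm_rm: "rm K B M"
 and bm_on_carriers: "on_carriers (carrier B) (carrier M) (lact M) = lact M"
 and bm_closed: "!!x b. x IN M ==> b IN B ==> lact M b x IN M"
 and bm_addr: "!!x y b. x IN M ==> y IN M ==> b IN B ==>
 lact M b (x \<oplus>\<^bsub>M\<^esub> y) = lact M b x \<oplus>\<^bsub>M\<^esub> lact M b y"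
 and bm_addl: "!!x b c. x IN M ==> b IN B ==> c IN B ==>
 lact M (b \<oplus>\<^bsub>B\<^esub> c) x = lact M b x \<oplus>\<^bsub>M\<^esub> lact M c x"
 and bm_mult: "!!x b c. x IN M ==> b IN B ==> c IN B ==>
 lact M (b \<otimes>\<^bsub>B\<^esub> c) x = lact M b (lact M c x)"
 and bm_one: "!!x. x IN M ==> lact M \<one>\<^bsub>B\<^esub> x = x"
 and bm_smultr: "!!kk x b. kk IN K ==> x IN M ==> b IN B ==>
 lact M b (kk \<odot>\<^bsub>M\<^esub> x) = kk \<odot>\<^bsub>M\<^esub> lact M b x"
 and bm_smultl: "!!kk x b. kk IN K ==> x IN M ==> b IN B ==>
 lact M (kk \<odot>\<^bsub>B\<^esub> b) x = kk \<odot>\<^bsub>M\<^esub> lact M b x"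
 and bm_comm: "!!x b c. x IN M ==> b IN B ==> c IN B ==>
 ract M (lact M b x) c = lact M b (ract M x c)"
 by (use assms in "simp add: bimodule_def"; fail | use assms[unfolded bimodule_def] in metis; fail)+

lemma bimoduleI:
 assumes "rm K B M" "on_carriers (carrier B) (carrier M) (lact M) = lact M"
 "!!x b. x IN M ==> b IN B ==> lact M b x IN M"
 "!!x y b. x IN M ==> y IN M ==> b IN B ==>
 lact M b (x \<oplus>\<^bsub>M\<^esub> y) = lact M b x \<oplus>\<^bsub>M\<^esub> lact M b y"
 "!!x b c. x IN M ==> b IN B ==> c IN B ==>
 lact M (b \<oplus>\<^bsub>B\<^esub> c) x = lact M b x \<oplus>\<^bsub>M\<^esub> lact M c x"
 "!!x b c. x IN M ==> b IN B ==> c IN B ==>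
 lact M (b \<otimes>\<^bsub>B\<^esub> c) x = lact M b (lact M c x)"
 "!!x. x IN M ==> lact M \<one>\<^bsub>B\<^esub> x = x"
 "!!kk x b. kk IN K ==> x IN M ==> b IN B ==>
 lact M b (kk \<odot>\<^bsub>M\<^esub> x) = kk \<odot>\<^bsub>M\<^esub> lact M b x"
 "!!kk x b. kk IN K ==> x IN M ==> b IN B ==>
 lact M (kk \<odot>\<^bsub>B\<^esub> b) x = kk \<odot>\<^bsub>M\<^esub> lact M b x"
 "!!x b c. x IN M ==> b IN B ==> c IN B ==>
 ract M (lact M b x) c = lact M b (ract M x c)"
 shows "bm K B M"
 unfolding bimodule_def using assms by simp

text \<open>The calculus is set up over an arbitrary algebra because it is used three times: over
  \<open>R\<close>, over \<open>H\<close>, and over the ordinary algebra underlying A.\<close>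

locale k_alg =
 fixes K :: "('k, 'x) ring_scheme" and B :: "('k, 'a univ, 'z) module_scheme"
 assumes K_cring: "cring K" and B_alg: "k_algebra K B"
begin

lemma B_ring: "ring B" and B_module: "module K B"
 using B_alg by (simp_all add: k_algebra_def)

lemma B_smult_left: "kk IN K ==> x IN B ==> y IN B ==>
 (kk \<odot>\<^bsub>B\<^esub> x) \<otimes>\<^bsub>B\<^esub> y = kk \<odot>\<^bsub>B\<^esub> (x \<otimes>\<^bsub>B\<^esub> y)"
 and B_smult_right: "kk IN K ==> x IN B ==> y IN B ==>
 x \<otimes>\<^bsub>B\<^esub> (kk \<odot>\<^bsub>B\<^esub> y) = kk \<odot>\<^bsub>B\<^esub> (x \<otimes>\<^bsub>B\<^esub> y)"
 using B_alg by (simp_all add: k_algebra_def)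

lemma B_simps [simp]:
 "\<one>\<^bsub>B\<^esub> IN B" "\<zero>\<^bsub>B\<^esub> IN B"
 "x IN B ==> y IN B ==> x \<otimes>\<^bsub>B\<^esub> y IN B"
 "x IN B ==> y IN B ==> x \<oplus>\<^bsub>B\<^esub> y IN B"
 "kk IN K ==> y IN B ==> kk \<odot>\<^bsub>B\<^esub> y IN B"
 "x IN B ==> \<one>\<^bsub>B\<^esub> \<otimes>\<^bsub>B\<^esub> x = x" "x IN B ==> x \<otimes>\<^bsub>B\<^esub> \<one>\<^bsub>B\<^esub> = x"
proof -
 interpret ring B by (rule B_ring)
 show "\<one>\<^bsub>B\<^esub> IN B" "\<zero>\<^bsub>B\<^esub> IN B"
 "x IN B ==> y IN B ==> x \<otimes>\<^bsub>B\<^esub> y IN B"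
 "x IN B ==> y IN B ==> x \<oplus>\<^bsub>B\<^esub> y IN B"
 "kk IN K ==> y IN B ==> kk \<odot>\<^bsub>B\<^esub> y IN B"
 "x IN B ==> \<one>\<^bsub>B\<^esub> \<otimes>\<^bsub>B\<^esub> x = x" "x IN B ==> x \<otimes>\<^bsub>B\<^esub> \<one>\<^bsub>B\<^esub> = x"
 by (simp_all add: m_smult_closed[OF B_module])
qed

lemma B_assoc: "x IN B ==> y IN B ==> z IN B ==>
 (x \<otimes>\<^bsub>B\<^esub> y) \<otimes>\<^bsub>B\<^esub> z = x \<otimes>\<^bsub>B\<^esub> (y \<otimes>\<^bsub>B\<^esub> z)"
 and B_distr_left: "x IN B ==> y IN B ==> z IN B ==>
 (x \<oplus>\<^bsub>B\<^esub> y) \<otimes>\<^bsub>B\<^esub> z = x \<otimes>\<^bsub>B\<^esub> z \<oplus>\<^bsub>B\<^esub> y \<otimes>\<^bsub>B\<^esub> z"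
 and B_distr_right: "x IN B ==> y IN B ==> z IN B ==>
 x \<otimes>\<^bsub>B\<^esub> (y \<oplus>\<^bsub>B\<^esub> z) = x \<otimes>\<^bsub>B\<^esub> y \<oplus>\<^bsub>B\<^esub> x \<otimes>\<^bsub>B\<^esub> z"
 using B_ring by (simp_all add: ring.ring_simprules)

lemma bm_rm' [simp]: "bm K B M ==> rm K B M"
 by (rule bm_rm)
lemma rm_module' [simp]: "rm K B M ==> module K M"
 by (rule rm_module)

lemmas rm_simps [simp] = rm_closed [where K = K and B = B] rm_one [where K = K and B = B]
 bm_closed [where K = K and B = B] bm_one [where K = K and B = B]
 m_add_closed [where K = K] m_zero_closed [where K = K] m_smult_closed [where K = K]

lemmas rm_lin = rm_addl [where K = K and B = B] rm_addr [where K = K and B = B]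
 rm_smultl [where K = K and B = B] rm_smultr [where K = K and B = B]
 bm_addl [where K = K and B = B] bm_addr [where K = K and B = B]
 bm_smultl [where K = K and B = B] bm_smultr [where K = K and B = B] bm_comm [where K = K and B = B]
 m_smult_add [where K = K]

end

text \<open>The relation reads only the listed fields. The same module often occurs as several
  records (a bimodule and its underlying right module, a comodule and its bimodule), and their
  tensor products are then literally equal.\<close>

lemma teq_cong:
 assumes "carrier M = carrier M'" "add M = add M'" "zero M = zero M'" "ract M = ract M'"
 "carrier N = carrier N'" "add N = add N'" "lact N = lact N'" "carrier B = carrier B'"
 shows "teq B M N = teq B' M' N'"
proof (intro ext iffI)
 show "teq B' M' N' xs ys" if "teq B M N xs ys" for xs ys
 using that
 by induction (metis (full_types) assms teq_refl, metis teq_sym, metis teq_trans, metis teq_append,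
 metis (full_types) assms teq_commute, metis assms teq_zero, metis assms teq_add_left, metis assms teq_add_right,
 metis assms teq_balanced)
 show "teq B M N xs ys" if "teq B' M' N' xs ys" for xs ys
 using that
 by induction (metis (full_types) assms teq_refl, metis teq_sym, metis teq_trans, metis teq_append,
 metis (full_types) assms teq_commute, metis assms teq_zero, metis assms teq_add_left, metis assms teq_add_right,
 metis assms teq_balanced)
qed

lemma tens_cong:
 assumes "carrier M = carrier M'" "add M = add M'" "zero M = zero M'" "ract M = ract M'"
 "carrier N = carrier N'" "add N = add N'" "lact N = lact N'" "carrier B = carrier B'"
 shows tsum_cong: "tsum B M N = tsum B' M' N'"
 and ptens_cong: "pt B M N = pt B' M' N'"
 and tens_cong': "smult N = smult N' ==> tens B M N = tens B' M' N'"
 and rtens_cong: "smult N = smult N' ==> ract N = ract N' ==> rtens B M N = rtens B' M' N'"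
 using teq_cong[OF assms] assms
 by (simp_all add: tsum_def ptens_def tens_def rtens_def fun_eq_iff)

lemma rtens_simps [simp]:
 "carrier (rtens B M N) = carrier (tens B M N)" "add (rtens B M N) = add (tens B M N)"
 "zero (rtens B M N) = zero (tens B M N)" "smult (rtens B M N) = smult (tens B M N)"
 by (simp_all add: rtens_def)

lemma btens_simps [simp]:
 "carrier (btens B M N) = carrier (tens B M N)" "add (btens B M N) = add (tens B M N)"
 "zero (btens B M N) = zero (tens B M N)" "smult (btens B M N) = smult (tens B M N)"
 "ract (btens B M N) = ract (rtens B M N)"
 by (simp_all add: btens_def)

text \<open>In a left factor only the right action counts, so for bimodules the iterated products
  formed with \<open>rtens\<close> and with \<open>btens\<close> coincide.\<close>

lemma rt_left [simp]:
 fixes L :: "('k, 'a univ, 'z) bimod_scheme"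
 shows "tsum B (rtens B L M) N = tsum B (btens B L M) N"
 "pt B (rtens B L M) N = pt B (btens B L M) N"
 "tens B (rtens B L M) N = tens B (btens B L M) N"
 "rtens B (rtens B L M) N = rtens B (btens B L M) N"
 by (rule tens_cong; simp)+

lemma tlift_target_cong: "add P = add Q ==> zero P = zero Q ==> tf P F u = tf Q F u"
 by (simp add: tlift_def)

lemma tlift_rtens [simp]: "tf (rtens B M N) = tf (tens B M N)"
 by (simp add: tlift_def fun_eq_iff)
lemma tlift_btens [simp]: "tf (btens B M N) = tf (tens B M N)"
 by (simp add: tlift_def fun_eq_iff)

context k_alg
begin

lemma teq_lists:
 assumes "rm K B M" "bm K B N" "teq B M N xs ys"
 shows "xs \<in> lists (carrier M \<times> carrier N) & ys \<in> lists (carrier M \<times> carrier N)"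
 using assms(3) by induction (auto simp: assms)

text \<open>Each generating relation of \<open>teq\<close> is an identity that a biadditive balanced
  function satisfies; for the zero relation this is F(0, n) = F(0, n) + F(0, n).\<close>

lemma psum_teq:
 assumes M: "rm K B M" and N: "bm K B N" and P: "module K P" and F: "biadditive B M N P F"
 and t: "teq B M N xs ys"
 shows "psum P F xs = psum P F ys"
proof -
 have cl: "F m n IN P" if "m IN M" "n IN N" for m n
 using F that by (simp add: biadditive_def)
 have ap: "psum P F (xs @ ys) = psum P F xs \<oplus>\<^bsub>P\<^esub> psum P F ys"
 if "xs \<in> lists (carrier M \<times> carrier N)" "ys \<in> lists (carrier M \<times> carrier N)" for xs ys
 using psum_append[where F = F, OF P cl that] by blast
 have ps: "psum P F xs IN P" if "xs \<in> lists (carrier M \<times> carrier N)" for xs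
 using psum_closed[where F = F, OF P that cl] by blast
 show ?thesis
 using t
 proof induction
 case (teq_append xs ys us vs)
 then show ?case
 using teq_lists[OF M N] ap by metis
 next
 case (teq_commute xs ys)
 then show ?case
 using ap ps m_a_comm[OF P] by metis
 next
 case (teq_zero n)
 have "F \<zero>\<^bsub>M\<^esub> n = F (\<zero>\<^bsub>M\<^esub> \<oplus>\<^bsub>M\<^esub> \<zero>\<^bsub>M\<^esub>) n"
 using M by (simp add: m_l_zero[of K])
 also have "... = F \<zero>\<^bsub>M\<^esub> n \<oplus>\<^bsub>P\<^esub> F \<zero>\<^bsub>M\<^esub> n"
 using F teq_zero M by (simp add: biadditive_def)
 finally have "F \<zero>\<^bsub>M\<^esub> n = \<zero>\<^bsub>P\<^esub>"
 using m_idem_zero[OF P] cl teq_zero M by simp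
 then show ?case
 using P by (simp add: m_l_zero[OF P])
 next
 case (teq_add_left m m' n)
 then show ?case
 using F cl M N P by (simp add: biadditive_def m_r_zero[OF P])
 next
 case (teq_add_right m n n')
 then show ?case
 using F cl M N P by (simp add: biadditive_def m_r_zero[OF P])
 next
 case (teq_balanced m b n)
 then show ?case
 using F by (simp add: biadditive_def)
 qed simp_all
qed

lemma teq_terms:
 assumes "xs \<in> lists (carrier M \<times> carrier N)"
 shows "teq B M N xs (terms (tsum B M N xs))"
 using someI[of "teq B M N xs", OF teq_refl[OF assms]] by (simp add: tsum_def)

text \<open>Related lists define the same predicate \<open>teq B M N xs\<close>, hence Hilbert
  choice returns the same representative.\<close>

lemma tsum_eqI:
 assumes "teq B M N xs ys"
 shows "tsum B M N xs = tsum B M N ys"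
proof -
 have "teq B M N xs = teq B M N ys"
 using assms teq_trans teq_sym by blast
 then show ?thesis by (simp add: tsum_def)
qed

lemma tens_cases:
 assumes "rm K B M" "bm K B N" "u IN (tens B M N)"
 shows terms_lists: "terms u \<in> lists (carrier M \<times> carrier N)"
 and tsum_terms: "tsum B M N (terms u) = u"
proof -
 obtain xs where xs: "xs \<in> lists (carrier M \<times> carrier N)" "u = tsum B M N xs"
 using assms by (auto simp: tens_def)
 show "terms u \<in> lists (carrier M \<times> carrier N)"
 using teq_lists[OF assms(1,2) teq_terms[OF xs(1)]] xs(2) by simp
 show "tsum B M N (terms u) = u"
 using tsum_eqI[OF teq_terms[OF xs(1)]] xs(2) by simp
qed

lemma tsum_closed: "xs \<in> lists (carrier M \<times> carrier N) ==> tsum B M N xs IN (tens B M N)"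
 by (simp add: tens_def)

lemma tens_add_tsum:
 assumes "rm K B M" "bm K B N"
 "xs \<in> lists (carrier M \<times> carrier N)" "ys \<in> lists (carrier M \<times> carrier N)"
 shows "tsum B M N xs \<oplus>\<^bsub>tens B M N\<^esub> tsum B M N ys = tsum B M N (xs @ ys)"
 using tsum_eqI[OF teq_append[OF teq_terms[OF assms(3)] teq_terms[OF assms(4)]]] by (simp add: tens_def)

lemma tens_abelian:
 assumes M: "rm K B M" and N: "bm K B N"
 shows "abelian_group (tens B M N)"
proof -
 note add = tens_add_tsum[OF M N]
 have zero: "zero (tens B M N) = tsum B M N []"
 by (simp add: tens_def)
 have car: "EX xs:lists (carrier M \<times> carrier N). u = tsum B M N xs" if "u IN (tens B M N)" for u
 using that by (auto simp: tens_def)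
 \<comment> \<open>The presentation has no inverses. A list is cancelled by pairs with negated left
   entries, since \<open>[(m, n), (m', n)]\<close> reduces to a pair with left entry zero and then
   to the empty list.\<close>
 have neg: "EX ys:lists (carrier M \<times> carrier N). teq B M N (ys @ xs) []"
 if "xs \<in> lists (carrier M \<times> carrier N)" for xs
 using that
 proof (induction xs rule: pl_induct)
 case Nil
 show ?case by (rule bexI[of _ "[]"]) (auto intro: teq_refl)
 next
 case (Cons m n xs)
 then obtain ys where ys: "ys \<in> lists (carrier M \<times> carrier N)" "teq B M N (ys @ xs) []"
 by blast
 obtain m' where m': "m' IN M" "m \<oplus>\<^bsub>M\<^esub> m' = \<zero>\<^bsub>M\<^esub>"
 using m_neg[OF rm_module[OF M] Cons(1)] by blast
 have "teq B M N [(m, n), (m', n)] [(m \<oplus>\<^bsub>M\<^esub> m', n)]"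
 using Cons m' by (blast intro: teq_sym teq_add_left)
 then have 1: "teq B M N ([(m, n)] @ [(m', n)]) []"
 using m' Cons teq_trans[OF _ teq_zero] by simp
 have "teq B M N ((ys @ [(m', n)]) @ ((m, n) # xs)) (((m, n) # xs) @ (ys @ [(m', n)]))"
 using ys Cons m' by (intro teq_commute) auto
 moreover have "teq B M N (((m, n) # xs) @ (ys @ [(m', n)])) ([(m, n)] @ [] @ [(m', n)])"
 proof -
 have "teq B M N (xs @ ys) []"
 using ys Cons by (blast intro: teq_trans teq_commute)
 then have "teq B M N ([(m, n)] @ (xs @ ys) @ [(m', n)]) ([(m, n)] @ [] @ [(m', n)])"
 using Cons m' by (intro teq_append teq_refl) auto
 then show ?thesis by simp
 qed
 ultimately have "teq B M N ((ys @ [(m', n)]) @ ((m, n) # xs)) []"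
 using 1 by (metis append_Nil teq_trans)
 then show ?case
 using ys m' Cons by (intro bexI[of _ "ys @ [(m', n)]"]) auto
 qed
 show ?thesis
 proof (rule abelian_groupI)
 fix u v assume "u IN (tens B M N)" "v IN (tens B M N)"
 then obtain xs ys where "xs \<in> lists (carrier M \<times> carrier N)" "ys \<in> lists (carrier M \<times> carrier N)"
 "u = tsum B M N xs" "v = tsum B M N ys"
 using car by meson
 then show "u \<oplus>\<^bsub>tens B M N\<^esub> v IN (tens B M N)"
 "u \<oplus>\<^bsub>tens B M N\<^esub> v = v \<oplus>\<^bsub>tens B M N\<^esub> u"
 by (auto simp: add intro!: tsum_closed tsum_eqI[OF teq_commute])
 next
 show "\<zero>\<^bsub>tens B M N\<^esub> IN (tens B M N)"
 unfolding zero by (rule tsum_closed) simp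
 next
 fix u v w assume "u IN (tens B M N)" "v IN (tens B M N)" "w IN (tens B M N)"
 then obtain xs ys zs where "xs \<in> lists (carrier M \<times> carrier N)" "ys \<in> lists (carrier M \<times> carrier N)"
 "zs \<in> lists (carrier M \<times> carrier N)"
 "u = tsum B M N xs" "v = tsum B M N ys" "w = tsum B M N zs"
 using car by meson
 then show "u \<oplus>\<^bsub>tens B M N\<^esub> v \<oplus>\<^bsub>tens B M N\<^esub> w = u \<oplus>\<^bsub>tens B M N\<^esub> (v \<oplus>\<^bsub>tens B M N\<^esub> w)"
 by (simp add: add del: in_lists_conv_set)
 next
 fix u assume "u IN (tens B M N)"
 then obtain xs where xs: "xs \<in> lists (carrier M \<times> carrier N)" "u = tsum B M N xs"
 using car by meson
 then show "\<zero>\<^bsub>tens B M N\<^esub> \<oplus>\<^bsub>tens B M N\<^esub> u = u"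
 by (simp add: zero add del: in_lists_conv_set)
 obtain ys where ys: "ys \<in> lists (carrier M \<times> carrier N)" "teq B M N (ys @ xs) []"
 using neg[OF xs(1)] by blast
 show "EX y:carrier (tens B M N). y \<oplus>\<^bsub>tens B M N\<^esub> u = \<zero>\<^bsub>tens B M N\<^esub>"
 by (rule bexI[OF _ tsum_closed[OF ys(1)]]) (simp only: zero xs(2) add[OF ys(1) xs(1)] tsum_eqI[OF ys(2)])
 qed
qed

lemma ptens_closed [simp]:
 "m IN M ==> n IN N ==> pt B M N m n IN (tens B M N)"
 by (auto simp: ptens_def intro!: tsum_closed)

lemma ptens_biadditive:
 assumes M: "rm K B M" and N: "bm K B N"
 shows "biadditive B M N (tens B M N) (pt B M N)"
 unfolding biadditive_def
 using M N by (auto simp: ptens_def tens_add_tsum tsum_closed tsum_eqI[OF teq_add_left] tsum_eqI[OF teq_add_right]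
 tsum_eqI[OF teq_balanced])

lemma tsum_Cons:
 assumes "rm K B M" "bm K B N" "m IN M" "n IN N" "xs \<in> lists (carrier M \<times> carrier N)"
 shows "tsum B M N ((m, n) # xs) = pt B M N m n \<oplus>\<^bsub>tens B M N\<^esub> tsum B M N xs"
 using tens_add_tsum[OF assms(1,2) _ assms(5), of "[(m, n)]"] assms by (simp add: ptens_def)

lemma tsum_psum:
 assumes "rm K B M" "bm K B N" "xs \<in> lists (carrier M \<times> carrier N)"
 shows "tsum B M N xs = psum (tens B M N) (pt B M N) xs"
 using assms(3)
 by (induction xs rule: pl_induct) (simp add: tens_def, simp add: tsum_Cons assms del: in_lists_conv_set)

lemma tsum_map:
 assumes "rm K B M" "bm K B N" "xs \<in> lists (S \<times> T)"
 "!!m n. m \<in> S ==> n \<in> T ==> f m n IN M" "!!m n. m \<in> S ==> n \<in> T ==> g m n IN N"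
 shows "tsum B M N (map (%(m, n). (f m n, g m n)) xs) = psum (tens B M N) (%m n. pt B M N (f m n) (g m n)) xs"
proof -
 have "map (%(m, n). (f m n, g m n)) xs \<in> lists (carrier M \<times> carrier N)"
 using assms(3-5) by fastforce
 then show ?thesis
 using tsum_psum[OF assms(1,2)] by (simp add: psum_map)
qed

lemma tlift_tsum:
 assumes "rm K B M" "bm K B N" "module K P" "biadditive B M N P F" "xs \<in> lists (carrier M \<times> carrier N)"
 shows "tf P F (tsum B M N xs) = psum P F xs"
 using psum_teq[OF assms(1-4) teq_terms[OF assms(5)]] by (simp add: tlift_psum)

lemma tlift_ptens':
 assumes "rm K B M" "bm K B N" "module K P" "biadditive B M N P F" "m IN M" "n IN N"
 shows "tf P F (pt B M N m n) = F m n"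
 using assms tlift_tsum[OF assms(1-4), of "[(m, n)]"]
 by (simp add: ptens_def biadditive_def m_r_zero[OF assms(3)])

lemma tlift_add':
 assumes M: "rm K B M" and N: "bm K B N" and P: "module K P" and F: "biadditive B M N P F"
 and u: "u IN (tens B M N)" "v IN (tens B M N)"
 shows "tf P F (u \<oplus>\<^bsub>tens B M N\<^esub> v) = tf P F u \<oplus>\<^bsub>P\<^esub> tf P F v"
proof -
 note t = terms_lists[OF M N]
 have "u \<oplus>\<^bsub>tens B M N\<^esub> v = tsum B M N (terms u @ terms v)"
 by (simp add: tens_def)
 moreover have "psum P F (terms u @ terms v) = psum P F (terms u) \<oplus>\<^bsub>P\<^esub> psum P F (terms v)"
 using F by (intro psum_append[OF P _ t[OF u(1)] t[OF u(2)]]) (simp add: biadditive_def)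
 ultimately show ?thesis
 using tlift_tsum[OF M N P F] t[OF u(1)] t[OF u(2)] by (simp add: tlift_psum del: in_lists_conv_set)
qed

lemma tens_induct [consumes 3, case_names zero add]:
 assumes M: "rm K B M" and N: "bm K B N" and u: "u IN (tens B M N)"
 and "Q \<zero>\<^bsub>tens B M N\<^esub>"
 "!!m n u. m IN M ==> n IN N ==> u IN (tens B M N) ==> Q u ==>
 Q (pt B M N m n \<oplus>\<^bsub>tens B M N\<^esub> u)"
 shows "Q u"
proof -
 have "Q (tsum B M N xs)" if "xs \<in> lists (carrier M \<times> carrier N)" for xs
 using that
 proof (induction xs rule: pl_induct)
 case Nil
 show ?case using assms(4) by (simp add: tens_def)
 next
 case (Cons m n xs)
 then show ?case using assms(5) tsum_Cons[OF M N] tsum_closed by metis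
 qed
 then show ?thesis
 using terms_lists[OF M N u] tsum_terms[OF M N u] by metis
qed

text \<open>The map id \<otimes> h on formal sums. It is treated directly on \<open>teq\<close>
  because scalar multiplication is such a map, while the universal property presupposes that its
  target is already a module.\<close>

lemma teq_map_right:
 assumes M: "rm K B M" and N: "bm K B N" and t: "teq B M N xs ys"
 and h: "!!n. n IN N ==> h n IN N"
 "!!n n'. n IN N ==> n' IN N ==> h (n \<oplus>\<^bsub>N\<^esub> n') = h n \<oplus>\<^bsub>N\<^esub> h n'"
 "!!b n. b IN B ==> n IN N ==> h (lact N b n) = lact N b (h n)"
 shows "teq B M N (map (%(m, n). (m, h n)) xs) (map (%(m, n). (m, h n)) ys)"
proof -
 have l: "map (%(m, n). (m, h n)) xs \<in> lists (carrier M \<times> carrier N)" if "xs \<in> lists (carrier M \<times> carrier N)" for xs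
 using that h(1) by fastforce
 show ?thesis
 using t
 proof induction
 case (teq_refl xs)
 show ?case by (rule teq.teq_refl[OF l[OF teq_refl]])
 next
 case (teq_sym xs ys)
 show ?case by (rule teq.teq_sym[OF teq_sym(2)])
 next
 case (teq_trans xs ys zs)
 show ?case by (rule teq.teq_trans[OF teq_trans(3,4)])
 next
 case (teq_append xs ys us vs)
 show ?case using teq.teq_append[OF teq_append(3,4)] by simp
 next
 case (teq_commute xs ys)
 show ?case using teq.teq_commute[OF l l] teq_commute by simp
 qed (use h M N in "auto intro: teq.intros")
qed

lemma tsum_map_right:
 assumes M: "rm K B M" and N: "bm K B N" and xs: "xs \<in> lists (carrier M \<times> carrier N)"
 and h: "!!n. n IN N ==> h n IN N"
 "!!n n'. n IN N ==> n' IN N ==> h (n \<oplus>\<^bsub>N\<^esub> n') = h n \<oplus>\<^bsub>N\<^esub> h n'"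
 "!!b n. b IN B ==> n IN N ==> h (lact N b n) = lact N b (h n)"
 shows "tsum B M N (map (%(m, n). (m, h n)) (terms (tsum B M N xs))) = tsum B M N (map (%(m, n). (m, h n)) xs)"
 by (rule tsum_eqI[OF teq_sym, OF teq_map_right[OF M N teq_terms[OF xs]], OF h])

lemma map_right_add:
 assumes M: "rm K B M" and N: "bm K B N"
 and h: "!!n. n IN N ==> h n IN N"
 "!!n n'. n IN N ==> n' IN N ==> h (n \<oplus>\<^bsub>N\<^esub> n') = h n \<oplus>\<^bsub>N\<^esub> h n'"
 "!!b n. b IN B ==> n IN N ==> h (lact N b n) = lact N b (h n)"
 and u: "u IN (tens B M N)" and v: "v IN (tens B M N)"
 defines "g \<equiv> %u. tsum B M N (map (%(m, n). (m, h n)) (terms u))"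
 shows "g u IN (tens B M N)" "g (u \<oplus>\<^bsub>tens B M N\<^esub> v) = g u \<oplus>\<^bsub>tens B M N\<^esub> g v"
 "m IN M ==> n IN N ==> g (pt B M N m n) = pt B M N m (h n)"
 "g \<zero>\<^bsub>tens B M N\<^esub> = \<zero>\<^bsub>tens B M N\<^esub>"
proof -
 have l: "map (%(m, n). (m, h n)) xs \<in> lists (carrier M \<times> carrier N)" if "xs \<in> lists (carrier M \<times> carrier N)" for xs
 using that h(1) by fastforce
 note tu = terms_lists[OF M N u] and tv = terms_lists[OF M N v]
 note g = tsum_map_right[OF M N _ h, folded g_def]
 show "g u IN (tens B M N)"
 unfolding g_def by (rule tsum_closed[OF l[OF tu]])
 have 1: "terms u @ terms v \<in> lists (carrier M \<times> carrier N)"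
 using tu tv by simp
 have "u \<oplus>\<^bsub>tens B M N\<^esub> v = tsum B M N (terms u @ terms v)"
 by (simp add: tens_def)
 then show "g (u \<oplus>\<^bsub>tens B M N\<^esub> v) = g u \<oplus>\<^bsub>tens B M N\<^esub> g v"
 using g[OF 1] tens_add_tsum[OF M N l[OF tu] l[OF tv]] by (simp add: g_def)
 show "g (pt B M N m n) = pt B M N m (h n)" if "m IN M" "n IN N"
 using g[of "[(m, n)]"] that by (simp add: ptens_def g_def)
 show "g \<zero>\<^bsub>tens B M N\<^esub> = \<zero>\<^bsub>tens B M N\<^esub>"
 using g[of "[]"] by (simp add: tens_def g_def)
qed

lemma
 assumes M: "rm K B M" and N: "bm K B N"
 shows ptens_addl: "m IN M ==> m' IN M ==> n IN N ==>
 pt B M N (m \<oplus>\<^bsub>M\<^esub> m') n = pt B M N m n \<oplus>\<^bsub>tens B M N\<^esub> pt B M N m' n"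
 and ptens_addr: "m IN M ==> n IN N ==> n' IN N ==>
 pt B M N m (n \<oplus>\<^bsub>N\<^esub> n') = pt B M N m n \<oplus>\<^bsub>tens B M N\<^esub> pt B M N m n'"
 and pt_bal: "m IN M ==> b IN B ==> n IN N ==>
 pt B M N (ract M m b) n = pt B M N m (lact N b n)"
 using ptens_biadditive[OF M N] by (simp_all add: biadditive_def)

text \<open>The laws that are additive in the tensor come from \<open>map_right_add\<close>; those
  that concern the scalars alone are proved by induction over sums of pure tensors.\<close>

lemma tens_module [simp]:
 assumes M: "rm K B M" and N: "bm K B N"
 shows "module K (tens B M N)"
proof -
 interpret T: abelian_group "tens B M N" by (rule tens_abelian[OF M N])
 have sm: "kk \<odot>\<^bsub>tens B M N\<^esub> u = tsum B M N (map (%(m, n). (m, kk \<odot>\<^bsub>N\<^esub> n)) (terms u))" for kk u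
 by (simp add: tens_def)
 have S: "kk \<odot>\<^bsub>tens B M N\<^esub> u IN (tens B M N)"
 "kk \<odot>\<^bsub>tens B M N\<^esub> (u \<oplus>\<^bsub>tens B M N\<^esub> v) = kk \<odot>\<^bsub>tens B M N\<^esub> u \<oplus>\<^bsub>tens B M N\<^esub> kk \<odot>\<^bsub>tens B M N\<^esub> v"
 "m IN M ==> n IN N ==> kk \<odot>\<^bsub>tens B M N\<^esub> pt B M N m n = pt B M N m (kk \<odot>\<^bsub>N\<^esub> n)"
 "kk \<odot>\<^bsub>tens B M N\<^esub> \<zero>\<^bsub>tens B M N\<^esub> = \<zero>\<^bsub>tens B M N\<^esub>"
 if k: "kk IN K" and u: "u IN (tens B M N)" and v: "v IN (tens B M N)" for kk u v m n
 proof -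
 have h: "!!n. n IN N ==> kk \<odot>\<^bsub>N\<^esub> n IN N"
 "!!n n'. n IN N ==> n' IN N ==> kk \<odot>\<^bsub>N\<^esub> (n \<oplus>\<^bsub>N\<^esub> n') = kk \<odot>\<^bsub>N\<^esub> n \<oplus>\<^bsub>N\<^esub> kk \<odot>\<^bsub>N\<^esub> n'"
 "!!b n. b IN B ==> n IN N ==> kk \<odot>\<^bsub>N\<^esub> (lact N b n) = lact N b (kk \<odot>\<^bsub>N\<^esub> n)"
 using k N by (simp_all add: rm_lin)
 show "kk \<odot>\<^bsub>tens B M N\<^esub> u IN (tens B M N)"
 unfolding sm by (rule map_right_add(1)[where h = "%n. kk \<odot>\<^bsub>N\<^esub> n", OF M N h u v])
 show "kk \<odot>\<^bsub>tens B M N\<^esub> (u \<oplus>\<^bsub>tens B M N\<^esub> v) = kk \<odot>\<^bsub>tens B M N\<^esub> u \<oplus>\<^bsub>tens B M N\<^esub> kk \<odot>\<^bsub>tens B M N\<^esub> v"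
 unfolding sm by (rule map_right_add(2)[where h = "%n. kk \<odot>\<^bsub>N\<^esub> n", OF M N h u v])
 show "kk \<odot>\<^bsub>tens B M N\<^esub> pt B M N m n = pt B M N m (kk \<odot>\<^bsub>N\<^esub> n)" if "m IN M" "n IN N"
 unfolding sm by (rule map_right_add(3)[where h = "%n. kk \<odot>\<^bsub>N\<^esub> n", OF M N h u v that])
 show "kk \<odot>\<^bsub>tens B M N\<^esub> \<zero>\<^bsub>tens B M N\<^esub> = \<zero>\<^bsub>tens B M N\<^esub>"
 unfolding sm by (rule map_right_add(4)[where h = "%n. kk \<odot>\<^bsub>N\<^esub> n", OF M N h u v])
 qed
 interpret K: cring K by (rule K_cring)
 note z = T.zero_closed
 note s = S(1) S(2) S(3)[OF _ z z] S(4)[OF _ z z]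
 show ?thesis
 proof (rule moduleI)
 show "cring K" by (rule K_cring)
 show "abelian_group (tens B M N)" ..
 show "kk \<odot>\<^bsub>tens B M N\<^esub> u IN (tens B M N)" if "kk IN K" "u IN (tens B M N)" for kk u
 using that S by blast
 show "(kk \<oplus>\<^bsub>K\<^esub> kk') \<odot>\<^bsub>tens B M N\<^esub> u = kk \<odot>\<^bsub>tens B M N\<^esub> u \<oplus>\<^bsub>tens B M N\<^esub> kk' \<odot>\<^bsub>tens B M N\<^esub> u"
 if k: "kk IN K" "kk' IN K" and u: "u IN (tens B M N)" for kk kk' u
 using M N u by (induction u rule: tens_induct)
 (use M N k in "simp_all add: s ptens_addr m_add_smult[of K] T.a_ac")
 show "kk \<otimes>\<^bsub>K\<^esub> kk' \<odot>\<^bsub>tens B M N\<^esub> u = kk \<odot>\<^bsub>tens B M N\<^esub> (kk' \<odot>\<^bsub>tens B M N\<^esub> u)"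
 if k: "kk IN K" "kk' IN K" and u: "u IN (tens B M N)" for kk kk' u
 using M N u by (induction u rule: tens_induct)
 (use M N k in "simp_all add: s m_mult_smult[of K]")
 show "kk \<odot>\<^bsub>tens B M N\<^esub> (u \<oplus>\<^bsub>tens B M N\<^esub> v) = kk \<odot>\<^bsub>tens B M N\<^esub> u \<oplus>\<^bsub>tens B M N\<^esub> kk \<odot>\<^bsub>tens B M N\<^esub> v"
 if "kk IN K" "u IN (tens B M N)" "v IN (tens B M N)" for kk u v
 using that S by blast
 show "\<one>\<^bsub>K\<^esub> \<odot>\<^bsub>tens B M N\<^esub> u = u" if u: "u IN (tens B M N)" for u
 using M N u by (induction u rule: tens_induct) (use M N in "simp_all add: s m_one_smult[of K]")
 qed
qed

lemma ptens_smult: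
 assumes M: "rm K B M" and N: "bm K B N"
 shows "kk IN K ==> m IN M ==> n IN N ==>
 pt B M N m (kk \<odot>\<^bsub>N\<^esub> n) = kk \<odot>\<^bsub>tens B M N\<^esub> pt B M N m n"
 and ptens_smult_left: "kk IN K ==> m IN M ==> n IN N ==>
 pt B M N (kk \<odot>\<^bsub>M\<^esub> m) n = kk \<odot>\<^bsub>tens B M N\<^esub> pt B M N m n"
proof -
 show 1: "pt B M N m (kk \<odot>\<^bsub>N\<^esub> n) = kk \<odot>\<^bsub>tens B M N\<^esub> pt B M N m n"
 if "kk IN K" "m IN M" "n IN N" for kk m n
 proof -
 have "tsum B M N (map (%(m, n). (m, kk \<odot>\<^bsub>N\<^esub> n)) (terms (tsum B M N [(m, n)])))
 = tsum B M N (map (%(m, n). (m, kk \<odot>\<^bsub>N\<^esub> n)) [(m, n)])"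
 by (rule tsum_map_right[OF M N]) (use that N in "simp_all add: rm_lin")
 then show ?thesis by (simp add: tens_def ptens_def)
 qed
 show "pt B M N (kk \<odot>\<^bsub>M\<^esub> m) n = kk \<odot>\<^bsub>tens B M N\<^esub> pt B M N m n"
 if k: "kk IN K" "m IN M" "n IN N" for kk m n
 proof -
 \<comment> \<open>The scalar acts as the right action of an element of \<open>B\<close>, which can
   be moved across the tensor sign.\<close>
 have "kk \<odot>\<^bsub>M\<^esub> m = ract M m (kk \<odot>\<^bsub>B\<^esub> \<one>\<^bsub>B\<^esub>)"
 using k M by (simp add: rm_smultr[OF M])
 then have "pt B M N (kk \<odot>\<^bsub>M\<^esub> m) n = pt B M N m (lact N (kk \<odot>\<^bsub>B\<^esub> \<one>\<^bsub>B\<^esub>) n)"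
 using k B_module by (simp add: pt_bal[OF M N])
 also have "lact N (kk \<odot>\<^bsub>B\<^esub> \<one>\<^bsub>B\<^esub>) n = kk \<odot>\<^bsub>N\<^esub> n"
 using k N by (simp add: bm_smultl[OF N])
 finally show ?thesis using 1 k by simp
 qed
qed

section \<open>The universal property\<close>

lemma ptens_bal:
 assumes M: "rm K B M" and N: "bm K B N"
 shows "balanced K B M N (tens B M N) (pt B M N)"
 unfolding balanced_def using ptens_biadditive[OF M N] ptens_smult[OF M N] by simp

context
 fixes M :: "('k, 'a univ, 'm) rmod_scheme" and N :: "('k, 'a univ, 'n) bimod_scheme"
 and P :: "('k, 'a univ, 'p) module_scheme"
 assumes M: "rm K B M" and N: "bm K B N" and P: "module K P"
begin

lemma tlift_ptens [simp]:
 "balanced K B M N P F ==> m IN M ==> n IN N ==> tf P F (pt B M N m n) = F m n"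
 by (rule tlift_ptens'[OF M N P]) (simp_all add: balanced_def)

lemma tlift_closed:
 assumes "!!m n. m IN M ==> n IN N ==> F m n IN P" "u IN (tens B M N)"
 shows "tf P F u IN P"
 unfolding tlift_psum by (rule psum_closed[OF P terms_lists[OF M N assms(2)]]) (rule assms(1))

lemma tlift_cong:
 assumes "u IN (tens B M N)" "!!m n. m IN M ==> n IN N ==> F m n = G m n"
 shows "tf P F u = tf P G u"
 unfolding tlift_psum by (rule psum_cong[OF terms_lists[OF M N assms(1)]]) (simp_all add: assms)

lemma tlift_lin:
 assumes F: "balanced K B M N P F"
 shows "tf P F : lm K (tens B M N) P"
proof (rule lmI)
 note F' = bal_biadditive[OF F]
 show cl: "tf P F u IN P" if "u IN (tens B M N)" for u
 by (rule tlift_closed[OF bal_closed[OF F] that])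
 show ad: "tf P F (u \<oplus>\<^bsub>tens B M N\<^esub> v) = tf P F u \<oplus>\<^bsub>P\<^esub> tf P F v"
 if "u IN (tens B M N)" "v IN (tens B M N)" for u v
 by (rule tlift_add'[OF M N P F' that])
 show "tf P F (kk \<odot>\<^bsub>tens B M N\<^esub> u) = kk \<odot>\<^bsub>P\<^esub> tf P F u"
 if k: "kk IN K" and u: "u IN (tens B M N)" for kk u
 using M N u
 proof (induction u rule: tens_induct)
 case zero
 have "tf P F \<zero>\<^bsub>tens B M N\<^esub> = \<zero>\<^bsub>P\<^esub>"
 using tlift_tsum[OF M N P F', of "[]"] by (simp add: tens_def)
 then show ?case
 using k by (simp add: m_smult_zero[OF tens_module[OF M N]] m_smult_zero[OF P])
 next
 case (add m n u)
 have k1: "kk \<odot>\<^bsub>tens B M N\<^esub> (pt B M N m n \<oplus>\<^bsub>tens B M N\<^esub> u) =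
 pt B M N m (kk \<odot>\<^bsub>N\<^esub> n) \<oplus>\<^bsub>tens B M N\<^esub> kk \<odot>\<^bsub>tens B M N\<^esub> u"
 using add k M N by (simp add: m_smult_add[OF tens_module[OF M N]] ptens_smult[OF M N])
 have "tf P F (pt B M N m (kk \<odot>\<^bsub>N\<^esub> n) \<oplus>\<^bsub>tens B M N\<^esub> kk \<odot>\<^bsub>tens B M N\<^esub> u)
 = F m (kk \<odot>\<^bsub>N\<^esub> n) \<oplus>\<^bsub>P\<^esub> tf P F (kk \<odot>\<^bsub>tens B M N\<^esub> u)"
 using add k M N F by (simp add: ad)
 also have "... = kk \<odot>\<^bsub>P\<^esub> (F m n \<oplus>\<^bsub>P\<^esub> tf P F u)"
 using add k by (simp add: bal_smult[OF F] m_smult_add[OF P] bal_closed[OF F] cl)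
 also have "F m n \<oplus>\<^bsub>P\<^esub> tf P F u = tf P F (pt B M N m n \<oplus>\<^bsub>tens B M N\<^esub> u)"
 using add F by (simp add: ad)
 finally show ?case using k1 by simp
 qed
qed

text \<open>Both sides sum over the same chosen representative of \<open>u\<close>, so linearity of
  \<open>L\<close> suffices. This is the rule that merges nested Sweedler sums.\<close>

lemma tlift_fuse:
 assumes L: "L : lm K P Q" and Q: "module K Q" and u: "u IN (tens B M N)"
 and F: "!!m n. m IN M ==> n IN N ==> F m n IN P"
 shows "L (tf P F u) = tf Q (%m n. L (F m n)) u"
 unfolding tlift_psum by (rule psum_lin[OF L P Q terms_lists[OF M N u] F])

text \<open>For additivity in a parameter of the summand, such as the algebra element that acts;
  again all sums run over one representative.\<close>

lemma tlift_addI: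
 assumes u: "u IN (tens B M N)"
 and "!!m n. m IN M ==> n IN N ==> F m n = G m n \<oplus>\<^bsub>P\<^esub> H m n"
 and G: "!!m n. m IN M ==> n IN N ==> G m n IN P"
 and H: "!!m n. m IN M ==> n IN N ==> H m n IN P"
 shows "tf P F u = tf P G u \<oplus>\<^bsub>P\<^esub> tf P H u"
 using tlift_cong[OF u assms(2)] psum_add[OF P terms_lists[OF M N u] G H] by (simp add: tlift_psum)

lemma tlift_smultI:
 assumes u: "u IN (tens B M N)" and k: "kk IN K"
 and "!!m n. m IN M ==> n IN N ==> F m n = kk \<odot>\<^bsub>P\<^esub> G m n"
 and G: "!!m n. m IN M ==> n IN N ==> G m n IN P"
 shows "tf P F u = kk \<odot>\<^bsub>P\<^esub> tf P G u"
 using tlift_cong[OF u assms(3)] psum_smult[OF P terms_lists[OF M N u] G k] by (simp add: tlift_psum)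

text \<open>The basic proof principle: an equation between linear expressions in a tensor is checked
  on pure tensors.\<close>

lemma tens_ext:
 assumes "f : lm K (tens B M N) P" "g : lm K (tens B M N) P"
 "!!m n. m IN M ==> n IN N ==> f (pt B M N m n) = g (pt B M N m n)"
 and u: "u IN (tens B M N)"
 shows "f u = g u"
 using M N u
 by (induction u rule: tens_induct)
 (use M N in "simp_all add: lin_zero[OF assms(1)] lin_zero[OF assms(2)] P lin_add[OF assms(1)] lin_add[OF assms(2)] assms(3)")

end

lemma tlift_ptens_id:
 assumes "rm K B M" "bm K B N" "u IN (tens B M N)"
 shows "tf (tens B M N) (pt B M N) u = u"
 using tsum_psum[OF assms(1,2) terms_lists[OF assms]] tsum_terms[OF assms] by (simp add: tlift_psum)

end

lemma lm_cong:
 assumes "carrier M = carrier M'" "add M = add M'" "smult M = smult M'"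
 "carrier N = carrier N'" "add N = add N'" "smult N = smult N'"
 shows "lm K M N = lm K M' N'"
 using assms by (simp add: linear_maps_def)

lemma linear_maps_rtens [simp]:
 "lm K (rtens B M N) P = lm K (tens B M N) P"
 "lm K P (rtens B M N) = lm K P (tens B M N)"
 by (rule lm_cong; simp)+

lemma linear_maps_btens [simp]:
 "lm K (btens B M N) P = lm K (tens B M N) P"
 "lm K P (btens B M N) = lm K P (tens B M N)"
 by (rule lm_cong; simp)+

lemma module_rtens_iff [simp]: "module K (rtens B M N) = module K (tens B M N)"
 by (rule iffI; erule mod_cong; simp)
lemma module_btens_iff [simp]: "module K (btens B M N) = module K (tens B M N)"
 by (rule iffI; erule mod_cong; simp)

text \<open>Balancedness in adjacent pairs of variables with the third one fixed: the data from
  which a map out of a threefold tensor product can be built with either bracketing.\<close>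

definition trilinear where
 "trilinear K B L M N P F \<longleftrightarrow>
 (ALL l:carrier L. balanced K B M N P (F l)) &
 (ALL n:carrier N. balanced K B L M P (%l m. F l m n))"

lemma trilinearI:
 assumes "!!l m n. l IN L ==> m IN M ==> n IN N ==> F l m n IN P"
 "!!l l' m n. l IN L ==> l' IN L ==> m IN M ==> n IN N ==>
 F (l \<oplus>\<^bsub>L\<^esub> l') m n = F l m n \<oplus>\<^bsub>P\<^esub> F l' m n"
 "!!l m m' n. l IN L ==> m IN M ==> m' IN M ==> n IN N ==>
 F l (m \<oplus>\<^bsub>M\<^esub> m') n = F l m n \<oplus>\<^bsub>P\<^esub> F l m' n"
 "!!l m n n'. l IN L ==> m IN M ==> n IN N ==> n' IN N ==>
 F l m (n \<oplus>\<^bsub>N\<^esub> n') = F l m n \<oplus>\<^bsub>P\<^esub> F l m n'"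
 "!!l b m n. l IN L ==> b IN B ==> m IN M ==> n IN N ==>
 F (ract L l b) m n = F l (lact M b m) n"
 "!!l b m n. l IN L ==> b IN B ==> m IN M ==> n IN N ==>
 F l (ract M m b) n = F l m (lact N b n)"
 "!!kk l m n. kk IN K ==> l IN L ==> m IN M ==> n IN N ==>
 F l (kk \<odot>\<^bsub>M\<^esub> m) n = kk \<odot>\<^bsub>P\<^esub> F l m n"
 "!!kk l m n. kk IN K ==> l IN L ==> m IN M ==> n IN N ==>
 F l m (kk \<odot>\<^bsub>N\<^esub> n) = kk \<odot>\<^bsub>P\<^esub> F l m n"
 shows "trilinear K B L M N P F"
 using assms by (simp add: trilinear_def balanced_def biadditive_def)

lemma
 assumes "trilinear K B L M N P F"
 shows trilinear_right: "l IN L ==> balanced K B M N P (F l)"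
 and trilinear_left: "n IN N ==> balanced K B L M P (%l m. F l m n)"
 using assms by (simp_all add: trilinear_def)

lemma
 shows rl_lin: "f : rlm K B M N ==> f : lm K M N"
 and rl_ract: "f : rlm K B M N ==> x IN M ==> b IN B ==>
 f (ract M x b) = ract N (f x) b"
 and bl_rl: "f : blm K B M' N' ==> f : rlm K B M' N'"
 and bilinear_lact: "f : blm K B M' N' ==> x IN M' ==> b IN B ==>
 f (lact M' b x) = lact N' b (f x)"
 by (auto simp: right_linear_maps_def bilinear_maps_def)

lemma rlmI:
 assumes "f : lm K M N"
 "!!x b. x IN M ==> b IN B ==> f (ract M x b) = ract N (f x) b"
 shows "f : rlm K B M N"
 using assms by (simp add: right_linear_maps_def)

lemma blmI:
 assumes "f : lm K M N"
 "!!x b. x IN M ==> b IN B ==> f (ract M x b) = ract N (f x) b"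
 "!!x b. x IN M ==> b IN B ==> f (lact M b x) = lact N b (f x)"
 shows "f : blm K B M N"
 using assms by (simp add: right_linear_maps_def bilinear_maps_def)

context k_alg
begin

text \<open>The addition that occurs on the left-hand side is an arbitrary \<open>add T\<close>, since the simplifier
 replaces the operations of \<open>rtens B M N\<close> and \<open>btens B M N\<close> by those of \<open>tens B M N\<close>.\<close>

lemma lin_simps:
 "[|rm K B M; bm K B N; add T = add M; m IN M; m' IN M; n IN N|] ==>
 pt B M N (m \<oplus>\<^bsub>T\<^esub> m') n = pt B M N m n \<oplus>\<^bsub>tens B M N\<^esub> pt B M N m' n"
 "[|rm K B M; bm K B N; add T = add N; m IN M; n IN N; n' IN N|] ==>
 pt B M N m (n \<oplus>\<^bsub>T\<^esub> n') = pt B M N m n \<oplus>\<^bsub>tens B M N\<^esub> pt B M N m n'"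
 "[|rm K B M; bm K B N; smult T' = smult M; kk IN K; m IN M; n IN N|] ==>
 pt B M N (kk \<odot>\<^bsub>T'\<^esub> m) n = kk \<odot>\<^bsub>tens B M N\<^esub> pt B M N m n"
 "[|rm K B M; bm K B N; smult T' = smult N; kk IN K; m IN M; n IN N|] ==>
 pt B M N m (kk \<odot>\<^bsub>T'\<^esub> n) = kk \<odot>\<^bsub>tens B M N\<^esub> pt B M N m n"
 "[|rm K B M; add T = add M; m IN M; m' IN M; b IN B|] ==>
 ract M (m \<oplus>\<^bsub>T\<^esub> m') b = ract M m b \<oplus>\<^bsub>M\<^esub> ract M m' b"
 "[|rm K B M; add T = add B; m IN M; b IN B; c IN B|] ==>
 ract M m (b \<oplus>\<^bsub>T\<^esub> c) = ract M m b \<oplus>\<^bsub>M\<^esub> ract M m c"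
 "[|rm K B M; smult T' = smult M; kk IN K; m IN M; b IN B|] ==>
 ract M (kk \<odot>\<^bsub>T'\<^esub> m) b = kk \<odot>\<^bsub>M\<^esub> ract M m b"
 "[|rm K B M; smult T' = smult B; kk IN K; m IN M; b IN B|] ==>
 ract M m (kk \<odot>\<^bsub>T'\<^esub> b) = kk \<odot>\<^bsub>M\<^esub> ract M m b"
 "[|bm K B N; add T = add N; m IN N; m' IN N; b IN B|] ==>
 lact N b (m \<oplus>\<^bsub>T\<^esub> m') = lact N b m \<oplus>\<^bsub>N\<^esub> lact N b m'"
 "[|bm K B N; add T = add B; m IN N; b IN B; c IN B|] ==>
 lact N (b \<oplus>\<^bsub>T\<^esub> c) m = lact N b m \<oplus>\<^bsub>N\<^esub> lact N c m"
 "[|bm K B N; smult T' = smult N; kk IN K; m IN N; b IN B|] ==>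
 lact N b (kk \<odot>\<^bsub>T'\<^esub> m) = kk \<odot>\<^bsub>N\<^esub> lact N b m"
 "[|bm K B N; smult T' = smult B; kk IN K; m IN N; b IN B|] ==>
 lact N (kk \<odot>\<^bsub>T'\<^esub> b) m = kk \<odot>\<^bsub>N\<^esub> lact N b m"
 "[|bm K B N; m IN N; b IN B; c IN B|] ==>
 ract N (lact N b m) c = lact N b (ract N m c)"
 "[|rm K B M; bm K B N; m IN M; n IN N; b IN B|] ==>
 pt B M N (ract M m b) n = pt B M N m (lact N b n)"
 "[|module K M; smult T' = smult M; add T = add M; kk IN K; m IN M; m' IN M|] ==>
 kk \<odot>\<^bsub>T'\<^esub> (m \<oplus>\<^bsub>T\<^esub> m') = kk \<odot>\<^bsub>M\<^esub> m \<oplus>\<^bsub>M\<^esub> kk \<odot>\<^bsub>M\<^esub> m'"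
 by (simp_all add: ptens_addl ptens_addr ptens_smult ptens_smult_left rm_lin pt_bal)

lemmas lin_simps' = lin_simps(1-14)

context
 fixes M :: "('k, 'a univ, 'm) rmod_scheme" and N :: "('k, 'a univ, 'n) bimod_scheme"
 assumes M: "rm K B M" and N: "bm K B N"
begin

lemma ract_tens_bal: "b IN B ==> balanced K B M N (tens B M N) (%m n. pt B M N m (ract N n b))"
 by (rule balancedI) (use M N in "simp_all add: lin_simps'")

text \<open>The action is defined on a representative; rewritten as the \<open>tlift\<close> of a
  balanced function it becomes linear in the tensor.\<close>

lemma ract_rtens:
 "u IN (tens B M N) ==> b IN B ==>
 ract (rtens B M N) u b = tf (tens B M N) (%m n. pt B M N m (ract N n b)) u"
 using tsum_map[OF M N terms_lists[OF M N], of u "%m n. m" "%m n. ract N n b"] N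
 by (simp add: rtens_def tlift_psum)

lemma ract_lin:
 assumes "b IN B"
 shows "(%u. ract (rtens B M N) u b) : lm K (tens B M N) (tens B M N)"
 by (rule lin_cong[OF tlift_lin[OF M N _ ract_tens_bal]])
 (use M N assms in "simp_all add: ract_rtens")

lemma ract_rtens_ptens [simp]:
 "m IN M ==> n IN N ==> b IN B ==>
 ract (rtens B M N) (pt B M N m n) b = pt B M N m (ract N n b)"
 by (simp add: ract_rtens M N ract_tens_bal)

lemma rtens_right_module [simp]: "rm K B (rtens B M N)"
proof (rule right_moduleI)
 note rl = ract_lin
 note m = tens_module[OF M N]
 show "module K (rtens B M N)" by (simp add: m)
 show "on_carriers (carrier (rtens B M N)) (carrier B) (ract (rtens B M N)) = ract (rtens B M N)"
 by (simp add: rtens_def)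
 show "ract (rtens B M N) x b IN (rtens B M N)" if "x IN (rtens B M N)" "b IN B" for x b
 using lin_closed[OF rl] that by simp
 show "ract (rtens B M N) (x \<oplus>\<^bsub>rtens B M N\<^esub> y) b = ract (rtens B M N) x b \<oplus>\<^bsub>rtens B M N\<^esub> ract (rtens B M N) y b"
 if "x IN (rtens B M N)" "y IN (rtens B M N)" "b IN B" for x y b
 using lin_add[OF rl] that by simp
 show "ract (rtens B M N) x (b \<oplus>\<^bsub>B\<^esub> c) = ract (rtens B M N) x b \<oplus>\<^bsub>rtens B M N\<^esub> ract (rtens B M N) x c"
 if x: "x IN (rtens B M N)" and b: "b IN B" "c IN B" for x b c
 proof -
 have "tf (tens B M N) (%m n. pt B M N m (ract N n (b \<oplus>\<^bsub>B\<^esub> c))) x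
 = tf (tens B M N) (%m n. pt B M N m (ract N n b)) x \<oplus>\<^bsub>tens B M N\<^esub>
 tf (tens B M N) (%m n. pt B M N m (ract N n c)) x"
 by (rule tlift_addI[OF M N m]) (use x b M N in "simp_all add: lin_simps")
 then show ?thesis using x b by (simp add: ract_rtens)
 qed
 show "ract (rtens B M N) x (b \<otimes>\<^bsub>B\<^esub> c) = ract (rtens B M N) (ract (rtens B M N) x b) c"
 if x: "x IN (rtens B M N)" and b: "b IN B" "c IN B" for x b c
 by (rule tens_ext[OF M N m rl lin_comp[OF rl rl]])
 (use x b N in "simp_all add: rm_mult[of K B]")
 show "ract (rtens B M N) x \<one>\<^bsub>B\<^esub> = x" if "x IN (rtens B M N)" for x
 by (rule tens_ext[OF M N m rl lin_id]) (use that N in simp_all)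
 show "ract (rtens B M N) (kk \<odot>\<^bsub>rtens B M N\<^esub> x) b = kk \<odot>\<^bsub>rtens B M N\<^esub> ract (rtens B M N) x b"
 if "kk IN K" "x IN (rtens B M N)" "b IN B" for kk x b
 using lin_smult[OF rl] that by simp
 show "ract (rtens B M N) x (kk \<odot>\<^bsub>B\<^esub> b) = kk \<odot>\<^bsub>rtens B M N\<^esub> ract (rtens B M N) x b"
 if k: "kk IN K" and x: "x IN (rtens B M N)" "b IN B" for kk x b
 proof -
 have "tf (tens B M N) (%m n. pt B M N m (ract N n (kk \<odot>\<^bsub>B\<^esub> b))) x
 = kk \<odot>\<^bsub>tens B M N\<^esub> tf (tens B M N) (%m n. pt B M N m (ract N n b)) x"
 by (rule tlift_smultI[OF M N m]) (use x k M N in "simp_all add: lin_simps")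
 then show ?thesis using x k B_module by (simp add: ract_rtens)
 qed
qed

end

context
 fixes M :: "('k, 'a univ, 'm) bimod_scheme" and N :: "('k, 'a univ, 'n) bimod_scheme"
 assumes M: "bm K B M" and N: "bm K B N"
begin

lemma lact_tens_bal: "b IN B ==> balanced K B M N (tens B M N) (%m n. pt B M N (lact M b m) n)"
 by (rule balancedI) (use M N in "simp_all add: lin_simps' lin_simps(13)[symmetric] del: lin_simps(13)")

lemma lact_btens:
 "u IN (tens B M N) ==> b IN B ==>
 lact (btens B M N) b u = tf (tens B M N) (%m n. pt B M N (lact M b m) n) u"
 using tsum_map[OF bm_rm[OF M] N terms_lists[OF bm_rm[OF M] N], of u "%m n. lact M b m" "%m n. n"] M
 by (simp add: btens_def tlift_psum)

lemma lact_lin: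
 assumes "b IN B"
 shows "(%u. lact (btens B M N) b u) : lm K (tens B M N) (tens B M N)"
 by (rule lin_cong[OF tlift_lin[OF _ N _ lact_tens_bal]])
 (use M N assms in "simp_all add: lact_btens")

lemma lact_btens_ptens [simp]:
 "m IN M ==> n IN N ==> b IN B ==>
 lact (btens B M N) b (pt B M N m n) = pt B M N (lact M b m) n"
 using M N by (simp add: lact_btens lact_tens_bal)

lemma btens_bimodule [simp]: "bm K B (btens B M N)"
proof (rule bimoduleI)
 note M' = bm_rm[OF M]
 note rl = lact_lin
 note m = tens_module[OF M' N]
 show "rm K B (btens B M N)"
 using rtens_right_module[OF M' N] unfolding right_module_def by simp
 show "on_carriers (carrier B) (carrier (btens B M N)) (lact (btens B M N)) = lact (btens B M N)"
 by (simp add: btens_def)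
 show "lact (btens B M N) b x IN (btens B M N)" if "x IN (btens B M N)" "b IN B" for x b
 using lin_closed[OF rl] that by simp
 show "lact (btens B M N) b (x \<oplus>\<^bsub>btens B M N\<^esub> y) = lact (btens B M N) b x \<oplus>\<^bsub>btens B M N\<^esub> lact (btens B M N) b y"
 if "x IN (btens B M N)" "y IN (btens B M N)" "b IN B" for x y b
 using lin_add[OF rl] that by simp
 show "lact (btens B M N) (b \<oplus>\<^bsub>B\<^esub> c) x = lact (btens B M N) b x \<oplus>\<^bsub>btens B M N\<^esub> lact (btens B M N) c x"
 if x: "x IN (btens B M N)" and b: "b IN B" "c IN B" for x b c
 proof -
 have "tf (tens B M N) (%m n. pt B M N (lact M (b \<oplus>\<^bsub>B\<^esub> c) m) n) x
 = tf (tens B M N) (%m n. pt B M N (lact M b m) n) x \<oplus>\<^bsub>tens B M N\<^esub>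
 tf (tens B M N) (%m n. pt B M N (lact M c m) n) x"
 by (rule tlift_addI[OF M' N m]) (use x b M N in "simp_all add: lin_simps")
 then show ?thesis using x b by (simp add: lact_btens)
 qed
 show "lact (btens B M N) (b \<otimes>\<^bsub>B\<^esub> c) x = lact (btens B M N) b (lact (btens B M N) c x)"
 if x: "x IN (btens B M N)" and b: "b IN B" "c IN B" for x b c
 by (rule tens_ext[OF M' N m rl lin_comp[OF rl rl]])
 (use x b M in "simp_all add: bm_mult[of K B]")
 show "lact (btens B M N) \<one>\<^bsub>B\<^esub> x = x" if "x IN (btens B M N)" for x
 by (rule tens_ext[OF M' N m rl lin_id]) (use that M in simp_all)
 show "lact (btens B M N) b (kk \<odot>\<^bsub>btens B M N\<^esub> x) = kk \<odot>\<^bsub>btens B M N\<^esub> lact (btens B M N) b x"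
 if "kk IN K" "x IN (btens B M N)" "b IN B" for kk x b
 using lin_smult[OF rl] that by simp
 show "lact (btens B M N) (kk \<odot>\<^bsub>B\<^esub> b) x = kk \<odot>\<^bsub>btens B M N\<^esub> lact (btens B M N) b x"
 if k: "kk IN K" and x: "x IN (btens B M N)" "b IN B" for kk x b
 proof -
 have "tf (tens B M N) (%m n. pt B M N (lact M (kk \<odot>\<^bsub>B\<^esub> b) m) n) x
 = kk \<odot>\<^bsub>tens B M N\<^esub> tf (tens B M N) (%m n. pt B M N (lact M b m) n) x"
 by (rule tlift_smultI[OF M' N m]) (use x k M N in "simp_all add: lin_simps")
 then show ?thesis using x k B_module by (simp add: lact_btens)
 qed
 show "ract (btens B M N) (lact (btens B M N) b x) c = lact (btens B M N) b (ract (btens B M N) x c)"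
 if x: "x IN (btens B M N)" "b IN B" "c IN B" for x b c
 unfolding btens_simps
 by (rule tens_ext[OF M' N m lin_comp[OF rl ract_lin[OF M' N]] lin_comp[OF ract_lin[OF M' N] rl]])
 (use x M N in simp_all)
qed

end

section \<open>Threefold tensor products\<close>

context
 fixes L :: "('k, 'a univ, 'l) rmod_scheme" and M :: "('k, 'a univ, 'm) bimod_scheme"
 and N :: "('k, 'a univ, 'n) bimod_scheme" and P :: "('k, 'a univ, 'p) module_scheme"
 assumes L: "rm K B L" and M: "bm K B M" and N: "bm K B N" and P: "module K P"
begin

text \<open>Sums over L \<otimes> M first. The condition across the remaining tensor sign is an
  equation of linear maps in the element of L \<otimes> M, so it reduces to the balancing of
  \<open>F\<close> between \<open>m\<close> and \<open>n\<close>.\<close>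

lemma tri_left_bal:
 assumes F: "trilinear K B L M N P F"
 shows "balanced K B (rtens B L M) N P (%v n. tf P (%l m. F l m n) v)"
proof (rule balancedI)
 note Fl = trilinear_left[OF F] and Fr = trilinear_right[OF F]
 note lin = tlift_lin[OF L M P Fl]
 have cl: "F l m n IN P" if "l IN L" "m IN M" "n IN N" for l m n
 using bal_closed[OF Fl] that by blast
 show "tf P (%l m. F l m n) v IN P" if "v IN (rtens B L M)" "n IN N" for v n
 using lin_closed[OF lin] that by simp
 show "tf P (%l m. F l m n) (v \<oplus>\<^bsub>rtens B L M\<^esub> v') = tf P (%l m. F l m n) v \<oplus>\<^bsub>P\<^esub> tf P (%l m. F l m n) v'"
 if "v IN (rtens B L M)" "v' IN (rtens B L M)" "n IN N" for v v' n
 using lin_add[OF lin] that by simp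
 show "tf P (%l m. F l m (n \<oplus>\<^bsub>N\<^esub> n')) v = tf P (%l m. F l m n) v \<oplus>\<^bsub>P\<^esub> tf P (%l m. F l m n') v"
 if "v IN (rtens B L M)" "n IN N" "n' IN N" for v n n'
 by (rule tlift_addI[OF L M P]) (use that cl bal_addr[OF Fr] in simp_all)
 show "tf P (%l m. F l m (kk \<odot>\<^bsub>N\<^esub> n)) v = kk \<odot>\<^bsub>P\<^esub> tf P (%l m. F l m n) v"
 if "kk IN K" "v IN (rtens B L M)" "n IN N" for v kk n
 by (rule tlift_smultI[OF L M P]) (use that cl bal_smult[OF Fr] in simp_all)
 show "tf P (%l m. F l m n) (ract (rtens B L M) v b) = tf P (%l m. F l m (lact N b n)) v"
 if v: "v IN (rtens B L M)" and b: "b IN B" and n: "n IN N" for v b n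
 by (rule tens_ext[OF L M P lin_comp[OF ract_lin[OF L M b] lin[OF n]] lin])
 (use v b n L M N in "simp_all add: P Fl bal_bal[OF Fr]")
qed

lemma tri_right_bal:
 assumes F: "trilinear K B L M N P F"
 shows "balanced K B L (btens B M N) P (%l w. tf P (F l) w)"
proof (rule balancedI)
 note Fl = trilinear_left[OF F] and Fr = trilinear_right[OF F]
 note M' = bm_rm[OF M]
 note lin = tlift_lin[OF M' N P Fr]
 have cl: "F l m n IN P" if "l IN L" "m IN M" "n IN N" for l m n
 using bal_closed[OF Fl] that by blast
 show "tf P (F l) w IN P" if "l IN L" "w IN (btens B M N)" for l w
 using lin_closed[OF lin] that by simp
 show "tf P (F l) (w \<oplus>\<^bsub>btens B M N\<^esub> w') = tf P (F l) w \<oplus>\<^bsub>P\<^esub> tf P (F l) w'"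
 if "l IN L" "w IN (btens B M N)" "w' IN (btens B M N)" for l w w'
 using lin_add[OF lin] that by simp
 show "tf P (F (l \<oplus>\<^bsub>L\<^esub> l')) w = tf P (F l) w \<oplus>\<^bsub>P\<^esub> tf P (F l') w"
 if "l IN L" "l' IN L" "w IN (btens B M N)" for l l' w
 by (rule tlift_addI[OF M' N P]) (use that cl bal_addl[OF Fl] in simp_all)
 show "tf P (F l) (kk \<odot>\<^bsub>btens B M N\<^esub> w) = kk \<odot>\<^bsub>P\<^esub> tf P (F l) w"
 if "kk IN K" "l IN L" "w IN (btens B M N)" for l w kk
 using lin_smult[OF lin] that by simp
 show "tf P (F (ract L l b)) w = tf P (F l) (lact (btens B M N) b w)"
 if l: "l IN L" and b: "b IN B" and w: "w IN (btens B M N)" for l b w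
 by (rule tens_ext[OF M' N P lin lin_comp[OF lact_lin[OF M N b] lin[OF l]]])
 (use l b w L M N in "simp_all add: P Fr bal_bal[OF Fl]")
qed

lemma tens3_left_ext:
 assumes f: "f : lm K (tens B (rtens B L M) N) P" and g: "g : lm K (tens B (rtens B L M) N) P"
 and e: "!!l m n. l IN L ==> m IN M ==> n IN N ==>
 f (pt B (rtens B L M) N (pt B L M l m) n) = g (pt B (rtens B L M) N (pt B L M l m) n)"
 and u: "u IN (tens B (rtens B L M) N)"
 shows "f u = g u"
proof (rule tens_ext[OF _ N P f g _ u])
 show "rm K B (rtens B L M)" using L M by simp
 fix v n assume v: "v IN (rtens B L M)" and n: "n IN N"
 have lin: "(%v. pt B (rtens B L M) N v n) : lm K (tens B L M) (tens B (rtens B L M) N)"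
 by (rule lmI) (use L M N n in "simp_all add: lin_simps del: rt_left")
 show "f (pt B (rtens B L M) N v n) = g (pt B (rtens B L M) N v n)"
 by (rule tens_ext[OF L M P lin_comp[OF lin f] lin_comp[OF lin g] e[OF _ _ n]]) (use v in simp_all)
qed

lemma tens3_right_ext:
 assumes f: "f : lm K (tens B L (btens B M N)) P" and g: "g : lm K (tens B L (btens B M N)) P"
 and e: "!!l m n. l IN L ==> m IN M ==> n IN N ==>
 f (pt B L (btens B M N) l (pt B M N m n)) = g (pt B L (btens B M N) l (pt B M N m n))"
 and u: "u IN (tens B L (btens B M N))"
 shows "f u = g u"
proof (rule tens_ext[OF L _ P f g _ u])
 show "bm K B (btens B M N)" using M N by simp
 fix l w assume l: "l IN L" and w: "w IN (btens B M N)"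
 have lin: "(%w. pt B L (btens B M N) l w) : lm K (tens B M N) (tens B L (btens B M N))"
 by (rule lmI) (use L M N l in "simp_all add: lin_simps")
 show "f (pt B L (btens B M N) l w) = g (pt B L (btens B M N) l w)"
 by (rule tens_ext[OF bm_rm[OF M] N P lin_comp[OF lin f] lin_comp[OF lin g] e[OF l]]) (use w in simp_all)
qed

end

end

section \<open>Concrete categories\<close>

text \<open>The categories in use are record extensions of \<open>concrete_cat\<close>, so plain
  equality with it cannot be stated; agreement of the six categorical fields is stated
  instead.\<close>

definition is_concrete ::
 "('o, 'o \<times> ('u \<Rightarrow> 'u) \<times> 'o, 'z) cat_scheme \<Rightarrow> 'o set \<Rightarrow> ('o \<Rightarrow> 'u set) \<Rightarrow> ('o \<Rightarrow> 'o \<Rightarrow> ('u \<Rightarrow> 'u) set) \<Rightarrow> bool" where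
 "is_concrete C Obs car H \<longleftrightarrow> (let C' = concrete_cat Obs car H in
 Ob C = Ob C' & Ar C = Ar C' & Dom C = Dom C' & Cod C = Cod C' & Idn C = Idn C' & Cmp C = Cmp C')"

lemma is_concrete_simps:
 assumes "is_concrete C Obs car H"
 shows "Ob C = Obs" "Ar C = {(x, f, y). x \<in> Obs & y \<in> Obs & f \<in> H x y \<inter> extensional (car x)}"
 "Dom C f = fst f" "Cod C f = cod f" "Idn C x = (x, \<lambda>u \<in> car x. u, x)"
 "Cmp C g f = (fst f, compose (car (fst f)) (afun g) (afun f), cod g)"
 using assms by (simp_all add: is_concrete_def concrete_cat_def afun_def split: prod.split)

text \<open>One locale serves right modules, right modules with the action of bimodules, bimodules,
  and modules over the bialgebroid.\<close>

locale concrete_category =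
 fixes C :: "('o, 'o \<times> ('u \<Rightarrow> 'u) \<times> 'o, 'z) cat_scheme" and Obs car H
 assumes conc: "is_concrete C Obs car H"
 and H_closed: "!!x y f u. x \<in> Obs ==> y \<in> Obs ==> f \<in> H x y ==> u \<in> car x ==> f u \<in> car y"
 and H_id: "!!x. x \<in> Obs ==> (%u. u) \<in> H x x"
 and H_comp: "!!x y z f g. x \<in> Obs ==> y \<in> Obs ==> z \<in> Obs ==> f \<in> H x y ==> g \<in> H y z ==>
 (%u. g (f u)) \<in> H x z"
 and H_restrict: "!!x y f. x \<in> Obs ==> y \<in> Obs ==> f \<in> H x y ==> restrict f (car x) \<in> H x y"
begin

lemmas c_simps = is_concrete_simps[OF conc]

lemma ar_iff: "f : Ar C \<longleftrightarrow> fst f \<in> Obs & cod f \<in> Obs & afun f \<in> H (fst f) (cod f) &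
 afun f \<in> extensional (car (fst f))"
 by (auto simp: c_simps afun_def split: prod.splits)

lemma hom_iff: "f \<in> Hom C x y \<longleftrightarrow> f : Ar C & fst f = x & cod f = y"
 by (auto simp: Hom_def c_simps)

lemma cmp_simps [simp]: "fst (Cmp C g f) = fst f" "cod (Cmp C g f) = cod g"
 "fst (Idn C x) = x" "cod (Idn C x) = x"
 by (simp_all add: c_simps)

lemma cmp_app [simp]: "u \<in> car (fst f) ==> afun (Cmp C g f) u = afun g (afun f u)"
 by (simp add: c_simps(6)) (simp add: afun_def compose_def)

lemma idn_app [simp]: "u \<in> car x ==> afun (Idn C x) u = u"
 by (simp add: c_simps(5)) (simp add: afun_def)

lemma app_closed: "f : Ar C ==> u \<in> car (fst f) ==> afun f u \<in> car (cod f)"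
 by (auto simp: ar_iff intro: H_closed)

lemma app_closed': "f : Ar C ==> u \<in> car (fst f) ==> car (cod f) = S ==> afun f u \<in> S"
 using app_closed by blast

lemma ar_cmp [simp]: "f : Ar C ==> g : Ar C ==> cod f = fst g ==> Cmp C g f : Ar C"
proof -
 assume "f : Ar C" "g : Ar C" and c: "cod f = fst g"
 note fg = this(1,2)[unfolded ar_iff] c
 have e: "afun (Cmp C g f) = restrict (%u. afun g (afun f u)) (car (fst f))"
 by (simp add: c_simps(6)) (simp add: afun_def compose_def)
 have "afun (Cmp C g f) \<in> H (fst f) (cod g)"
 unfolding e by (rule H_restrict[OF _ _ H_comp[of _ "fst g"]]) (use fg in simp_all)
 moreover have "afun (Cmp C g f) \<in> extensional (car (fst f))"
 unfolding e by simp
 ultimately show ?thesis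
 using fg by (simp add: ar_iff)
qed

lemma ar_idn [simp]: "x \<in> Obs ==> Idn C x : Ar C"
 by (simp add: ar_iff) (simp add: c_simps(5) afun_def H_id H_restrict)

text \<open>The functions in arrows are extensional, so agreement on the carrier of the source is
  equality.\<close>

lemma ar_eqI:
 assumes "f : Ar C" "g : Ar C" "fst f = fst g" "cod f = cod g"
 "!!u. u \<in> car (fst f) ==> afun f u = afun g u"
 shows "f = g"
proof -
 have "afun f = afun g"
 by (rule extensionalityI[of _ "car (fst f)"]) (use assms in "auto simp: ar_iff")
 then show ?thesis
 using assms by (auto simp: afun_def prod_eq_iff split: prod.splits)
qed

lemma category: "category C"
proof
 fix f assume "f : Ar C"
 then show "Dom C f \<in> Ob C" "Cod C f \<in> Ob C" by (simp_all add: c_simps split: prod.splits)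
next
 fix x assume "x \<in> Ob C"
 then show "Idn C x \<in> Hom C x x" by (simp add: hom_iff c_simps(1))
next
 fix f g x y z assume "f \<in> Hom C x y" "g \<in> Hom C y z"
 then show "Cmp C g f \<in> Hom C x z" by (simp add: hom_iff)
next
 fix f x y assume f: "f \<in> Hom C x y"
 then have "x \<in> Obs" "y \<in> Obs" by (auto simp: hom_iff ar_iff)
 then show "Cmp C f (Idn C x) = f" "Cmp C (Idn C y) f = f"
 using f by (auto simp: hom_iff app_closed' intro!: ar_eqI)
next
 fix f g h w x y z assume "f \<in> Hom C w x" "g \<in> Hom C x y" "h \<in> Hom C y z"
 then show "Cmp C (Cmp C h g) f = Cmp C h (Cmp C g f)"
 by (auto simp: hom_iff app_closed' intro!: ar_eqI)
qed

lemma is_inverseI: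
 assumes "f : Ar C" "g : Ar C" "fst g = cod f" "cod g = fst f"
 "!!u. u \<in> car (fst f) ==> afun g (afun f u) = u" "!!u. u \<in> car (cod f) ==> afun f (afun g u) = u"
 shows "is_inverse C f g"
proof -
 have o: "fst f \<in> Obs" "cod f \<in> Obs" using assms(1) by (auto simp: ar_iff)
 show ?thesis
 unfolding is_inverse_def c_simps(3,4) hom_iff
 using assms o by (auto simp: app_closed' intro!: ar_eqI)
qed

text \<open>Two-sided inverses are unique in any category, so an explicit inverse determines the
  description \<open>inv_arrow\<close>.\<close>

lemma inv_arrowI:
 assumes "is_inverse C f g"
 shows "inv_arrow C f = g"
 unfolding inv_arrow_def
proof (rule the_equality[where P = "is_inverse C f", OF assms])
 fix h assume h: "is_inverse C f h"
 interpret category C by (rule category)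
 have g': "g \<in> Hom C (Cod C f) (Dom C f)" "f \<in> Hom C (Dom C f) (Cod C f)" "h \<in> Hom C (Cod C f) (Dom C f)"
 using assms h by (auto simp: is_inverse_def Hom_def)
 have "h = Cmp C h (Cmp C f g)"
 using assms h id_right[OF g'(3)] by (simp add: is_inverse_def)
 also have "... = Cmp C (Cmp C h f) g"
 using cmp_assoc[OF g'(1,2,3)] by simp
 also have "... = g"
 using h id_left[OF g'(1)] by (simp add: is_inverse_def)
 finally show "h = g" .
qed

end

lemma afun_triple [simp]: "afun (x, f, y) = f"
 by (simp add: afun_def)

lemma is_concrete_mod: "is_concrete (mod_cat K B) {M. rm K B M} carrier (rlm K B)"
 by (simp add: is_concrete_def mod_cat_def)

lemma is_concrete_actcat: "is_concrete (mod_actcat K B) {M. rm K B M} carrier (rlm K B)"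
 by (simp add: is_concrete_def mod_actcat_def mod_cat_def cat.defs concrete_cat_def)

lemma is_concrete_bimod: "is_concrete (bimod_moncat K B) {M. bm K B M} carrier (blm K B)"
 by (simp add: is_concrete_def bimod_moncat_def cat.defs concrete_cat_def)

lemma rl_conc:
 shows "!!x y f u. f : rlm K B x y ==> u IN x ==> f u IN y"
 "!!x. (%u. u) : rlm K B x x"
 "!!x y z f g. f : rlm K B x y ==> g : rlm K B y z ==>
 (%u. g (f u)) : rlm K B x z"
 "!!x y f. rm K B x ==> f : rlm K B x y ==> restrict f (carrier x) : rlm K B x y"
 by (auto simp: right_linear_maps_def lin_closed lin_id rm_closed
 intro!: lin_restrict rm_module intro: lin_comp)

lemma bl_conc:
 shows "!!x y f u. f : blm K B x y ==> u IN x ==> f u IN y"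
 "!!x. (%u. u) : blm K B x x"
 "!!x y z f g. f : blm K B x y ==> g : blm K B y z ==>
 (%u. g (f u)) : blm K B x z"
 "!!x y f. bm K B x ==> f : blm K B x y ==> restrict f (carrier x) : blm K B x y"
 by (auto simp: bilinear_maps_def rl_conc bm_closed rl_conc(1)
 intro!: rl_conc(4) bm_rm intro: rl_conc(3))

global_interpretation M: concrete_category "mod_cat K B" "{M. rm K B M}" carrier "rlm K B"
 for K :: "('k, 'x) ring_scheme" and B :: "('k, 'u, 'z) module_scheme"
 by unfold_locales (use is_concrete_mod in "auto intro: rl_conc")

global_interpretation D: concrete_category "mod_actcat K B" "{M. rm K B M}" carrier "rlm K B"
 for K :: "('k, 'x) ring_scheme" and B :: "('k, 'a univ, 'z) module_scheme"
 by unfold_locales (use is_concrete_actcat in "auto intro: rl_conc")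

global_interpretation C: concrete_category "bimod_moncat K B" "{M. bm K B M}" carrier "blm K B"
 for K :: "('k, 'x) ring_scheme" and B :: "('k, 'a univ, 'z) module_scheme"
 by unfold_locales (use is_concrete_bimod in "auto intro: bl_conc")

lemma bimod_moncat_simps [simp]:
 "TenO (bimod_moncat K B) = btens B" "UnitO (bimod_moncat K B) = rg B"
 "Ob (bimod_moncat K B) = {M. bm K B M}"
 by (simp_all add: bimod_moncat_def cat.defs moncat.defs concrete_cat_def)

lemma TenA_simps [simp]:
 "fst (TenA (bimod_moncat K B) f g) = btens B (fst f) (fst g)"
 "cod (TenA (bimod_moncat K B) f g) = btens B (cod f) (cod g)"
 "afun (TenA (bimod_moncat K B) f g) =
 tmap B (fst f) (fst g) (cod f) (cod g) (afun f) (afun g)"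
 by (simp_all add: bimod_moncat_def cat.defs moncat.defs concrete_cat_def afun_def split: prod.splits)

lemma mod_actcat_simps [simp]:
 "ActO (mod_actcat K B) = rtens B" "Ob (mod_actcat K B) = {M. rm K B M}"
 by (simp_all add: mod_actcat_def mod_cat_def cat.defs actcat.defs concrete_cat_def)

lemma ActA_simps [simp]:
 "fst (ActA (mod_actcat K B) f g) = rtens B (fst f) (fst g)"
 "cod (ActA (mod_actcat K B) f g) = rtens B (cod f) (cod g)"
 "afun (ActA (mod_actcat K B) f g) =
 tmap B (fst f) (fst g) (cod f) (cod g) (afun f) (afun g)"
 by (simp_all add: mod_actcat_def mod_cat_def cat.defs actcat.defs concrete_cat_def afun_def split: prod.splits)

lemma self_action_simps [simp]:
 "ActO (self_action C) = TenO C" "ActA (self_action C) = TenA C" "ActAssoc (self_action C) = Assoc C"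
 "ActUnit (self_action C) = RUnit C" "Ob (self_action C) = Ob C" "Ar (self_action C) = Ar C"
 "Dom (self_action C) = Dom C" "Cod (self_action C) = Cod C" "Idn (self_action C) = Idn C"
 "Cmp (self_action C) = Cmp C" "Hom (self_action C) = Hom C" "inv_arrow (self_action C) = inv_arrow C"
 by (auto simp: self_action_def cat.defs actcat.defs Hom_def fun_eq_iff inv_arrow_def is_inverse_def)

section \<open>Monoidal structure\<close>

lemma reg_bimod_simps [simp]:
 "carrier (rg B) = carrier B" "add (rg B) = add B" "zero (rg B) = zero B"
 "smult (rg B) = smult B"
 "x IN B ==> y IN B ==> ract (rg B) x y = x \<otimes>\<^bsub>B\<^esub> y"
 "x IN B ==> y IN B ==> lact (rg B) x y = x \<otimes>\<^bsub>B\<^esub> y"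
 by (simp_all add: reg_bimod_def)

definition tassoc_inv where
 "tassoc_inv B L M N = (\<lambda>u \<in> carrier (tens B L (btens B M N)).
 tf (tens B (rtens B L M) N)
 (%l w. tf (tens B (rtens B L M) N) (%m n. pt B (rtens B L M) N (pt B L M l m) n) w) u)"

context k_alg
begin

lemma reg_bimodule [simp]: "bm K B (rg B)"
proof (rule bimoduleI[OF right_moduleI])
 show "module K (rg B)"
 by (rule mod_cong[OF B_module]) simp_all
qed (simp_all add: B_assoc B_distr_left B_distr_right B_smult_left B_smult_right, simp_all add: reg_bimod_def)

context
 fixes M :: "('k, 'a univ, 'm) rmod_scheme" and N :: "('k, 'a univ, 'n) bimod_scheme"
 and M' :: "('k, 'a univ, 'm1) rmod_scheme" and N' :: "('k, 'a univ, 'n1) bimod_scheme"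
 and f g
 assumes M: "rm K B M" and N: "bm K B N"
 and M': "rm K B M'" and N': "bm K B N'"
 and f: "f : rlm K B M M'" and g: "g : blm K B N N'"
begin

private lemmas fg = lin_closed[OF rl_lin[OF f]] lin_closed[OF rl_lin[OF bl_rl[OF g]]]
 lin_add[OF rl_lin[OF f]] lin_add[OF rl_lin[OF bl_rl[OF g]]]
 lin_smult[OF rl_lin[OF f]] lin_smult[OF rl_lin[OF bl_rl[OF g]]]
 rl_ract[OF f] rl_ract[OF bl_rl[OF g]] bilinear_lact[OF g]

lemma tmap_bal: "balanced K B M N (tens B M' N') (%m n. pt B M' N' (f m) (g n))"
 by (rule balancedI) (use M N M' N' in "simp_all add: fg lin_simps")

lemma tmap_ptens:
 "m IN M ==> n IN N ==> tmap B M N M' N' f g (pt B M N m n) = pt B M' N' (f m) (g n)"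
 using M N M' N' tmap_bal by (simp add: tmap_def)

lemma tmap_lin: "tmap B M N M' N' f g : lm K (tens B M N) (tens B M' N')"
 unfolding tmap_def by (rule lin_restrict[OF tlift_lin[OF M N _ tmap_bal]]) (use M N M' N' in simp_all)

lemma tmap_right_linear: "tmap B M N M' N' f g : rlm K B (rtens B M N) (rtens B M' N')"
proof (rule rlmI)
 show "tmap B M N M' N' f g : lm K (rtens B M N) (rtens B M' N')" using tmap_lin by simp
 fix u b assume u: "u IN (rtens B M N)" and b: "b IN B"
 show "tmap B M N M' N' f g (ract (rtens B M N) u b) = ract (rtens B M' N') (tmap B M N M' N' f g u) b"
 by (rule tens_ext[OF M N _ lin_comp[OF ract_lin[OF M N b] tmap_lin] lin_comp[OF tmap_lin ract_lin[OF M' N' b]]])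
 (use u b M N M' N' in "simp_all add: tmap_ptens fg")
qed

end

lemma tmap_bilinear:
 assumes M: "bm K B M" and N: "bm K B N" and M': "bm K B M'" and N': "bm K B N'"
 and f: "f : blm K B M M'" and g: "g : blm K B N N'"
 shows "tmap B M N M' N' f g : blm K B (btens B M N) (btens B M' N')"
proof -
 note tm = tmap_lin[OF bm_rm[OF M] N bm_rm[OF M'] N' bl_rl[OF f] g]
 tmap_ptens[OF bm_rm[OF M] N bm_rm[OF M'] N' bl_rl[OF f] g]
 tmap_right_linear[OF bm_rm[OF M] N bm_rm[OF M'] N' bl_rl[OF f] g]
 have "tmap B M N M' N' f g (lact (btens B M N) b u) = lact (btens B M' N') b (tmap B M N M' N' f g u)"
 if u: "u IN (tens B M N)" and b: "b IN B" for u b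
 by (rule tens_ext[OF bm_rm[OF M] N _ lin_comp[OF lact_lin[OF M N b] tm(1)] lin_comp[OF tm(1) lact_lin[OF M' N' b]]])
 (use u b M N M' N' f g in "simp_all add: tm(2) bilinear_lact[OF f] lin_closed[OF rl_lin[OF bl_rl]]")
 then show ?thesis
 using tm(1) rl_ract[OF tm(3)] by (intro blmI) simp_all
qed

context
 fixes L :: "('k, 'a univ, 'l) rmod_scheme" and M :: "('k, 'a univ, 'm) bimod_scheme"
 and N :: "('k, 'a univ, 'n) bimod_scheme"
 assumes L: "rm K B L" and M: "bm K B M" and N: "bm K B N"
begin

text \<open>The balancing between \<open>l\<close> and \<open>m\<close> happens at the outer tensor
  sign, so the action on \<open>m\<close> has to be read backwards as the action on m \<otimes>
  n.\<close>

lemma tassoc_tri: "trilinear K B L M N (tens B L (btens B M N)) (%l m n. pt B L (btens B M N) l (pt B M N m n))"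
 by (rule trilinearI) (use L M N in "simp_all add: lin_simps lact_btens_ptens[symmetric] del: lact_btens_ptens")

lemma tassoc_inv_tri: "trilinear K B L M N (tens B (rtens B L M) N) (%l m n. pt B (rtens B L M) N (pt B L M l m) n)"
 by (rule trilinearI)
 (use L M N in "simp_all add: lin_simps ract_rtens_ptens[symmetric] del: ract_rtens_ptens rt_left")

lemma tassoc_ptens:
 "l IN L ==> m IN M ==> n IN N ==>
 tassoc B L M N (pt B (rtens B L M) N (pt B L M l m) n) = pt B L (btens B M N) l (pt B M N m n)"
 using L M N tri_left_bal[OF L M N _ tassoc_tri] trilinear_left[OF tassoc_tri]
 by (simp add: tassoc_def del: rt_left)

lemma tassoc_inv_ptens:
 "l IN L ==> m IN M ==> n IN N ==>
 tassoc_inv B L M N (pt B L (btens B M N) l (pt B M N m n)) = pt B (rtens B L M) N (pt B L M l m) n"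
 using L M N tri_right_bal[OF L M N _ tassoc_inv_tri] trilinear_right[OF tassoc_inv_tri]
 by (simp add: tassoc_inv_def del: rt_left)

lemma tassoc_lin: "tassoc B L M N : lm K (tens B (rtens B L M) N) (tens B L (btens B M N))"
 unfolding tassoc_def
 by (rule lin_restrict[OF tlift_lin[OF _ N _ tri_left_bal[OF L M N _ tassoc_tri]]])
 (use L M N in "simp_all del: rt_left")

lemma tassoc_inv_lin: "tassoc_inv B L M N : lm K (tens B L (btens B M N)) (tens B (rtens B L M) N)"
 unfolding tassoc_inv_def
 by (rule lin_restrict[OF tlift_lin[OF L _ _ tri_right_bal[OF L M N _ tassoc_inv_tri]]])
 (use L M N in "simp_all del: rt_left")

lemma tassoc_inv1: "u IN (tens B (rtens B L M) N) ==> tassoc_inv B L M N (tassoc B L M N u) = u"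
 by (rule tens3_left_ext[OF L M N _ lin_comp[OF tassoc_lin tassoc_inv_lin] lin_id])
 (use L M N in "simp_all add: tassoc_ptens tassoc_inv_ptens del: rt_left")

lemma tassoc_inv2: "u IN (tens B L (btens B M N)) ==> tassoc B L M N (tassoc_inv B L M N u) = u"
 by (rule tens3_right_ext[OF L M N _ lin_comp[OF tassoc_inv_lin tassoc_lin] lin_id])
 (use L M N in "simp_all add: tassoc_ptens tassoc_inv_ptens del: rt_left")

lemma tassoc_right_linear:
 "tassoc B L M N : rlm K B (rtens B (rtens B L M) N) (rtens B L (btens B M N))"
proof (rule rlmI)
 note LM = rtens_right_module[OF L M] and MN = btens_bimodule[OF M N]
 show "tassoc B L M N : lm K (rtens B (rtens B L M) N) (rtens B L (btens B M N))"
 using tassoc_lin by (simp del: rt_left)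
 fix u b assume u: "u IN (rtens B (rtens B L M) N)" and b: "b IN B"
 show "tassoc B L M N (ract (rtens B (rtens B L M) N) u b) = ract (rtens B L (btens B M N)) (tassoc B L M N u) b"
 by (rule tens3_left_ext[OF L M N _ lin_comp[OF ract_lin[OF LM N b] tassoc_lin] lin_comp[OF tassoc_lin ract_lin[OF L MN b]]])
 (use u b L M N LM MN in "simp_all add: tassoc_ptens del: rt_left")
qed

lemma tassoc_inv_right_linear:
 "tassoc_inv B L M N : rlm K B (rtens B L (btens B M N)) (rtens B (rtens B L M) N)"
proof (rule rlmI)
 note LM = rtens_right_module[OF L M] and MN = btens_bimodule[OF M N]
 show "tassoc_inv B L M N : lm K (rtens B L (btens B M N)) (rtens B (rtens B L M) N)"
 using tassoc_inv_lin by (simp del: rt_left)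
 fix u b assume u: "u IN (rtens B L (btens B M N))" and b: "b IN B"
 show "tassoc_inv B L M N (ract (rtens B L (btens B M N)) u b) = ract (rtens B (rtens B L M) N) (tassoc_inv B L M N u) b"
 by (rule tens3_right_ext[OF L M N _ lin_comp[OF ract_lin[OF L MN b] tassoc_inv_lin] lin_comp[OF tassoc_inv_lin ract_lin[OF LM N b]]])
 (use u b L M N LM MN in "simp_all add: tassoc_inv_ptens del: rt_left")
qed

lemma tassoc_extensional:
 "tassoc B L M N \<in> extensional (carrier (tens B (rtens B L M) N))"
 "tassoc_inv B L M N \<in> extensional (carrier (tens B L (btens B M N)))"
 by (simp_all add: tassoc_def tassoc_inv_def del: rt_left)

end

context
 fixes L :: "('k, 'a univ, 'l) bimod_scheme" and M :: "('k, 'a univ, 'm) bimod_scheme"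
 and N :: "('k, 'a univ, 'n) bimod_scheme"
 assumes L: "bm K B L" and M: "bm K B M" and N: "bm K B N"
begin

lemma tassoc_bilinear: "tassoc B L M N : blm K B (btens B (btens B L M) N) (btens B L (btens B M N))"
proof (rule blmI)
 note LM = btens_bimodule[OF L M] and MN = btens_bimodule[OF M N] and L' = bm_rm[OF L]
 show "tassoc B L M N : lm K (btens B (btens B L M) N) (btens B L (btens B M N))"
 using tassoc_lin[OF L' M N] by simp
 fix u b assume u: "u IN (btens B (btens B L M) N)" and b: "b IN B"
 show "tassoc B L M N (ract (btens B (btens B L M) N) u b) = ract (btens B L (btens B M N)) (tassoc B L M N u) b"
 using rl_ract[OF tassoc_right_linear[OF L' M N]] u b by simp
 note t = tassoc_lin[OF L' M N]
 show "tassoc B L M N (lact (btens B (btens B L M) N) b u) = lact (btens B L (btens B M N)) b (tassoc B L M N u)"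
 by (rule tens3_left_ext[OF L' M N _ lin_comp[OF _ t] lin_comp[OF t lact_lin[OF L MN b]]])
 (use u b L M N LM MN tassoc_ptens[OF L' M N] lact_lin[OF LM N b] in simp_all)
qed

lemma tassoc_inv_bilinear: "tassoc_inv B L M N : blm K B (btens B L (btens B M N)) (btens B (btens B L M) N)"
proof (rule blmI)
 note LM = btens_bimodule[OF L M] and MN = btens_bimodule[OF M N] and L' = bm_rm[OF L]
 show "tassoc_inv B L M N : lm K (btens B L (btens B M N)) (btens B (btens B L M) N)"
 using tassoc_inv_lin[OF L' M N] by simp
 fix u b assume u: "u IN (btens B L (btens B M N))" and b: "b IN B"
 show "tassoc_inv B L M N (ract (btens B L (btens B M N)) u b) = ract (btens B (btens B L M) N) (tassoc_inv B L M N u) b"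
 using rl_ract[OF tassoc_inv_right_linear[OF L' M N]] u b by simp
 note t = tassoc_inv_lin[OF L' M N, simplified]
 show "tassoc_inv B L M N (lact (btens B L (btens B M N)) b u) = lact (btens B (btens B L M) N) b (tassoc_inv B L M N u)"
 by (rule tens3_right_ext[OF L' M N _ lin_comp[OF lact_lin[OF L MN b] t] lin_comp[OF t lact_lin[OF LM N b]]])
 (use u b L M N LM MN tassoc_inv_ptens[OF L' M N] in simp_all)
qed

end

lemma lunit_bal: "bm K B M ==> balanced K B (rg B) M M (lact M)"
 by (rule balancedI) (simp_all add: lin_simps bm_mult[of K B])

lemma runit_bal: "rm K B M ==> balanced K B M (rg B) M (ract M)"
 by (rule balancedI) (simp_all add: lin_simps rm_mult[of K B])

lemma lunit_ptens [simp]: "bm K B M ==> b IN B ==> m IN M ==>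
 tf M (lact M) (pt B (rg B) M b m) = lact M b m"
 by (simp add: lunit_bal)

lemma runit_ptens [simp]: "rm K B M ==> b IN B ==> m IN M ==>
 tf M (ract M) (pt B M (rg B) m b) = ract M m b"
 by (simp add: runit_bal)

end

lemma moncat_arrow_simps [simp]:
 "fst (Assoc (bimod_moncat K B) L M N) = btens B (btens B L M) N"
 "cod (Assoc (bimod_moncat K B) L M N) = btens B L (btens B M N)"
 "fst (LUnit (bimod_moncat K B) M) = btens B (rg B) M" "cod (LUnit (bimod_moncat K B) M) = M"
 "fst (RUnit (bimod_moncat K B) M) = btens B M (rg B)" "cod (RUnit (bimod_moncat K B) M) = M"
 by (simp_all add: bimod_moncat_def cat.defs moncat.defs concrete_cat_def)

lemma C_afun:
 "afun (Assoc (bimod_moncat K B) L M N) = tassoc B L M N"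
 "afun (LUnit (bimod_moncat K B) M) = (\<lambda>u \<in> carrier (tens B (rg B) M). tf M (lact M) u)"
 "afun (RUnit (bimod_moncat K B) M) = (\<lambda>u \<in> carrier (tens B M (rg B)). tf M (ract M) u)"
 by (simp_all add: bimod_moncat_def cat.defs moncat.defs concrete_cat_def)

lemma actcat_arrow_simps [simp]:
 "fst (ActAssoc (mod_actcat K B) L M N) = rtens B (rtens B L M) N"
 "cod (ActAssoc (mod_actcat K B) L M N) = rtens B L (btens B M N)"
 "fst (ActUnit (mod_actcat K B) L) = rtens B L (rg B)" "cod (ActUnit (mod_actcat K B) L) = L"
 by (simp_all add: mod_actcat_def mod_cat_def cat.defs actcat.defs concrete_cat_def)

lemma D_afun:
 "afun (ActAssoc (mod_actcat K B) L M N) = tassoc B L M N"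
 "afun (ActUnit (mod_actcat K B) L) = (\<lambda>u \<in> carrier (tens B L (rg B)). tf L (ract L) u)"
 by (simp_all add: mod_actcat_def mod_cat_def cat.defs actcat.defs concrete_cat_def)

text \<open>From here a tensor product of arrows is evaluated on pure tensors; unfolding it to
  \<open>tmap\<close> would hide that form, so it is done only on request.\<close>

declare TenA_simps(3) [simp del] ActA_simps(3) [simp del]

lemma arrow_lin:
 "f : Ar (bimod_moncat K B) ==> afun f : lm K (fst f) (cod f)"
 "g : Ar (mod_actcat K B) ==> afun g : lm K (fst g) (cod g)"
 by (auto simp: C.ar_iff D.ar_iff bilinear_maps_def right_linear_maps_def)

lemma arrow_ob [simp]:
 "f : Ar (bimod_moncat K B) ==> bm K B (fst f)" "f : Ar (bimod_moncat K B) ==> bm K B (cod f)"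
 "g : Ar (mod_actcat K B) ==> rm K B (fst g)" "g : Ar (mod_actcat K B) ==> rm K B (cod g)"
 by (auto simp: C.ar_iff D.ar_iff)

lemma arrow_equi:
 "[|f : Ar (bimod_moncat K B); fst f = x; u IN x; b IN B|] ==>
 afun f (ract x u b) = ract (cod f) (afun f u) b"
 "[|f : Ar (bimod_moncat K B); fst f = x; u IN x; b IN B|] ==>
 afun f (lact x b u) = lact (cod f) b (afun f u)"
 "[|g : Ar (mod_actcat K B); fst g = y; v IN y; b IN B|] ==>
 afun g (ract y v b) = ract (cod g) (afun g v) b"
 by (auto simp: C.ar_iff D.ar_iff bilinear_maps_def right_linear_maps_def simp del: arrow_ob)

section \<open>Constraint arrows, their inverses, and extensionality on pure tensors\<close>

context k_alg
begin

text \<open>Serves the two pentagon laws, where four factors occur.\<close>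

lemma tens4_left_ext:
 fixes W :: "('k, 'a univ, 'w) rmod_scheme" and L :: "('k, 'a univ, 'l) bimod_scheme"
 and M :: "('k, 'a univ, 'm) bimod_scheme" and N :: "('k, 'a univ, 'n) bimod_scheme"
 assumes W: "rm K B W" and L: "bm K B L" and M: "bm K B M" and N: "bm K B N" and P: "module K P"
 and f: "f : lm K (tens B (rtens B (rtens B W L) M) N) P"
 and g: "g : lm K (tens B (rtens B (rtens B W L) M) N) P"
 and e: "!!w l m n. w IN W ==> l IN L ==> m IN M ==> n IN N ==>
 f (pt B (rtens B (rtens B W L) M) N (pt B (rtens B W L) M (pt B W L w l) m) n)
 = g (pt B (rtens B (rtens B W L) M) N (pt B (rtens B W L) M (pt B W L w l) m) n)"
 and u: "u IN (tens B (rtens B (rtens B W L) M) N)"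
 shows "f u = g u"
proof (rule tens3_left_ext[OF _ M N P f g _ u])
 show WL: "rm K B (rtens B W L)" using W L by simp
 fix v m n assume v: "v IN (rtens B W L)" and m: "m IN M" and n: "n IN N"
 have lin: "(%v. pt B (rtens B (rtens B W L) M) N (pt B (rtens B W L) M v m) n)
 : lm K (tens B W L) (tens B (rtens B (rtens B W L) M) N)"
 by (rule lmI) (use W L M N WL m n in "simp_all add: lin_simps del: rt_left")
 show "f (pt B (rtens B (rtens B W L) M) N (pt B (rtens B W L) M v m) n)
 = g (pt B (rtens B (rtens B W L) M) N (pt B (rtens B W L) M v m) n)"
 by (rule tens_ext[OF W L P lin_comp[OF lin f] lin_comp[OF lin g] e[OF _ _ m n]]) (use v in simp_all)
qed

abbreviation "RMR \<equiv> bimod_moncat K B"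
abbreviation "MR \<equiv> mod_actcat K B"

lemma C_closed [simp]: "f : Ar RMR ==> u IN (fst f) ==> carrier (cod f) = S ==> afun f u \<in> S"
 using C.app_closed by blast

lemma D_closed [simp]: "f : Ar MR ==> u IN (fst f) ==> carrier (cod f) = S ==> afun f u \<in> S"
 using D.app_closed by blast

text \<open>Explicit candidates for the inverse constraints, so that \<open>inv_arrow\<close> can be
  rewritten to something that computes.\<close>

definition "AssocI L M N = (btens B L (btens B M N), tassoc_inv B L M N, btens B (btens B L M) N)"
definition "ActAssocI L M N = (rtens B L (btens B M N), tassoc_inv B L M N, rtens B (rtens B L M) N)"
definition "LUnitI M = (M, \<lambda>m \<in> carrier M. pt B (rg B) M \<one>\<^bsub>B\<^esub> m, btens B (rg B) M)"
definition "RUnitI M = (M, \<lambda>m \<in> carrier M. pt B M (rg B) m \<one>\<^bsub>B\<^esub>, btens B M (rg B))"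
definition "ActUnitI L = (L, \<lambda>m \<in> carrier L. pt B L (rg B) m \<one>\<^bsub>B\<^esub>, rtens B L (rg B))"

lemma inv_arrows_simps [simp]:
 "fst (AssocI L M N) = btens B L (btens B M N)" "cod (AssocI L M N) = btens B (btens B L M) N"
 "fst (ActAssocI V M N) = rtens B V (btens B M N)" "cod (ActAssocI V M N) = rtens B (rtens B V M) N"
 "fst (LUnitI M) = M" "cod (LUnitI M) = btens B (rg B) M"
 "fst (RUnitI M) = M" "cod (RUnitI M) = btens B M (rg B)"
 "fst (ActUnitI V) = V" "cod (ActUnitI V) = rtens B V (rg B)"
 by (simp_all add: AssocI_def ActAssocI_def LUnitI_def RUnitI_def ActUnitI_def)

text \<open>Sources enter as premises such as \<open>fst f = x\<close>, so that the rules match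
  whatever form the simplifier has given to the source.\<close>

lemma C_app [simp]:
 "[|f : Ar RMR; g : Ar RMR; fst f = x; fst g = y; m IN x; n IN y|] ==>
 afun (TenA RMR f g) (pt B x y m n) = pt B (cod f) (cod g) (afun f m) (afun g n)"
 "[|bm K B L; bm K B M; bm K B N; l IN L; m' IN M; n' IN N|] ==>
 afun (Assoc RMR L M N) (pt B (btens B L M) N (pt B L M l m') n') = pt B L (btens B M N) l (pt B M N m' n')"
 "[|bm K B L; bm K B M; bm K B N; l IN L; m' IN M; n' IN N|] ==>
 afun (AssocI L M N) (pt B L (btens B M N) l (pt B M N m' n')) = pt B (btens B L M) N (pt B L M l m') n'"
 "[|bm K B M; b IN B; m' IN M|] ==> afun (LUnit RMR M) (pt B (rg B) M b m') = lact M b m'"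
 "[|bm K B M; b IN B; m' IN M|] ==> afun (RUnit RMR M) (pt B M (rg B) m' b) = ract M m' b"
 "m' IN M ==> afun (LUnitI M) m' = pt B (rg B) M \<one>\<^bsub>B\<^esub> m'"
 "m' IN M ==> afun (RUnitI M) m' = pt B M (rg B) m' \<one>\<^bsub>B\<^esub>"
 subgoal by (auto simp: TenA_simps(3) C.ar_iff bl_rl simp del: arrow_ob intro!: tmap_ptens)
 subgoal using tassoc_ptens[OF bm_rm] by (simp add: C_afun)
 subgoal using tassoc_inv_ptens[OF bm_rm] by (simp add: AssocI_def)
 by (simp_all add: C_afun LUnitI_def RUnitI_def)

lemma D_app [simp]:
 "[|f : Ar MR; g : Ar RMR; fst f = x; fst g = y; m IN x; n IN y|] ==>
 afun (ActA MR f g) (pt B x y m n) = pt B (cod f) (cod g) (afun f m) (afun g n)"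
 "[|rm K B L; bm K B M; bm K B N; l IN L; m' IN M; n' IN N|] ==>
 afun (ActAssoc MR L M N) (pt B (rtens B L M) N (pt B L M l m') n') = pt B L (btens B M N) l (pt B M N m' n')"
 "[|rm K B L; bm K B M; bm K B N; l IN L; m' IN M; n' IN N|] ==>
 afun (ActAssocI L M N) (pt B L (btens B M N) l (pt B M N m' n')) = pt B (rtens B L M) N (pt B L M l m') n'"
 "[|rm K B L; b IN B; l IN L|] ==> afun (ActUnit MR L) (pt B L (rg B) l b) = ract L l b"
 "l IN L ==> afun (ActUnitI L) l = pt B L (rg B) l \<one>\<^bsub>B\<^esub>"
 subgoal by (auto simp: ActA_simps(3) C.ar_iff D.ar_iff simp del: arrow_ob intro!: tmap_ptens)
 subgoal using tassoc_ptens by (simp add: D_afun)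
 subgoal using tassoc_inv_ptens by (simp add: ActAssocI_def)
 by (simp_all add: D_afun ActUnitI_def)

lemma C_ar [simp]:
 "f : Ar RMR ==> g : Ar RMR ==> TenA RMR f g : Ar RMR"
 "[|bm K B L; bm K B M; bm K B N|] ==> Assoc RMR L M N : Ar RMR"
 "[|bm K B L; bm K B M; bm K B N|] ==> AssocI L M N : Ar RMR"
 "bm K B M ==> LUnit RMR M : Ar RMR"
 "bm K B M ==> RUnit RMR M : Ar RMR"
 "bm K B M ==> LUnitI M : Ar RMR"
 "bm K B M ==> RUnitI M : Ar RMR"
proof -
 show "TenA RMR f g : Ar RMR" if "f : Ar RMR" "g : Ar RMR"
 using that tmap_bilinear by (auto simp: C.ar_iff TenA_simps(3) tmap_def simp del: arrow_ob)
 show "Assoc RMR L M N : Ar RMR" "AssocI L M N : Ar RMR" if "bm K B L" "bm K B M" "bm K B N"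
 using that tassoc_bilinear[OF that] tassoc_inv_bilinear[OF that] tassoc_extensional[OF bm_rm, OF that]
 by (simp_all add: C.ar_iff C_afun del: arrow_ob) (simp_all add: AssocI_def)
 show "LUnit RMR M : Ar RMR" "RUnit RMR M : Ar RMR" "LUnitI M : Ar RMR" "RUnitI M : Ar RMR" if M: "bm K B M"
 proof -
 note M' = bm_rm[OF M] and R = reg_bimodule and R' = bm_rm[OF reg_bimodule]
 have MM: "module K M" using M by simp
 note l = tlift_lin[OF R' M MM lunit_bal[OF M]] and r = tlift_lin[OF M' R MM runit_bal[OF M']]
 have "tf M (lact M) (ract (btens B (rg B) M) u b) = ract M (tf M (lact M) u) b"
 if u: "u IN (tens B (rg B) M)" and b: "b IN B" for u b
 unfolding btens_simps
 by (rule tens_ext[OF R' M MM lin_comp[OF ract_lin[OF R' M b] l] lin_comp[OF l]])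
 (use u M b in "auto simp: lin_simps intro!: lmI")
 moreover have "tf M (lact M) (lact (btens B (rg B) M) b u) = lact M b (tf M (lact M) u)"
 if u: "u IN (tens B (rg B) M)" and b: "b IN B" for u b
 by (rule tens_ext[OF R' M MM lin_comp[OF lact_lin[OF R M b] l] lin_comp[OF l]])
 (use u M b in "auto simp: lin_simps bm_mult[of K B] intro!: lmI")
 ultimately have 1: "tf M (lact M) : blm K B (btens B (rg B) M) M"
 by (intro blmI) (use l in simp_all)
 have "tf M (ract M) (ract (btens B M (rg B)) u b) = ract M (tf M (ract M) u) b"
 if u: "u IN (tens B M (rg B))" and b: "b IN B" for u b
 unfolding btens_simps
 by (rule tens_ext[OF M' R MM lin_comp[OF ract_lin[OF M' R b] r] lin_comp[OF r]])
 (use u M b in "auto simp: lin_simps rm_mult[of K B] intro!: lmI")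
 moreover have "tf M (ract M) (lact (btens B M (rg B)) b u) = lact M b (tf M (ract M) u)"
 if u: "u IN (tens B M (rg B))" and b: "b IN B" for u b
 by (rule tens_ext[OF M' R MM lin_comp[OF lact_lin[OF M R b] r] lin_comp[OF r]])
 (use u M b in "auto simp: lin_simps intro!: lmI")
 ultimately have 2: "tf M (ract M) : blm K B (btens B M (rg B)) M"
 by (intro blmI) (use r in simp_all)
 \<comment> \<open>Every pure tensor of B \<otimes> M can be written with first factor 1; this makes
   the inverse left unit constraint left linear.\<close>
 have q: "pt B (rg B) M b m = pt B (rg B) M \<one>\<^bsub>B\<^esub> (lact M b m)"
 if "b IN B" "m IN M" for b m
 using pt_bal[OF R' M, of "\<one>\<^bsub>B\<^esub>" b m] that by simp
 have 3: "(%m. pt B (rg B) M \<one>\<^bsub>B\<^esub> m) : blm K B M (btens B (rg B) M)"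
 by (rule blmI[OF lmI]) (use M in "simp_all add: lin_simps q[symmetric]")
 have 4: "(%m. pt B M (rg B) m \<one>\<^bsub>B\<^esub>) : blm K B M (btens B M (rg B))"
 by (rule blmI[OF lmI]) (use M in "simp_all add: lin_simps")
 note restr = bl_conc(4)[of K B]
 show "LUnit RMR M : Ar RMR" "RUnit RMR M : Ar RMR" "LUnitI M : Ar RMR" "RUnitI M : Ar RMR"
 using M restr[OF _ 1] restr[OF _ 2] restr[OF M 3] restr[OF M 4]
 by (simp_all add: C.ar_iff C_afun LUnitI_def RUnitI_def del: arrow_ob)
 qed
qed

lemma D_ar [simp]:
 "f : Ar MR ==> g : Ar RMR ==> ActA MR f g : Ar MR"
 "[|rm K B L; bm K B M; bm K B N|] ==> ActAssoc MR L M N : Ar MR"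
 "[|rm K B L; bm K B M; bm K B N|] ==> ActAssocI L M N : Ar MR"
 "rm K B L ==> ActUnit MR L : Ar MR"
 "rm K B L ==> ActUnitI L : Ar MR"
proof -
 show "ActA MR f g : Ar MR" if "f : Ar MR" "g : Ar RMR"
 using that tmap_right_linear by (auto simp: C.ar_iff D.ar_iff ActA_simps(3) tmap_def simp del: arrow_ob)
 show "ActAssoc MR L M N : Ar MR" "ActAssocI L M N : Ar MR"
 if "rm K B L" "bm K B M" "bm K B N"
 using that tassoc_right_linear[OF that] tassoc_inv_right_linear[OF that] tassoc_extensional[OF that]
 by (simp_all add: D.ar_iff D_afun del: arrow_ob) (simp_all add: ActAssocI_def)
 show "ActUnit MR L : Ar MR" "ActUnitI L : Ar MR" if L: "rm K B L"
 proof -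
 note R = reg_bimodule
 have LL: "module K L" using L by simp
 note r = tlift_lin[OF L R LL runit_bal[OF L]]
 have "tf L (ract L) (ract (rtens B L (rg B)) u b) = ract L (tf L (ract L) u) b"
 if u: "u IN (tens B L (rg B))" and b: "b IN B" for u b
 by (rule tens_ext[OF L R LL lin_comp[OF ract_lin[OF L R b] r] lin_comp[OF r]])
 (use u L b in "auto simp: lin_simps rm_mult[of K B] intro!: lmI")
 then have 2: "tf L (ract L) : rlm K B (rtens B L (rg B)) L"
 by (intro rlmI) (use r in simp_all)
 have q: "pt B L (rg B) (ract L m b) \<one>\<^bsub>B\<^esub> = pt B L (rg B) m b"
 if "b IN B" "m IN L" for b m
 using pt_bal[OF L R, of m b "\<one>\<^bsub>B\<^esub>"] that by simp
 have 4: "(%m. pt B L (rg B) m \<one>\<^bsub>B\<^esub>) : rlm K B L (rtens B L (rg B))"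
 by (rule rlmI[OF lmI]) (use L in "simp_all add: lin_simps q")
 note restr = rl_conc(4)[of K B]
 show "ActUnit MR L : Ar MR" "ActUnitI L : Ar MR"
 using L restr[OF _ 2] restr[OF L 4]
 by (simp_all add: D.ar_iff D_afun ActUnitI_def del: arrow_ob)
 qed
qed

lemma C_ext2:
 assumes "f : Ar RMR" "g : Ar RMR" "cod f = cod g" "fst f = btens B M N" "fst g = btens B M N"
 "bm K B M" "bm K B N"
 "!!m n. m IN M ==> n IN N ==> afun f (pt B M N m n) = afun g (pt B M N m n)"
 shows "f = g"
proof (rule C.ar_eqI[OF assms(1,2)])
 fix u assume u: "u IN (fst f)"
 show "afun f u = afun g u"
 by (rule tens_ext[where f = "afun f" and g = "afun g" and P = "cod f", OF bm_rm[OF assms(6)] assms(7)])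
 (use u assms arrow_lin(1)[OF assms(1)] arrow_lin(1)[OF assms(2)] in "simp_all add: rm_module[OF bm_rm]")
qed (simp_all add: assms)

lemma C_ext3l:
 assumes "f : Ar RMR" "g : Ar RMR" "cod f = cod g" "fst f = btens B (btens B L M) N" "fst g = btens B (btens B L M) N"
 "bm K B L" "bm K B M" "bm K B N"
 "!!l m n. l IN L ==> m IN M ==> n IN N ==>
 afun f (pt B (btens B L M) N (pt B L M l m) n) = afun g (pt B (btens B L M) N (pt B L M l m) n)"
 shows "f = g"
proof (rule C.ar_eqI[OF assms(1,2)])
 fix u assume u: "u IN (fst f)"
 show "afun f u = afun g u"
 by (rule tens3_left_ext[where f = "afun f" and g = "afun g" and P = "cod f", OF bm_rm[OF assms(6)] assms(7,8)])
 (use u assms arrow_lin(1)[OF assms(1)] arrow_lin(1)[OF assms(2)] in "simp_all add: rm_module[OF bm_rm]")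
qed (simp_all add: assms)

lemma C_ext3r:
 assumes "f : Ar RMR" "g : Ar RMR" "cod f = cod g" "fst f = btens B L (btens B M N)" "fst g = btens B L (btens B M N)"
 "bm K B L" "bm K B M" "bm K B N"
 "!!l m n. l IN L ==> m IN M ==> n IN N ==>
 afun f (pt B L (btens B M N) l (pt B M N m n)) = afun g (pt B L (btens B M N) l (pt B M N m n))"
 shows "f = g"
proof (rule C.ar_eqI[OF assms(1,2)])
 fix u assume u: "u IN (fst f)"
 show "afun f u = afun g u"
 by (rule tens3_right_ext[where f = "afun f" and g = "afun g" and P = "cod f", OF bm_rm[OF assms(6)] assms(7,8)])
 (use u assms arrow_lin(1)[OF assms(1)] arrow_lin(1)[OF assms(2)] in "simp_all add: rm_module[OF bm_rm]")
qed (simp_all add: assms)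

lemma C_ext4l:
 assumes "f : Ar RMR" "g : Ar RMR" "cod f = cod g"
 "fst f = btens B (btens B (btens B W L) M) N" "fst g = btens B (btens B (btens B W L) M) N"
 "bm K B W" "bm K B L" "bm K B M" "bm K B N"
 "!!w l m n. w IN W ==> l IN L ==> m IN M ==> n IN N ==>
 afun f (pt B (btens B (btens B W L) M) N (pt B (btens B W L) M (pt B W L w l) m) n)
 = afun g (pt B (btens B (btens B W L) M) N (pt B (btens B W L) M (pt B W L w l) m) n)"
 shows "f = g"
proof (rule C.ar_eqI[OF assms(1,2)])
 fix u assume u: "u IN (fst f)"
 have e: "pt B (rtens B (rtens B W L) M) N = pt B (btens B (btens B W L) M) N"
 "tens B (rtens B (rtens B W L) M) N = tens B (btens B (btens B W L) M) N"
 by (rule tens_cong; simp)+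
 show "afun f u = afun g u"
 by (rule tens4_left_ext[where f = "afun f" and g = "afun g" and P = "cod f", OF bm_rm[OF assms(6)] assms(7-9)])
 (use u assms arrow_lin(1)[OF assms(1)] arrow_lin(1)[OF assms(2)] in "simp_all add: rm_module[OF bm_rm] e")
qed (simp_all add: assms)

lemma D_ext2:
 assumes "f : Ar MR" "g : Ar MR" "cod f = cod g" "fst f = rtens B M N" "fst g = rtens B M N"
 "rm K B M" "bm K B N"
 "!!m n. m IN M ==> n IN N ==> afun f (pt B M N m n) = afun g (pt B M N m n)"
 shows "f = g"
proof (rule D.ar_eqI[OF assms(1,2)])
 fix u assume u: "u IN (fst f)"
 show "afun f u = afun g u"
 by (rule tens_ext[where f = "afun f" and g = "afun g" and P = "cod f", OF assms(6) assms(7)])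
 (use u assms arrow_lin(2)[OF assms(1)] arrow_lin(2)[OF assms(2)] in "simp_all add: rm_module")
qed (simp_all add: assms)

lemma D_ext3l:
 assumes "f : Ar MR" "g : Ar MR" "cod f = cod g" "fst f = rtens B (rtens B L M) N" "fst g = rtens B (rtens B L M) N"
 "rm K B L" "bm K B M" "bm K B N"
 "!!l m n. l IN L ==> m IN M ==> n IN N ==>
 afun f (pt B (rtens B L M) N (pt B L M l m) n) = afun g (pt B (rtens B L M) N (pt B L M l m) n)"
 shows "f = g"
proof (rule D.ar_eqI[OF assms(1,2)])
 fix u assume u: "u IN (fst f)"
 show "afun f u = afun g u"
 by (rule tens3_left_ext[where f = "afun f" and g = "afun g" and P = "cod f", OF assms(6) assms(7,8)])
 (use u assms arrow_lin(2)[OF assms(1)] arrow_lin(2)[OF assms(2)] in "simp_all add: rm_module")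
qed (simp_all add: assms)

lemma D_ext4l:
 assumes "f : Ar MR" "g : Ar MR" "cod f = cod g"
 "fst f = rtens B (rtens B (rtens B W L) M) N" "fst g = rtens B (rtens B (rtens B W L) M) N"
 "rm K B W" "bm K B L" "bm K B M" "bm K B N"
 "!!w l m n. w IN W ==> l IN L ==> m IN M ==> n IN N ==>
 afun f (pt B (rtens B (rtens B W L) M) N (pt B (rtens B W L) M (pt B W L w l) m) n)
 = afun g (pt B (rtens B (rtens B W L) M) N (pt B (rtens B W L) M (pt B W L w l) m) n)"
 shows "f = g"
proof (rule D.ar_eqI[OF assms(1,2)])
 fix u assume u: "u IN (fst f)"
 show "afun f u = afun g u"
 by (rule tens4_left_ext[where f = "afun f" and g = "afun g" and P = "cod f", OF assms(6-9)])
 (use u assms arrow_lin(2)[OF assms(1)] arrow_lin(2)[OF assms(2)] in "simp_all add: rm_module")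
qed (simp_all add: assms)

lemma C_inverses:
 "[|bm K B L; bm K B M; bm K B N|] ==> is_inverse RMR (Assoc RMR L M N) (AssocI L M N)"
 "bm K B M ==> is_inverse RMR (LUnit RMR M) (LUnitI M)"
 "bm K B M ==> is_inverse RMR (RUnit RMR M) (RUnitI M)"
proof -
 show "is_inverse RMR (Assoc RMR L M N) (AssocI L M N)" if "bm K B L" "bm K B M" "bm K B N"
 by (rule C.is_inverseI)
 (use that tassoc_inv1[OF bm_rm, OF that] tassoc_inv2[OF bm_rm, OF that] in
 \<open>simp_all add: C_afun, simp_all add: AssocI_def\<close>)
 show "is_inverse RMR (LUnit RMR M) (LUnitI M)" if M: "bm K B M"
 proof -
 have q: "pt B (rg B) M \<one>\<^bsub>B\<^esub> (lact M b m) = pt B (rg B) M b m"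
 if "b IN B" "m IN M" for b m
 using pt_bal[OF bm_rm[OF reg_bimodule] M, of "\<one>\<^bsub>B\<^esub>" b m] that by simp
 have "Cmp RMR (LUnitI M) (LUnit RMR M) = Idn RMR (btens B (rg B) M)"
 by (rule C_ext2[where M = "rg B" and N = M]) (use M q in simp_all)
 then have "afun (Cmp RMR (LUnitI M) (LUnit RMR M)) = afun (Idn RMR (btens B (rg B) M))" by simp
 then have "afun (LUnitI M) (afun (LUnit RMR M) u) = u" if "u IN (tens B (rg B) M)" for u
 using that C.cmp_app[of u "LUnit RMR M" "K" B "LUnitI M"] by simp
 then show ?thesis by (intro C.is_inverseI) (use M in simp_all)
 qed
 show "is_inverse RMR (RUnit RMR M) (RUnitI M)" if M: "bm K B M"
 proof -
 have q: "pt B M (rg B) (ract M m b) \<one>\<^bsub>B\<^esub> = pt B M (rg B) m b"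
 if "b IN B" "m IN M" for b m
 using pt_bal[OF bm_rm[OF M] reg_bimodule, of m b "\<one>\<^bsub>B\<^esub>"] that by simp
 have "Cmp RMR (RUnitI M) (RUnit RMR M) = Idn RMR (btens B M (rg B))"
 by (rule C_ext2[where N = "rg B" and M = M]) (use M q in simp_all)
 then have "afun (Cmp RMR (RUnitI M) (RUnit RMR M)) = afun (Idn RMR (btens B M (rg B)))" by simp
 then have "afun (RUnitI M) (afun (RUnit RMR M) u) = u" if "u IN (tens B M (rg B))" for u
 using that C.cmp_app[of u "RUnit RMR M" "K" B "RUnitI M"] by simp
 then show ?thesis by (intro C.is_inverseI) (use M in simp_all)
 qed
qed

lemma D_inverses:
 "[|rm K B L; bm K B M; bm K B N|] ==> is_inverse MR (ActAssoc MR L M N) (ActAssocI L M N)"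
 "rm K B L ==> is_inverse MR (ActUnit MR L) (ActUnitI L)"
proof -
 show "is_inverse MR (ActAssoc MR L M N) (ActAssocI L M N)" if "rm K B L" "bm K B M" "bm K B N"
 by (rule D.is_inverseI)
 (use that tassoc_inv1[OF that] tassoc_inv2[OF that] in
 \<open>simp_all add: D_afun, simp_all add: ActAssocI_def\<close>)
 show "is_inverse MR (ActUnit MR M) (ActUnitI M)" if M: "rm K B M" for M
 proof -
 have q: "pt B M (rg B) (ract M m b) \<one>\<^bsub>B\<^esub> = pt B M (rg B) m b"
 if "b IN B" "m IN M" for b m
 using pt_bal[OF M reg_bimodule, of m b "\<one>\<^bsub>B\<^esub>"] that by simp
 have "Cmp MR (ActUnitI M) (ActUnit MR M) = Idn MR (rtens B M (rg B))"
 by (rule D_ext2[where N = "rg B" and M = M]) (use M q in simp_all)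
 then have "afun (Cmp MR (ActUnitI M) (ActUnit MR M)) = afun (Idn MR (rtens B M (rg B)))" by simp
 then have "afun (ActUnitI M) (afun (ActUnit MR M) u) = u" if "u IN (tens B M (rg B))" for u
 using that D.cmp_app[of u "ActUnit MR M" "K" B "ActUnitI M"] by simp
 then show ?thesis by (intro D.is_inverseI) (use M in simp_all)
 qed
qed

lemmas inv_arrows = C_inverses[THEN C.inv_arrowI] D_inverses[THEN D.inv_arrowI]

text \<open>Naturality, pentagon and triangle are equations between arrows out of tensor products,
  each decided by one evaluation on pure tensors.\<close>

lemma monoidal: "monoidal_category RMR"
proof (intro monoidal_category.intro C.category monoidal_category_axioms.intro)
 show "iso_arrow RMR (Assoc RMR x y z)" if "x \<in> Ob RMR" "y \<in> Ob RMR" "z \<in> Ob RMR" for x y z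
 using C_inverses(1)[of x y z] that unfolding iso_arrow_def by (simp del: split_paired_Ex, blast)
 show "iso_arrow RMR (LUnit RMR x)" "iso_arrow RMR (RUnit RMR x)" if "x \<in> Ob RMR" for x
 using C_inverses(2,3)[of x] that unfolding iso_arrow_def by (auto simp del: split_paired_Ex)
next
 fix f f' f'' g g' g'' x x' x'' y y' y'' assume "f \<in> Hom RMR x x'" "f' \<in> Hom RMR x' x''" "g \<in> Hom RMR y y'" "g' \<in> Hom RMR y' y''"
 then show "TenA RMR (Cmp RMR f' f) (Cmp RMR g' g) = Cmp RMR (TenA RMR f' g') (TenA RMR f g)"
 by (intro C_ext2[where M = x and N = y]) (auto simp: C.hom_iff)
next
 fix f g h x x' y y' z z' assume "f \<in> Hom RMR x x'" "g \<in> Hom RMR y y'" "h \<in> Hom RMR z z'"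
 then show "Cmp RMR (Assoc RMR x' y' z') (TenA RMR (TenA RMR f g) h) = Cmp RMR (TenA RMR f (TenA RMR g h)) (Assoc RMR x y z)"
 by (intro C_ext3l[where L = x and M = y and N = z]) (auto simp: C.hom_iff)
next
 fix f x x' assume f: "f \<in> Hom RMR x x'"
 show "Cmp RMR (LUnit RMR x') (TenA RMR (Idn RMR (UnitO RMR)) f) = Cmp RMR f (LUnit RMR x)"
 using f by (intro C_ext2[where M = "rg B" and N = x]) (auto simp: C.hom_iff arrow_equi)
 show "Cmp RMR (RUnit RMR x') (TenA RMR f (Idn RMR (UnitO RMR))) = Cmp RMR f (RUnit RMR x)"
 using f by (intro C_ext2[where N = "rg B" and M = x])
 (auto simp: C.hom_iff arrow_equi)
next
 fix w x y z assume "w \<in> Ob RMR" "x \<in> Ob RMR" "y \<in> Ob RMR" "z \<in> Ob RMR"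
 then show "Cmp RMR (Assoc RMR w x (TenO RMR y z)) (Assoc RMR (TenO RMR w x) y z) =
 Cmp RMR (TenA RMR (Idn RMR w) (Assoc RMR x y z)) (Cmp RMR (Assoc RMR w (TenO RMR x y) z) (TenA RMR (Assoc RMR w x y) (Idn RMR z)))"
 by (intro C_ext4l[where W = w and L = x and M = y and N = z]) auto
next
 fix x y assume "x \<in> Ob RMR" "y \<in> Ob RMR"
 then show "Cmp RMR (TenA RMR (Idn RMR x) (LUnit RMR y)) (Assoc RMR x (UnitO RMR) y) = TenA RMR (RUnit RMR x) (Idn RMR y)"
 by (intro C_ext3l[where L = x and M = "rg B" and N = y]) (auto simp: lin_simps)
 show "TenA RMR (Idn RMR x) (Idn RMR y) = Idn RMR (TenO RMR x y)"
 using \<open>x \<in> Ob RMR\<close> \<open>y \<in> Ob RMR\<close> by (intro C_ext2[where M = x and N = y]) auto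
qed (auto simp: C.hom_iff)

lemma right_cat: "right_category RMR MR"
proof (intro right_category.intro monoidal D.category right_category_axioms.intro)
 show "iso_arrow MR (ActAssoc MR x y z)" if "x \<in> Ob MR" "y \<in> Ob RMR" "z \<in> Ob RMR" for x y z
 using D_inverses(1)[of x y z] that unfolding iso_arrow_def by (simp del: split_paired_Ex, blast)
 show "iso_arrow MR (ActUnit MR x)" if "x \<in> Ob MR" for x
 using D_inverses(2)[of x] that unfolding iso_arrow_def by (auto simp del: split_paired_Ex)
next
 fix f f' g g' x x' x'' y y' y'' assume "f \<in> Hom MR x x'" "f' \<in> Hom MR x' x''" "g \<in> Hom RMR y y'" "g' \<in> Hom RMR y' y''"
 then show "ActA MR (Cmp MR f' f) (Cmp RMR g' g) = Cmp MR (ActA MR f' g') (ActA MR f g)"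
 by (intro D_ext2[where M = x and N = y]) (auto simp: C.hom_iff D.hom_iff)
next
 fix f g h x x' y y' z z' assume "f \<in> Hom MR x x'" "g \<in> Hom RMR y y'" "h \<in> Hom RMR z z'"
 then show "Cmp MR (ActAssoc MR x' y' z') (ActA MR (ActA MR f g) h) = Cmp MR (ActA MR f (TenA RMR g h)) (ActAssoc MR x y z)"
 by (intro D_ext3l[where L = x and M = y and N = z]) (auto simp: C.hom_iff D.hom_iff)
next
 fix f x x' assume f: "f \<in> Hom MR x x'"
 show "Cmp MR (ActUnit MR x') (ActA MR f (Idn RMR (UnitO RMR))) = Cmp MR f (ActUnit MR x)"
 using f by (intro D_ext2[where N = "rg B" and M = x])
 (auto simp: D.hom_iff arrow_equi)
next
 fix w x y z assume "w \<in> Ob MR" "x \<in> Ob RMR" "y \<in> Ob RMR" "z \<in> Ob RMR"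
 then show "Cmp MR (ActAssoc MR w x (TenO RMR y z)) (ActAssoc MR (ActO MR w x) y z) =
 Cmp MR (ActA MR (Idn MR w) (Assoc RMR x y z)) (Cmp MR (ActAssoc MR w (TenO RMR x y) z) (ActA MR (ActAssoc MR w x y) (Idn RMR z)))"
 by (intro D_ext4l[where W = w and L = x and M = y and N = z]) auto
next
 fix x y assume "x \<in> Ob MR" "y \<in> Ob RMR"
 then show "Cmp MR (ActA MR (Idn MR x) (LUnit RMR y)) (ActAssoc MR x (UnitO RMR) y) = ActA MR (ActUnit MR x) (Idn RMR y)"
 by (intro D_ext3l[where L = x and M = "rg B" and N = y]) (auto simp: lin_simps)
 show "Cmp MR (ActA MR (Idn MR x) (RUnit RMR y)) (ActAssoc MR x y (UnitO RMR)) = ActUnit MR (ActO MR x y)"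
 using \<open>x \<in> Ob MR\<close> \<open>y \<in> Ob RMR\<close>
 by (intro D_ext3l[where L = x and N = "rg B" and M = y]) auto
 show "ActA MR (Idn MR x) (Idn RMR y) = Idn MR (ActO MR x y)"
 using \<open>x \<in> Ob MR\<close> \<open>y \<in> Ob RMR\<close> by (intro D_ext2[where M = x and N = y]) auto
qed (auto simp: C.hom_iff D.hom_iff)

end

section \<open>Coalgebras and comodules in Sweedler notation\<close>

context k_alg
begin

lemma bal_smult_left:
 assumes M: "rm K B M" and N: "bm K B N" and F: "balanced K B M N P F"
 shows "kk IN K ==> m IN M ==> n IN N ==> F (kk \<odot>\<^bsub>M\<^esub> m) n = kk \<odot>\<^bsub>P\<^esub> F m n"
proof -
 assume k: "kk IN K" "m IN M" "n IN N"
 have "F (ract M m (kk \<odot>\<^bsub>B\<^esub> \<one>\<^bsub>B\<^esub>)) n = F m (lact N (kk \<odot>\<^bsub>B\<^esub> \<one>\<^bsub>B\<^esub>) n)"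
 using bal_bal[OF F] k B_module by simp
 moreover have "ract M m (kk \<odot>\<^bsub>B\<^esub> \<one>\<^bsub>B\<^esub>) = kk \<odot>\<^bsub>M\<^esub> m" "lact N (kk \<odot>\<^bsub>B\<^esub> \<one>\<^bsub>B\<^esub>) n = kk \<odot>\<^bsub>N\<^esub> n"
 using k M N by (simp_all add: lin_simps)
 ultimately show ?thesis
 using bal_smult[OF F] k by simp
qed

lemma bal_lin_left:
 assumes M: "rm K B M" and N: "bm K B N" and F: "balanced K B M N P F" and n: "n IN N"
 shows "(%m. F m n) : lm K M P"
 by (rule lmI) (use n bal_closed[OF F] bal_addl[OF F] bal_smult_left[OF M N F] in simp_all)

lemma bal_lin_right:
 assumes F: "balanced K B M N P F" and m: "m IN M"
 shows "F m : lm K N P"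
 by (rule lmI) (use m bal_closed[OF F] bal_addr[OF F] bal_smult[OF F] in simp_all)

text \<open>The entry into Sweedler notation: the element is replaced by the sum of pure tensors
  that represents it, and \<open>L\<close> passes under the sum.\<close>

lemma lin_expand:
 assumes M: "rm K B M" and N: "bm K B N" and P: "module K P"
 and L: "L : lm K (tens B M N) P" and u: "u IN (tens B M N)"
 shows "L u = tf P (%m n. L (pt B M N m n)) u"
 using tlift_fuse[where F = "pt B M N", OF M N tens_module[OF M N] L P u ptens_closed] tlift_ptens_id[OF M N u] by simp

context
 fixes M :: "('k, 'a univ, 'm) rmod_scheme" and X :: "('k, 'a univ, 'n) bimod_scheme"
 and r d :: "'a univ \<Rightarrow> 'a univ" and P :: "('k, 'a univ, 'p) module_scheme"
 assumes M: "rm K B M" and X: "bm K B X" and P: "module K P"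
 and r: "r : rlm K B M (rtens B M X)"
 and d: "d : blm K B X (btens B X X)"
begin

private lemma rd: "m IN M ==> r m IN (tens B M X)" "x IN X ==> d x IN (tens B X X)"
 using lin_closed[OF rl_lin[OF r]] lin_closed[OF rl_lin[OF bl_rl[OF d]]] by simp_all

text \<open>The two composites in the coassociativity law become m_00 \<otimes> m_01 \<otimes> m_1
  and m_0 \<otimes> m_11 \<otimes> m_12, tested against an arbitrary trilinear \<open>F\<close>.
  Associators and tensored maps thereby disappear from computations with the law.\<close>

lemma coassoc_expand:
 assumes F: "trilinear K B M X X P F" and m: "m IN M"
 shows coassoc_expand_left:
 "tf P (%l w. tf P (F l) w) (tassoc B M X X (tmap B M X (rtens B M X) X r (idc X) (r m)))
 = tf P (%m0 x. tf P (%m00 x1. F m00 x1 x) (r m0)) (r m)"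
 and coassoc_expand_right:
 "tf P (%l w. tf P (F l) w) (tmap B M X M (btens B X X) (idc M) d (r m))
 = tf P (%m0 x. tf P (F m0) (d x)) (r m)"
proof -
 note MX = rtens_right_module[OF M X] and XX = btens_bimodule[OF X X]
 have idX: "(idc X) : blm K B X X"
 by (rule bl_conc(4)[OF X bl_conc(2)])
 have idM: "(idc M) : rlm K B M M"
 by (rule rl_conc(4)[OF M rl_conc(2)])
 define L where "L = tf P (%l w. tf P (F l) w)"
 have L: "L : lm K (tens B M (btens B X X)) P"
 unfolding L_def by (rule tlift_lin[OF M XX P tri_right_bal[OF M X X P F]])
 have Lp: "L (pt B M (btens B X X) l w) = tf P (F l) w"
 if "l IN M" "w IN (tens B X X)" for l w
 unfolding L_def using that tri_right_bal[OF M X X P F] M XX P by simp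
 have 1: "(%u. L (tassoc B M X X (tmap B M X (rtens B M X) X r (idc X) u))) : lm K (tens B M X) P"
 using lin_comp[OF tmap_lin[OF M X MX X r idX] lin_comp[OF tassoc_lin[OF M X X] L]] .
 have 2: "(%v. L (tassoc B M X X (pt B (rtens B M X) X v x))) : lm K (tens B M X) P" if "x IN X" for x
 proof -
 have "(%v. pt B (rtens B M X) X v x) : lm K (tens B M X) (tens B (rtens B M X) X)"
 using bal_lin_left[OF MX X ptens_bal[OF MX X] that] by (simp del: rt_left)
 then show ?thesis using lin_comp[OF _ lin_comp[OF tassoc_lin[OF M X X] L]] by blast
 qed
 show "tf P (%l w. tf P (F l) w) (tassoc B M X X (tmap B M X (rtens B M X) X r (idc X) (r m)))
 = tf P (%m0 x. tf P (%m00 x1. F m00 x1 x) (r m0)) (r m)"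
 unfolding L_def[symmetric] lin_expand[OF M X P 1 rd(1)[OF m]]
 proof (rule tlift_cong[OF M X P rd(1)[OF m]])
 fix m0 x assume x: "m0 IN M" "x IN X"
 have "L (tassoc B M X X (tmap B M X (rtens B M X) X r (idc X) (pt B M X m0 x)))
 = L (tassoc B M X X (pt B (rtens B M X) X (r m0) x))"
 using x by (simp add: tmap_ptens[OF M X MX X r idX] del: rt_left)
 also have "... = tf P (%m00 x1. L (tassoc B M X X (pt B (rtens B M X) X (pt B M X m00 x1) x))) (r m0)"
 by (rule lin_expand[OF M X P 2[OF x(2)] rd(1)[OF x(1)]])
 also have "... = tf P (%m00 x1. F m00 x1 x) (r m0)"
 proof (rule tlift_cong[OF M X P rd(1)[OF x(1)]])
 fix m00 x1 assume y: "m00 IN M" "x1 IN X"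
 have "L (tassoc B M X X (pt B (rtens B M X) X (pt B M X m00 x1) x)) = L (pt B M (btens B X X) m00 (pt B X X x1 x))"
 by (simp only: tassoc_ptens[OF M X X y x(2)])
 also have "... = F m00 x1 x"
 using x y X P by (simp add: Lp trilinear_right[OF F])
 finally show "L (tassoc B M X X (pt B (rtens B M X) X (pt B M X m00 x1) x)) = F m00 x1 x" .
 qed
 finally show "L (tassoc B M X X (tmap B M X (rtens B M X) X r (idc X) (pt B M X m0 x)))
 = tf P (%m00 x1. F m00 x1 x) (r m0)" .
 qed
 have 3: "(%u. L (tmap B M X M (btens B X X) (idc M) d u)) : lm K (tens B M X) P"
 using lin_comp[OF tmap_lin[OF M X M XX idM d] L] .
 show "tf P (%l w. tf P (F l) w) (tmap B M X M (btens B X X) (idc M) d (r m))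
 = tf P (%m0 x. tf P (F m0) (d x)) (r m)"
 unfolding L_def[symmetric] lin_expand[OF M X P 3 rd(1)[OF m]]
 by (rule tlift_cong[OF M X P rd(1)[OF m]])
 (use M X XX P in "simp add: tmap_ptens[OF M X M XX idM d] Lp rd")
qed

end

lemma Idn_app: "Idn RMR x = (x, \<lambda>u \<in> carrier x. u, x)" "Idn MR y = (y, \<lambda>u \<in> carrier y. u, y)"
 by (simp_all add: C.c_simps D.c_simps)


text \<open>Stated for functions instead of arrows, so that the law can be compared across different
  records of the same module.\<close>

definition "coassoc_on M X r d \<longleftrightarrow> (ALL m:carrier M.
 tassoc B M X X (tmap B M X (rtens B M X) X r (idc X) (r m))
 = tmap B M X M (btens B X X) (idc M) d (r m))"

definition "counit_on M X r e \<longleftrightarrow> (ALL m:carrier M. tf M (%m x. ract M m (e x)) (r m) = m)"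

lemma counit_bal:
 assumes "rm K B M" "bm K B X" "e : blm K B X (rg B)"
 shows "balanced K B M X M (%m x. ract M m (e x))"
proof -
 note e = lin_closed[OF rl_lin[OF bl_rl[OF assms(3)]], simplified]
 lin_add[OF rl_lin[OF bl_rl[OF assms(3)]]]
 lin_smult[OF rl_lin[OF bl_rl[OF assms(3)]]] bilinear_lact[OF assms(3)]
 show ?thesis
 by (rule balancedI) (use assms(1,2) in "simp_all add: e lin_simps rm_mult[of K B]")
qed

lemma counit_expand:
 assumes M: "rm K B M" and X: "bm K B X" and e: "e : blm K B X (rg B)"
 and u: "u IN (tens B M X)"
 shows "tf M (ract M) (tmap B M X M (rg B) (idc M) e u) = tf M (%m x. ract M m (e x)) u"
proof -
 note R = reg_bimodule
 have idM: "(idc M) : rlm K B M M"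
 by (rule rl_conc(4)[OF M rl_conc(2)])
 have MM: "module K M" using M by simp
 note ec = lin_closed[OF rl_lin[OF bl_rl[OF e]], simplified]
 show ?thesis
 unfolding lin_expand[OF M X MM lin_comp[OF tmap_lin[OF M X M R idM e] tlift_lin[OF M R MM runit_bal[OF M]]] u]
 by (rule tlift_cong[OF M X MM u]) (use M X e in "simp add: tmap_ptens[OF M X M R idM e] ec")
qed

lemma coassoc_lift:
 assumes "rm K B M" "bm K B X" "module K P" "r : rlm K B M (rtens B M X)"
 "d : blm K B X (btens B X X)" "coassoc_on M X r d" "trilinear K B M X X P F" "m IN M"
 shows "tf P (%m0 x. tf P (%m00 x1. F m00 x1 x) (r m0)) (r m) = tf P (%m0 x. tf P (F m0) (d x)) (r m)"
 using coassoc_expand[OF assms(1-5,7,8)] assms(6,8) by (simp add: coassoc_on_def)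

text \<open>Separates the typing of \<open>rho\<close> as an arrow, which includes its linearity,
  from the pointwise laws for its function.\<close>

lemma comodule_iff:
 assumes X: "bm K B X" and d: "d : Ar RMR" "fst d = X" "cod d = btens B X X"
 and e: "e : Ar RMR" "fst e = X" "cod e = rg B"
 shows "right_comodule_in RMR MR X d e (M, rho) \<longleftrightarrow>
 rho : Ar MR & fst rho = M & cod rho = rtens B M X & coassoc_on M X (afun rho) (afun d) & counit_on M X (afun rho) (afun e)"
proof (cases "rho : Ar MR & fst rho = M & cod rho = rtens B M X")
 case False
 then show ?thesis by (auto simp: right_comodule_in_def D.hom_iff)
next
 case True
 then have rho: "rho : Ar MR" "fst rho = M" "cod rho = rtens B M X" by auto
 then have M: "rm K B M" using arrow_ob(3) by blast
 have cl: "afun rho m IN (tens B M X)" if "m IN M" for m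
 using D.app_closed[OF rho(1)] that rho by simp
 let ?l1 = "Cmp MR (ActAssoc MR M X X) (Cmp MR (ActA MR rho (Idn RMR X)) rho)" and ?r1 = "Cmp MR (ActA MR (Idn MR M) d) rho"
 have ar: "?l1 : Ar MR" "?r1 : Ar MR" using M X d rho by simp_all
 have tcl: "afun (ActA MR rho (Idn RMR X)) (afun rho m) IN (tens B (rtens B M X) X)" if "m IN M" for m
 using D.app_closed[of "ActA MR rho (Idn RMR X)" K B "afun rho m"] M X rho cl[OF that] by (simp del: rt_left)
 have "?l1 = ?r1 \<longleftrightarrow> (ALL m:carrier M. afun ?l1 m = afun ?r1 m)"
 using D.ar_eqI[OF ar] M X rho d by (auto simp del: D.cmp_app)
 also have "... \<longleftrightarrow> coassoc_on M X (afun rho) (afun d)"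
 unfolding coassoc_on_def using M X rho d cl tcl
 by (simp add: D_afun ActA_simps(3) Idn_app)
 finally have 1: "?l1 = ?r1 \<longleftrightarrow> coassoc_on M X (afun rho) (afun d)" .
 let ?l2 = "Cmp MR (ActUnit MR M) (Cmp MR (ActA MR (Idn MR M) e) rho)"
 have ar: "?l2 : Ar MR" using M X e rho by simp
 have tcl: "afun (ActA MR (Idn MR M) e) (afun rho m) IN (tens B M (rg B))" if "m IN M" for m
 using D.app_closed[of "ActA MR (Idn MR M) e" K B "afun rho m"] M X rho e cl[OF that] by simp
 have e': "afun e : blm K B X (rg B)" using e by (simp add: C.ar_iff del: arrow_ob)
 have "?l2 = Idn MR M \<longleftrightarrow> (ALL m:carrier M. afun ?l2 m = m)"
 using ar M by (auto intro!: D.ar_eqI simp del: D.cmp_app simp: rho)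
 also have "... \<longleftrightarrow> counit_on M X (afun rho) (afun e)"
 unfolding counit_on_def using M X rho e cl tcl counit_expand[OF M X e']
 by (simp add: D_afun ActA_simps(3) Idn_app)
 finally show ?thesis
 using 1 rho M by (simp add: right_comodule_in_def D.hom_iff)
qed

lemma coalgebra_iff:
 assumes "coalgebra_in RMR X d e"
 shows "bm K B X" "d : Ar RMR" "fst d = X" "cod d = btens B X X"
 "e : Ar RMR" "fst e = X" "cod e = rg B"
 "coassoc_on X X (afun d) (afun d)" "counit_on X X (afun d) (afun e)"
 "x IN X ==> tf X (%y z. lact X (afun e y) z) (afun d x) = x"
proof -
 show X: "bm K B X" and d: "d : Ar RMR" "fst d = X" "cod d = btens B X X"
 and e: "e : Ar RMR" "fst e = X" "cod e = rg B"
 using assms by (auto simp: coalgebra_in_def C.hom_iff)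
 have cl: "afun d m IN (tens B X X)" if "m IN X" for m
 using C.app_closed[OF d(1)] that d by simp
 have X': "rm K B X" and XX: "module K X" using X by simp_all
 note R = reg_bimodule
 have idX: "(idc X) : blm K B X X"
 by (rule bl_conc(4)[OF X bl_conc(2)])
 have e': "afun e : blm K B X (rg B)" using e by (simp add: C.ar_iff del: arrow_ob)
 have tcl: "afun (TenA RMR d (Idn RMR X)) (afun d m) IN (tens B (btens B X X) X)"
 "afun (TenA RMR (Idn RMR X) e) (afun d m) IN (tens B X (rg B))"
 "afun (TenA RMR e (Idn RMR X)) (afun d m) IN (tens B (rg B) X)" if "m IN X" for m
 using C.app_closed[of "TenA RMR d (Idn RMR X)" K B "afun d m"] C.app_closed[of "TenA RMR (Idn RMR X) e" K B "afun d m"]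
 C.app_closed[of "TenA RMR e (Idn RMR X)" K B "afun d m"]
 X d e cl[OF that] by simp_all
 have eq: "afun (Cmp RMR (Assoc RMR X X X) (Cmp RMR (TenA RMR d (Idn RMR X)) d)) m = afun (Cmp RMR (TenA RMR (Idn RMR X) d) d) m"
 "afun (Cmp RMR (LUnit RMR X) (Cmp RMR (TenA RMR e (Idn RMR X)) d)) m = afun (Idn RMR X) m"
 "afun (Cmp RMR (RUnit RMR X) (Cmp RMR (TenA RMR (Idn RMR X) e) d)) m = afun (Idn RMR X) m" for m
 using assms by (simp_all add: coalgebra_in_def)
 have tm: "tmap B X X (rtens B X X) X f g = tmap B X X (btens B X X) X f g" for f g
 by (simp add: tmap_def)
 show "coassoc_on X X (afun d) (afun d)"
 unfolding coassoc_on_def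
 proof
 fix m assume m: "m IN X"
 show "tassoc B X X X (tmap B X X (rtens B X X) X (afun d) (idc X) (afun d m)) =
 tmap B X X X (btens B X X) (idc X) (afun d) (afun d m)"
 using eq(1)[of m] m X d cl tcl by (simp add: C_afun TenA_simps(3) Idn_app tm)
 qed
 show "counit_on X X (afun d) (afun e)"
 unfolding counit_on_def
 proof
 fix m assume m: "m IN X"
 show "tf X (%m x. ract X m (afun e x)) (afun d m) = m"
 using eq(3)[of m] m X d e cl tcl counit_expand[OF X' X e'] by (simp add: C_afun TenA_simps(3) Idn_app)
 qed
 show "tf X (%y z. lact X (afun e y) z) (afun d m) = m" if m: "m IN X" for m
 proof -
 note ec = lin_closed[OF rl_lin[OF bl_rl[OF e']], simplified]
 have "tf X (lact X) (tmap B X X (rg B) X (afun e) (idc X) (afun d m))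
 = tf X (%y z. lact X (afun e y) z) (afun d m)"
 unfolding lin_expand[OF X' X XX lin_comp[OF tmap_lin[OF X' X bm_rm[OF R] X bl_rl[OF e'] idX]
 tlift_lin[OF bm_rm[OF R] X XX lunit_bal[OF X]]] cl[OF m]]
 by (rule tlift_cong[OF X' X XX cl[OF m]])
 (use X in "simp add: tmap_ptens[OF X' X bm_rm[OF R] X bl_rl[OF e'] idX] ec")
 then show ?thesis
 using eq(2)[of m] m X d e cl tcl by (simp add: C_afun TenA_simps(3) Idn_app)
 qed
qed

end

section \<open>Right bialgebroids\<close>

locale bgd =
 fixes K :: "('k, 'x) ring_scheme" and R :: "('k, 'a univ) module" and H :: "('k, 'a univ) bialgebroid"
 assumes field_K: "field K" and alg_R: "k_algebra K R" and bgd_H: "right_bialgebroid K R H"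
begin

abbreviation (input) hmult (infixl "\<star>" 70) where "x \<star> y \<equiv> x \<otimes>\<^bsub>H\<^esub> y"

sublocale R: k_alg K R
 by (rule k_alg.intro) (use field_K alg_R in "auto simp: field_def domain_def")

sublocale H: k_alg K H
 by (rule k_alg.intro[OF R.K_cring]) (use bgd_H in "simp add: right_bialgebroid_def")

abbreviation "s \<equiv> src H"
abbreviation "t \<equiv> tgt H"
abbreviation "eps \<equiv> counit H"
abbreviation "\<Delta> \<equiv> comult H"
abbreviation "Hb \<equiv> bgd_bimod R H"
abbreviation "HH \<equiv> btens R Hb Hb"

lemma src_tgt [simp]:
 "r IN R ==> s r IN H" "r IN R ==> t r IN H"
 "s \<one>\<^bsub>R\<^esub> = \<one>\<^bsub>H\<^esub>" "t \<one>\<^bsub>R\<^esub> = \<one>\<^bsub>H\<^esub>"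
 using bgd_H by (auto simp: right_bialgebroid_def ring_hom_def linear_maps_def)

lemma src_tgt_lin:
 "r IN R ==> r' IN R ==> s (r \<otimes>\<^bsub>R\<^esub> r') = s r \<star> s r'"
 "r IN R ==> r' IN R ==> t (r \<otimes>\<^bsub>R\<^esub> r') = t r' \<star> t r"
 "r IN R ==> r' IN R ==> s (r \<oplus>\<^bsub>R\<^esub> r') = s r \<oplus>\<^bsub>H\<^esub> s r'"
 "r IN R ==> r' IN R ==> t (r \<oplus>\<^bsub>R\<^esub> r') = t r \<oplus>\<^bsub>H\<^esub> t r'"
 "kk IN K ==> r IN R ==> s (kk \<odot>\<^bsub>R\<^esub> r) = kk \<odot>\<^bsub>H\<^esub> s r"
 "kk IN K ==> r IN R ==> t (kk \<odot>\<^bsub>R\<^esub> r) = kk \<odot>\<^bsub>H\<^esub> t r"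
 using bgd_H by (auto simp: right_bialgebroid_def ring_hom_def linear_maps_def)

lemma src_tgt_comm: "r IN R ==> r' IN R ==> s r \<star> t r' = t r' \<star> s r"
 using bgd_H by (auto simp: right_bialgebroid_def)

lemma Hb_simps [simp]:
 "carrier Hb = carrier H" "add Hb = add H" "zero Hb = zero H" "smult Hb = smult H"
 "h IN H ==> r IN R ==> ract Hb h r = h \<star> s r"
 "h IN H ==> r IN R ==> lact Hb r h = h \<star> t r"
 by (simp_all add: bgd_bimod_def)

lemmas coalg_H = R.coalgebra_iff[of Hb "bgd_comult R H" "bgd_counit R H", unfolded bgd_comult_def bgd_counit_def afun_triple]

lemma coalg_H_in: "coalgebra_in (bimod_moncat K R) Hb (Hb, \<Delta>, HH) (Hb, eps, rg R)"
 using bgd_H by (simp add: right_bialgebroid_def bgd_comult_def bgd_counit_def)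

lemma Hb_bm [simp]: "bm K R Hb"
 using coalg_H(1)[OF coalg_H_in] .

lemma \<Delta>_bilinear: "\<Delta> : blm K R Hb HH"
 and eps_bilinear: "eps : blm K R Hb (rg R)"
 using coalg_H(2,5)[OF coalg_H_in] by (simp_all add: C.ar_iff del: arrow_ob)

lemma \<Delta>_closed [simp]: "h IN H ==> \<Delta> h IN (tens R Hb Hb)"
 using lin_closed[OF rl_lin[OF bl_rl[OF \<Delta>_bilinear]]] by simp

lemma eps_closed [simp]: "h IN H ==> eps h IN R"
 using lin_closed[OF rl_lin[OF bl_rl[OF eps_bilinear]]] by simp

lemma eps_lin:
 "h IN H ==> h' IN H ==> eps (h \<oplus>\<^bsub>H\<^esub> h') = eps h \<oplus>\<^bsub>R\<^esub> eps h'"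
 "kk IN K ==> h IN H ==> eps (kk \<odot>\<^bsub>H\<^esub> h) = kk \<odot>\<^bsub>R\<^esub> eps h"
 "h IN H ==> r IN R ==> eps (h \<star> s r) = eps h \<otimes>\<^bsub>R\<^esub> r"
 "h IN H ==> r IN R ==> eps (h \<star> t r) = r \<otimes>\<^bsub>R\<^esub> eps h"
 using lin_add[OF rl_lin[OF bl_rl[OF eps_bilinear]]]
 lin_smult[OF rl_lin[OF bl_rl[OF eps_bilinear]]]
 rl_ract[OF bl_rl[OF eps_bilinear]] bilinear_lact[OF eps_bilinear] by auto

lemma eps_mult:
 "h IN H ==> h' IN H ==> eps (s (eps h) \<star> h') = eps (h \<star> h')"
 "h IN H ==> h' IN H ==> eps (t (eps h) \<star> h') = eps (h \<star> h')"
 "eps \<one>\<^bsub>H\<^esub> = \<one>\<^bsub>R\<^esub>"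
 using bgd_H by (auto simp: right_bialgebroid_def)

lemma eps_src_tgt [simp]: "r IN R ==> eps (s r) = r" "r IN R ==> eps (t r) = r"
 using eps_lin(3,4)[of "\<one>\<^bsub>H\<^esub>" r] by (simp_all add: eps_mult)

text \<open>The counit axiom \<epsilon>(t(\<epsilon>(h)) h') = \<epsilon>(h h') at h = s(r), where
  \<epsilon>(s(r)) = r.\<close>

lemma eps_tgt: "r IN R ==> h IN H ==> eps (t r \<star> h) = eps (s r \<star> h)"
 using eps_mult(2)[of "s r" h] by simp

lemmas hlin = H.B_distr_left H.B_distr_right H.B_smult_left H.B_smult_right H.B_assoc

lemma eps_lin_right:
 "x IN H ==> h IN H ==> r IN R ==> eps (x \<star> (h \<star> s r)) = eps (x \<star> h) \<otimes>\<^bsub>R\<^esub> r"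
 "x IN H ==> h IN H ==> r IN R ==> eps (x \<star> (h \<star> t r)) = r \<otimes>\<^bsub>R\<^esub> eps (x \<star> h)"
 by (simp_all add: H.B_assoc[symmetric] eps_lin)


text \<open>Applies the linear extension of \<open>F\<close> to the equation that defines the
  Takeuchi product.\<close>

lemma takeuchi_lift:
 assumes P: "module K P" and F: "balanced K R Hb Hb P F" and h: "h IN H" and r: "r IN R"
 shows "tf P (%x y. F (s r \<star> x) y) (\<Delta> h) = tf P (%x y. F x (t r \<star> y)) (\<Delta> h)"
proof -
 note B = Hb_bm and B' = bm_rm[OF Hb_bm]
 note L = R.tlift_lin[OF B' B P F]
 note fuse = R.tlift_fuse[OF B' B R.tens_module[OF B' B] L P \<Delta>_closed[OF h]]
 have eq: "tf (tens R Hb Hb) (%x y. pt R Hb Hb (s r \<star> x) y) (\<Delta> h)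
 = tf (tens R Hb Hb) (%x y. pt R Hb Hb x (t r \<star> y)) (\<Delta> h)"
 using bgd_H h r by (simp add: right_bialgebroid_def takeuchi_def)
 have "tf P (%x y. F (s r \<star> x) y) (\<Delta> h) = tf P F (tf (tens R Hb Hb) (%x y. pt R Hb Hb (s r \<star> x) y) (\<Delta> h))"
 by (subst fuse) (use r P F in "auto intro!: R.tlift_cong[OF B' B P \<Delta>_closed[OF h]]")
 also have "... = tf P (%x y. F x (t r \<star> y)) (\<Delta> h)"
 unfolding eq
 by (subst fuse) (use r P F in "auto intro!: R.tlift_cong[OF B' B P \<Delta>_closed[OF h]]")
 finally show ?thesis .
qed

text \<open>R acts on H by right multiplication with s(r) and t(r), so left multiplication in either
  factor respects the balancing.\<close>

lemma mult_bal:
 assumes x: "x IN H" and y: "y IN H"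
 shows "balanced K R Hb Hb (tens R Hb Hb) (%x' y'. pt R Hb Hb (x \<star> x') (y \<star> y'))"
proof (rule balancedI)
 fix m b n assume "m IN Hb" "b IN R" "n IN Hb"
 then show "pt R Hb Hb (x \<star> ract Hb m b) (y \<star> n) = pt R Hb Hb (x \<star> m) (y \<star> lact Hb b n)"
 using R.pt_bal[OF bm_rm[OF Hb_bm] Hb_bm, of "x \<star> m" b "y \<star> n"] x y
 by (simp add: H.B_assoc)
qed (use x y in "simp_all add: hlin R.lin_simps")

text \<open>Componentwise multiplication is not defined on all of H \<otimes> H. With
  \<open>\<Delta> h\<close> as right factor it is, because x s(r) x' \<otimes> y y' and x x'
  \<otimes> y t(r) y' have the same sum when the x' \<otimes> y' sum to an element of the Takeuchi
  product.\<close>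

lemma \<Delta>_mult_left_bal:
 assumes h: "h IN H"
 shows "balanced K R Hb Hb (tens R Hb Hb) (%x y. tf (tens R Hb Hb) (%x' y'. pt R Hb Hb (x \<star> x') (y \<star> y')) (\<Delta> h))"
proof (rule balancedI)
 note B = Hb_bm and B' = bm_rm[OF Hb_bm]
 note T = R.tens_module[OF B' B]
 show "tf (tens R Hb Hb) (%x' y'. pt R Hb Hb (x \<star> x') (y \<star> y')) (\<Delta> h) IN (tens R Hb Hb)"
 if "x IN Hb" "y IN Hb" for x y
 by (rule R.tlift_closed[OF B' B T]) (use h that in simp_all)
 show "tf (tens R Hb Hb) (%x' y'. pt R Hb Hb ((x \<oplus>\<^bsub>Hb\<^esub> z) \<star> x') (y \<star> y')) (\<Delta> h) =
 tf (tens R Hb Hb) (%x' y'. pt R Hb Hb (x \<star> x') (y \<star> y')) (\<Delta> h) \<oplus>\<^bsub>tens R Hb Hb\<^esub>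
 tf (tens R Hb Hb) (%x' y'. pt R Hb Hb (z \<star> x') (y \<star> y')) (\<Delta> h)"
 if "x IN Hb" "z IN Hb" "y IN Hb" for x y z
 by (rule R.tlift_addI[OF B' B T]) (use h that in "simp_all add: hlin R.lin_simps")
 show "tf (tens R Hb Hb) (%x' y'. pt R Hb Hb (x \<star> x') ((y \<oplus>\<^bsub>Hb\<^esub> z) \<star> y')) (\<Delta> h) =
 tf (tens R Hb Hb) (%x' y'. pt R Hb Hb (x \<star> x') (y \<star> y')) (\<Delta> h) \<oplus>\<^bsub>tens R Hb Hb\<^esub>
 tf (tens R Hb Hb) (%x' y'. pt R Hb Hb (x \<star> x') (z \<star> y')) (\<Delta> h)"
 if "x IN Hb" "y IN Hb" "z IN Hb" for x y z
 by (rule R.tlift_addI[OF B' B T]) (use h that in "simp_all add: hlin R.lin_simps")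
 show "tf (tens R Hb Hb) (%x' y'. pt R Hb Hb (x \<star> x') ((kk \<odot>\<^bsub>Hb\<^esub> y) \<star> y')) (\<Delta> h) =
 kk \<odot>\<^bsub>tens R Hb Hb\<^esub> tf (tens R Hb Hb) (%x' y'. pt R Hb Hb (x \<star> x') (y \<star> y')) (\<Delta> h)"
 if "kk IN K" "x IN Hb" "y IN Hb" for x y kk
 by (rule R.tlift_smultI[OF B' B T]) (use h that in "simp_all add: hlin R.lin_simps")
 show "tf (tens R Hb Hb) (%x' y'. pt R Hb Hb (ract Hb x r \<star> x') (y \<star> y')) (\<Delta> h) =
 tf (tens R Hb Hb) (%x' y'. pt R Hb Hb (x \<star> x') (lact Hb r y \<star> y')) (\<Delta> h)"
 if x: "x IN Hb" and r: "r IN R" and y: "y IN Hb" for x y r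
 proof -
 have "tf (tens R Hb Hb) (%x' y'. pt R Hb Hb (ract Hb x r \<star> x') (y \<star> y')) (\<Delta> h) =
 tf (tens R Hb Hb) (%x' y'. pt R Hb Hb (x \<star> (s r \<star> x')) (y \<star> y')) (\<Delta> h)"
 by (rule R.tlift_cong[OF B' B T \<Delta>_closed[OF h]]) (use x y r in "simp add: H.B_assoc")
 also have "... = tf (tens R Hb Hb) (%x' y'. pt R Hb Hb (x \<star> x') (y \<star> (t r \<star> y'))) (\<Delta> h)"
 using takeuchi_lift[OF T mult_bal h r] x y by simp
 also have "... = tf (tens R Hb Hb) (%x' y'. pt R Hb Hb (x \<star> x') (lact Hb r y \<star> y')) (\<Delta> h)"
 by (rule R.tlift_cong[OF B' B T \<Delta>_closed[OF h]]) (use x y r in "simp add: H.B_assoc")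
 finally show ?thesis .
 qed
qed

lemma \<Delta>_mult: "h IN H ==> h' IN H ==>
 \<Delta> (h \<star> h') = tf (tens R Hb Hb) (%x y. tf (tens R Hb Hb)
 (%x' y'. pt R Hb Hb (x \<star> x') (y \<star> y')) (\<Delta> h')) (\<Delta> h)"
 using bgd_H by (auto simp: right_bialgebroid_def takeuchi_mult_def)

lemma \<Delta>_one: "\<Delta> \<one>\<^bsub>H\<^esub> = pt R Hb Hb \<one>\<^bsub>H\<^esub> \<one>\<^bsub>H\<^esub>"
 using bgd_H by (auto simp: right_bialgebroid_def)

text \<open>For the bimodule structure s(r) = 1 r and t(r) = r 1, so bilinearity reduces both to the
  value at 1.\<close>

lemma \<Delta>_src_tgt:
 assumes r: "r IN R"
 shows "\<Delta> (s r) = pt R Hb Hb \<one>\<^bsub>H\<^esub> (s r)" "\<Delta> (t r) = pt R Hb Hb (t r) \<one>\<^bsub>H\<^esub>"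
 using r rl_ract[OF bl_rl[OF \<Delta>_bilinear], of "\<one>\<^bsub>H\<^esub>" r] bilinear_lact[OF \<Delta>_bilinear, of "\<one>\<^bsub>H\<^esub>" r]
 by (simp_all add: \<Delta>_one)

lemma \<Delta>_src_mult:
 assumes r: "r IN R" and h: "h IN H"
 shows "\<Delta> (s r \<star> h) = tf (tens R Hb Hb) (%x y. pt R Hb Hb x (s r \<star> y)) (\<Delta> h)"
 and "\<Delta> (t r \<star> h) = tf (tens R Hb Hb) (%x y. pt R Hb Hb (t r \<star> x) y) (\<Delta> h)"
 using r h \<Delta>_mult_left_bal[OF h]
 by (auto simp: \<Delta>_mult \<Delta>_src_tgt intro!: R.tlift_cong[OF bm_rm[OF Hb_bm] Hb_bm _ \<Delta>_closed])

lemma counit_H: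
 assumes h: "h IN H"
 shows "tf Hb (%x y. x \<star> s (eps y)) (\<Delta> h) = h" "tf Hb (%x y. y \<star> t (eps x)) (\<Delta> h) = h"
proof -
 note B = Hb_bm and B' = bm_rm[OF Hb_bm]
 have T: "module K Hb" by simp
 have "tf Hb (%x y. x \<star> s (eps y)) (\<Delta> h) = tf Hb (%x y. ract Hb x (eps y)) (\<Delta> h)"
 "tf Hb (%x y. y \<star> t (eps x)) (\<Delta> h) = tf Hb (%x y. lact Hb (eps x) y) (\<Delta> h)"
 by (rule R.tlift_cong[OF B' B T \<Delta>_closed[OF h]]; simp)+
 then show "tf Hb (%x y. x \<star> s (eps y)) (\<Delta> h) = h" "tf Hb (%x y. y \<star> t (eps x)) (\<Delta> h) = h"
 using coalg_H(9,10)[OF coalg_H_in] h by (simp_all add: R.counit_on_def)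
qed

lemma mult_lin [simp]: "h IN H ==> (%x. h \<star> x) : lm K H H"
 "h IN H ==> (%x. x \<star> h) : lm K H H"
 by (rule lmI; simp add: hlin)+

text \<open>The counit laws applied to s(r)h and t(r)h, where the comultiplication puts s(r) on the
  right leg and t(r) on the left one. The second also uses \<epsilon>(t(r)x) =
  \<epsilon>(s(r)x).\<close>

lemma counit_src:
 assumes h: "h IN H" and r: "r IN R"
 shows "tf Hb (%x y. x \<star> s (eps (s r \<star> y))) (\<Delta> h) = s r \<star> h"
 "tf Hb (%x y. y \<star> t (eps (s r \<star> x))) (\<Delta> h) = t r \<star> h"
proof -
 note B = Hb_bm and B' = bm_rm[OF Hb_bm]
 have T: "module K Hb" by simp
 have b1: "balanced K R Hb Hb Hb (%x y. x \<star> s (eps y))"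
 by (rule balancedI) (simp_all add: hlin eps_lin src_tgt_lin)
 have b2: "balanced K R Hb Hb Hb (%x y. y \<star> t (eps x))"
 by (rule balancedI) (simp_all add: hlin eps_lin src_tgt_lin)
 note f1 = R.tlift_fuse[OF B' B R.tens_module[OF B' B] R.tlift_lin[OF B' B T b1] T \<Delta>_closed[OF h]]
 note f2 = R.tlift_fuse[OF B' B R.tens_module[OF B' B] R.tlift_lin[OF B' B T b2] T \<Delta>_closed[OF h]]
 have "s r \<star> h = tf Hb (%x y. x \<star> s (eps y)) (\<Delta> (s r \<star> h))"
 by (rule counit_H(1)[symmetric]) (use h r in simp)
 also have "... = tf Hb (%x y. x \<star> s (eps (s r \<star> y))) (\<Delta> h)"
 unfolding \<Delta>_src_mult[OF r h]
 by (subst f1) (use h r b1 in "auto intro!: R.tlift_cong[OF B' B T \<Delta>_closed]")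
 finally show "tf Hb (%x y. x \<star> s (eps (s r \<star> y))) (\<Delta> h) = s r \<star> h" by simp
 have "t r \<star> h = tf Hb (%x y. y \<star> t (eps x)) (\<Delta> (t r \<star> h))"
 by (rule counit_H(2)[symmetric]) (use h r in simp)
 also have "... = tf Hb (%x y. y \<star> t (eps (s r \<star> x))) (\<Delta> h)"
 unfolding \<Delta>_src_mult[OF r h]
 by (subst f2) (use h r b2 in "auto simp: eps_tgt intro!: R.tlift_cong[OF B' B T \<Delta>_closed]")
 finally show "tf Hb (%x y. y \<star> t (eps (s r \<star> x))) (\<Delta> h) = t r \<star> h" by simp
qed

section \<open>The bimodule structure of a comodule\<close>

text \<open>The left action that a comodule inherits, in terms of the function \<open>rho\<close>
  alone; \<open>comod_bimod\<close> wraps the same formula into a record.\<close>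

definition lam where
 "lam M rho r m = tf M (%m0 m1. ract M m0 (eps (s r \<star> m1))) (rho m)"

context
 fixes M :: "('k, 'a univ) rmod" and rho :: "'a univ \<Rightarrow> 'a univ"
 assumes M: "rm K R M" and rho: "rho : rlm K R M (rtens R M Hb)"
 and coassoc: "R.coassoc_on M Hb rho \<Delta>" and counit: "R.counit_on M Hb rho eps"
begin

lemma rho_closed: "m IN M ==> rho m IN (tens R M Hb)"
 using lin_closed[OF rl_lin[OF rho]] by simp

private lemmas MB = M Hb_bm

lemma lam_bal: "r IN R ==> balanced K R M Hb M (%m h. ract M m (eps (s r \<star> h)))"
 by (rule balancedI) (use M in "simp_all add: hlin eps_lin eps_lin_right R.lin_simps rm_mult[of K R]")

lemma lam_closed: "r IN R ==> m IN M ==> lam M rho r m IN M"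
 unfolding lam_def by (rule R.tlift_closed[OF MB]) (use M rho_closed in simp_all)

lemma lam_lin: "r IN R ==> lam M rho r : lm K M M"
 unfolding lam_def using lin_comp[OF rl_lin[OF rho], simplified, OF R.tlift_lin[OF MB _ lam_bal]] M by simp

lemma rho_ract_lift:
 assumes P: "module K P" and F: "balanced K R M Hb P F" and m: "m IN M" and r: "r IN R"
 shows "tf P F (rho (ract M m r)) = tf P (%m0 h. F m0 (h \<star> s r)) (rho m)"
proof -
 note T = R.tens_module[OF MB]
 have "tf P F (rho (ract M m r)) = tf P F (tf (tens R M Hb) (%m0 h. pt R M Hb m0 (ract Hb h r)) (rho m))"
 using rl_ract[OF rho m r] R.ract_rtens[OF MB rho_closed[OF m] r] by simp
 also have "... = tf P (%m0 h. tf P F (pt R M Hb m0 (ract Hb h r))) (rho m)"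
 by (rule R.tlift_fuse[OF MB T R.tlift_lin[OF MB P F] P rho_closed[OF m]]) (use r in simp)
 also have "... = tf P (%m0 h. F m0 (h \<star> s r)) (rho m)"
 by (rule R.tlift_cong[OF MB P rho_closed[OF m]]) (use r M P F in simp)
 finally show ?thesis .
qed

lemma bal_lin_right': "balanced K R M Hb P F ==> m IN M ==> F m : lm K Hb P"
 using R.bal_lin_right by blast

text \<open>Right linearity of the coaction gives m_00 \<otimes> m_01 s(\<epsilon>(s(r) m_1)).
  Coassociativity moves the inner sum into H, where the counit law for s(r)h collapses it to m_0
  \<otimes> s(r) m_1.\<close>

lemma rho_lam:
 assumes P: "module K P" and F: "balanced K R M Hb P F" and m: "m IN M" and r: "r IN R"
 shows "tf P F (rho (lam M rho r m)) = tf P (%m0 h. F m0 (s r \<star> h)) (rho m)"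
proof -
 note T = R.tens_module[OF MB] and B = Hb_bm
 have MM: "module K M" and HM: "module K Hb" using M by simp_all
 note L = lin_comp[OF rl_lin[OF rho], simplified, OF R.tlift_lin[OF MB P F]]
 \<comment> \<open>Balancing between \<open>m00\<close> and \<open>h1\<close> moves a factor t(r')
   past s(...), which is possible because the images of s and t commute.\<close>
 have tri: "trilinear K R M Hb Hb P (%m00 h1 h. F m00 (h1 \<star> s (eps (s r \<star> h))))"
 by (rule trilinearI)
 (use r bal_closed[OF F] bal_addl[OF F] bal_addr[OF F] bal_smult[OF F] bal_bal[OF F] M in
 \<open>simp_all add: hlin eps_lin eps_lin_right src_tgt_lin src_tgt_comm\<close>)
 have "tf P F (rho (lam M rho r m)) = tf P (%m0 h. tf P F (rho (ract M m0 (eps (s r \<star> h))))) (rho m)"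
 unfolding lam_def
 by (rule R.tlift_fuse[OF MB MM L P rho_closed[OF m]]) (use r M in simp)
 also have "... = tf P (%m0 h. tf P (%m00 h1. F m00 (h1 \<star> s (eps (s r \<star> h)))) (rho m0)) (rho m)"
 by (rule R.tlift_cong[OF MB P rho_closed[OF m]]) (use r rho_ract_lift[OF P F] in simp)
 also have "... = tf P (%m0 h. tf P (%h1 h2. F m0 (h1 \<star> s (eps (s r \<star> h2)))) (\<Delta> h)) (rho m)"
 by (rule R.coassoc_lift[OF M B P rho \<Delta>_bilinear coassoc tri m])
 also have "... = tf P (%m0 h. F m0 (s r \<star> h)) (rho m)"
 proof (rule R.tlift_cong[OF MB P rho_closed[OF m]])
 fix m0 h assume x: "m0 IN M" "h IN Hb"
 have "tf P (%h1 h2. F m0 (h1 \<star> s (eps (s r \<star> h2)))) (\<Delta> h)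
 = F m0 (tf Hb (%h1 h2. h1 \<star> s (eps (s r \<star> h2))) (\<Delta> h))"
 by (rule R.tlift_fuse[OF bm_rm[OF B] B HM bal_lin_right'[OF F x(1)] P, symmetric]) (use r x in simp_all)
 then show "tf P (%h1 h2. F m0 (h1 \<star> s (eps (s r \<star> h2)))) (\<Delta> h) = F m0 (s r \<star> h)"
 using counit_src(1)[of h r] x r by simp
 qed
 finally show ?thesis .
qed

text \<open>Balancing moves the scalar \<epsilon>(s(r) m_01) to the right leg as a factor
  t(\<epsilon>(s(r) m_01)); then coassociativity and the counit law for t(r)h apply. This is r m_0
  \<otimes> m_1 = m_0 \<otimes> t(r) m_1.\<close>

lemma lam_takeuchi:
 assumes P: "module K P" and F: "balanced K R M Hb P F" and m: "m IN M" and r: "r IN R"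
 shows "tf P (%m0 h. F (lam M rho r m0) h) (rho m) = tf P (%m0 h. F m0 (t r \<star> h)) (rho m)"
proof -
 note T = R.tens_module[OF MB] and B = Hb_bm
 have MM: "module K M" and HM: "module K Hb" using M by simp_all
 note Fm = bal_closed[OF F] bal_addl[OF F] bal_addr[OF F] bal_smult[OF F] bal_bal[OF F, simplified] R.bal_smult_left[OF MB F]
 \<comment> \<open>Here the balancing uses that t reverses products.\<close>
 have tri: "trilinear K R M Hb Hb P (%m00 h1 h. F m00 (h \<star> t (eps (s r \<star> h1))))"
 by (rule trilinearI)
 (use r Fm M in "simp_all add: hlin eps_lin eps_lin_right src_tgt_lin")
 have "tf P (%m0 h. F (lam M rho r m0) h) (rho m) = tf P (%m0 h. tf P (%m00 h1. F (ract M m00 (eps (s r \<star> h1))) h) (rho m0)) (rho m)"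
 proof (rule R.tlift_cong[OF MB P rho_closed[OF m]])
 fix m0 h assume x: "m0 IN M" "h IN Hb"
 show "F (lam M rho r m0) h = tf P (%m00 h1. F (ract M m00 (eps (s r \<star> h1))) h) (rho m0)"
 unfolding lam_def
 by (rule R.tlift_fuse[OF MB MM R.bal_lin_left[OF MB F x(2)] P rho_closed[OF x(1)]]) (use r M in simp)
 qed
 also have "... = tf P (%m0 h. tf P (%m00 h1. F m00 (h \<star> t (eps (s r \<star> h1)))) (rho m0)) (rho m)"
 proof (rule R.tlift_cong[OF MB P rho_closed[OF m]])
 fix m0 h assume x: "m0 IN M" "h IN Hb"
 show "tf P (%m00 h1. F (ract M m00 (eps (s r \<star> h1))) h) (rho m0) = tf P (%m00 h1. F m00 (h \<star> t (eps (s r \<star> h1)))) (rho m0)"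
 by (rule R.tlift_cong[OF MB P rho_closed[OF x(1)]]) (use r x bal_bal[OF F] in simp)
 qed
 also have "... = tf P (%m0 h. tf P (%h1 h2. F m0 (h2 \<star> t (eps (s r \<star> h1)))) (\<Delta> h)) (rho m)"
 by (rule R.coassoc_lift[OF M B P rho \<Delta>_bilinear coassoc tri m])
 also have "... = tf P (%m0 h. F m0 (t r \<star> h)) (rho m)"
 proof (rule R.tlift_cong[OF MB P rho_closed[OF m]])
 fix m0 h assume x: "m0 IN M" "h IN Hb"
 have "tf P (%h1 h2. F m0 (h2 \<star> t (eps (s r \<star> h1)))) (\<Delta> h)
 = F m0 (tf Hb (%h1 h2. h2 \<star> t (eps (s r \<star> h1))) (\<Delta> h))"
 by (rule R.tlift_fuse[OF bm_rm[OF B] B HM bal_lin_right'[OF F x(1)] P, symmetric]) (use r x in simp_all)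
 then show "tf P (%h1 h2. F m0 (h2 \<star> t (eps (s r \<star> h1)))) (\<Delta> h) = F m0 (t r \<star> h)"
 using counit_src(2)[of h r] x r by simp
 qed
 finally show ?thesis .
qed

lemma comod_bimod_simps:
 "carrier (comod_bimod R H (M, (X, rho, Y))) = carrier M" "add (comod_bimod R H (M, (X, rho, Y))) = add M"
 "zero (comod_bimod R H (M, (X, rho, Y))) = zero M" "smult (comod_bimod R H (M, (X, rho, Y))) = smult M"
 "ract (comod_bimod R H (M, (X, rho, Y))) = ract M"
 "r IN R ==> m IN M ==> lact (comod_bimod R H (M, (X, rho, Y))) r m = lam M rho r m"
 by (simp_all add: comod_bimod_def lam_def)

text \<open>Only the left action needs an argument. Its multiplicativity is the formula for the
  coaction of r m inserted into its definition, its unit law is the counit law of the comodule, and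
  it commutes with the right action by right linearity of the coaction.\<close>

lemma comod_bimodule: "bm K R (comod_bimod R H (M, (X, rho, Y)))"
proof (rule bimoduleI)
 let ?M = "comod_bimod R H (M, (X, rho, Y))"
 note cb = comod_bimod_simps
 have MM: "module K M" using M by simp
 have "module K ?M" by (rule mod_cong[OF MM]) (simp_all add: cb)
 then show "rm K R ?M"
 by (rule right_moduleI) (use M in "simp_all add: cb R.lin_simps rm_on_carriers[of K R] rm_mult[of K R]")
 show "on_carriers (carrier R) (carrier ?M) (lact ?M) = lact ?M"
 by (simp add: comod_bimod_def)
 show "lact ?M b x IN ?M" if "x IN ?M" "b IN R" for x b
 using that by (simp add: cb lam_closed)
 show "lact ?M b (x \<oplus>\<^bsub>?M\<^esub> y) = lact ?M b x \<oplus>\<^bsub>?M\<^esub> lact ?M b y"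
 if "x IN ?M" "y IN ?M" "b IN R" for x y b
 using that M lin_add[OF lam_lin] by (simp add: cb)
 show "lact ?M b (kk \<odot>\<^bsub>?M\<^esub> x) = kk \<odot>\<^bsub>?M\<^esub> lact ?M b x"
 if "kk IN K" "x IN ?M" "b IN R" for x b kk
 using that M lin_smult[OF lam_lin] by (simp add: cb)
 show "lact ?M (b \<oplus>\<^bsub>R\<^esub> c) x = lact ?M b x \<oplus>\<^bsub>?M\<^esub> lact ?M c x"
 if "x IN ?M" "b IN R" "c IN R" for x b c
 proof -
 have "lam M rho (b \<oplus>\<^bsub>R\<^esub> c) x = lam M rho b x \<oplus>\<^bsub>M\<^esub> lam M rho c x"
 unfolding lam_def
 by (rule R.tlift_addI[OF MB MM]) (use that M rho_closed in "simp_all add: cb src_tgt_lin hlin eps_lin R.lin_simps")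
 then show ?thesis using that by (simp add: cb)
 qed
 show "lact ?M (kk \<odot>\<^bsub>R\<^esub> b) x = kk \<odot>\<^bsub>?M\<^esub> lact ?M b x"
 if "kk IN K" "x IN ?M" "b IN R" for x b kk
 proof -
 have "lam M rho (kk \<odot>\<^bsub>R\<^esub> b) x = kk \<odot>\<^bsub>M\<^esub> lam M rho b x"
 unfolding lam_def
 by (rule R.tlift_smultI[OF MB MM]) (use that M rho_closed in "simp_all add: cb src_tgt_lin hlin eps_lin R.lin_simps")
 then show ?thesis using that by (simp add: cb)
 qed
 show "lact ?M (b \<otimes>\<^bsub>R\<^esub> c) x = lact ?M b (lact ?M c x)"
 if "x IN ?M" "b IN R" "c IN R" for x b c
 proof -
 have x: "x IN M" using that by (simp add: cb)
 have "lam M rho b (lam M rho c x) = tf M (%m0 h. ract M m0 (eps (s b \<star> (s c \<star> h)))) (rho x)"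
 using rho_lam[OF MM lam_bal[OF that(2)] x that(3)] by (simp add: lam_def)
 also have "... = lam M rho (b \<otimes>\<^bsub>R\<^esub> c) x"
 unfolding lam_def
 by (rule R.tlift_cong[OF MB MM]) (use that rho_closed in "simp_all add: cb src_tgt_lin H.B_assoc")
 finally show ?thesis using that by (simp add: cb lam_closed)
 qed
 show "lact ?M \<one>\<^bsub>R\<^esub> x = x" if "x IN ?M" for x
 proof -
 have "lam M rho \<one>\<^bsub>R\<^esub> x = tf M (%m h. ract M m (eps h)) (rho x)"
 unfolding lam_def
 by (rule R.tlift_cong[OF MB MM]) (use that rho_closed in "simp_all add: cb")
 then show ?thesis using that counit by (simp add: cb R.counit_on_def)
 qed
 show "ract ?M (lact ?M b x) c = lact ?M b (ract ?M x c)"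
 if "x IN ?M" "b IN R" "c IN R" for x b c
 proof -
 have x: "x IN M" using that by (simp add: cb)
 have rl: "(%m. ract M m c) : lm K M M"
 by (rule lmI) (use that M in "simp_all add: R.lin_simps")
 have "lam M rho b (ract M x c) = tf M (%m0 h. ract M m0 (eps (s b \<star> (h \<star> s c)))) (rho x)"
 unfolding lam_def by (rule rho_ract_lift[OF MM lam_bal[OF that(2)] x that(3)])
 also have "... = tf M (%m0 h. ract M (ract M m0 (eps (s b \<star> h))) c) (rho x)"
 by (rule R.tlift_cong[OF MB MM rho_closed[OF x]])
 (use that M in "simp add: eps_lin_right rm_mult[of K R]")
 also have "... = ract M (lam M rho b x) c"
 unfolding lam_def by (rule R.tlift_fuse[OF MB MM rl MM rho_closed[OF x], symmetric]) (use that M in simp)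
 finally show ?thesis using that M by (simp add: cb)
 qed
qed

end

end

section \<open>Doi-Koppinen data\<close>

lemma structured_cat_simps [simp]:
 "Ob (structured_cat D Obs U P) = Obs"
 "Dom (structured_cat D Obs U P) f = fst f" "Cod (structured_cat D Obs U P) f = cod f"
 "Idn (structured_cat D Obs U P) x = (x, Idn D (U x), x)"
 "Cmp (structured_cat D Obs U P) g f = (fst f, Cmp D (afun g) (afun f), cod g)"
 "f : Ar (structured_cat D Obs U P) \<longleftrightarrow> fst f \<in> Obs & cod f \<in> Obs &
 afun f \<in> Hom D (U (fst f)) (U (cod f)) & P (fst f) (afun f) (cod f)"
 by (auto simp: structured_cat_def afun_def split: prod.splits)

lemma structured_cat_Hom:
 "f \<in> Hom (structured_cat D Obs U P) x y \<longleftrightarrow> x \<in> Obs & y \<in> Obs & fst f = x & cod f = y &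
 afun f \<in> Hom D (U x) (U y) & P x (afun f) y"
 by (auto simp: Hom_def)

lemma comodule_cat_Hom:
 "f \<in> Hom (comodule_cat C D X d e) x y \<longleftrightarrow> right_comodule_in C D X d e x & right_comodule_in C D X d e y &
 fst f = x & cod f = y & afun f \<in> Hom D (fst x) (fst y) &
 Cmp D (snd y) (afun f) = Cmp D (ActA D (afun f) (Idn C X)) (snd x)"
 by (auto simp: comodule_cat_def structured_cat_Hom split: prod.splits)

lemma comod_moncat_simps [simp]:
 "Ob (comod_moncat K R H) = {M. right_comodule_in (bimod_moncat K R) (mod_actcat K R) (bgd_bimod R H) (bgd_comult R H) (bgd_counit R H) M}"
 "Hom (comod_moncat K R H) = Hom (comodule_cat (bimod_moncat K R) (mod_actcat K R) (bgd_bimod R H) (bgd_comult R H) (bgd_counit R H))"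
 "Idn (comod_moncat K R H) x = (x, Idn (mod_actcat K R) (fst x), x)"
 "Cmp (comod_moncat K R H) g f = (fst f, Cmp (mod_actcat K R) (afun g) (afun f), cod g)"
 "TenO (comod_moncat K R H) = comod_tens R H" "UnitO (comod_moncat K R H) = comod_unit R H"
 "afun (TenA (comod_moncat K R H) f g) = (fst (comod_tens R H (fst f) (fst g)),
 tmap R (fst (fst f)) (comod_bimod R H (fst g)) (fst (cod f)) (comod_bimod R H (cod g))
 (afun (afun f)) (afun (afun g)), fst (comod_tens R H (cod f) (cod g)))"
 "afun (Assoc (comod_moncat K R H) x y z) = (fst (comod_tens R H (comod_tens R H x y) z),
 tassoc R (fst x) (comod_bimod R H y) (comod_bimod R H z), fst (comod_tens R H x (comod_tens R H y z)))"
 "afun (LUnit (comod_moncat K R H) x) = (fst (comod_tens R H (comod_unit R H) x),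
 \<lambda>u \<in> carrier (fst (comod_tens R H (comod_unit R H) x)). tf (fst x) (lact (comod_bimod R H x)) u, fst x)"
 "afun (RUnit (comod_moncat K R H) x) = (fst (comod_tens R H x (comod_unit R H)),
 \<lambda>u \<in> carrier (fst (comod_tens R H x (comod_unit R H))). tf (fst x) (ract (fst x)) u, fst x)"
 by (simp_all add: comod_moncat_def Let_def cat.defs moncat.defs comodule_cat_def Hom_def structured_cat_def
 afun_def split_beta fun_eq_iff)

lemma is_concrete_hmod: "is_concrete (hmod_moncat K R H) {M. rm K H M} carrier (rlm K H)"
 by (simp add: is_concrete_def hmod_moncat_def mod_cat_def Let_def cat.defs concrete_cat_def)

global_interpretation HM: concrete_category "hmod_moncat K R H" "{M. rm K H M}" carrier "rlm K H"
 for K :: "('k, 'x) ring_scheme" and R :: "('k, 'a univ) module" and H :: "('k, 'a univ) bialgebroid"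
 by unfold_locales (use is_concrete_hmod in "auto intro: rl_conc")

lemma hmod_moncat_simps [simp]:
 "TenO (hmod_moncat K R H) = hmod_tens R H" "UnitO (hmod_moncat K R H) = hmod_unit R H"
 "fst (TenA (hmod_moncat K R H) f g) = hmod_tens R H (fst f) (fst g)"
 "afun (TenA (hmod_moncat K R H) f g) = tmap R (hmod_bimod R H (fst f)) (hmod_bimod R H (fst g))
 (hmod_bimod R H (cod f)) (hmod_bimod R H (cod g)) (afun f) (afun g)"
 "afun (Assoc (hmod_moncat K R H) x y z) = tassoc R (hmod_bimod R H x) (hmod_bimod R H y) (hmod_bimod R H z)"
 "afun (LUnit (hmod_moncat K R H) x) =
 (\<lambda>u \<in> carrier (hmod_tens R H (hmod_unit R H) x). tf x (lact (hmod_bimod R H x)) u)"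
 "afun (RUnit (hmod_moncat K R H) x) =
 (\<lambda>u \<in> carrier (hmod_tens R H x (hmod_unit R H)). tf x (ract (hmod_bimod R H x)) u)"
 by (simp_all add: hmod_moncat_def Let_def cat.defs moncat.defs mod_cat_def concrete_cat_def afun_def split: prod.splits)

lemma bimod_eqI:
 fixes M N :: "('k, 'u) bimod"
 assumes "carrier M = carrier N" "mult M = mult N" "one M = one N" "zero M = zero N" "add M = add N"
 "smult M = smult N" "ract M = ract N" "lact M = lact N"
 shows "M = N"
 using assms by (cases M; cases N) simp

section \<open>Morphisms of comodules over the bialgebroid\<close>

context bgd
begin


lemma comod_ob:
 assumes "right_comodule_in R.RMR R.MR Hb (bgd_comult R H) (bgd_counit R H) x"
 shows "rm K R (fst x)" "snd x : Ar R.MR" "fst (snd x) = fst x" "cod (snd x) = rtens R (fst x) Hb"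
 "afun (snd x) : rlm K R (fst x) (rtens R (fst x) Hb)"
 "R.coassoc_on (fst x) Hb (afun (snd x)) \<Delta>" "R.counit_on (fst x) Hb (afun (snd x)) eps"
proof -
 note cH = coalg_H[OF coalg_H_in]
 have *: "snd x : Ar R.MR & fst (snd x) = fst x & cod (snd x) = rtens R (fst x) Hb &
 R.coassoc_on (fst x) Hb (afun (snd x)) \<Delta> & R.counit_on (fst x) Hb (afun (snd x)) eps"
 using assms cH(2-7) R.comodule_iff[OF Hb_bm, of "(Hb, \<Delta>, HH)" "(Hb, eps, rg R)" "fst x" "snd x"]
 by (simp add: bgd_comult_def bgd_counit_def)
 then show "snd x : Ar R.MR" "fst (snd x) = fst x" "cod (snd x) = rtens R (fst x) Hb"
 "R.coassoc_on (fst x) Hb (afun (snd x)) \<Delta>" "R.counit_on (fst x) Hb (afun (snd x)) eps" by auto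
 show "rm K R (fst x)" using arrow_ob(3)[of "snd x" K R] * by simp
 show "afun (snd x) : rlm K R (fst x) (rtens R (fst x) Hb)"
 using * unfolding D.ar_iff by metis
qed

lemma comod_eq: "x = (fst x, (fst (snd x), afun (snd x), cod (snd x)))"
 by (cases x) (auto simp: afun_def split: prod.splits)

lemma comod_bimod_eqs [simp]:
 "carrier (comod_bimod R H x) = carrier (fst x)" "add (comod_bimod R H x) = add (fst x)"
 "zero (comod_bimod R H x) = zero (fst x)" "smult (comod_bimod R H x) = smult (fst x)"
 "ract (comod_bimod R H x) = ract (fst x)" "mult (comod_bimod R H x) = mult (fst x)"
 "one (comod_bimod R H x) = one (fst x)"
 by (simp_all add: comod_bimod_def split_beta)

lemma comod_lact:
 "r IN R ==> m IN (fst x) ==> lact (comod_bimod R H x) r m = lam (fst x) (afun (snd x)) r m"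
 by (simp add: comod_bimod_def lam_def split_beta)

lemma comod_bimod_left:
 "tens R (comod_bimod R H x) N = tens R (fst x) N" "pt R (comod_bimod R H x) N = pt R (fst x) N"
 "rtens R (comod_bimod R H x) N = rtens R (fst x) N"
 by (rule tens_cong; simp)+

context
 fixes x assumes x: "right_comodule_in R.RMR R.MR Hb (bgd_comult R H) (bgd_counit R H) x"
begin

lemmas x_ob = comod_ob[OF x]

lemma b_bimod: "bm K R (comod_bimod R H x)"
 using comod_bimodule[OF x_ob(1,5-7)] comod_eq[of x] by metis

lemma lam_lin_x: "r IN R ==> lact (comod_bimod R H x) r : lm K (fst x) (fst x)"
 by (rule lin_cong[OF lam_lin[OF x_ob(1,5-7)]]) (use x_ob(1) in "simp_all add: comod_lact")

end

context
 fixes x y f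
 assumes x: "right_comodule_in R.RMR R.MR Hb (bgd_comult R H) (bgd_counit R H) x"
 and y: "right_comodule_in R.RMR R.MR Hb (bgd_comult R H) (bgd_counit R H) y"
 and f: "f \<in> Hom (comod_moncat K R H) x y"
begin

lemma comod_hom:
 "afun f : Ar R.MR" "fst (afun f) = fst x" "cod (afun f) = fst y" "fst f = x" "cod f = y"
 "afun (afun f) : rlm K R (fst x) (fst y)"
 "afun (afun f) \<in> extensional (carrier (fst x))"
proof -
 show *: "afun f : Ar R.MR" "fst (afun f) = fst x" "cod (afun f) = fst y" "fst f = x" "cod f = y"
 using f by (auto simp: comodule_cat_Hom D.hom_iff)
 then show "afun (afun f) : rlm K R (fst x) (fst y)" "afun (afun f) \<in> extensional (carrier (fst x))"
 by (simp_all add: D.ar_iff del: arrow_ob)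
qed

lemma comod_hom_coaction:
 assumes P: "module K P" and F: "balanced K R (fst y) Hb P F" and m: "m IN (fst x)"
 shows "tf P F (afun (snd y) (afun (afun f) m)) = tf P (%m0 h. F (afun (afun f) m0) h) (afun (snd x) m)"
proof -
 note X = comod_ob[OF x] and Y = comod_ob[OF y]
 note ch = comod_hom
 have idX: "(idc Hb) : blm K R Hb Hb"
 by (rule bl_conc(4)[OF Hb_bm bl_conc(2)])
 have xm: "afun (snd x) m IN (tens R (fst x) Hb)"
 using lin_closed[OF rl_lin[OF X(5)] m] by simp
 have "afun (Cmp R.MR (snd y) (afun f)) m = afun (Cmp R.MR (ActA R.MR (afun f) (Idn R.RMR Hb)) (snd x)) m"
 using f by (auto simp: comodule_cat_Hom)
 then have "afun (snd y) (afun (afun f) m) = tmap R (fst x) Hb (fst y) Hb (afun (afun f)) (idc Hb) (afun (snd x) m)"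
 using m ch X by (simp add: ActA_simps(3) R.Idn_app)
 moreover note L = lin_comp[OF R.tmap_lin[OF X(1) Hb_bm Y(1) Hb_bm ch(6) idX] R.tlift_lin[OF Y(1) Hb_bm P F]]
 have "tf P F (tmap R (fst x) Hb (fst y) Hb (afun (afun f)) (idc Hb) (afun (snd x) m))
 = tf P (%m0 h. F (afun (afun f) m0) h) (afun (snd x) m)"
 unfolding R.lin_expand[OF X(1) Hb_bm P L xm]
 proof (rule R.tlift_cong[OF X(1) Hb_bm P xm])
 fix m0 h assume "m0 IN (fst x)" "h IN Hb"
 then show "tf P F (tmap R (fst x) Hb (fst y) Hb (afun (afun f)) (idc Hb) (pt R (fst x) Hb m0 h)) = F (afun (afun f) m0) h"
 using Y(1) P F R.tmap_ptens[OF X(1) Hb_bm Y(1) Hb_bm ch(6) idX] lin_closed[OF rl_lin[OF ch(6)]] by simp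
 qed
 ultimately show ?thesis by simp
qed

text \<open>The left action is made from the coaction and the right action, and a comodule map
  respects both.\<close>

lemma comod_hom_lact:
 assumes r: "r IN R" and m: "m IN (fst x)"
 shows "afun (afun f) (lact (comod_bimod R H x) r m) = lact (comod_bimod R H y) r (afun (afun f) m)"
proof -
 note X = comod_ob[OF x] and Y = comod_ob[OF y] and ch = comod_hom
 have XX: "module K (fst x)" and YY: "module K (fst y)" using X(1) Y(1) by simp_all
 have xm: "afun (snd x) m IN (tens R (fst x) Hb)"
 using lin_closed[OF rl_lin[OF X(5)] m] by simp
 have ym: "afun (afun f) m IN (fst y)" by (rule lin_closed[OF rl_lin[OF ch(6)] m])
 have "lact (comod_bimod R H y) r (afun (afun f) m) = tf (fst y) (%m0 h. ract (fst y) (afun (afun f) m0) (eps (s r \<star> h))) (afun (snd x) m)"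
 using comod_hom_coaction[OF YY lam_bal[OF Y(1,5-7) r] m] comod_lact[OF r ym] by (simp add: lam_def)
 also have "... = tf (fst y) (%m0 h. afun (afun f) (ract (fst x) m0 (eps (s r \<star> h)))) (afun (snd x) m)"
 by (rule R.tlift_cong[OF X(1) Hb_bm YY xm]) (use r rl_ract[OF ch(6)] in simp)
 also have "... = afun (afun f) (lam (fst x) (afun (snd x)) r m)"
 unfolding lam_def
 by (rule R.tlift_fuse[OF X(1) Hb_bm XX rl_lin[OF ch(6)] YY xm, symmetric]) (use X r in simp)
 finally show ?thesis using comod_lact[OF r m] by simp
qed

end

end

section \<open>The comodule algebra and the algebra of R-bimodules that underlies it\<close>

locale dk = bgd K R H
 for K :: "('k, 'x) ring_scheme" and R :: "('k, 'a univ) module" and H :: "('k, 'a univ) bialgebroid" +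
 fixes A :: "('k, 'a univ) rcomod" and mA uA :: "('k, 'a univ) carr"
 and C :: "('k, 'a univ) rmod" and dC eC :: "('k, 'a univ) rarr"
 assumes comodule_algebra: "algebra_in (comod_moncat K R H) A mA uA"
 and module_coalgebra: "coalgebra_in (hmod_moncat K R H) C dC eC"
begin

abbreviation "MA \<equiv> fst A"
abbreviation "rho \<equiv> afun (snd A)"
abbreviation "A' \<equiv> comod_bimod R H A"
abbreviation "TA \<equiv> comod_tens R H A A"
abbreviation "IA \<equiv> comod_unit R H"
abbreviation "phi \<equiv> afun (afun mA)"
abbreviation "eta \<equiv> afun (afun uA)"

text \<open>That A \<otimes> A and R are comodules is read off from the arrows \<open>mA\<close> and
  \<open>uA\<close>: the source of an arrow of comodules is a comodule.\<close>

lemma A_comod: "right_comodule_in R.RMR R.MR Hb (bgd_comult R H) (bgd_counit R H) A"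
 and TA_comod: "right_comodule_in R.RMR R.MR Hb (bgd_comult R H) (bgd_counit R H) TA"
 and IA_comod: "right_comodule_in R.RMR R.MR Hb (bgd_comult R H) (bgd_counit R H) IA"
 and mA_hom: "mA \<in> Hom (comod_moncat K R H) TA A" and uA_hom: "uA \<in> Hom (comod_moncat K R H) IA A"
 using comodule_algebra by (auto simp: algebra_in_def comodule_cat_Hom)

lemmas A_ob = comod_ob[OF A_comod] and TA_ob = comod_ob[OF TA_comod] and IA_ob = comod_ob[OF IA_comod]
lemmas mA_arr = comod_hom[OF TA_comod A_comod mA_hom] and uA_arr = comod_hom[OF IA_comod A_comod uA_hom]

lemma A'_bm [simp]: "bm K R A'"
 by (rule b_bimod[OF A_comod])

lemma MA_rm [simp]: "rm K R MA"
 by (rule A_ob)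

lemma rho_cl: "a IN MA ==> rho a IN (tens R MA Hb)"
 by (rule rho_closed[OF A_ob(1,5-7)])

lemma lact_A': "r IN R ==> a IN MA ==> lact A' r a = lam MA rho r a"
 by (rule comod_lact)

lemma rho_lact:
 assumes "module K P" "balanced K R MA Hb P F" "a IN MA" "r IN R"
 shows "tf P F (rho (lact A' r a)) = tf P (%a0 h. F a0 (s r \<star> h)) (rho a)"
 using rho_lam[OF A_ob(1,5-7) assms] assms by (simp add: lact_A')

lemma rho_takeuchi:
 assumes "module K P" "balanced K R MA Hb P F" "a IN MA" "r IN R"
 shows "tf P (%a0 h. F (lact A' r a0) h) (rho a) = tf P (%a0 h. F a0 (t r \<star> h)) (rho a)"
proof -
 have "tf P (%a0 h. F (lact A' r a0) h) (rho a) = tf P (%a0 h. F (lam MA rho r a0) h) (rho a)"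
 by (rule R.tlift_cong[OF MA_rm Hb_bm assms(1) rho_cl[OF assms(3)]]) (use assms in "simp add: lact_A'")
 then show ?thesis using lam_takeuchi[OF A_ob(1,5-7) assms] by simp
qed

lemmas rho_ract = rho_ract_lift[OF A_ob(1,5-7)]

abbreviation "AA \<equiv> rtens R MA A'"
abbreviation "AAH \<equiv> tens R AA Hb"

lemma TA_eq: "TA = (AA, (AA, \<lambda>u \<in> carrier AA. tf (rtens R AA Hb) (%m n.
 tf (rtens R AA Hb) (%m0 m1.
 tf (rtens R AA Hb) (%n0 n1. pt R AA Hb (pt R MA A' m0 n0) (m1 \<star> n1))
 (rho n)) (rho m)) u, rtens R AA Hb))"
 by (simp add: comod_tens_def Let_def split_beta del: tlift_rtens)

lemma TA_simps [simp]: "fst TA = AA"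
 "u IN (tens R MA A') ==> afun (snd TA) u = tf AAH (%m n. tf AAH (%m0 m1.
 tf AAH (%n0 n1. pt R AA Hb (pt R MA A' m0 n0) (m1 \<star> n1)) (rho n)) (rho m)) u"
 by (simp_all add: TA_eq)

lemma AA_rm [simp]: "rm K R AA" by simp
lemma AAH_mod [simp]: "module K AAH" by (rule R.tens_module) simp_all

text \<open>The innermost of the three sums in the coaction m_0 \<otimes> n_0 \<otimes> m_1 n_1 of A
  \<otimes> A. Independence of representatives is established from the inside out.\<close>

lemma coact2_bal:
 assumes "m0 IN MA" "m1 IN H"
 shows "balanced K R MA Hb AAH (%n0 n1. pt R AA Hb (pt R MA A' m0 n0) (m1 \<star> n1))"
proof (rule balancedI)
 fix n0 r n1 assume *: "n0 IN MA" "r IN R" "n1 IN Hb"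
 have "pt R AA Hb (pt R MA A' m0 (ract MA n0 r)) (m1 \<star> n1) = pt R AA Hb (ract AA (pt R MA A' m0 n0) r) (m1 \<star> n1)"
 using assms * by simp
 also have "... = pt R AA Hb (pt R MA A' m0 n0) (lact Hb r (m1 \<star> n1))"
 by (rule R.pt_bal) (use assms * in simp_all)
 finally show "pt R AA Hb (pt R MA A' m0 (ract MA n0 r)) (m1 \<star> n1) = pt R AA Hb (pt R MA A' m0 n0) (m1 \<star> lact Hb r n1)"
 using assms * by (simp add: H.B_assoc)
qed (use assms in "simp_all add: R.lin_simps hlin")

lemma coact1_bal:
 assumes n: "n IN MA"
 shows "balanced K R MA Hb AAH (%m0 m1. tf AAH (%n0 n1. pt R AA Hb (pt R MA A' m0 n0) (m1 \<star> n1)) (rho n))"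
proof (rule balancedI)
 note MB = MA_rm Hb_bm
 note T = AAH_mod
 show "tf AAH (%n0 n1. pt R AA Hb (pt R MA A' m0 n0) (m1 \<star> n1)) (rho n) IN AAH"
 if "m0 IN MA" "m1 IN Hb" for m0 m1
 by (rule R.tlift_closed[OF MB T]) (use n that rho_cl in simp_all)
 show "tf AAH (%n0 n1. pt R AA Hb (pt R MA A' (m0 \<oplus>\<^bsub>MA\<^esub> m0') n0) (m1 \<star> n1)) (rho n) =
 tf AAH (%n0 n1. pt R AA Hb (pt R MA A' m0 n0) (m1 \<star> n1)) (rho n) \<oplus>\<^bsub>AAH\<^esub>
 tf AAH (%n0 n1. pt R AA Hb (pt R MA A' m0' n0) (m1 \<star> n1)) (rho n)"
 if "m0 IN MA" "m0' IN MA" "m1 IN Hb" for m0 m0' m1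
 by (rule R.tlift_addI[OF MB T]) (use n that rho_cl in "simp_all add: hlin R.lin_simps")
 show "tf AAH (%n0 n1. pt R AA Hb (pt R MA A' m0 n0) ((m1 \<oplus>\<^bsub>Hb\<^esub> m1') \<star> n1)) (rho n) =
 tf AAH (%n0 n1. pt R AA Hb (pt R MA A' m0 n0) (m1 \<star> n1)) (rho n) \<oplus>\<^bsub>AAH\<^esub>
 tf AAH (%n0 n1. pt R AA Hb (pt R MA A' m0 n0) (m1' \<star> n1)) (rho n)"
 if "m0 IN MA" "m1' IN Hb" "m1 IN Hb" for m0 m1' m1
 by (rule R.tlift_addI[OF MB T]) (use n that rho_cl in "simp_all add: hlin R.lin_simps")
 show "tf AAH (%n0 n1. pt R AA Hb (pt R MA A' m0 n0) ((kk \<odot>\<^bsub>Hb\<^esub> m1) \<star> n1)) (rho n) =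
 kk \<odot>\<^bsub>AAH\<^esub> tf AAH (%n0 n1. pt R AA Hb (pt R MA A' m0 n0) (m1 \<star> n1)) (rho n)"
 if "kk IN K" "m0 IN MA" "m1 IN Hb" for m0 kk m1
 by (rule R.tlift_smultI[OF MB T]) (use n that rho_cl in "simp_all add: hlin R.lin_simps")
 show "tf AAH (%n0 n1. pt R AA Hb (pt R MA A' (ract MA m0 r) n0) (m1 \<star> n1)) (rho n) =
 tf AAH (%n0 n1. pt R AA Hb (pt R MA A' m0 n0) (lact Hb r m1 \<star> n1)) (rho n)"
 if m0: "m0 IN MA" and r: "r IN R" and m1: "m1 IN Hb" for m0 r m1
 proof -
 have "tf AAH (%n0 n1. pt R AA Hb (pt R MA A' (ract MA m0 r) n0) (m1 \<star> n1)) (rho n)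
 = tf AAH (%n0 n1. pt R AA Hb (pt R MA A' m0 (lact A' r n0)) (m1 \<star> n1)) (rho n)"
 by (rule R.tlift_cong[OF MB T rho_cl[OF n]]) (use m0 r m1 in "simp add: R.pt_bal")
 \<comment> \<open>The Takeuchi property of the coaction of A trades the left action on
   \<open>n0\<close> for a factor t(r) in front of \<open>n1\<close>.\<close>
 also have "... = tf AAH (%n0 n1. pt R AA Hb (pt R MA A' m0 n0) (m1 \<star> (t r \<star> n1))) (rho n)"
 using rho_takeuchi[OF T coact2_bal n r, of m0 m1] m0 m1 by simp
 also have "... = tf AAH (%n0 n1. pt R AA Hb (pt R MA A' m0 n0) (lact Hb r m1 \<star> n1)) (rho n)"
 by (rule R.tlift_cong[OF MB T rho_cl[OF n]]) (use m0 r m1 in "simp add: H.B_assoc")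
 finally show ?thesis .
 qed
qed

text \<open>The tensors m r \<otimes> n and m \<otimes> r n both give m_0 \<otimes> n_0 \<otimes>
  m_1 s(r) n_1: the first by right linearity of the coaction, the second by its formula on r
  n.\<close>

lemma coact_bal:
 "balanced K R MA A' AAH (%m n. tf AAH (%m0 m1.
 tf AAH (%n0 n1. pt R AA Hb (pt R MA A' m0 n0) (m1 \<star> n1)) (rho n)) (rho m))"
proof (rule balancedI)
 note MB = MA_rm Hb_bm and T = AAH_mod
 let ?G = "%n m0 m1. tf AAH (%n0 n1. pt R AA Hb (pt R MA A' m0 n0) (m1 \<star> n1)) (rho n)"
 note Gcl = bal_closed[OF coact1_bal, simplified]
 have rl: "lm K MA (rtens R MA Hb) = lm K MA (tens R MA Hb)" by simp
 note rho_lin = rl_lin[OF A_ob(5), unfolded rl]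
 note L1 = lin_comp[OF rho_lin R.tlift_lin[OF MB T coact1_bal]]
 have L2: "(%n. ?G n m0 m1) : lm K MA AAH" if "m0 IN MA" "m1 IN H" for m0 m1
 by (rule lin_comp[OF rho_lin R.tlift_lin[OF MB T coact2_bal[OF that]]])
 show "tf AAH (?G n) (rho m) IN AAH" if "m IN MA" "n IN A'" for m n
 using that lin_closed[OF L1] by simp
 show "tf AAH (?G n) (rho (m \<oplus>\<^bsub>MA\<^esub> m')) = tf AAH (?G n) (rho m) \<oplus>\<^bsub>AAH\<^esub> tf AAH (?G n) (rho m')"
 if "m IN MA" "m' IN MA" "n IN A'" for m m' n
 using that lin_add[OF L1] by simp
 show "tf AAH (?G (n \<oplus>\<^bsub>A'\<^esub> n')) (rho m) = tf AAH (?G n) (rho m) \<oplus>\<^bsub>AAH\<^esub> tf AAH (?G n') (rho m)"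
 if "m IN MA" "n' IN A'" "n IN A'" for m n n'
 by (rule R.tlift_addI[OF MB T]) (use that rho_cl lin_add[OF L2] Gcl in simp_all)
 show "tf AAH (?G (kk \<odot>\<^bsub>A'\<^esub> n)) (rho m) = kk \<odot>\<^bsub>AAH\<^esub> tf AAH (?G n) (rho m)"
 if "m IN MA" "kk IN K" "n IN A'" for m n kk
 by (rule R.tlift_smultI[OF MB T]) (use that rho_cl lin_smult[OF L2] Gcl in simp_all)
 show "tf AAH (?G n) (rho (ract MA m r)) = tf AAH (?G (lact A' r n)) (rho m)"
 if m: "m IN MA" and r: "r IN R" and n: "n IN A'" for m r n
 proof -
 have n': "n IN MA" using n by simp
 have "tf AAH (?G n) (rho (ract MA m r)) = tf AAH (%m0 m1. ?G n m0 (m1 \<star> s r)) (rho m)"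
 by (rule rho_ract[OF T coact1_bal[OF n'] m r])
 also have "... = tf AAH (?G (lact A' r n)) (rho m)"
 proof (rule R.tlift_cong[OF MB T rho_cl[OF m]])
 fix m0 m1 assume x: "m0 IN MA" "m1 IN Hb"
 have "?G n m0 (m1 \<star> s r) = tf AAH (%n0 n1. pt R AA Hb (pt R MA A' m0 n0) (m1 \<star> (s r \<star> n1))) (rho n)"
 by (rule R.tlift_cong[OF MB T rho_cl[OF n']]) (use x r in "simp add: H.B_assoc")
 then show "?G n m0 (m1 \<star> s r) = ?G (lact A' r n) m0 m1"
 using rho_lact[OF T coact2_bal n' r, of m0 m1] x by simp
 qed
 finally show ?thesis .
 qed
qed

lemma coact_ptens: "a IN MA ==> b IN MA ==>
 afun (snd TA) (pt R MA A' a b) = tf AAH (%m0 m1.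
 tf AAH (%n0 n1. pt R AA Hb (pt R MA A' m0 n0) (m1 \<star> n1)) (rho b)) (rho a)"
 using coact_bal by simp

lemma coact_lift:
 assumes P: "module K P" and F: "balanced K R AA Hb P F" and ab: "a IN MA" "b IN MA"
 shows "tf P F (afun (snd TA) (pt R MA A' a b)) =
 tf P (%m0 m1. tf P (%n0 n1. F (pt R MA A' m0 n0) (m1 \<star> n1)) (rho b)) (rho a)"
proof -
 note MB = MA_rm Hb_bm and T = AAH_mod
 note L = R.tlift_lin[OF AA_rm Hb_bm P F]
 have "tf P F (afun (snd TA) (pt R MA A' a b)) =
 tf P (%m0 m1. tf P F (tf AAH (%n0 n1. pt R AA Hb (pt R MA A' m0 n0) (m1 \<star> n1)) (rho b))) (rho a)"
 unfolding coact_ptens[OF ab]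
 by (rule R.tlift_fuse[OF MB T L P rho_cl[OF ab(1)]]) (use bal_closed[OF coact1_bal[OF ab(2)]] in simp)
 also have "... = tf P (%m0 m1. tf P (%n0 n1. F (pt R MA A' m0 n0) (m1 \<star> n1)) (rho b)) (rho a)"
 proof (rule R.tlift_cong[OF MB P rho_cl[OF ab(1)]])
 fix m0 m1 assume x: "m0 IN MA" "m1 IN Hb"
 have "tf P F (tf AAH (%n0 n1. pt R AA Hb (pt R MA A' m0 n0) (m1 \<star> n1)) (rho b))
 = tf P (%n0 n1. tf P F (pt R AA Hb (pt R MA A' m0 n0) (m1 \<star> n1))) (rho b)"
 by (rule R.tlift_fuse[OF MB T L P rho_cl[OF ab(2)]]) (use bal_closed[OF coact2_bal] x in simp)
 also have "... = tf P (%n0 n1. F (pt R MA A' m0 n0) (m1 \<star> n1)) (rho b)"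
 by (rule R.tlift_cong[OF MB P rho_cl[OF ab(2)]]) (use x F P in simp)
 finally show "tf P F (tf AAH (%n0 n1. pt R AA Hb (pt R MA A' m0 n0) (m1 \<star> n1)) (rho b))
 = tf P (%n0 n1. F (pt R MA A' m0 n0) (m1 \<star> n1)) (rho b)" .
 qed
 finally show ?thesis .
qed

text \<open>The inherited left action involves \<epsilon>(s(r) m_1 n_1) =
  \<epsilon>(s(\<epsilon>(s(r) m_1)) n_1). The inner sum is thus the left action of the scalar
  \<epsilon>(s(r) m_1) on b, which balances over to a.\<close>

lemma lact_TA:
 assumes ab: "a IN MA" "b IN MA" and r: "r IN R"
 shows "lact (comod_bimod R H TA) r (pt R MA A' a b) = pt R MA A' (lact A' r a) b"
proof -
 note MB = MA_rm Hb_bm and MM = rm_module[OF MA_rm]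
 have T: "module K AA" "module K (tens R MA A')" using rm_module[OF AA_rm] by simp_all
 have lin2: "(%n. pt R MA A' m n) : lm K MA (tens R MA A')" if "m IN MA" for m
 by (rule lmI) (use that in "simp_all add: R.lin_simps")
 have lin1: "(%m. pt R MA A' m b) : lm K MA (tens R MA A')"
 by (rule lmI) (use ab in "simp_all add: R.lin_simps")
 have "lact (comod_bimod R H TA) r (pt R MA A' a b)
 = tf AA (%p h. ract AA p (eps (s r \<star> h))) (afun (snd TA) (pt R MA A' a b))"
 using ab r comod_lact[of r "pt R MA A' a b" TA] by (simp add: lam_def del: TA_simps(2))
 also have "... = tf AA (%m0 m1. tf AA (%n0 n1. ract AA (pt R MA A' m0 n0) (eps (s r \<star> (m1 \<star> n1)))) (rho b)) (rho a)"
 by (rule coact_lift[OF T(1) lam_bal[OF TA_ob(1,5-7) r, unfolded TA_simps(1)] ab])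
 also have "... = tf (tens R MA A') (%m0 m1. pt R MA A' (ract MA m0 (eps (s r \<star> m1))) b) (rho a)"
 unfolding tlift_rtens
 proof (rule R.tlift_cong[OF MB T(2) rho_cl[OF ab(1)]])
 fix m0 m1 assume x: "m0 IN MA" "m1 IN Hb"
 let ?x = "eps (s r \<star> m1)"
 have "tf (tens R MA A') (%n0 n1. ract AA (pt R MA A' m0 n0) (eps (s r \<star> (m1 \<star> n1)))) (rho b)
 = tf (tens R MA A') (%n0 n1. pt R MA A' m0 (ract MA n0 (eps (s ?x \<star> n1)))) (rho b)"
 by (rule R.tlift_cong[OF MB T(2) rho_cl[OF ab(2)]]) (use x r in "simp add: H.B_assoc[symmetric] eps_mult")
 also have "... = pt R MA A' m0 (lam MA rho ?x b)"
 unfolding lam_def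
 by (rule R.tlift_fuse[OF MB MM lin2[OF x(1)] T(2) rho_cl[OF ab(2)], symmetric]) (use x r in simp)
 also have "... = pt R MA A' (ract MA m0 ?x) b"
 using x r ab by (simp add: R.pt_bal lact_A')
 finally show "tf (tens R MA A') (%n0 n1. ract AA (pt R MA A' m0 n0) (eps (s r \<star> (m1 \<star> n1)))) (rho b)
 = pt R MA A' (ract MA m0 ?x) b" .
 qed
 also have "... = pt R MA A' (lam MA rho r a) b"
 unfolding lam_def
 by (rule R.tlift_fuse[OF MB MM lin1 T(2) rho_cl[OF ab(1)], symmetric]) (use r in simp)
 finally show ?thesis using lact_A' ab r by simp
qed

text \<open>Passing from comodules to bimodules is strictly compatible with A \<otimes> A: the
  records are equal. So the multiplication of A in comodules is one in bimodules with the same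
  function.\<close>

lemma comod_bimod_TA: "comod_bimod R H TA = btens R A' A'"
proof (rule bimod_eqI)
 have e: "tens R A' A' = tens R MA A'" "rtens R A' A' = AA" "pt R A' A' = pt R MA A'"
 by (simp_all add: comod_bimod_left)
 show "lact (comod_bimod R H TA) = lact (btens R A' A')"
 proof -
 have "on_carriers (carrier R) (carrier AA) (lact (comod_bimod R H TA)) = on_carriers (carrier R) (carrier AA) (lact (btens R A' A'))"
 proof (rule on_carriers_cong)
 fix r u assume r: "r IN R" and u: "u IN AA"
 note l1 = lam_lin_x[OF TA_comod r, simplified]
 note l2 = R.lact_lin[OF A'_bm A'_bm r, unfolded e]
 show "lact (comod_bimod R H TA) r u = lact (btens R A' A') r u"
 by (rule R.tens_ext[OF MA_rm A'_bm R.tens_module[OF MA_rm A'_bm] l1 l2])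
 (use u r R.lact_btens_ptens[OF A'_bm A'_bm, unfolded e] in "simp_all add: lact_TA")
 qed
 then show ?thesis
 using bm_on_carriers[OF b_bimod[OF TA_comod]] bm_on_carriers[OF R.btens_bimodule[OF A'_bm A'_bm]]
 by (simp add: e)
 qed
qed (simp_all add: comod_bimod_left, simp_all add: btens_def rtens_def comod_bimod_left)

lemma IA_simps [simp]: "carrier (fst IA) = carrier R" "add (fst IA) = add R" "zero (fst IA) = zero R"
 "smult (fst IA) = smult R" "ract (fst IA) = ract (rg R)" "mult (fst IA) = mult R" "one (fst IA) = one R"
 "r IN R ==> afun (snd IA) r = pt R (fst IA) Hb \<one>\<^bsub>R\<^esub> (s r)"
 by (simp_all add: comod_unit_def Let_def)

lemma comod_bimod_IA: "comod_bimod R H IA = rg R"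
proof (rule bimod_eqI)
 have "on_carriers (carrier R) (carrier R) (lact (comod_bimod R H IA)) = on_carriers (carrier R) (carrier R) (lact (rg R))"
 proof (rule on_carriers_cong)
 fix r x assume rx: "r IN R" "x IN R"
 have "lact (comod_bimod R H IA) r x = ract (fst IA) \<one>\<^bsub>R\<^esub> (eps (s r \<star> s x))"
 using rx comod_lact[of r x IA] lam_bal[OF IA_ob(1,5-7) rx(1)] IA_ob(1) by (simp add: lam_def)
 then show "lact (comod_bimod R H IA) r x = lact (rg R) r x"
 using rx by (simp add: src_tgt_lin(1)[symmetric])
 qed
 then show "lact (comod_bimod R H IA) = lact (rg R)"
 using bm_on_carriers[OF b_bimod[OF IA_comod]] bm_on_carriers[OF R.reg_bimodule] by simp
qed (simp_all add: reg_bimod_def)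

end

section \<open>Exchange of finite double sums, and invariance under change of record\<close>

lemma psum_swap:
 assumes P: "module K P" and xs: "xs \<in> lists (S \<times> T)" and ys: "ys \<in> lists (S' \<times> T')"
 and F: "!!m n x y. m \<in> S ==> n \<in> T ==> x \<in> S' ==> y \<in> T' ==> F m n x y IN P"
 shows "psum P (%m n. psum P (F m n) ys) xs = psum P (%x y. psum P (%m n. F m n x y) xs) ys"
 using xs
proof (induction xs rule: pl_induct)
 case Nil
 show ?case using ys by (induction ys rule: pl_induct) (simp_all add: m_l_zero[OF P] m_zero_closed[OF P])
next
 case (Cons m n xs)
 have "psum P (%m n. F m n x y) xs IN P" if "x \<in> S'" "y \<in> T'" for x y
 by (rule psum_closed[OF P Cons(3)]) (use F that in simp)
 then show ?case
 using Cons psum_add[OF P ys, of "F m n" "%x y. psum P (%m n. F m n x y) xs"] F by simp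
qed

context k_alg
begin

lemma tlift_swap:
 assumes "rm K B M" "bm K B N" "rm K B M'" "bm K B N'" and P: "module K P"
 and "u IN (tens B M N)" "v IN (tens B M' N')"
 "!!m n x y. m IN M ==> n IN N ==> x IN M' ==> y IN N' ==> F m n x y IN P"
 shows "tf P (%m n. tf P (F m n) v) u = tf P (%x y. tf P (%m n. F m n x y) u) v"
 unfolding tlift_psum
 by (rule psum_swap[OF P terms_lists[OF assms(1,2,6)] terms_lists[OF assms(3,4,7)] assms(8)])

lemma coassoc_on_cong:
 assumes "carrier M = carrier M'" "add M = add M'" "zero M = zero M'" "ract M = ract M'"
 shows "coassoc_on M X r d = coassoc_on M' X r d"
proof -
 have e: "tens B M N = tens B M' N" "pt B M N = pt B M' N" "rtens B M N = rtens B M' N" for N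
 by (rule tens_cong; simp add: assms)+
 have "tf M = tf M'" by (simp add: fun_eq_iff tlift_def assms)
 then show ?thesis
 by (simp add: coassoc_on_def tassoc_def tmap_def e assms)
qed

lemma counit_on_cong:
 assumes "carrier M = carrier M'" "add M = add M'" "zero M = zero M'" "ract M = ract M'"
 shows "counit_on M X r e = counit_on M' X r e"
 by (simp add: counit_on_def assms tlift_def)

end

context dk
begin

abbreviation (input) "CR \<equiv> Cmp R.RMR"
abbreviation (input) "TR \<equiv> TenA R.RMR"
abbreviation (input) "IR \<equiv> Idn R.RMR"
abbreviation (input) "CM \<equiv> Cmp R.MR"
abbreviation (input) "AM \<equiv> ActA R.MR"
abbreviation (input) "IM \<equiv> Idn R.MR"

text \<open>\<open>MA\<close> and \<open>A'\<close> are the same module, once as a right module and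
  once with its inherited left action; these rules move between the two records.\<close>

lemma linear_A': "lm K MA N = lm K A' N" "lm K N MA = lm K N A'"
 by (rule lm_cong; simp)+

lemma balanced_A': "balanced K R MA N P F = balanced K R A' N P F"
 "balanced K R M N MA F = balanced K R M N A' F"
 by (simp_all add: balanced_def biadditive_def)

lemma tens_A': "tens R MA N = tens R A' N" "pt R MA N = pt R A' N" "rtens R MA N = rtens R A' N"
 by (simp_all add: comod_bimod_left)

lemma tlift_A': "tf MA F u = tf A' F u"
 by (rule tlift_target_cong) simp_all

lemma ract_MA: "ract MA = ract A'" and carrier_MA: "carrier MA = carrier A'" and add_MA: "add MA = add A'"
 by simp_all

abbreviation "am a b \<equiv> phi (pt R A' A' a b)"
abbreviation "uno \<equiv> dk_one R uA"

lemma phi_bilinear: "phi : blm K R (btens R A' A') A'"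
proof (rule blmI)
 have r: "phi : rlm K R AA MA" using mA_arr(6) by simp
 then show "phi : lm K (btens R A' A') A'"
 using rl_lin[OF r] by (simp add: tens_A' linear_A')
 show "phi (ract (btens R A' A') x b) = ract A' (phi x) b" if "x IN (btens R A' A')" "b IN R" for x b
 using rl_ract[OF r] that by (simp add: tens_A')
 show "phi (lact (btens R A' A') b x) = lact A' b (phi x)" if "x IN (btens R A' A')" "b IN R" for x b
 using comod_hom_lact[OF TA_comod A_comod mA_hom] that by (simp add: comod_bimod_TA tens_A')
qed

lemma am_closed [simp]: "a IN A' ==> b IN A' ==> am a b IN A'"
 using lin_closed[OF rl_lin[OF bl_rl[OF phi_bilinear]]] by simp

lemma eta_bilinear: "eta : blm K R (rg R) A'"
proof (rule blmI)
 note r = uA_arr(6)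
 have "lm K (fst IA) MA = lm K (rg R) A'"
 by (rule lm_cong) simp_all
 then show "eta : lm K (rg R) A'"
 using rl_lin[OF r] by simp
 show "eta (ract (rg R) x b) = ract A' (eta x) b" if "x IN (rg R)" "b IN R" for x b
 using rl_ract[OF r] that by simp
 show "eta (lact (rg R) b x) = lact A' b (eta x)" if "x IN (rg R)" "b IN R" for x b
 using comod_hom_lact[OF IA_comod A_comod uA_hom] that by (simp add: comod_bimod_IA del: reg_bimod_simps(6))
qed

lemma uno_closed [simp]: "uno IN A'"
 using lin_closed[OF rl_lin[OF bl_rl[OF eta_bilinear]]] by (simp add: dk_one_def)

lemma eta_eq: "r IN R ==> eta r = ract A' uno r" "r IN R ==> eta r = lact A' r uno"
 using rl_ract[OF bl_rl[OF eta_bilinear], of "\<one>\<^bsub>R\<^esub>" r]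
 bilinear_lact[OF eta_bilinear, of "\<one>\<^bsub>R\<^esub>" r] by (simp_all add: dk_one_def)

lemma idA: "(idc MA) : blm K R A' A'" "(idc MA) : rlm K R MA MA"
 using bl_conc(4)[OF A'_bm bl_conc(2)] rl_conc(4)[OF MA_rm rl_conc(2)] by simp_all

lemma alg_eqs:
 "afun (afun (Cmp (comod_moncat K R H) mA (TenA (comod_moncat K R H) mA (Idn (comod_moncat K R H) A)))) u
 = afun (afun (Cmp (comod_moncat K R H) mA (Cmp (comod_moncat K R H)
 (TenA (comod_moncat K R H) (Idn (comod_moncat K R H) A) mA) (Assoc (comod_moncat K R H) A A A)))) u"
 "afun (afun (Cmp (comod_moncat K R H) mA (TenA (comod_moncat K R H) uA (Idn (comod_moncat K R H) A)))) u
 = afun (afun (LUnit (comod_moncat K R H) A)) u"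
 "afun (afun (Cmp (comod_moncat K R H) mA (TenA (comod_moncat K R H) (Idn (comod_moncat K R H) A) uA))) u
 = afun (afun (RUnit (comod_moncat K R H) A)) u"
 using comodule_algebra by (auto simp: algebra_in_def simp del: comod_moncat_simps)

lemma fst_comod_tens: "fst (comod_tens R H x y) = rtens R (fst x) (comod_bimod R H y)"
 by (simp add: comod_tens_def Let_def split_beta)

lemma am_assoc:
 assumes abc: "a IN A'" "b IN A'" "c IN A'"
 shows "am (am a b) c = am a (am b c)"
proof -
 let ?u = "pt R AA A' (pt R MA A' a b) c"
 have phi: "phi : rlm K R AA MA" "phi : blm K R (comod_bimod R H TA) A'"
 using mA_arr(6) phi_bilinear by (simp_all add: comod_bimod_TA)
 have bT: "bm K R (comod_bimod R H TA)" by (simp add: comod_bimod_TA)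
 have u: "?u IN (tens R AA A')" using abc by simp
 have i: "afun (IM MA) = (idc MA)" by (simp add: R.Idn_app)
 have "afun (afun (Cmp (comod_moncat K R H) mA (TenA (comod_moncat K R H) mA (Idn (comod_moncat K R H) A)))) ?u
 = phi (tmap R AA A' MA A' phi (idc MA) ?u)"
 using u mA_arr by (simp add: fst_comod_tens i)
 also have "... = phi (pt R MA A' (phi (pt R MA A' a b)) c)"
 using abc R.tmap_ptens[OF AA_rm A'_bm MA_rm A'_bm phi(1) idA(1)] by simp
 finally have 1: "afun (afun (Cmp (comod_moncat K R H) mA (TenA (comod_moncat K R H) mA (Idn (comod_moncat K R H) A)))) ?u
 = am (am a b) c" by (simp add: tens_A')
 have "afun (afun (Cmp (comod_moncat K R H) mA (Cmp (comod_moncat K R H)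
 (TenA (comod_moncat K R H) (Idn (comod_moncat K R H) A) mA) (Assoc (comod_moncat K R H) A A A)))) ?u
 = phi (tmap R MA (comod_bimod R H TA) MA A' (idc MA) phi (tassoc R MA A' A' ?u))"
 using u mA_arr lin_closed[OF R.tassoc_lin[OF MA_rm A'_bm A'_bm] u]
 by (simp add: fst_comod_tens i comod_bimod_TA)
 also have "tassoc R MA A' A' ?u = pt R MA (comod_bimod R H TA) a (pt R MA A' b c)"
 using abc by (simp add: R.tassoc_ptens[OF MA_rm A'_bm A'_bm] comod_bimod_TA comod_bimod_left)
 also have "tmap R MA (comod_bimod R H TA) MA A' (idc MA) phi (pt R MA (comod_bimod R H TA) a (pt R MA A' b c))
 = pt R MA A' a (am b c)"
 using abc R.tmap_ptens[OF MA_rm bT MA_rm A'_bm idA(2) phi(2)] by (simp add: tens_A')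
 finally show ?thesis
 using 1 alg_eqs(1)[of ?u] by (simp add: tens_A')
qed

lemma IA_tens: "pt R (fst IA) N = pt R (rg R) N" "tens R (fst IA) N = tens R (rg R) N"
 by (rule tens_cong; simp)+

lemma am_eta:
 assumes a: "a IN A'" and r: "r IN R"
 shows "am (eta r) a = lact A' r a" "am a (eta r) = ract A' a r"
proof -
 have i: "afun (IM MA) = (idc MA)" by (simp add: R.Idn_app)
 have bI: "bm K R (comod_bimod R H IA)" by (simp add: comod_bimod_IA)
 have eta: "eta : blm K R (comod_bimod R H IA) A'" using eta_bilinear by (simp add: comod_bimod_IA)
 let ?u = "pt R (fst IA) A' r a"
 have u: "?u IN (tens R (fst IA) A')" using a r by simp
 have "afun (afun (Cmp (comod_moncat K R H) mA (TenA (comod_moncat K R H) uA (Idn (comod_moncat K R H) A)))) ?u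
 = phi (tmap R (fst IA) A' MA A' eta (idc MA) ?u)"
 using u uA_arr by (simp add: fst_comod_tens i)
 also have "... = am (eta r) a"
 using a r R.tmap_ptens[OF IA_ob(1) A'_bm MA_rm A'_bm uA_arr(6) idA(1)] by (simp add: tens_A')
 finally show "am (eta r) a = lact A' r a"
 using alg_eqs(2)[of ?u] u a r by (simp add: fst_comod_tens tlift_A' IA_tens)
 let ?v = "pt R MA (comod_bimod R H IA) a r"
 have v: "?v IN (tens R MA (comod_bimod R H IA))" using a r by simp
 have "afun (afun (Cmp (comod_moncat K R H) mA (TenA (comod_moncat K R H) (Idn (comod_moncat K R H) A) uA))) ?v
 = phi (tmap R MA (comod_bimod R H IA) MA A' (idc MA) eta ?v)"
 using v uA_arr by (simp add: fst_comod_tens i)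
 also have "... = am a (eta r)"
 using a r R.tmap_ptens[OF MA_rm bI MA_rm A'_bm idA(2) eta] by (simp add: tens_A')
 finally show "am a (eta r) = ract A' a r"
 using alg_eqs(3)[of ?v] v a r by (simp add: fst_comod_tens comod_bimod_IA)
qed

lemma rho_right_linear: "rho : rlm K R A' (rtens R A' Hb)"
 using A_ob(5) by (simp add: right_linear_maps_def tens_A' linear_A')

lemma rho_coassoc: "R.coassoc_on A' Hb rho \<Delta>" and rho_counit: "R.counit_on A' Hb rho eps"
proof -
 have "R.coassoc_on MA Hb rho \<Delta> = R.coassoc_on A' Hb rho \<Delta>" "R.counit_on MA Hb rho eps = R.counit_on A' Hb rho eps"
 by (rule R.coassoc_on_cong R.counit_on_cong; simp)+
 then show "R.coassoc_on A' Hb rho \<Delta>" "R.counit_on A' Hb rho eps"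
 using A_ob(6,7) by blast+
qed

text \<open>The multiplication is a comodule map from A \<otimes> A, so the coaction is
  multiplicative.\<close>

lemma rho_am:
 assumes P: "module K P" and F: "balanced K R A' Hb P F" and ab: "a IN A'" "b IN A'"
 shows "tf P F (rho (am a b)) = tf P (%a0 a1. tf P (%b0 b1. F (am a0 b0) (a1 \<star> b1)) (rho b)) (rho a)"
proof -
 have F': "balanced K R MA Hb P F" using F by (simp add: balanced_A')
 have ab': "a IN MA" "b IN MA" using ab by simp_all
 have FF: "balanced K R AA Hb P (%m. F (phi m))"
 by (rule balancedI)
 (use bal_closed[OF F'] bal_addl[OF F'] bal_addr[OF F'] bal_smult[OF F'] bal_bal[OF F']
 lin_closed[OF rl_lin[OF mA_arr(6)]] lin_add[OF rl_lin[OF mA_arr(6)]] rl_ract[OF mA_arr(6)] in simp_all)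
 have "pt R MA A' a b IN (fst TA)" using ab' by simp
 from comod_hom_coaction[OF TA_comod A_comod mA_hom P F' this]
 show ?thesis using coact_lift[OF P FF ab'] by (simp add: tens_A' del: TA_simps(2))
qed

text \<open>The unit is a comodule map from R, whose coaction sends 1 to 1 \<otimes> s(1).\<close>

lemma rho_uno: "rho uno = pt R A' Hb uno \<one>\<^bsub>H\<^esub>"
proof -
 have "tf (tens R A' Hb) (pt R A' Hb) (rho uno) = tf (tens R A' Hb) (%m. pt R A' Hb (eta m)) (pt R (fst IA) Hb \<one>\<^bsub>R\<^esub> \<one>\<^bsub>H\<^esub>)"
 using comod_hom_coaction[OF IA_comod A_comod uA_hom, of "tens R A' Hb" "pt R A' Hb" "\<one>\<^bsub>R\<^esub>"]
 R.ptens_bal[OF bm_rm[OF A'_bm] Hb_bm] by (simp add: dk_one_def balanced_A')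
 also have "... = pt R A' Hb uno \<one>\<^bsub>H\<^esub>"
 proof -
 have "balanced K R (fst IA) Hb (tens R A' Hb) (%m. pt R A' Hb (eta m))"
 by (rule balancedI)
 (use lin_closed[OF rl_lin[OF uA_arr(6)]] lin_add[OF rl_lin[OF uA_arr(6)]] rl_ract[OF uA_arr(6)] in
 \<open>simp_all add: tens_A'[symmetric] R.lin_simps\<close>)
 then show ?thesis using IA_ob(1) by (simp add: dk_one_def)
 qed
 finally show ?thesis
 using R.tlift_ptens_id[OF bm_rm[OF A'_bm] Hb_bm, of "rho uno"] rho_cl[of uno] uno_closed by (simp add: tens_A' del: uno_closed)
qed

lemma rho_lact_A':
 assumes "module K P" "balanced K R A' Hb P F" "a IN A'" "r IN R"
 shows "tf P F (rho (lact A' r a)) = tf P (%a0 h. F a0 (s r \<star> h)) (rho a)"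
 and "tf P F (rho (ract A' a r)) = tf P (%a0 h. F a0 (h \<star> s r)) (rho a)"
 and "tf P (%a0 h. F (lact A' r a0) h) (rho a) = tf P (%a0 h. F a0 (t r \<star> h)) (rho a)"
 using rho_lact[of P F a r] rho_ract[of P F a r] rho_takeuchi[of P F a r] assms by (simp_all add: balanced_A')

lemma lact_counit: "r IN R ==> a IN A' ==>
 lact A' r a = tf A' (%a0 h. ract A' a0 (eps (s r \<star> h))) (rho a)"
 by (simp add: lact_A' lam_def tlift_A')

section \<open>The module coalgebra\<close>

abbreviation "HMC \<equiv> hmod_moncat K R H"
abbreviation "X \<equiv> hmod_bimod R H C"
abbreviation "\<delta>C \<equiv> afun dC"
abbreviation "epsC \<equiv> afun eC"

lemma hb_simps [simp]:
 "carrier (hmod_bimod R H D) = carrier D" "add (hmod_bimod R H D) = add D" "zero (hmod_bimod R H D) = zero D"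
 "smult (hmod_bimod R H D) = smult D" "mult (hmod_bimod R H D) = mult D" "one (hmod_bimod R H D) = one D"
 "c IN D ==> r IN R ==> ract (hmod_bimod R H D) c r = ract D c (s r)"
 "c IN D ==> r IN R ==> lact (hmod_bimod R H D) r c = ract D c (t r)"
 by (simp_all add: hmod_bimod_def)

text \<open>Since t reverses products, acting by t(r) on the right is a left action of R; it
  commutes with the action of s(r) because the images of s and t commute.\<close>

lemma hmod_bimodule:
 assumes D: "rm K H D"
 shows "bm K R (hmod_bimod R H D)"
proof (rule bimoduleI[OF right_moduleI])
 show "module K (hmod_bimod R H D)"
 by (rule mod_cong[OF rm_module[OF D]]) simp_all
qed (use D in "simp_all add: H.lin_simps src_tgt_lin rm_mult[of K H] R.B_module",
 simp_all add: hmod_bimod_def rm_mult[OF D, symmetric] src_tgt_comm)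

text \<open>As for A, the module structures on C \<otimes> C and on R are read off from the arrows
  \<open>dC\<close> and \<open>eC\<close> that end there.\<close>

lemma C_coalg:
 "rm K H C" "rm K H (hmod_tens R H C C)" "rm K H (hmod_unit R H)"
 "dC : Ar HMC" "fst dC = C" "cod dC = hmod_tens R H C C"
 "eC : Ar HMC" "fst eC = C" "cod eC = hmod_unit R H"
 using module_coalgebra
 by (auto simp: coalgebra_in_def HM.hom_iff HM.ar_iff)

lemma X_bm [simp]: "bm K R X"
 by (rule hmod_bimodule[OF C_coalg(1)])

lemma C_rm [simp]: "rm K H C"
 by (rule C_coalg(1))

lemma hmod_tens_simps [simp]:
 "carrier (hmod_tens R H C C) = carrier (tens R X X)" "add (hmod_tens R H C C) = add (tens R X X)"
 "zero (hmod_tens R H C C) = zero (tens R X X)" "smult (hmod_tens R H C C) = smult (tens R X X)"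
 "mult (hmod_tens R H C C) = mult (tens R X X)" "one (hmod_tens R H C C) = one (tens R X X)"
 "u IN (tens R X X) ==> h IN H ==> ract (hmod_tens R H C C) u h =
 tf (tens R X X) (%c d. tf (tens R X X) (%h1 h2. pt R X X (ract C c h1) (ract C d h2)) (\<Delta> h)) u"
 by (simp_all add: hmod_tens_def Let_def)

lemma hmod_unit_simps [simp]:
 "carrier (hmod_unit R H) = carrier R" "add (hmod_unit R H) = add R" "zero (hmod_unit R H) = zero R"
 "smult (hmod_unit R H) = smult R" "mult (hmod_unit R H) = mult R" "one (hmod_unit R H) = one R"
 "r IN R ==> h IN H ==> ract (hmod_unit R H) r h = eps (s r \<star> h)"
 by (simp_all add: hmod_unit_def)

lemma X_act_bal:
 assumes c: "c IN C" "d IN C"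
 shows "balanced K R Hb Hb (tens R X X) (%h1 h2. pt R X X (ract C c h1) (ract C d h2))"
proof (rule balancedI)
 fix m b n assume *: "m IN Hb" "b IN R" "n IN Hb"
 then have "pt R X X (ract X (ract C c m) b) (ract C d n) = pt R X X (ract C c m) (lact X b (ract C d n))"
 using c by (intro R.pt_bal) simp_all
 then show "pt R X X (ract C c (ract Hb m b)) (ract C d n) = pt R X X (ract C c m) (ract C d (lact Hb b n))"
 using * c by (simp add: rm_mult[of K H])
qed (use c in "simp_all add: R.lin_simps H.lin_simps")

text \<open>R acts on the H-module C \<otimes> C through s(r) and t(r). The comultiplication sends
  these to 1 \<otimes> s(r) and t(r) \<otimes> 1, so each affects only one factor.\<close>

lemma hmod_bimod_tens: "hmod_bimod R H (hmod_tens R H C C) = btens R X X"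
proof (rule bimod_eqI)
 note B = X_bm and B' = bm_rm[OF X_bm]
 note T = R.tens_module[OF B' B]
 have "on_carriers (carrier (tens R X X)) (carrier R) (ract (hmod_bimod R H (hmod_tens R H C C)))
 = on_carriers (carrier (tens R X X)) (carrier R) (ract (btens R X X))"
 proof (rule on_carriers_cong)
 fix u r assume u: "u IN (tens R X X)" and r: "r IN R"
 have "tf (tens R X X) (%c d. tf (tens R X X) (%h1 h2. pt R X X (ract C c h1) (ract C d h2)) (\<Delta> (s r))) u
 = tf (tens R X X) (%c d. pt R X X c (ract X d r)) u"
 by (rule R.tlift_cong[OF B' B T u]) (use r X_act_bal in "simp add: \<Delta>_src_tgt")
 then show "ract (hmod_bimod R H (hmod_tens R H C C)) u r = ract (btens R X X) u r"
 using u r by (simp add: R.ract_rtens[OF B' B])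
 qed
 then show "ract (hmod_bimod R H (hmod_tens R H C C)) = ract (btens R X X)"
 using rm_on_carriers[OF bm_rm[OF hmod_bimodule[OF C_coalg(2)]]] rm_on_carriers[OF bm_rm[OF R.btens_bimodule[OF B B]]] by simp
 have "on_carriers (carrier R) (carrier (tens R X X)) (lact (hmod_bimod R H (hmod_tens R H C C)))
 = on_carriers (carrier R) (carrier (tens R X X)) (lact (btens R X X))"
 proof (rule on_carriers_cong)
 fix u r assume u: "u IN (tens R X X)" and r: "r IN R"
 have "tf (tens R X X) (%c d. tf (tens R X X) (%h1 h2. pt R X X (ract C c h1) (ract C d h2)) (\<Delta> (t r))) u
 = tf (tens R X X) (%c d. pt R X X (lact X r c) d) u"
 by (rule R.tlift_cong[OF B' B T u]) (use r X_act_bal in "simp add: \<Delta>_src_tgt")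
 then show "lact (hmod_bimod R H (hmod_tens R H C C)) r u = lact (btens R X X) r u"
 using u r by (simp add: R.lact_btens[OF B B])
 qed
 then show "lact (hmod_bimod R H (hmod_tens R H C C)) = lact (btens R X X)"
 using bm_on_carriers[OF hmod_bimodule[OF C_coalg(2)]] bm_on_carriers[OF R.btens_bimodule[OF B B]] by simp
qed (simp_all, simp_all add: btens_def)

text \<open>For the left action, \<epsilon>(s(x) t(y)) = \<epsilon>(t(y) s(x)) = \<epsilon>(s(y)
  s(x)) = y x.\<close>

lemma hmod_bimod_unit: "hmod_bimod R H (hmod_unit R H) = rg R"
proof (rule bimod_eqI)
 have "on_carriers (carrier R) (carrier R) (ract (hmod_bimod R H (hmod_unit R H))) = on_carriers (carrier R) (carrier R) (ract (rg R))"
 by (rule on_carriers_cong) (simp add: src_tgt_lin(1)[symmetric])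
 then show "ract (hmod_bimod R H (hmod_unit R H)) = ract (rg R)"
 using rm_on_carriers[OF bm_rm[OF hmod_bimodule[OF C_coalg(3)]]] rm_on_carriers[OF bm_rm[OF R.reg_bimodule]] by simp
 have "eps (s x \<star> t y) = y \<otimes>\<^bsub>R\<^esub> x" if "x IN R" "y IN R" for x y
 using that by (simp add: src_tgt_comm eps_tgt src_tgt_lin(1)[symmetric])
 then have "on_carriers (carrier R) (carrier R) (lact (hmod_bimod R H (hmod_unit R H))) = on_carriers (carrier R) (carrier R) (lact (rg R))"
 by (intro on_carriers_cong) simp
 then show "lact (hmod_bimod R H (hmod_unit R H)) = lact (rg R)"
 using bm_on_carriers[OF hmod_bimodule[OF C_coalg(3)]] bm_on_carriers[OF R.reg_bimodule] by simp
qed (simp_all add: reg_bimod_def)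

lemma \<delta>C_H: "\<delta>C : rlm K H C (hmod_tens R H C C)" "epsC : rlm K H C (hmod_unit R H)"
 "\<delta>C \<in> extensional (carrier C)" "epsC \<in> extensional (carrier C)"
 using C_coalg by (auto simp: HM.ar_iff)

lemma hmod_linear_bilinear:
 assumes "rm K H D" "rm K H E" "f : rlm K H D E"
 shows "f : blm K R (hmod_bimod R H D) (hmod_bimod R H E)"
proof -
 have "lm K (hmod_bimod R H D) (hmod_bimod R H E) = lm K D E"
 by (rule lm_cong) simp_all
 then show ?thesis
 using rl_lin[OF assms(3)] rl_ract[OF assms(3)] lin_closed[OF rl_lin[OF assms(3)]]
 by (intro blmI) simp_all
qed

lemma \<delta>C_bilinear: "\<delta>C : blm K R X (btens R X X)"
 and epsC_bilinear: "epsC : blm K R X (rg R)"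
 using hmod_linear_bilinear[OF C_coalg(1,2) \<delta>C_H(1)] hmod_linear_bilinear[OF C_coalg(1,3) \<delta>C_H(2)]
 by (simp_all add: hmod_bimod_tens hmod_bimod_unit)

lemma \<delta>C_closed [simp]: "c IN C ==> \<delta>C c IN (tens R X X)"
 and epsC_closed [simp]: "c IN C ==> epsC c IN R"
 using lin_closed[OF rl_lin[OF bl_rl[OF \<delta>C_bilinear]]]
 lin_closed[OF rl_lin[OF bl_rl[OF epsC_bilinear]]] by simp_all

lemma epsC_act: "c IN C ==> h IN H ==> epsC (ract C c h) = eps (s (epsC c) \<star> h)"
 using rl_ract[OF \<delta>C_H(2)] by simp

text \<open>The comultiplication of C is H-linear for the diagonal action, so (c h)_1 \<otimes> (c
  h)_2 may be replaced by c_1 h_1 \<otimes> c_2 h_2 under any balanced function.\<close>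

lemma \<delta>C_act:
 assumes P: "module K P" and F: "balanced K R X X P F" and c: "c IN C" and h: "h IN H"
 shows "tf P F (\<delta>C (ract C c h)) = tf P (%c1 c2. tf P (%h1 h2. F (ract C c1 h1) (ract C c2 h2)) (\<Delta> h)) (\<delta>C c)"
proof -
 note B = X_bm and B' = bm_rm[OF X_bm] and H' = bm_rm[OF Hb_bm]
 note T = R.tens_module[OF B' B]
 note L = R.tlift_lin[OF B' B P F]
 have "tf P F (\<delta>C (ract C c h)) =
 tf P (%c1 c2. tf P F (tf (tens R X X) (%h1 h2. pt R X X (ract C c1 h1) (ract C c2 h2)) (\<Delta> h))) (\<delta>C c)"
 proof -
 have cl: "tf (tens R X X) (%h1 h2. pt R X X (ract C c1 h1) (ract C c2 h2)) (\<Delta> h) IN (tens R X X)"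
 if "c1 IN X" "c2 IN X" for c1 c2
 by (rule R.tlift_closed[OF H' Hb_bm T _ \<Delta>_closed[OF h]]) (use that in simp)
 show ?thesis
 using rl_ract[OF \<delta>C_H(1) c h] c h R.tlift_fuse[OF B' B T L P \<delta>C_closed[OF c] cl] by simp
 qed
 also have "... = tf P (%c1 c2. tf P (%h1 h2. F (ract C c1 h1) (ract C c2 h2)) (\<Delta> h)) (\<delta>C c)"
 proof (rule R.tlift_cong[OF B' B P \<delta>C_closed[OF c]])
 fix c1 c2 assume x: "c1 IN X" "c2 IN X"
 have "tf P F (tf (tens R X X) (%h1 h2. pt R X X (ract C c1 h1) (ract C c2 h2)) (\<Delta> h))
 = tf P (%h1 h2. tf P F (pt R X X (ract C c1 h1) (ract C c2 h2))) (\<Delta> h)"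
 by (rule R.tlift_fuse[OF H' Hb_bm T L P \<Delta>_closed[OF h]]) (use x in simp)
 also have "... = tf P (%h1 h2. F (ract C c1 h1) (ract C c2 h2)) (\<Delta> h)"
 by (rule R.tlift_cong[OF H' Hb_bm P \<Delta>_closed[OF h]]) (use x P F in simp)
 finally show "tf P F (tf (tens R X X) (%h1 h2. pt R X X (ract C c1 h1) (ract C c2 h2)) (\<Delta> h))
 = tf P (%h1 h2. F (ract C c1 h1) (ract C c2 h2)) (\<Delta> h)" .
 qed
 finally show ?thesis .
qed

lemma coalg_eqs:
 "afun (Cmp HMC (Assoc HMC C C C) (Cmp HMC (TenA HMC dC (Idn HMC C)) dC)) c = afun (Cmp HMC (TenA HMC (Idn HMC C) dC) dC) c"
 "afun (Cmp HMC (LUnit HMC C) (Cmp HMC (TenA HMC eC (Idn HMC C)) dC)) c = afun (Idn HMC C) c"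
 "afun (Cmp HMC (RUnit HMC C) (Cmp HMC (TenA HMC (Idn HMC C) eC) dC)) c = afun (Idn HMC C) c"
 using module_coalgebra by (auto simp: coalgebra_in_def simp del: hmod_moncat_simps)

lemma hmod_idn: "Idn HMC D = (D, \<lambda>u \<in> carrier D. u, D)"
 by (simp add: HM.c_simps)

lemma hmod_tens_carrier: "carrier (hmod_tens R H D E) = carrier (tens R (hmod_bimod R H D) (hmod_bimod R H E))"
 by (simp add: hmod_tens_def Let_def)

lemma C_coassoc: "R.coassoc_on X X \<delta>C \<delta>C"
 unfolding R.coassoc_on_def
proof
 fix c assume c: "c IN X"
 have tm: "tmap R X X (rtens R X X) X f g = tmap R X X (btens R X X) X f g" for f g
 by (simp add: tmap_def)
 have idX: "(idc C) : blm K R X X"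
 using bl_conc(4)[OF X_bm bl_conc(2)] by simp
 have "tmap R X X (btens R X X) X \<delta>C (idc C) (\<delta>C c) IN (tens R (btens R X X) X)"
 using lin_closed[OF R.tmap_lin[OF bm_rm[OF X_bm] X_bm bm_rm[OF R.btens_bimodule[OF X_bm X_bm]] X_bm
 bl_rl[OF \<delta>C_bilinear] idX]] c by simp
 then show "tassoc R X X X (tmap R X X (rtens R X X) X \<delta>C (idc X) (\<delta>C c)) =
 tmap R X X X (btens R X X) (idc X) \<delta>C (\<delta>C c)"
 using coalg_eqs(1)[of c] c C_coalg by (simp add: hmod_idn hmod_bimod_tens tm)
qed

lemma C_counit: "R.counit_on X X \<delta>C epsC" "c IN C ==> tf X (%y z. lact X (epsC y) z) (\<delta>C c) = c"
proof -
 note B = X_bm and B' = bm_rm[OF X_bm]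
 note Rb = R.reg_bimodule
 have idX: "(idc C) : blm K R X X"
 using bl_conc(4)[OF X_bm bl_conc(2)] by simp
 have tl: "tf C F u = tf X F u" for F u by (rule tlift_target_cong) simp_all
 have car: "carrier (hmod_tens R H C (hmod_unit R H)) = carrier (tens R X (rg R))"
 "carrier (hmod_tens R H (hmod_unit R H) C) = carrier (tens R (rg R) X)"
 by (simp_all add: hmod_tens_carrier hmod_bimod_unit)
 have "tmap R X X X (rg R) (idc C) epsC (\<delta>C c) IN (tens R X (rg R))"
 "tmap R X X (rg R) X epsC (idc C) (\<delta>C c) IN (tens R (rg R) X)" if "c IN C" for c
 using lin_closed[OF R.tmap_lin[OF B' B B' Rb bl_rl[OF idX] epsC_bilinear]]
 lin_closed[OF R.tmap_lin[OF B' B bm_rm[OF Rb] B bl_rl[OF epsC_bilinear] idX]] that by simp_all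
 note tcl = this
 show "R.counit_on X X \<delta>C epsC"
 unfolding R.counit_on_def
 proof
 fix c assume c: "c IN X"
 then show "tf X (%m x. ract X m (epsC x)) (\<delta>C c) = c"
 using coalg_eqs(3)[of c] tcl C_coalg R.counit_expand[OF B' B epsC_bilinear, of "\<delta>C c"]
 by (simp add: hmod_idn hmod_bimod_unit car tl)
 qed
 show "tf X (%y z. lact X (epsC y) z) (\<delta>C c) = c" if c: "c IN C"
 proof -
 have XX: "module K X" by simp
 have "tf X (lact X) (tmap R X X (rg R) X epsC (idc C) (\<delta>C c))
 = tf X (%y z. lact X (epsC y) z) (\<delta>C c)"
 unfolding R.lin_expand[OF B' B XX lin_comp[OF R.tmap_lin[OF B' B bm_rm[OF Rb] B bl_rl[OF epsC_bilinear] idX]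
 R.tlift_lin[OF bm_rm[OF Rb] B XX R.lunit_bal[OF B]]] \<delta>C_closed[OF c]]
 by (rule R.tlift_cong[OF B' B XX \<delta>C_closed[OF c]])
 (simp add: R.tmap_ptens[OF B' B bm_rm[OF Rb] B bl_rl[OF epsC_bilinear] idX])
 then show ?thesis
 using coalg_eqs(2)[of c] tcl c C_coalg by (simp add: hmod_idn hmod_bimod_unit car tl)
 qed
qed

end

section \<open>The cowreath\<close>

context dk
begin

text \<open>From here \<open>A'\<close> is the normal form, so the rules that rewrite its fields to
  those of \<open>MA\<close> are withdrawn.\<close>

declare comod_bimod_eqs [simp del]

abbreviation "AX \<equiv> btens R A' X"
abbreviation "XX \<equiv> btens R X X"

lemmas A'_rm [simp] = bm_rm[OF A'_bm]
lemmas X_rm [simp] = bm_rm[OF X_bm]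
lemmas Hb_rm = bm_rm[OF Hb_bm]

lemma rho_closed_A' [simp]: "a IN A' ==> rho a IN (tens R A' Hb)"
 using lin_closed[OF rl_lin[OF rho_right_linear]] by simp

lemma am_simps:
 "a IN A' ==> a' IN A' ==> b IN A' ==> am (a \<oplus>\<^bsub>A'\<^esub> a') b = am a b \<oplus>\<^bsub>A'\<^esub> am a' b"
 "a IN A' ==> b IN A' ==> b' IN A' ==> am a (b \<oplus>\<^bsub>A'\<^esub> b') = am a b \<oplus>\<^bsub>A'\<^esub> am a b'"
 "kk IN K ==> a IN A' ==> b IN A' ==> am (kk \<odot>\<^bsub>A'\<^esub> a) b = kk \<odot>\<^bsub>A'\<^esub> am a b"
 "kk IN K ==> a IN A' ==> b IN A' ==> am a (kk \<odot>\<^bsub>A'\<^esub> b) = kk \<odot>\<^bsub>A'\<^esub> am a b"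
 "r IN R ==> a IN A' ==> b IN A' ==> am (lact A' r a) b = lact A' r (am a b)"
 "r IN R ==> a IN A' ==> b IN A' ==> am a (ract A' b r) = ract A' (am a b) r"
 "r IN R ==> a IN A' ==> b IN A' ==> am (ract A' a r) b = am a (lact A' r b)"
 using lin_add[OF rl_lin[OF bl_rl[OF phi_bilinear]]]
 lin_smult[OF rl_lin[OF bl_rl[OF phi_bilinear]]]
 rl_ract[OF bl_rl[OF phi_bilinear], of "pt R A' A' a b" r]
 bilinear_lact[OF phi_bilinear, of "pt R A' A' a b" r]
 by (simp_all add: R.lin_simps)

lemma am_uno [simp]: "a IN A' ==> am uno a = a" "a IN A' ==> am a uno = a"
 using am_eta[of a "\<one>\<^bsub>R\<^esub>"] eta_eq(1)[of "\<one>\<^bsub>R\<^esub>"] by simp_all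

lemma rho_fuse:
 assumes "L : lm K P Q" "module K P" "module K Q" "a IN A'"
 "!!a0 h. a0 IN A' ==> h IN H ==> F a0 h IN P"
 shows "L (tf P F (rho a)) = tf Q (%a0 h. L (F a0 h)) (rho a)"
 by (rule R.tlift_fuse[OF A'_rm Hb_bm assms(2,1,3)]) (use assms in simp_all)

lemma rho_cong:
 assumes "module K P" "a IN A'" "!!a0 h. a0 IN A' ==> h IN H ==> F a0 h = G a0 h"
 shows "tf P F (rho a) = tf P G (rho a)"
 by (rule R.tlift_cong[OF A'_rm Hb_bm assms(1)]) (use assms in simp_all)

lemma \<delta>_expand:
 assumes "L : lm K XX Q" "module K Q" "c IN C"
 shows "L (\<delta>C c) = tf Q (%c1 c2. L (pt R X X c1 c2)) (\<delta>C c)"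
 by (rule R.lin_expand[OF X_rm X_bm assms(2)]) (use assms in simp_all)

lemma \<delta>_cong:
 assumes "module K P" "c IN C" "!!c1 c2. c1 IN C ==> c2 IN C ==> F c1 c2 = G c1 c2"
 shows "tf P F (\<delta>C c) = tf P G (\<delta>C c)"
 by (rule R.tlift_cong[OF X_rm X_bm assms(1)]) (use assms in simp_all)

lemma C_lin_simps:
 "c IN C ==> h IN H ==> r IN R ==> lact X r (ract C c h) = ract C c (h \<star> t r)"
 "c IN C ==> h IN H ==> r IN R ==> ract X (ract C c h) r = ract C c (h \<star> s r)"
 "c IN C ==> h IN H ==> r IN R ==> ract C (lact X r c) h = ract C c (t r \<star> h)"
 "c IN C ==> h IN H ==> r IN R ==> ract C (ract X c r) h = ract C c (s r \<star> h)"
 by (simp_all add: rm_mult[of K H])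

lemma psi_inner_bal:
 assumes c: "c IN C"
 shows "balanced K R A' Hb (tens R A' X) (%a0 a1. pt R A' X a0 (ract C c a1))"
 by (rule balancedI) (use c in "simp_all add: R.lin_simps H.lin_simps C_lin_simps rm_mult[of K H]")

text \<open>For the balancing between c and a, the coaction of r a is a_0 \<otimes> s(r) a_1, and
  letting s(r) act on c is the right R-action on c.\<close>

lemma psi_bal: "balanced K R X A' (tens R A' X) (%c a. tf (tens R A' X) (%a0 a1. pt R A' X a0 (ract C c a1)) (rho a))"
proof (rule balancedI)
 let ?F = "%c a0 a1. pt R A' X a0 (ract C c a1)"
 have T: "module K (tens R A' X)" by simp
 have rl: "lm K A' (rtens R A' Hb) = lm K A' (tens R A' Hb)" by simp
 have L: "(%a. tf (tens R A' X) (?F c) (rho a)) : lm K A' (tens R A' X)" if "c IN C" for c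
 by (rule lin_comp[OF rl_lin[OF rho_right_linear, unfolded rl] R.tlift_lin[OF A'_rm Hb_bm T psi_inner_bal[OF that]]])
 note ba = A'_rm Hb_bm T
 show "tf (tens R A' X) (?F c) (rho a) IN (tens R A' X)" if "c IN X" "a IN A'" for c a
 using lin_closed[OF L] that by simp
 show "tf (tens R A' X) (?F c) (rho (a \<oplus>\<^bsub>A'\<^esub> b)) = tf (tens R A' X) (?F c) (rho a) \<oplus>\<^bsub>tens R A' X\<^esub> tf (tens R A' X) (?F c) (rho b)"
 if "c IN X" "a IN A'" "b IN A'" for c a b
 using lin_add[OF L] that by simp
 show "tf (tens R A' X) (?F c) (rho (kk \<odot>\<^bsub>A'\<^esub> a)) = kk \<odot>\<^bsub>tens R A' X\<^esub> tf (tens R A' X) (?F c) (rho a)"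
 if "kk IN K" "c IN X" "a IN A'" for c a kk
 using lin_smult[OF L] that by simp
 show "tf (tens R A' X) (?F (c \<oplus>\<^bsub>X\<^esub> d)) (rho a) = tf (tens R A' X) (?F c) (rho a) \<oplus>\<^bsub>tens R A' X\<^esub> tf (tens R A' X) (?F d) (rho a)"
 if "c IN X" "a IN A'" "d IN X" for c a d
 by (rule R.tlift_addI[OF ba]) (use that in "simp_all add: R.lin_simps H.lin_simps")
 show "tf (tens R A' X) (?F (ract X c r)) (rho a) = tf (tens R A' X) (?F c) (rho (lact A' r a))"
 if "c IN X" "r IN R" "a IN A'" for c a r
 proof -
 have "tf (tens R A' X) (?F (ract X c r)) (rho a) = tf (tens R A' X) (%a0 h. ?F c a0 (s r \<star> h)) (rho a)"
 by (rule rho_cong[OF T]) (use that in "simp_all add: rm_mult[of K H]")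
 then show ?thesis
 using rho_lact_A'(1)[OF T psi_inner_bal, of c a r] that by simp
 qed
qed

abbreviation "psi \<equiv> dk_psi R H A C"
abbreviation "\<delta> \<equiv> dk_delta R H A uA C dC"
abbreviation "ff \<equiv> dk_f R H A uA C eC"
abbreviation "mm \<equiv> dk_mult R H A mA"
abbreviation "ee \<equiv> dk_unit R H A uA"

lemma dk_arrow_simps [simp]:
 "fst psi = btens R X A'" "cod psi = AX"
 "fst \<delta> = X" "cod \<delta> = btens R A' XX"
 "fst ff = X" "cod ff = A'"
 "fst mm = btens R A' A'" "cod mm = A'"
 "fst ee = rg R" "cod ee = A'"
 by (simp_all add: dk_psi_def dk_delta_def dk_f_def dk_mult_def dk_unit_def Let_def)

lemma afun_mm: "afun mm = phi" and afun_ee: "afun ee = eta"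
 by (simp_all add: dk_mult_def dk_unit_def Let_def)

lemma psi_app [simp]: "c IN C ==> a IN A' ==>
 afun psi (pt R X A' c a) = tf (tens R A' X) (%a0 a1. pt R A' X a0 (ract C c a1)) (rho a)"
 using psi_bal by (simp add: dk_psi_def Let_def)

lemma \<delta>_app [simp]: "c IN C ==> afun \<delta> c = pt R A' XX uno (\<delta>C c)"
 by (simp add: dk_delta_def Let_def)

lemma i_eq: "r IN R ==> dk_i R H A uA r = eta r"
 by (simp add: dk_i_def eta_eq(2))

lemma ff_app [simp]: "c IN C ==> afun ff c = eta (epsC c)"
 by (simp add: dk_f_def i_eq compose_def)

lemma eta_closed [simp]: "r IN R ==> eta r IN A'"
 using lin_closed[OF rl_lin[OF bl_rl[OF eta_bilinear]]] by simp

lemma psi_lin: "afun psi : lm K (tens R X A') (tens R A' X)"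
 unfolding dk_psi_def Let_def afun_triple
 using lin_restrict[OF R.tlift_lin[OF X_rm A'_bm _ psi_bal]] by simp

lemma psi_right: "u IN (tens R X A') ==> r IN R ==> afun psi (ract (rtens R X A') u r) = ract (rtens R A' X) (afun psi u) r"
proof (rule R.tens_ext[OF X_rm A'_bm _ lin_comp[OF R.ract_lin[OF X_rm A'_bm] psi_lin] lin_comp[OF psi_lin R.ract_lin[OF A'_rm X_bm]]])
 fix c a assume r: "r IN R" and c: "c IN X" "a IN A'"
 have T: "module K (tens R A' X)" by simp
 have "afun psi (pt R X A' c (ract A' a r)) = tf (tens R A' X) (%a0 a1. pt R A' X a0 (ract C c (a1 \<star> s r))) (rho a)"
 using rho_lact_A'(2)[OF T psi_inner_bal c(2) r, of c] c r by simp
 also have "... = tf (tens R A' X) (%a0 a1. ract (rtens R A' X) (pt R A' X a0 (ract C c a1)) r) (rho a)"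
 by (rule rho_cong[OF T c(2)]) (use r c in "simp add: rm_mult[of K H]")
 also have "... = ract (rtens R A' X) (afun psi (pt R X A' c a)) r"
 using rho_fuse[OF R.ract_lin[OF A'_rm X_bm r] T T c(2), of "%a0 a1. pt R A' X a0 (ract C c a1)"] c by simp
 finally show "afun psi (ract (rtens R X A') (pt R X A' c a) r) = ract (rtens R A' X) (afun psi (pt R X A' c a)) r"
 using c r by simp
qed simp_all

text \<open>Acting by r on c inserts t(r) in front of a_1; the Takeuchi property of the coaction
  turns this into r a_0.\<close>

lemma psi_left: "u IN (tens R X A') ==> r IN R ==> afun psi (lact (btens R X A') r u) = lact (btens R A' X) r (afun psi u)"
proof (rule R.tens_ext[OF X_rm A'_bm _ lin_comp[OF R.lact_lin[OF X_bm A'_bm] psi_lin] lin_comp[OF psi_lin R.lact_lin[OF A'_bm X_bm]]])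
 fix c a assume r: "r IN R" and c: "c IN X" "a IN A'"
 have T: "module K (tens R A' X)" by simp
 have "afun psi (pt R X A' (lact X r c) a) = tf (tens R A' X) (%a0 a1. pt R A' X a0 (ract C c (t r \<star> a1))) (rho a)"
 using c r by (simp, intro rho_cong[OF T]) (simp_all add: rm_mult[of K H])
 also have "... = tf (tens R A' X) (%a0 a1. pt R A' X (lact A' r a0) (ract C c a1)) (rho a)"
 using rho_lact_A'(3)[OF T psi_inner_bal c(2) r, of c] c r by simp
 also have "... = tf (tens R A' X) (%a0 a1. lact (btens R A' X) r (pt R A' X a0 (ract C c a1))) (rho a)"
 by (rule rho_cong[OF T c(2)]) (use r c in simp)
 also have "... = lact (btens R A' X) r (afun psi (pt R X A' c a))"
 using rho_fuse[OF R.lact_lin[OF A'_bm X_bm r] T T c(2), of "%a0 a1. pt R A' X a0 (ract C c a1)"] c by simp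
 finally show "afun psi (lact (btens R X A') r (pt R X A' c a)) = lact (btens R A' X) r (afun psi (pt R X A' c a))"
 using c r by simp
qed simp_all

lemma dk_ar [simp]: "psi : Ar R.RMR" "\<delta> : Ar R.RMR" "ff : Ar R.RMR" "mm : Ar R.RMR" "ee : Ar R.RMR"
proof -
 have "afun psi : blm K R (btens R X A') AX"
 by (rule blmI) (use psi_lin psi_right psi_left in simp_all)
 then show "psi : Ar R.RMR"
 by (simp add: C.ar_iff del: arrow_ob) (simp add: dk_psi_def Let_def)
 have "(%c. pt R A' XX uno (\<delta>C c)) : blm K R X (btens R A' XX)"
 proof (rule blmI)
 note d = lin_add[OF rl_lin[OF bl_rl[OF \<delta>C_bilinear]]]
 lin_smult[OF rl_lin[OF bl_rl[OF \<delta>C_bilinear]]]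
 rl_ract[OF bl_rl[OF \<delta>C_bilinear]] bilinear_lact[OF \<delta>C_bilinear]
 show "(%c. pt R A' XX uno (\<delta>C c)) : lm K X (btens R A' XX)"
 by (rule lmI) (use d in "simp_all add: R.lin_simps")
 show "pt R A' XX uno (\<delta>C (ract X x b)) = ract (btens R A' XX) (pt R A' XX uno (\<delta>C x)) b"
 if "x IN X" "b IN R" for x b
 using that d(3) by (simp del: hb_simps(7))
 show "pt R A' XX uno (\<delta>C (lact X b x)) = lact (btens R A' XX) b (pt R A' XX uno (\<delta>C x))"
 if "x IN X" "b IN R" for x b
 proof -
 \<comment> \<open>Left linearity of \<delta> depends on r 1_A = 1_A r: the action on the coalgebra
   part is balanced over to the right of 1_A, where it equals the action from the left.\<close>
 have "lact A' b uno = ract A' uno b" using that eta_eq by metis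
 then show ?thesis
 using that d(4) by (simp add: R.lin_simps del: hb_simps(8))
 qed
 qed
 from bl_conc(4)[OF X_bm this] show "\<delta> : Ar R.RMR"
 by (simp add: C.ar_iff del: arrow_ob) (simp add: dk_delta_def Let_def)
 have "(%c. eta (epsC c)) : blm K R X A'"
 by (rule bl_conc(3)[OF epsC_bilinear eta_bilinear])
 from bl_conc(4)[OF X_bm this] show "ff : Ar R.RMR"
 by (simp add: C.ar_iff del: arrow_ob) (simp add: dk_f_def compose_def i_eq cong: restrict_cong)
 show "mm : Ar R.RMR"
 using phi_bilinear mA_arr(7) by (simp add: C.ar_iff afun_mm tens_A' del: arrow_ob)
 show "ee : Ar R.RMR"
 using eta_bilinear uA_arr(7) by (simp add: C.ar_iff afun_ee del: arrow_ob)
qed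

lemma mm_app [simp]: "afun mm (pt R A' A' a b) = am a b" and ee_app [simp]: "afun ee r = eta r"
 by (simp_all add: afun_mm afun_ee)

lemma algebra_A: "algebra_in R.RMR A' mm ee"
proof -
 have "CR mm (TR mm (IR A')) = CR mm (CR (TR (IR A') mm) (Assoc R.RMR A' A' A'))"
 by (rule R.C_ext3l[where L = A' and M = A' and N = A']) (simp_all add: am_assoc)
 moreover have "CR mm (TR ee (IR A')) = LUnit R.RMR A'"
 by (rule R.C_ext2[where M = "rg R" and N = A']) (simp_all add: am_eta)
 moreover have "CR mm (TR (IR A') ee) = RUnit R.RMR A'"
 by (rule R.C_ext2[where N = "rg R" and M = A']) (simp_all add: am_eta)
 ultimately show ?thesis
 by (simp add: algebra_in_def C.hom_iff)
qed

lemma ar_lin: "W : Ar R.RMR ==> fst W = Y ==> cod W = Z ==> afun W : lm K Y Z"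
 using arrow_lin(1) by metis

lemma ptens_left_lin: "bm K R M ==> bm K R N ==> n IN N ==>
 (%v. pt R M N v n) : lm K M (tens R M N)"
 using R.bal_lin_left[OF bm_rm _ R.ptens_bal[OF bm_rm]] by blast

lemma ptens_right_lin: "bm K R M ==> bm K R N ==> m IN M ==>
 (%v. pt R M N m v) : lm K N (tens R M N)"
 using R.bal_lin_right[OF R.ptens_bal[OF bm_rm]] by blast

lemma psi_fuse:
 assumes "L : lm K AX Q" "module K Q" "c IN C" "a IN A'"
 shows "L (afun psi (pt R X A' c a)) = tf Q (%a0 h. L (pt R A' X a0 (ract C c h))) (rho a)"
 using rho_fuse[OF assms(1)[unfolded linear_maps_btens] _ assms(2,4), of "%a0 h. pt R A' X a0 (ract C c h)"] assms by simp

lemma psi_uno: "c IN C ==> afun psi (pt R X A' c uno) = pt R A' X uno c"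
 using psi_inner_bal by (simp add: rho_uno)

text \<open>The coaction of 1_A is trivial, so \<psi> sends c \<otimes> 1 to 1 \<otimes> c; right
  linearity extends this to the image of R.\<close>

lemma psi_eta:
 assumes "c IN C" "r IN R"
 shows "afun psi (pt R X A' c (eta r)) = pt R A' X uno (ract X c r)"
proof -
 have "pt R X A' c (eta r) = ract (rtens R X A') (pt R X A' c uno) r"
 using assms by (simp add: eta_eq(1))
 then show ?thesis
 using assms psi_right[of "pt R X A' c uno" r] psi_uno by simp
qed

lemma tlift_rho_closed: "module K P ==> a IN A' ==> (!!a0 h. a0 IN A' ==> h IN H ==> F a0 h IN P)
 ==> tf P F (rho a) IN P"
 by (rule R.tlift_closed[OF A'_rm Hb_bm]) simp_all

text \<open>Both sides send c \<otimes> a \<otimes> b to a_0 b_0 \<otimes> c a_1 b_1: one by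
  multiplicativity of the coaction, the other by two applications of \<psi>.\<close>

lemma eq_psi_mult: "CR psi (TR (IR X) mm)
 = CR (TR mm (IR X)) (CR (R.AssocI A' A' X) (CR (TR (IR A') psi)
 (CR (Assoc R.RMR A' X A') (CR (TR psi (IR A')) (R.AssocI X A' A')))))"
proof (rule R.C_ext3r[where L = X and M = A' and N = A'])
 fix c a b assume "c IN X" and ab: "a IN A'" "b IN A'"
 then have c: "c IN C" by simp
 have T: "module K (tens R A' X)" by simp
 \<comment> \<open>\<open>?W2\<close> multiplies the two algebra factors at the end, and
   \<open>?W\<close> is everything after the first \<psi>. With this split each \<psi> can be
   expanded separately under a linear map.\<close>
 let ?W2 = "CR (TR mm (IR X)) (R.AssocI A' A' X)"
 let ?W = "CR ?W2 (CR (TR (IR A') psi) (Assoc R.RMR A' X A'))"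
 let ?G = "%a0 h b0 h'. pt R A' X (am a0 b0) (ract C c (h \<star> h'))"
 have W: "(%v. afun ?W (pt R AX A' v b)) : lm K AX (tens R A' X)"
 using lin_comp[OF ptens_left_lin[of AX A' b] ar_lin[of ?W "btens R AX A'" AX, simplified]] ab by simp
 have W2: "(%v. afun ?W2 (pt R A' AX a0 v)) : lm K AX (tens R A' X)" if "a0 IN A'" for a0
 using lin_comp[OF ptens_right_lin[of A' AX a0] ar_lin[of ?W2 "btens R A' AX" AX, simplified]] that by simp
 have "afun (CR psi (TR (IR X) mm)) (pt R X (btens R A' A') c (pt R A' A' a b))
 = tf (tens R A' X) (%a0 h. pt R A' X a0 (ract C c h)) (rho (am a b))"
 using c ab by simp
 also have "... = tf (tens R A' X) (%a0 h. tf (tens R A' X) (?G a0 h) (rho b)) (rho a)"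
 by (rule rho_am[OF T psi_inner_bal[OF c] ab])
 also have "... = tf (tens R A' X) (%a0 h. afun ?W (pt R AX A' (pt R A' X a0 (ract C c h)) b)) (rho a)"
 proof (rule rho_cong[OF T ab(1)])
 fix a0 h assume x: "a0 IN A'" "h IN H"
 have "afun ?W (pt R AX A' (pt R A' X a0 (ract C c h)) b) = afun ?W2 (pt R A' AX a0 (afun psi (pt R X A' (ract C c h) b)))"
 using x c ab by (simp del: psi_app)
 also have "... = tf (tens R A' X) (%b0 h'. afun ?W2 (pt R A' AX a0 (pt R A' X b0 (ract C (ract C c h) h')))) (rho b)"
 by (rule psi_fuse[OF W2[OF x(1)] T]) (use x c ab in simp_all)
 also have "... = tf (tens R A' X) (?G a0 h) (rho b)"
 by (rule rho_cong[OF T ab(2)]) (use x c in "simp add: rm_mult[of K H]")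
 finally show "tf (tens R A' X) (?G a0 h) (rho b) = afun ?W (pt R AX A' (pt R A' X a0 (ract C c h)) b)" by simp
 qed
 also have "... = afun ?W (pt R AX A' (afun psi (pt R X A' c a)) b)"
 by (rule psi_fuse[OF W T c ab(1), symmetric])
 finally show "afun (CR psi (TR (IR X) mm)) (pt R X (btens R A' A') c (pt R A' A' a b))
 = afun (CR (TR mm (IR X)) (CR (R.AssocI A' A' X) (CR (TR (IR A') psi)
 (CR (Assoc R.RMR A' X A') (CR (TR psi (IR A')) (R.AssocI X A' A'))))))
 (pt R X (btens R A' A') c (pt R A' A' a b))"
 using c ab tlift_rho_closed[OF T ab(1), of "%a0 h. pt R A' X a0 (ract C c h)"] by simp
qed simp_all

lemma eq_psi_unit: "CR psi (TR (IR X) ee)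
 = CR (TR ee (IR X)) (CR (R.LUnitI X) (RUnit R.RMR X))"
proof (rule R.C_ext2[where M = X and N = "rg R"])
 fix c r assume "c IN X" "r IN (rg R)"
 then have c: "c IN C" "r IN R" by simp_all
 have "ract X c r IN C" using rm_closed[OF X_rm, of c r] c by simp
 then show "afun (CR psi (TR (IR X) ee)) (pt R X (rg R) c r)
 = afun (CR (TR ee (IR X)) (CR (R.LUnitI X) (RUnit R.RMR X))) (pt R X (rg R) c r)"
 using c psi_eta[OF c] by (simp add: eta_eq(1) del: psi_app hb_simps(7))
qed simp_all

text \<open>The left side becomes a_0 \<epsilon>(s(\<epsilon>_C(c)) a_1), which is by definition the
  left action of \<epsilon>_C(c) on a.\<close>

lemma eq_f_psi: "CR mm (CR (TR (IR A') ff) psi) = CR mm (TR ff (IR A'))"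
proof (rule R.C_ext2[where M = X and N = A'])
 fix c a assume "c IN X" and a: "a IN A'"
 then have c: "c IN C" by simp
 let ?W = "CR mm (TR (IR A') ff)"
 have T: "module K A'" by simp
 have W: "afun ?W : lm K AX A'" by (rule ar_lin) simp_all
 have "afun ?W (afun psi (pt R X A' c a)) = tf A' (%a0 h. afun ?W (pt R A' X a0 (ract C c h))) (rho a)"
 by (rule psi_fuse[OF W T c a])
 also have "... = tf A' (%a0 h. ract A' a0 (eps (s (epsC c) \<star> h))) (rho a)"
 by (rule rho_cong[OF T a]) (use c in "simp add: am_eta epsC_act")
 also have "... = am (eta (epsC c)) a"
 using a c by (simp add: am_eta lact_counit)
 finally show "afun (CR mm (CR (TR (IR A') ff) psi)) (pt R X A' c a)
 = afun (CR mm (TR ff (IR A'))) (pt R X A' c a)"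
 using a c tlift_rho_closed[of "tens R A' X" a "%a0 h. pt R A' X a0 (ract C c h)"] by simp
qed simp_all

end

section \<open>The cowreath identities that involve \<delta>\<close>

context dk
begin

lemma X_closed: "c IN C ==> r IN R ==> lact X r c IN C"
 "c IN C ==> r IN R ==> ract X c r IN C"
 by simp_all


text \<open>Multiplies an outer copy of A into A \<otimes> Y. The cowreath laws for \<delta> end
  with it, and \<open>absorb_uno\<close> removes it where \<delta> has put 1_A in front.\<close>

abbreviation "absorb Y \<equiv> CR (TR mm (IR Y)) (R.AssocI A' A' Y)"

lemma absorb_lin: "bm K R Y ==> a IN A' ==>
 (%w. afun (absorb Y) (pt R A' (btens R A' Y) a w)) : lm K (btens R A' Y) (tens R A' Y)"
 using lin_comp[OF ptens_right_lin[of A' "btens R A' Y" a] ar_lin[of "absorb Y" "btens R A' (btens R A' Y)" "btens R A' Y", simplified]]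
 by simp

lemma absorb_uno:
 assumes Y: "bm K R Y" and w: "w IN (tens R A' Y)"
 shows "afun (absorb Y) (pt R A' (btens R A' Y) uno w) = w"
 by (rule R.tens_ext[OF A'_rm Y _ absorb_lin[OF Y, simplified] lin_id _ w]) (use Y in simp_all)

lemma absorb_ptens [simp]: "[|bm K R Y; a IN A'; b IN A'; y IN Y|] ==>
 afun (absorb Y) (pt R A' (btens R A' Y) a (pt R A' Y b y)) = pt R A' Y (am a b) y"
 by simp

text \<open>The two applications of \<psi> that carry an element of A from right to left through X
  \<otimes> X: \<open>deltaV\<close> past the right factor, \<open>deltaU\<close> past the left
  one.\<close>

abbreviation "deltaU \<equiv> CR (Assoc R.RMR A' X X) (CR (TR psi (IR X)) (R.AssocI X A' X))"
abbreviation "deltaV \<equiv> CR (TR (IR X) psi) (Assoc R.RMR X X A')"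

text \<open>On the left, H-linearity of the comultiplication gives a_0 \<otimes> c_1 a_11 \<otimes>
  c_2 a_12; on the right, two applications of \<psi> give a_00 \<otimes> c_1 a_01 \<otimes> c_2 a_1.
  Coassociativity of the coaction of A identifies them.\<close>

lemma delta_psi_element:
 assumes c: "c IN C" and a: "a IN A'"
 shows "afun (CR (absorb XX) (TR (IR A') \<delta>)) (afun psi (pt R X A' c a)) = afun deltaU (afun deltaV (pt R XX A' (\<delta>C c) a))"
proof -
 let ?P = "tens R A' XX"
 have T: "module K ?P" by simp
 let ?p = "%a0 x y. pt R A' XX a0 (pt R X X x y)"
 let ?U = "CR (Assoc R.RMR A' X X) (CR (TR psi (IR X)) (R.AssocI X A' X))"
 let ?V = "CR (TR (IR X) psi) (Assoc R.RMR X X A')"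
 let ?L = "CR (absorb XX) (TR (IR A') \<delta>)"
 have L: "afun ?L : lm K AX ?P"
 using ar_lin[of ?L AX "btens R A' XX"] by simp
 have psi_cl: "tf (tens R A' X) (%a0 h. pt R A' X a0 (ract C x h)) (rho b) IN (tens R A' X)"
 if "x IN C" "b IN A'" for x b
 by (rule tlift_rho_closed) (use that in simp_all)
 have p2: "(%w. pt R A' XX a0 w) : lm K XX ?P" if "a0 IN A'" for a0
 using ptens_right_lin[of A' XX a0] that by simp
 have bal: "balanced K R X X ?P (?p a0)" if a0: "a0 IN A'" for a0
 by (rule balancedI) (use a0 in "simp_all add: R.lin_simps del: hb_simps(7,8)")
 have "afun ?L (afun psi (pt R X A' c a)) = tf ?P (%a0 h. afun ?L (pt R A' X a0 (ract C c h))) (rho a)"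
 by (rule psi_fuse[OF L T c a])
 also have "... = tf ?P (%a0 h. tf ?P (%c1 c2. tf ?P (%h1 h2. ?p a0 (ract C c1 h1) (ract C c2 h2)) (\<Delta> h)) (\<delta>C c)) (rho a)"
 proof (rule rho_cong[OF T a])
 fix a0 h assume x: "a0 IN A'" "h IN H"
 have "afun ?L (pt R A' X a0 (ract C c h)) = pt R A' XX a0 (\<delta>C (ract C c h))"
 using x c by simp
 also have "... = tf ?P (?p a0) (\<delta>C (ract C c h))"
 by (rule \<delta>_expand[OF p2[OF x(1)] T]) (use x c in simp)
 also have "... = tf ?P (%c1 c2. tf ?P (%h1 h2. ?p a0 (ract C c1 h1) (ract C c2 h2)) (\<Delta> h)) (\<delta>C c)"
 by (rule \<delta>C_act[OF T bal[OF x(1)] c x(2)])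
 finally show "afun ?L (pt R A' X a0 (ract C c h)) = ..." .
 qed
 \<comment> \<open>The sum over the comultiplication of c is moved outside, so that coassociativity
   can be applied to a with c_1 and c_2 fixed.\<close>
 also have "... = tf ?P (%c1 c2. tf ?P (%a0 h. tf ?P (%h1 h2. ?p a0 (ract C c1 h1) (ract C c2 h2)) (\<Delta> h)) (rho a)) (\<delta>C c)"
 by (rule R.tlift_swap[OF A'_rm Hb_bm X_rm X_bm T])
 (use a c in "auto intro!: R.tlift_closed[OF Hb_rm Hb_bm T]")
 also have "... = tf ?P (%c1 c2. tf ?P (%a0 h. tf ?P (%a00 h1. ?p a00 (ract C c1 h1) (ract C c2 h)) (rho a0)) (rho a)) (\<delta>C c)"
 proof (rule \<delta>_cong[OF T c])
 fix c1 c2 assume x: "c1 IN C" "c2 IN C"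
 have tri: "trilinear K R A' Hb Hb ?P (%a00 h1 h. ?p a00 (ract C c1 h1) (ract C c2 h))"
 proof (rule trilinearI)
 fix l b m n assume y: "l IN A'" "b IN R" "m IN Hb" "n IN Hb"
 show "?p (ract A' l b) (ract C c1 m) (ract C c2 n) = ?p l (ract C c1 (lact Hb b m)) (ract C c2 n)"
 using x y R.pt_bal[OF A'_rm R.btens_bimodule[OF X_bm X_bm], of l b "pt R X X (ract C c1 m) (ract C c2 n)"]
 by (simp add: rm_mult[of K H])
 show "?p l (ract C c1 (ract Hb m b)) (ract C c2 n) = ?p l (ract C c1 m) (ract C c2 (lact Hb b n))"
 using x y R.pt_bal[OF X_rm X_bm, of "ract C c1 m" b "ract C c2 n"] by (simp add: rm_mult[of K H])
 qed (use x in "simp_all add: R.lin_simps H.lin_simps")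
 show "tf ?P (%a0 h. tf ?P (%h1 h2. ?p a0 (ract C c1 h1) (ract C c2 h2)) (\<Delta> h)) (rho a)
 = tf ?P (%a0 h. tf ?P (%a00 h1. ?p a00 (ract C c1 h1) (ract C c2 h)) (rho a0)) (rho a)"
 by (rule R.coassoc_lift[OF A'_rm Hb_bm T rho_right_linear \<Delta>_bilinear rho_coassoc tri a, symmetric])
 qed
 also have "... = tf ?P (%c1 c2. afun ?U (afun ?V (pt R XX A' (pt R X X c1 c2) a))) (\<delta>C c)"
 proof (rule \<delta>_cong[OF T c])
 fix c1 c2 assume x: "c1 IN C" "c2 IN C"
 have U: "(%v. afun ?U (pt R X AX c1 v)) : lm K AX ?P"
 using lin_comp[OF ptens_right_lin[of X AX c1] ar_lin[of ?U "btens R X AX" "btens R A' XX", simplified]] x by simp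
 have "afun ?U (afun ?V (pt R XX A' (pt R X X c1 c2) a)) = afun ?U (pt R X AX c1 (afun psi (pt R X A' c2 a)))"
 using x a by (simp add: psi_cl)
 also have "... = tf ?P (%a0 h. afun ?U (pt R X AX c1 (pt R A' X a0 (ract C c2 h)))) (rho a)"
 by (rule psi_fuse[OF U T x(2) a])
 also have "... = tf ?P (%a0 h. tf ?P (%a00 h1. ?p a00 (ract C c1 h1) (ract C c2 h)) (rho a0)) (rho a)"
 proof (rule rho_cong[OF T a])
 fix a0 h assume y: "a0 IN A'" "h IN H"
 have AL: "(%v. afun (Assoc R.RMR A' X X) (pt R AX X v (ract C c2 h))) : lm K AX ?P"
 using lin_comp[OF ptens_left_lin[of AX X "ract C c2 h"] ar_lin[of "Assoc R.RMR A' X X" "btens R AX X" "btens R A' XX", simplified]] x y by simp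
 have "afun ?U (pt R X AX c1 (pt R A' X a0 (ract C c2 h))) = afun (Assoc R.RMR A' X X) (pt R AX X (afun psi (pt R X A' c1 a0)) (ract C c2 h))"
 using x y by (simp add: psi_cl)
 also have "... = tf ?P (%a00 h1. afun (Assoc R.RMR A' X X) (pt R AX X (pt R A' X a00 (ract C c1 h1)) (ract C c2 h))) (rho a0)"
 by (rule psi_fuse[OF AL T x(1) y(1)])
 also have "... = tf ?P (%a00 h1. ?p a00 (ract C c1 h1) (ract C c2 h)) (rho a0)"
 by (rule rho_cong[OF T y(1)]) (use x y in simp)
 finally show "afun ?U (pt R X AX c1 (pt R A' X a0 (ract C c2 h))) = ..." .
 qed
 finally show "tf ?P (%a0 h. tf ?P (%a00 h1. ?p a00 (ract C c1 h1) (ract C c2 h)) (rho a0)) (rho a)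
 = afun ?U (afun ?V (pt R XX A' (pt R X X c1 c2) a))" by simp
 qed
 also have "... = afun ?U (afun ?V (pt R XX A' (\<delta>C c) a))"
 proof -
 have UV: "(%v. afun ?U (afun ?V (pt R XX A' v a))) : lm K XX ?P"
 using lin_comp[OF ptens_left_lin[of XX A' a] lin_comp[OF ar_lin[of ?V "btens R XX A'" "btens R X AX", simplified]
 ar_lin[of ?U "btens R X AX" "btens R A' XX", simplified]]] a by simp
 show ?thesis by (rule \<delta>_expand[OF UV T c, symmetric])
 qed
 finally show ?thesis .
qed

lemma eq_delta_psi: "CR (TR mm (IR XX)) (CR (R.AssocI A' A' XX) (CR (TR (IR A') \<delta>) psi))
 = CR (TR mm (IR XX)) (CR (R.AssocI A' A' XX)
 (CR (TR (IR A') (CR (Assoc R.RMR A' X X) (CR (TR psi (IR X)) (R.AssocI X A' X))))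
 (CR (TR (IR A') (CR (TR (IR X) psi) (Assoc R.RMR X X A')))
 (CR (Assoc R.RMR A' XX A') (TR \<delta> (IR A'))))))"
proof (rule R.C_ext2[where M = X and N = A'])
 fix c a assume "c IN X" and a: "a IN A'"
 then have c: "c IN C" by simp
 let ?P = "tens R A' XX"
 let ?U = "deltaU" and ?V = "deltaV"
 let ?L = "CR (absorb XX) (TR (IR A') \<delta>)"
 have psi_cl: "tf (tens R A' X) (%a0 h. pt R A' X a0 (ract C x h)) (rho b) IN (tens R A' X)"
 if "x IN C" "b IN A'" for x b
 by (rule tlift_rho_closed) (use that in simp_all)
 note main = delta_psi_element[OF c a]
 have Vcl: "afun ?V (pt R XX A' (\<delta>C c) a) IN (tens R X AX)"
 and Ucl: "afun ?U (afun ?V (pt R XX A' (\<delta>C c) a)) IN ?P"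
 using a c by (auto simp del: C.cmp_app)
 show "afun (CR (TR mm (IR XX)) (CR (R.AssocI A' A' XX) (CR (TR (IR A') \<delta>) psi))) (pt R X A' c a)
 = afun (CR (TR mm (IR XX)) (CR (R.AssocI A' A' XX)
 (CR (TR (IR A') ?U) (CR (TR (IR A') ?V)
 (CR (Assoc R.RMR A' XX A') (TR \<delta> (IR A'))))))) (pt R X A' c a)"
 (is "afun ?l _ = afun ?r _")
 proof -
 have "afun ?l (pt R X A' c a) = afun ?L (afun psi (pt R X A' c a))"
 using a c psi_cl by simp
 \<comment> \<open>Composites are unfolded one instance at a time; unrestricted unfolding would
   break up \<open>?U\<close> and \<open>?V\<close>, which must stay intact to match
   \<open>delta_psi_element\<close>.\<close>
 moreover have "afun ?r (pt R X A' c a) = afun (absorb XX) (pt R A' (btens R A' XX) uno (afun ?U (afun ?V (pt R XX A' (\<delta>C c) a))))"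
 using a c Vcl Ucl by (simp del: C.cmp_app add: C.cmp_app[of _ "TR \<delta> (IR A')"] C.cmp_app[of _ "CR (Assoc R.RMR A' XX A') (TR \<delta> (IR A'))"]
 C.cmp_app[of _ "CR (TR (IR A') ?V) (CR (Assoc R.RMR A' XX A') (TR \<delta> (IR A')))"]
 C.cmp_app[of _ "CR (TR (IR A') ?U) (CR (TR (IR A') ?V) (CR (Assoc R.RMR A' XX A') (TR \<delta> (IR A'))))"]
 C.cmp_app[of _ "CR (R.AssocI A' A' XX) (CR (TR (IR A') ?U) (CR (TR (IR A') ?V) (CR (Assoc R.RMR A' XX A') (TR \<delta> (IR A')))))"]
 C.cmp_app[of _ "R.AssocI A' A' XX"])
 ultimately show ?thesis
 using main absorb_uno[of XX] Ucl by simp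
 qed
qed simp_all

text \<open>Since \<psi>(c \<otimes> 1) = 1 \<otimes> c, every copy of A carries the unit, and the
  law reduces to coassociativity of C.\<close>

lemma eq_delta_coassoc:
 "CR (TR mm (IR (btens R X XX))) (CR (R.AssocI A' A' (btens R X XX))
 (CR (TR (IR A') (CR (Assoc R.RMR A' X XX) (CR (TR psi (IR XX)) (R.AssocI X A' XX))))
 (CR (TR (IR A') (TR (IR X) \<delta>)) \<delta>)))
 = CR (TR mm (IR (btens R X XX))) (CR (R.AssocI A' A' (btens R X XX))
 (CR (TR (IR A') (CR (TR (IR A') (Assoc R.RMR X X X))
 (CR (Assoc R.RMR A' XX X) (TR \<delta> (IR X))))) \<delta>))"
proof (rule C.ar_eqI[where K = K and B = R])
 fix c assume "c IN (fst (CR (TR mm (IR (btens R X XX))) (CR (R.AssocI A' A' (btens R X XX))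
 (CR (TR (IR A') (CR (Assoc R.RMR A' X XX) (CR (TR psi (IR XX)) (R.AssocI X A' XX))))
 (CR (TR (IR A') (TR (IR X) \<delta>)) \<delta>)))))"
 then have c: "c IN C" by simp
 let ?Y = "btens R X XX"
 let ?P = "tens R A' ?Y"
 let ?U = "CR (Assoc R.RMR A' X XX) (CR (TR psi (IR XX)) (R.AssocI X A' XX))"
 let ?W = "CR (TR (IR A') (Assoc R.RMR X X X)) (CR (Assoc R.RMR A' XX X) (TR \<delta> (IR X)))"
 have T: "module K ?P" by simp
 have idX: "(idc X) : blm K R X X"
 by (rule bl_conc(4)[OF X_bm bl_conc(2)])
 have UL: "(%v. afun ?U (afun (TR (IR X) \<delta>) v)) : lm K XX ?P"
 using lin_comp[OF ar_lin[of "TR (IR X) \<delta>" XX "btens R X (btens R A' XX)", simplified]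
 ar_lin[of ?U "btens R X (btens R A' XX)" "btens R A' ?Y", simplified]] by simp
 have WL: "afun ?W : lm K XX ?P"
 using ar_lin[of ?W XX "btens R A' ?Y"] by simp
 have XXb: "bm K R XX" by simp
 note XXr = bm_rm[OF XXb]
 have e: "rtens R X X = rtens R X X" ..
 have tm: "tmap R X X (rtens R X X) X f g = tmap R X X XX X f g" for f g
 by (simp add: tmap_def)
 have d': "\<delta>C : rlm K R X XX"
 using bl_rl[OF \<delta>C_bilinear] .
 have 1: "(%u. pt R A' ?Y uno (tmap R X X X XX (idc X) \<delta>C u)) : lm K XX ?P"
 using lin_comp[OF R.tmap_lin[OF X_rm X_bm X_rm XXb bl_rl[OF idX] \<delta>C_bilinear] ptens_right_lin[of A' ?Y uno, simplified]] by simp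
 have 2: "(%u. pt R A' ?Y uno (afun (Assoc R.RMR X X X) (tmap R X X XX X \<delta>C (idc X) u))) : lm K XX ?P"
 using lin_comp[OF R.tmap_lin[OF X_rm X_bm XXr X_bm d' idX] lin_comp[OF ar_lin[of "Assoc R.RMR X X X" "btens R XX X" ?Y, simplified]
 ptens_right_lin[of A' ?Y uno, simplified]]] by simp
 have "afun ?U (afun (TR (IR X) \<delta>) (\<delta>C c)) = tf ?P (%c1 c2. afun ?U (afun (TR (IR X) \<delta>) (pt R X X c1 c2))) (\<delta>C c)"
 by (rule \<delta>_expand[OF UL T c])
 also have "... = tf ?P (%c1 c2. pt R A' ?Y uno (tmap R X X X XX (idc X) \<delta>C (pt R X X c1 c2))) (\<delta>C c)"
 by (rule \<delta>_cong[OF T c]) (use R.tmap_ptens[OF X_rm X_bm X_rm XXb bl_rl[OF idX] \<delta>C_bilinear] in "simp add: psi_uno del: psi_app")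
 also have "... = pt R A' ?Y uno (tmap R X X X XX (idc X) \<delta>C (\<delta>C c))"
 by (rule \<delta>_expand[OF 1 T c, symmetric])
 also have "... = pt R A' ?Y uno (afun (Assoc R.RMR X X X) (tmap R X X XX X \<delta>C (idc X) (\<delta>C c)))"
 using C_coassoc c by (simp add: R.coassoc_on_def C_afun tm)
 also have "... = tf ?P (%c1 c2. pt R A' ?Y uno (afun (Assoc R.RMR X X X) (tmap R X X XX X \<delta>C (idc X) (pt R X X c1 c2)))) (\<delta>C c)"
 by (rule \<delta>_expand[OF 2 T c])
 also have "... = tf ?P (%c1 c2. afun ?W (pt R X X c1 c2)) (\<delta>C c)"
 by (rule \<delta>_cong[OF T c]) (use R.tmap_ptens[OF X_rm X_bm XXr X_bm d' idX] in simp)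
 also have "... = afun ?W (\<delta>C c)"
 by (rule \<delta>_expand[OF WL T c, symmetric])
 finally have main: "afun ?U (afun (TR (IR X) \<delta>) (\<delta>C c)) = afun ?W (\<delta>C c)" .
 have cl: "afun (TR (IR X) \<delta>) (\<delta>C c) IN (tens R X (btens R A' XX))"
 using c by simp
 show "afun (CR (TR mm (IR ?Y)) (CR (R.AssocI A' A' ?Y)
 (CR (TR (IR A') ?U) (CR (TR (IR A') (TR (IR X) \<delta>)) \<delta>)))) c
 = afun (CR (TR mm (IR ?Y)) (CR (R.AssocI A' A' ?Y) (CR (TR (IR A') ?W) \<delta>))) c"
 (is "afun ?l _ = afun ?r _")
 proof -
 \<comment> \<open>The two composites are made opaque, so that the simplifier evaluates only what
   surrounds them.\<close>
 obtain U where U: "U = ?U" by simp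
 obtain W where W: "W = ?W" by simp
 have UW: "U : Ar R.RMR" "fst U = btens R X (btens R A' XX)" "cod U = btens R A' ?Y"
 "W : Ar R.RMR" "fst W = XX" "cod W = btens R A' ?Y"
 by (simp_all add: U W)
 show ?thesis
 using main UW cl c unfolding U[symmetric] W[symmetric] by simp
 qed
qed simp_all

text \<open>Balancing turns \<eta>(\<epsilon>_C(c_1)) \<otimes> c_2 into 1 \<otimes>
  \<epsilon>_C(c_1) c_2, and the left counit law of C applies.\<close>

lemma eq_counit_left: "CR (TR mm (IR X)) (CR (R.AssocI A' A' X)
 (CR (TR (IR A') (TR ff (IR X))) \<delta>))
 = CR (TR ee (IR X)) (R.LUnitI X)"
proof (rule C.ar_eqI[where K = K and B = R])
 fix c assume "c IN (fst (CR (TR mm (IR X)) (CR (R.AssocI A' A' X)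
 (CR (TR (IR A') (TR ff (IR X))) \<delta>))))"
 then have c: "c IN C" by simp
 have T: "module K (tens R A' X)" and TX: "module K X" by simp_all
 have L: "afun (TR ff (IR X)) : lm K XX (tens R A' X)"
 using ar_lin[of "TR ff (IR X)" XX AX] by simp
 have "afun (TR ff (IR X)) (\<delta>C c) = tf (tens R A' X) (%c1 c2. afun (TR ff (IR X)) (pt R X X c1 c2)) (\<delta>C c)"
 by (rule \<delta>_expand[OF L T c])
 also have "... = tf (tens R A' X) (%c1 c2. pt R A' X uno (lact X (epsC c1) c2)) (\<delta>C c)"
 by (rule \<delta>_cong[OF T c]) (simp add: eta_eq(1) R.pt_bal del: hb_simps(8))
 also have "... = pt R A' X uno (tf X (%c1 c2. lact X (epsC c1) c2) (\<delta>C c))"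
 by (rule R.tlift_fuse[OF X_rm X_bm TX ptens_right_lin[OF A'_bm X_bm uno_closed] T \<delta>C_closed[OF c], symmetric])
 (simp add: X_closed del: hb_simps(8))
 also have "... = pt R A' X uno c"
 using C_counit(2)[OF c] by simp
 finally show "afun (CR (TR mm (IR X)) (CR (R.AssocI A' A' X)
 (CR (TR (IR A') (TR ff (IR X))) \<delta>))) c = afun (CR (TR ee (IR X)) (R.LUnitI X)) c"
 using c by (simp add: eta_eq(1))
qed simp_all

text \<open>By \<open>psi_eta\<close>, \<psi> turns c_1 \<otimes> \<eta>(\<epsilon>_C(c_2)) into 1
  \<otimes> c_1 \<epsilon>_C(c_2), and the right counit law of C applies.\<close>

lemma eq_counit_right: "CR (TR mm (IR X)) (CR (R.AssocI A' A' X)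
 (CR (TR (IR A') psi) (CR (TR (IR A') (TR (IR X) ff)) \<delta>)))
 = CR (TR ee (IR X)) (R.LUnitI X)"
proof (rule C.ar_eqI[where K = K and B = R])
 fix c assume "c IN (fst (CR (TR mm (IR X)) (CR (R.AssocI A' A' X)
 (CR (TR (IR A') psi) (CR (TR (IR A') (TR (IR X) ff)) \<delta>)))))"
 then have c: "c IN C" by simp
 have T: "module K (tens R A' X)" and TX: "module K X" by simp_all
 let ?W = "TR (IR X) ff"
 have L: "(%v. afun psi (afun ?W v)) : lm K XX (tens R A' X)"
 using lin_comp[OF ar_lin[of ?W XX "btens R X A'", simplified] ar_lin[of psi "btens R X A'" AX, simplified]] by simp
 have "afun psi (afun ?W (\<delta>C c)) = tf (tens R A' X) (%c1 c2. afun psi (afun ?W (pt R X X c1 c2))) (\<delta>C c)"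
 by (rule \<delta>_expand[OF L T c])
 also have "... = tf (tens R A' X) (%c1 c2. pt R A' X uno (ract X c1 (epsC c2))) (\<delta>C c)"
 by (rule \<delta>_cong[OF T c]) (simp add: psi_eta del: psi_app hb_simps(7))
 also have "... = pt R A' X uno (tf X (%c1 c2. ract X c1 (epsC c2)) (\<delta>C c))"
 by (rule R.tlift_fuse[OF X_rm X_bm TX ptens_right_lin[OF A'_bm X_bm uno_closed] T \<delta>C_closed[OF c], symmetric])
 (simp add: X_closed del: hb_simps(7))
 also have "... = pt R A' X uno c"
 using C_counit(1) c by (simp add: R.counit_on_def)
 finally have main: "afun psi (afun ?W (\<delta>C c)) = pt R A' X uno c" .
 have cl: "afun ?W (\<delta>C c) IN (tens R X A')" using c by simp
 show "afun (CR (TR mm (IR X)) (CR (R.AssocI A' A' X)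
 (CR (TR (IR A') psi) (CR (TR (IR A') (TR (IR X) ff)) \<delta>)))) c = afun (CR (TR ee (IR X)) (R.LUnitI X)) c"
 using c main cl by (simp add: eta_eq(1))
qed simp_all

theorem cowreath_A_C: "cowreath R.RMR A' mm ee X psi \<delta> ff"
proof (intro cowreath.intro R.monoidal cowreath_axioms.intro algebra_A)
 note ia = R.inv_arrows
 show "psi \<in> Hom R.RMR (TenO R.RMR X A') (TenO R.RMR A' X)" "\<delta> \<in> Hom R.RMR X (TenO R.RMR A' (TenO R.RMR X X))" "ff \<in> Hom R.RMR X A'"
 by (simp_all add: C.hom_iff)
qed (use eq_psi_mult eq_psi_unit eq_delta_psi eq_delta_coassoc eq_f_psi eq_counit_left eq_counit_right in "simp_all add: R.inv_arrows")

end

section \<open>Coequalizers\<close>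

context concrete_category
begin

lemma coequalizer_iff:
 "is_coequalizer C f g q \<longleftrightarrow> q : Ar C & fst q = cod f & Cmp C q f = Cmp C q g &
 (ALL h : Ar C. fst h = cod f & Cmp C h f = Cmp C h g \<longrightarrow>
 (EX! u. u : Ar C & fst u = cod q & cod u = cod h & Cmp C u q = h))"
 unfolding is_coequalizer_def hom_iff c_simps(3,4) by (simp add: conj_assoc)

text \<open>\<open>balq\<close> picks an unknown coequalizer. Uniqueness up to isomorphism relates
  it to an explicit one by a bijection compatible with the two projections.\<close>

lemma coequalizer_compare:
 assumes q: "is_coequalizer C f g q" and q0: "is_coequalizer C f g q0"
 shows "EX v : Ar C. fst v = cod q & cod v = cod q0 & bij_betw (afun v) (car (cod q)) (car (cod q0)) &
 (ALL u:car (fst q). afun v (afun q u) = afun q0 u)"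
proof -
 have ex: "EX u. u : Ar C & fst u = cod p & cod u = cod p' & Cmp C u p = p'"
 if "is_coequalizer C f g p" "is_coequalizer C f g p'" for p p'
 using that unfolding coequalizer_iff by (metis (no_types, lifting))
 \<comment> \<open>An endomorphism of a coequalizer that fixes the projection is the identity; hence
   the two comparison arrows are mutually inverse.\<close>
 have un: "w = Idn C (cod p)" if p: "is_coequalizer C f g p"
 and w: "w : Ar C" "fst w = cod p" "cod w = cod p" "Cmp C w p = p" for p w
 proof -
 have pa: "p : Ar C" "fst p = cod f" "Cmp C p f = Cmp C p g" using p by (auto simp: coequalizer_iff)
 then have "EX! u. u : Ar C & fst u = cod p & cod u = cod p & Cmp C u p = p"
 using p unfolding coequalizer_iff by blast
 moreover have "cod p \<in> Obs" using pa by (simp add: ar_iff)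
 moreover have "Cmp C (Idn C (cod p)) p = p"
 using pa calculation(2) by (intro ar_eqI) (simp_all add: app_closed')
 ultimately show ?thesis
 using w by (metis ar_idn cmp_simps(3,4))
 qed
 obtain v where v: "v : Ar C" "fst v = cod q" "cod v = cod q0" "Cmp C v q = q0"
 using ex[OF q q0] by blast
 obtain w where w: "w : Ar C" "fst w = cod q0" "cod w = cod q" "Cmp C w q0 = q"
 using ex[OF q0 q] by blast
 have qa: "q : Ar C" "q0 : Ar C" using q q0 by (auto simp: coequalizer_iff)
 have fq: "fst q = cod f" "fst q0 = cod f" using q q0 by (auto simp: coequalizer_iff)
 have app: "afun v (afun q u) = afun q0 u" "afun w (afun q0 u) = afun q u" if "u \<in> car (fst q)" for u
 proof -
 have "afun (Cmp C v q) u = afun q0 u" "afun (Cmp C w q0) u = afun q u" using v w by simp_all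
 then show "afun v (afun q u) = afun q0 u" "afun w (afun q0 u) = afun q u" using that fq by simp_all
 qed
 have "Cmp C (Cmp C w v) q = q"
 by (rule ar_eqI) (use v w qa app fq in "simp_all add: app_closed'")
 then have wv: "Cmp C w v = Idn C (cod q)"
 using v w by (intro un[OF q]) simp_all
 have "Cmp C (Cmp C v w) q0 = q0"
 by (rule ar_eqI) (use v w qa app fq in "simp_all add: app_closed'")
 then have vw: "Cmp C v w = Idn C (cod q0)"
 using v w by (intro un[OF q0]) simp_all
 have 1: "afun w (afun v x) = x" if "x \<in> car (cod q)" for x
 proof -
 have "afun (Cmp C w v) x = afun (Idn C (cod q)) x" using wv by simp
 then show ?thesis using that v by simp
 qed
 have 2: "afun v (afun w x) = x" if "x \<in> car (cod q0)" for x
 proof -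
 have "afun (Cmp C v w) x = afun (Idn C (cod q0)) x" using vw by simp
 then show ?thesis using that w by simp
 qed
 have "bij_betw (afun v) (car (cod q)) (car (cod q0))"
 by (rule bij_betwI[of _ _ _ "afun w"]) (use 1 2 v w app_closed[OF v(1)] app_closed[OF w(1)] in auto)
 then show ?thesis
 using v app by blast
qed


text \<open>Surjectivity of \<open>q\<close> yields the uniqueness half of the universal property,
  which leaves the existence of a factorization.\<close>

lemma is_coequalizerI:
 assumes f: "f : Ar C" "g : Ar C" "fst f = fst g" "cod f = cod g"
 and q: "q : Ar C" "fst q = cod f" "!!u. u \<in> car (fst f) ==> afun q (afun f u) = afun q (afun g u)"
 and surj: "!!z. z \<in> car (cod q) ==> EX u:car (fst q). z = afun q u"
 and univ: "!!h. h : Ar C ==> fst h = cod f ==> (!!u. u \<in> car (fst f) ==> afun h (afun f u) = afun h (afun g u)) ==>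
 EX u : Ar C. fst u = cod q & cod u = cod h & (ALL x:car (fst q). afun u (afun q x) = afun h x)"
 shows "is_coequalizer C f g q"
 unfolding coequalizer_iff
proof (intro conjI ballI impI)
 show "q : Ar C" "fst q = cod f" by fact+
 show "Cmp C q f = Cmp C q g"
 by (rule ar_eqI) (use f q in simp_all)
 fix h assume h: "h : Ar C" "fst h = cod f & Cmp C h f = Cmp C h g"
 have "afun h (afun f u) = afun h (afun g u)" if "u \<in> car (fst f)" for u
 using h cmp_app[of u f h] cmp_app[of u g h] that f by simp
 then obtain u where u: "u : Ar C" "fst u = cod q" "cod u = cod h" "ALL x:car (fst q). afun u (afun q x) = afun h x"
 using univ h by blast
 show "EX! u. u : Ar C & fst u = cod q & cod u = cod h & Cmp C u q = h"
 proof (rule ex1I[of _ u])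
 have "Cmp C u q = h" by (rule ar_eqI) (use u q h in simp_all)
 then show "u : Ar C & fst u = cod q & cod u = cod h & Cmp C u q = h" using u by simp
 fix w assume w: "w : Ar C & fst w = cod q & cod w = cod h & Cmp C w q = h"
 show "w = u"
 proof (rule ar_eqI)
 fix z assume "z \<in> car (fst w)"
 then obtain x where x: "x \<in> car (fst q)" "z = afun q x" using surj w by auto
 have "afun (Cmp C w q) x = afun h x" using w by simp
 then show "afun w z = afun u z" using x u by simp
 qed (use u w in simp_all)
 qed
qed

lemma factor_through_eqI:
 assumes q: "q : Ar C" "!!z. z \<in> car (cod q) ==> EX u:car (fst q). z = afun q u"
 and u: "u : Ar C" "fst u = cod q" "cod u = cod g" and g: "g : Ar C" "fst g = fst q"
 and e: "!!x. x \<in> car (fst q) ==> afun u (afun q x) = afun g x"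
 shows "factor_through C q g = u"
 unfolding factor_through_def hom_iff c_simps(3,4)
proof (rule the_equality)
 have "Cmp C u q = g" by (rule ar_eqI) (use u q g e in simp_all)
 then show "(u : Ar C & fst u = cod q & cod u = cod g) & Cmp C u q = g" using u by simp
 fix w assume w: "(w : Ar C & fst w = cod q & cod w = cod g) & Cmp C w q = g"
 show "w = u"
 proof (rule ar_eqI)
 fix z assume "z \<in> car (fst w)"
 then obtain x where x: "x \<in> car (fst q)" "z = afun q x" using q(2) w by auto
 have "afun (Cmp C w q) x = afun g x" using w by simp
 then show "afun w z = afun u z" using x e by simp
 qed (use u w in simp_all)
qed

end

lemma is_coequalizer_self_action [simp]: "is_coequalizer (self_action C) = is_coequalizer C"
 by (simp add: is_coequalizer_def fun_eq_iff)

lemma factor_through_self_action [simp]: "factor_through (self_action C) = factor_through C"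
 by (simp add: factor_through_def fun_eq_iff)

section \<open>The algebra underlying \<open>A\<close>\<close>

context dk
begin

definition "BA = ord_algebra R A' mm ee"

lemma BA_simps [simp]:
 "carrier BA = carrier A'" "add BA = add A'" "zero BA = zero A'" "smult BA = smult A'"
 "mult BA a b = am a b" "one BA = uno"
 by (simp_all add: BA_def ord_algebra_def dk_one_def)

lemma A'_mod [simp]: "module K A'"
 by simp

text \<open>Makes the whole tensor calculus available over the ordinary algebra underlying
  A.\<close>

sublocale Q: k_alg K BA
proof (rule k_alg.intro[OF R.K_cring])
 have ag: "abelian_group A'" using m_abelian[OF A'_mod] .
 have "ring BA"
 proof (rule ringI)
 show "abelian_group BA" by (rule abelian_group_fields_cong[OF ag]) simp_all
 show "Group.monoid BA" by (rule monoidI) (simp_all add: am_assoc)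
 qed (simp_all add: am_simps)
 moreover have "module K BA" by (rule mod_cong[OF A'_mod]) simp_all
 ultimately show "k_algebra K BA" by (simp add: k_algebra_def am_simps)
qed

lemma eta_simps:
 "r IN R ==> r' IN R ==> eta (r \<oplus>\<^bsub>R\<^esub> r') = eta r \<oplus>\<^bsub>A'\<^esub> eta r'"
 "kk IN K ==> r IN R ==> eta (kk \<odot>\<^bsub>R\<^esub> r) = kk \<odot>\<^bsub>A'\<^esub> eta r"
 "r IN R ==> r' IN R ==> eta (r \<otimes>\<^bsub>R\<^esub> r') = am (eta r) (eta r')"
 "eta \<one>\<^bsub>R\<^esub> = uno"
 using lin_add[OF rl_lin[OF bl_rl[OF eta_bilinear]], of r r']
 lin_smult[OF rl_lin[OF bl_rl[OF eta_bilinear]], of kk r]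
 bilinear_lact[OF eta_bilinear, of r' r] by (simp_all add: am_eta(1) dk_one_def)


definition "resR (V :: ('k, 'a univ) rmod) = restrict_scalars R (dk_i R H A uA) V"

lemma resR_simps [simp]:
 "carrier (resR V) = carrier V" "add (resR V) = add V" "zero (resR V) = zero V" "smult (resR V) = smult V"
 "mult (resR V) = mult V" "one (resR V) = one V"
 "v IN V ==> r IN R ==> ract (resR V) v r = ract V v (eta r)"
 by (simp_all add: resR_def restrict_scalars_def i_eq)

lemma resR_right_module [simp]:
 assumes V: "rm K BA V"
 shows "rm K R (resR V)"
proof (rule right_moduleI)
 show "module K (resR V)" by (rule mod_cong[OF rm_module[OF V]]) simp_all
 show "on_carriers (carrier (resR V)) (carrier R) (ract (resR V)) = ract (resR V)"
 by (simp add: resR_def restrict_scalars_def)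
qed (use V rm_mult[OF V] rm_one[OF V] in "simp_all add: Q.lin_simps eta_simps")

text \<open>The right action goes through \<open>resR\<close>, so that it is
  \<open>undefined\<close> off the carriers by the same convention.\<close>

definition "resB W = bimod_of W (ract (resR (rmod_of W (ract W))))
 (on_carriers (carrier R) (carrier W) (%r w. lact W (eta r) w))"

lemma resB_simps [simp]:
 "carrier (resB W) = carrier W" "add (resB W) = add W" "zero (resB W) = zero W" "smult (resB W) = smult W"
 "w IN W ==> r IN R ==> ract (resB W) w r = ract W w (eta r)"
 "w IN W ==> r IN R ==> lact (resB W) r w = lact W (eta r) w"
 by (simp_all add: resB_def)

lemma resB_bimodule [simp]:
 assumes W: "bm K BA W"
 shows "bm K R (resB W)"
proof (rule bimoduleI[OF right_moduleI])
 note W' = bm_rm[OF W]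
 show "module K (resB W)" by (rule mod_cong[OF rm_module[OF W']]) simp_all
 show "on_carriers (carrier (resB W)) (carrier R) (ract (resB W)) = ract (resB W)"
 by (simp add: resB_def resR_def restrict_scalars_def)
 show "on_carriers (carrier R) (carrier (resB W)) (lact (resB W)) = lact (resB W)"
 by (simp add: resB_def)
qed (use W bm_rm[OF W] rm_mult[OF bm_rm[OF W]] rm_one[OF bm_rm[OF W]] bm_mult[OF W] bm_one[OF W] in "simp_all add: Q.lin_simps eta_simps")

section \<open>Balanced tensor products over \<open>A\<close>\<close>

text \<open>The data identify \<open>M\<close> and \<open>Y\<close> (modules in the category of bimodules) with the ordinary modules
 \<open>V\<close> and \<open>W\<close> over the algebra underlying \<open>A\<close>.\<close>

definition ident_right where
 "ident_right M mu V j \<longleftrightarrow> rm K BA V & bij_betw j (carrier M) (carrier V) & j : lm K M V &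
 (ALL m:carrier M. ALL a:carrier A'. mu (pt R M A' m a) IN M & j (mu (pt R M A' m a)) = ract V (j m) a) &
 (ALL m:carrier M. ALL r:carrier R. j (ract M m r) = ract V (j m) (eta r))"

definition ident_left where
 "ident_left Y l W k \<longleftrightarrow> bm K BA W & bij_betw k (carrier Y) (carrier W) & k : lm K Y W &
 (ALL a:carrier A'. ALL y:carrier Y. l (pt R A' Y a y) IN Y & k (l (pt R A' Y a y)) = lact W a (k y)) &
 (ALL y:carrier Y. ALL r:carrier R. k (ract Y y r) = ract W (k y) (eta r)) &
 (ALL y:carrier Y. ALL r:carrier R. k (lact Y r y) = lact W (eta r) (k y))"

text \<open>The explicit model of the coequalizer: the projection from the tensor product over R to
  the one over the ordinary algebra, read through the identifications \<open>j\<close> and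
  \<open>k\<close>.\<close>

definition "q0 M Y V W j k = (\<lambda>u \<in> carrier (tens R M Y). tf (tens BA V W) (%m y. pt BA V W (j m) (k y)) u)"

context
 fixes M :: "('k, 'a univ, 'm) rmod_scheme" and Y :: "('k, 'a univ) bimod" and V :: "('k, 'a univ, 'v) rmod_scheme" and W :: "('k, 'a univ) bimod"
 and mu l j k
 assumes M: "rm K R M" and Y: "bm K R Y"
 and jM: "ident_right M mu V j" and kY: "ident_left Y l W k"
begin

private lemma VW: "rm K BA V" "bm K BA W"
 using jM kY by (simp_all add: ident_right_def ident_left_def)

private lemma jk: "j : lm K M V" "k : lm K Y W"
 "m IN M ==> a IN A' ==> j (mu (pt R M A' m a)) = ract V (j m) a"
 "m IN M ==> r IN R ==> j (ract M m r) = ract V (j m) (eta r)"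
 "a IN A' ==> y IN Y ==> k (l (pt R A' Y a y)) = lact W a (k y)"
 "y IN Y ==> r IN R ==> k (ract Y y r) = ract W (k y) (eta r)"
 "y IN Y ==> r IN R ==> k (lact Y r y) = lact W (eta r) (k y)"
 "bij_betw j (carrier M) (carrier V)" "bij_betw k (carrier Y) (carrier W)"
 "m IN M ==> a IN A' ==> mu (pt R M A' m a) IN M"
 "a IN A' ==> y IN Y ==> l (pt R A' Y a y) IN Y"
 using jM kY by (simp_all add: ident_right_def ident_left_def)

private lemma jk_cl [simp]: "m IN M ==> j m IN V" "y IN Y ==> k y IN W"
 using lin_closed[OF jk(1)] lin_closed[OF jk(2)] by simp_all

private definition "ji = the_inv_into (carrier M) j"
private definition "ki = the_inv_into (carrier Y) k"

private lemma inv: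
 "m IN M ==> ji (j m) = m" "v IN V ==> j (ji v) = v" "v IN V ==> ji v IN M"
 "y IN Y ==> ki (k y) = y" "w IN W ==> k (ki w) = w" "w IN W ==> ki w IN Y"
 using jk(8,9) unfolding ji_def ki_def bij_betw_def
 by (auto simp: the_inv_into_f_f f_the_inv_into_f intro!: the_inv_into_into[OF _ _ order_refl])

private lemma ji_eqI: "m IN M ==> v IN V ==> v = j m ==> ji v = m"
 using inv by simp
private lemma ki_eqI: "y IN Y ==> w IN W ==> w = k y ==> ki w = y"
 using inv by simp

lemma q0_bal: "balanced K R M Y (tens BA V W) (%m y. pt BA V W (j m) (k y))"
 by (rule balancedI)
 (use VW M Y in "simp_all add: lin_add[OF jk(1)] lin_add[OF jk(2)] lin_smult[OF jk(2)] jk(4,7) Q.lin_simps")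

lemma q0_lin: "q0 M Y V W j k : lm K (tens R M Y) (tens BA V W)"
 unfolding q0_def by (rule lin_restrict[OF R.tlift_lin[OF M Y _ q0_bal]]) (use VW M Y in simp_all)

lemma q0_ptens: "m IN M ==> y IN Y ==> q0 M Y V W j k (pt R M Y m y) = pt BA V W (j m) (k y)"
 using q0_bal VW M Y by (simp add: q0_def)

lemma q0_surj:
 assumes z: "z IN (tens BA V W)"
 shows "EX u:carrier (tens R M Y). z = q0 M Y V W j k u"
 using VW z
proof (induction z rule: Q.tens_induct)
 case zero
 have "\<zero>\<^bsub>tens R M Y\<^esub> IN (tens R M Y)" using M Y by simp
 moreover have "q0 M Y V W j k \<zero>\<^bsub>tens R M Y\<^esub> = \<zero>\<^bsub>tens BA V W\<^esub>" by (rule lin_zero[OF q0_lin]) (use M Y VW in simp_all)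
 ultimately show ?case by metis
next
 case (add v w z)
 then obtain u where u: "u IN (tens R M Y)" "z = q0 M Y V W j k u" by blast
 have "pt BA V W v w \<oplus>\<^bsub>tens BA V W\<^esub> z = q0 M Y V W j k (pt R M Y (ji v) (ki w) \<oplus>\<^bsub>tens R M Y\<^esub> u)"
 using add u by (simp add: lin_add[OF q0_lin] q0_ptens inv)
 moreover have "pt R M Y (ji v) (ki w) \<oplus>\<^bsub>tens R M Y\<^esub> u IN (tens R M Y)"
 using add u inv M Y by simp
 ultimately show ?case by blast
qed

context
 fixes N :: "('k, 'a univ, 'n) module_scheme" and h
 assumes N: "module K N" and h: "h : lm K (tens R M Y) N"
 and hb: "!!m a y. m IN M ==> a IN A' ==> y IN Y ==>
 h (pt R M Y (mu (pt R M A' m a)) y) = h (pt R M Y m (l (pt R A' Y a y)))"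
begin

text \<open>The map on the quotient is read back along the inverses of \<open>j\<close> and
  \<open>k\<close>; the coequalizing hypothesis on \<open>h\<close> then becomes the balancing over
  the algebra.\<close>

lemma induced_bal: "balanced K BA V W N (%v w. h (pt R M Y (ji v) (ki w)))"
proof (rule balancedI)
 note iv = inv VW M Y
 show "h (pt R M Y (ji v) (ki w)) IN N" if "v IN V" "w IN W" for v w
 using lin_closed[OF h] that iv by simp
 show "h (pt R M Y (ji (v \<oplus>\<^bsub>V\<^esub> v')) (ki w)) = h (pt R M Y (ji v) (ki w)) \<oplus>\<^bsub>N\<^esub> h (pt R M Y (ji v') (ki w))"
 if "v IN V" "v' IN V" "w IN W" for v v' w
 proof -
 have "ji (v \<oplus>\<^bsub>V\<^esub> v') = ji v \<oplus>\<^bsub>M\<^esub> ji v'" by (rule ji_eqI) (use that iv lin_add[OF jk(1)] in simp_all)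
 then show ?thesis using that iv by (simp add: R.lin_simps lin_add[OF h])
 qed
 show "h (pt R M Y (ji v) (ki (w \<oplus>\<^bsub>W\<^esub> w'))) = h (pt R M Y (ji v) (ki w)) \<oplus>\<^bsub>N\<^esub> h (pt R M Y (ji v) (ki w'))"
 if "v IN V" "w' IN W" "w IN W" for v w' w
 proof -
 have "ki (w \<oplus>\<^bsub>W\<^esub> w') = ki w \<oplus>\<^bsub>Y\<^esub> ki w'" by (rule ki_eqI) (use that iv lin_add[OF jk(2)] in simp_all)
 then show ?thesis using that iv by (simp add: R.lin_simps lin_add[OF h])
 qed
 show "h (pt R M Y (ji v) (ki (kk \<odot>\<^bsub>W\<^esub> w))) = kk \<odot>\<^bsub>N\<^esub> h (pt R M Y (ji v) (ki w))"
 if "kk IN K" "v IN V" "w IN W" for v kk w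
 proof -
 have "ki (kk \<odot>\<^bsub>W\<^esub> w) = kk \<odot>\<^bsub>Y\<^esub> ki w" by (rule ki_eqI) (use that iv lin_smult[OF jk(2)] in simp_all)
 then show ?thesis using that iv by (simp add: R.lin_simps lin_smult[OF h])
 qed
 show "h (pt R M Y (ji (ract V v b)) (ki w)) = h (pt R M Y (ji v) (ki (lact W b w)))"
 if "v IN V" "b IN BA" "w IN W" for v b w
 proof -
 have "ji (ract V v b) = mu (pt R M A' (ji v) b)" by (rule ji_eqI) (use that iv jk in simp_all)
 moreover have "ki (lact W b w) = l (pt R A' Y b (ki w))" by (rule ki_eqI) (use that iv jk in simp_all)
 ultimately show ?thesis using hb that iv by simp
 qed
qed

lemma induced: "EX u : lm K (tens BA V W) N. ALL x:carrier (tens R M Y). u (q0 M Y V W j k x) = h x"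
proof
 let ?u = "tf N (%v w. h (pt R M Y (ji v) (ki w)))"
 show u: "?u : lm K (tens BA V W) N"
 by (rule Q.tlift_lin[OF VW N induced_bal])
 show "ALL x:carrier (tens R M Y). ?u (q0 M Y V W j k x) = h x"
 proof
 fix x assume x: "x IN (tens R M Y)"
 show "?u (q0 M Y V W j k x) = h x"
 by (rule R.tens_ext[OF M Y N lin_comp[OF q0_lin u] h _ x])
 (use induced_bal VW N inv in "simp add: q0_ptens")
 qed
qed

end

lemma q0_ract: "u IN (tens R M Y) ==> r IN R ==> q0 M Y V W j k (ract (rtens R M Y) u r) = ract (rtens BA V W) (q0 M Y V W j k u) (eta r)"
 by (rule R.tens_ext[OF M Y _ lin_comp[OF R.ract_lin[OF M Y] q0_lin] lin_comp[OF q0_lin Q.ract_lin[OF VW]]])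
 (use VW M Y in "simp_all add: q0_ptens jk")

end

end

text \<open>\<open>\<theta>\<close> is an injective coordinate on the target in which
  \<open>g\<close> depends only on the image under \<open>q\<close>; hence \<open>g\<close> is
  constant on the fibres of \<open>q\<close> and factors. \<open>H_surj\<close> makes the resulting
  function a morphism. The last conclusion is the one by which induced maps are computed.\<close>

lemma (in concrete_category) factor_surj:
 assumes q: "q : Ar C" "!!z. z \<in> car (cod q) ==> EX u:car (fst q). z = afun q u"
 and g: "g : Ar C" "fst g = fst q" and \<theta>: "inj_on \<theta> (car (cod g))"
 and \<Phi>: "!!x. x \<in> car (fst q) ==> \<theta> (afun g x) = \<Phi> (afun q x)"
 and H_surj: "!!w. (!!x. x \<in> car (fst q) ==> w (afun q x) = afun g x) ==> w \<in> H (cod q) (cod g)"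
 defines "u \<equiv> factor_through C q g"
 shows "u : Ar C" "fst u = cod q" "cod u = cod g" "x \<in> car (fst q) ==> afun u (afun q x) = afun g x"
 "z \<in> car (cod q) ==> \<theta> (afun u z) = \<Phi> z"
proof -
 define s where "s = inv_into (car (fst q)) (afun q)"
 have s: "s z \<in> car (fst q)" "afun q (s z) = z" if "z \<in> car (cod q)" for z
 using q(2)[OF that] unfolding s_def by (auto intro: inv_into_into f_inv_into_f)
 let ?w = "\<lambda>z \<in> car (cod q). afun g (s z)"
 have w: "?w (afun q x) = afun g x" if x: "x \<in> car (fst q)" for x
 proof -
 have qx: "afun q x \<in> car (cod q)" using app_closed[OF q(1) x] .
 have "\<theta> (afun g (s (afun q x))) = \<theta> (afun g x)" using \<Phi> s[OF qx] x by simp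
 then show ?thesis using inj_onD[OF \<theta>] app_closed[OF g(1)] g(2) s[OF qx] x qx by simp
 qed
 have ob: "cod q \<in> Obs" "cod g \<in> Obs" using q(1) g(1) by (auto simp: ar_iff)
 let ?u = "(cod q, ?w, cod g)"
 have "?w \<in> H (cod q) (cod g)" by (rule H_surj) (rule w)
 then have "?u : Ar C" using ob by (simp add: ar_iff)
 then have "u = ?u"
 unfolding u_def by (intro factor_through_eqI q g) (use w in simp_all)
 then show "u : Ar C" "fst u = cod q" "cod u = cod g" and
 app: "x \<in> car (fst q) ==> afun u (afun q x) = afun g x" for x
 using \<open>?u : Ar C\<close> w by simp_all
 show "\<theta> (afun u z) = \<Phi> z" if "z \<in> car (cod q)"
 using app[of "s z"] \<Phi>[of "s z"] s[OF that] by simp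
qed

text \<open>Values on the quotient are compared through preimages, so linearity descends; this
  serves the premise \<open>H_surj\<close> of \<open>factor_surj\<close>.\<close>

lemma linear_surj:
 assumes q: "q : lm K x y" "!!z. z IN y ==> EX u:carrier x. z = q u" and g: "g : lm K x z"
 and x: "module K x" and w: "!!u. u IN x ==> w (q u) = g u"
 shows "w : lm K y z"
proof -
 have "w (a \<oplus>\<^bsub>y\<^esub> b) = w a \<oplus>\<^bsub>z\<^esub> w b" "w a IN z" if "a IN y" "b IN y" for a b
 proof -
 obtain u v where "u IN x" "v IN x" "a = q u" "b = q v" using q(2) \<open>a IN y\<close> \<open>b IN y\<close> by meson
 then show "w (a \<oplus>\<^bsub>y\<^esub> b) = w a \<oplus>\<^bsub>z\<^esub> w b" "w a IN z"
 using w w[of "u \<oplus>\<^bsub>x\<^esub> v"] lin_add[OF q(1)] lin_add[OF g] lin_closed[OF g] m_add_closed[OF x] by simp_all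
 qed
 moreover have "w (kk \<odot>\<^bsub>y\<^esub> a) = kk \<odot>\<^bsub>z\<^esub> w a" if a: "a IN y" "kk IN K" for a kk
 proof -
 obtain u where "u IN x" "a = q u" using q(2) a by blast
 then show ?thesis
 using a w w[of "kk \<odot>\<^bsub>x\<^esub> u"] lin_smult[OF q(1)] lin_smult[OF g] m_smult_closed[OF x] by simp
 qed
 ultimately show ?thesis by (auto simp: linear_maps_def)
qed

context k_alg
begin

lemma D_factor:
 assumes q: "q : Ar MR" "!!z. z IN (cod q) ==> EX u:carrier (fst q). z = afun q u"
 and g: "g : Ar MR" "fst g = fst q" and \<theta>: "inj_on \<theta> (carrier (cod g))"
 and \<Phi>: "!!x. x IN (fst q) ==> \<theta> (afun g x) = \<Phi> (afun q x)"
 shows "factor_through MR q g : Ar MR" "fst (factor_through MR q g) = cod q" "cod (factor_through MR q g) = cod g"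
 "x IN (fst q) ==> afun (factor_through MR q g) (afun q x) = afun g x"
 "z IN (cod q) ==> \<theta> (afun (factor_through MR q g) z) = \<Phi> z"
proof -
 have x: "rm K B (fst q)" using q(1) by simp
 have "w : rlm K B (cod q) (cod g)" if w: "!!x. x IN (fst q) ==> w (afun q x) = afun g x" for w
 proof (rule rlmI)
 show "w : lm K (cod q) (cod g)"
 by (rule linear_surj[where x = "fst q" and q = "afun q" and g = "afun g", OF arrow_lin(2)[OF q(1)] q(2) _ rm_module[OF x] w]) (use arrow_lin(2)[OF g(1)] g(2) in auto)
 fix z b assume z: "z IN (cod q)" and b: "b IN B"
 obtain u where "u IN (fst q)" "z = afun q u" using q(2)[OF z] by blast
 then show "w (ract (cod q) z b) = ract (cod g) (w z) b"
 using b w w[of "ract (fst q) u b"] rm_closed[OF x] arrow_equi(3)[OF q(1) refl] arrow_equi(3)[OF g] by simp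
 qed
 from D.factor_surj[OF q g \<theta> \<Phi> this] show "factor_through MR q g : Ar MR" "fst (factor_through MR q g) = cod q"
 "cod (factor_through MR q g) = cod g" "x IN (fst q) ==> afun (factor_through MR q g) (afun q x) = afun g x"
 "z IN (cod q) ==> \<theta> (afun (factor_through MR q g) z) = \<Phi> z" by simp_all
qed

lemma C_factor:
 assumes q: "q : Ar RMR" "!!z. z IN (cod q) ==> EX u:carrier (fst q). z = afun q u"
 and g: "g : Ar RMR" "fst g = fst q" and \<theta>: "inj_on \<theta> (carrier (cod g))"
 and \<Phi>: "!!x. x IN (fst q) ==> \<theta> (afun g x) = \<Phi> (afun q x)"
 shows "factor_through RMR q g : Ar RMR" "fst (factor_through RMR q g) = cod q" "cod (factor_through RMR q g) = cod g"
 "x IN (fst q) ==> afun (factor_through RMR q g) (afun q x) = afun g x"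
 "z IN (cod q) ==> \<theta> (afun (factor_through RMR q g) z) = \<Phi> z"
proof -
 have x: "bm K B (fst q)" using q(1) by simp
 have "w : blm K B (cod q) (cod g)" if w: "!!x. x IN (fst q) ==> w (afun q x) = afun g x" for w
 proof (rule blmI)
 show "w : lm K (cod q) (cod g)"
 by (rule linear_surj[where x = "fst q" and q = "afun q" and g = "afun g", OF arrow_lin(1)[OF q(1)] q(2) _ rm_module[OF bm_rm[OF x]] w]) (use arrow_lin(1)[OF g(1)] g(2) in auto)
 fix z b assume z: "z IN (cod q)" and b: "b IN B"
 obtain u where "u IN (fst q)" "z = afun q u" using q(2)[OF z] by blast
 then show "w (ract (cod q) z b) = ract (cod g) (w z) b" "w (lact (cod q) b z) = lact (cod g) b (w z)"
 using b w w[of "ract (fst q) u b"] w[of "lact (fst q) b u"] rm_closed[OF bm_rm[OF x]] bm_closed[OF x]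
 arrow_equi(1,2)[OF q(1) refl] arrow_equi(1,2)[OF g] by simp_all
 qed
 from C.factor_surj[OF q g \<theta> \<Phi> this] show "factor_through RMR q g : Ar RMR" "fst (factor_through RMR q g) = cod q"
 "cod (factor_through RMR q g) = cod g" "x IN (fst q) ==> afun (factor_through RMR q g) (afun q x) = afun g x"
 "z IN (cod q) ==> \<theta> (afun (factor_through RMR q g) z) = \<Phi> z" by simp_all
qed

end

section \<open>Explicit coequalizers in right modules and in bimodules\<close>

context dk
begin

text \<open>Allows factoring through maps such as A \<otimes> q or q \<otimes> A, where q is a
  projection to a quotient.\<close>

lemma tmap_surj:
 assumes M: "rm K R M" and N: "bm K R N" and M': "rm K R M'" and N': "bm K R N'"
 and f: "f : rlm K R M M'" and g: "g : blm K R N N'"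
 and fs: "!!z. z IN M' ==> EX u:carrier M. z = f u" and gs: "!!z. z IN N' ==> EX u:carrier N. z = g u"
 and z: "z IN (tens R M' N')"
 shows "EX u:carrier (tens R M N). z = tmap R M N M' N' f g u"
proof -
 note tm = R.tmap_lin[OF M N M' N' f g]
 show ?thesis
 using M' N' z
 proof (induction z rule: R.tens_induct)
 case zero
 have "tmap R M N M' N' f g \<zero>\<^bsub>tens R M N\<^esub> = \<zero>\<^bsub>tens R M' N'\<^esub>"
 by (rule lin_zero[OF tm]) (use M N M' N' in simp_all)
 then show ?case using M N by (metis R.tens_module m_zero_closed)
 next
 case (add m n z)
 obtain u where u: "u IN (tens R M N)" "z = tmap R M N M' N' f g u" using add by blast
 obtain m' n' where mn: "m' IN M" "m = f m'" "n' IN N" "n = g n'" using fs gs add by meson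
 have "pt R M' N' m n \<oplus>\<^bsub>tens R M' N'\<^esub> z = tmap R M N M' N' f g (pt R M N m' n' \<oplus>\<^bsub>tens R M N\<^esub> u)"
 using u mn by (simp add: lin_add[OF tm] R.tmap_ptens[OF M N M' N' f g])
 moreover have "pt R M N m' n' \<oplus>\<^bsub>tens R M N\<^esub> u IN (tens R M N)" using u mn M N by simp
 ultimately show ?case by blast
 qed
qed

abbreviation "bal_f mu Y \<equiv> AM mu (IR Y)"
abbreviation "bal_g M Y l \<equiv> CM (AM (IM M) l) (ActAssoc R.MR M A' Y)"

text \<open>Records only source and target of an action; the module axioms enter through
  \<open>ident_right\<close>.\<close>

definition is_act where
 "is_act M mu \<longleftrightarrow> rm K R M & mu : Ar R.MR & fst mu = rtens R M A' & cod mu = M"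

definition is_lact where
 "is_lact Y l \<longleftrightarrow> bm K R Y & l : Ar R.RMR & fst l = btens R A' Y & cod l = Y"

lemma act_simps:
 "is_act M mu ==> rm K R M" "is_act M mu ==> mu : Ar R.MR" "is_act M mu ==> fst mu = rtens R M A'" "is_act M mu ==> cod mu = M"
 "is_lact Y l ==> bm K R Y" "is_lact Y l ==> l : Ar R.RMR" "is_lact Y l ==> fst l = btens R A' Y" "is_lact Y l ==> cod l = Y"
 by (simp_all add: is_act_def is_lact_def)

lemma bal_fg:
 assumes "is_act M mu" "is_lact Y l"
 shows "bal_f mu Y : Ar R.MR" "bal_g M Y l : Ar R.MR" "fst (bal_f mu Y) = rtens R (rtens R M A') Y" "fst (bal_g M Y l) = rtens R (rtens R M A') Y"
 "cod (bal_f mu Y) = rtens R M Y" "cod (bal_g M Y l) = rtens R M Y"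
 "[|m IN M; a IN A'; y IN Y|] ==>
 afun (bal_f mu Y) (pt R (rtens R M A') Y (pt R M A' m a) y) = pt R M Y (afun mu (pt R M A' m a)) y"
 "[|m IN M; a IN A'; y IN Y|] ==>
 afun (bal_g M Y l) (pt R (rtens R M A') Y (pt R M A' m a) y) = pt R M Y m (afun l (pt R A' Y a y))"
 using act_simps(1-4)[OF assms(1)] act_simps(5-8)[OF assms(2)] by simp_all

lemma bal_fg_ext:
 assumes a: "is_act M mu" "is_lact Y l" and h: "h : Ar R.MR" "fst h = rtens R M Y"
 and e: "!!m a y. m IN M ==> a IN A' ==> y IN Y ==>
 afun h (pt R M Y (afun mu (pt R M A' m a)) y) = afun h (pt R M Y m (afun l (pt R A' Y a y)))"
 and u: "u IN (tens R (rtens R M A') Y)"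
 shows "afun h (afun (bal_f mu Y) u) = afun h (afun (bal_g M Y l) u)"
proof -
 note s = act_simps(1-4)[OF a(1)] act_simps(5-8)[OF a(2)] and fg = bal_fg[OF a]
 have "CM h (bal_f mu Y) = CM h (bal_g M Y l)"
 by (rule R.D_ext3l[where L = M and M = A' and N = Y])
 (use s h e in "simp_all add: fg")
 then have "afun (CM h (bal_f mu Y)) u = afun (CM h (bal_g M Y l)) u" by simp
 then show ?thesis using u fg h by (simp del: R.D_app)
qed

text \<open>\<open>q0\<close> equalizes the pair because its target is balanced over the algebra, it
  is onto, and \<open>induced\<close> supplies the factorizations.\<close>

lemma D_coequalizer:
 fixes W :: "('k, 'a univ) bimod"
 assumes a: "is_act M mu" "is_lact Y l" and jM: "ident_right M (afun mu) V j" and kY: "ident_left Y (afun l) W k"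
 shows "is_coequalizer R.MR (bal_f mu Y) (bal_g M Y l) (rtens R M Y, q0 M Y V W j k, resR (rtens BA V W))"
proof -
 note s = act_simps(1-4)[OF a(1)] act_simps(5-8)[OF a(2)] and fg = bal_fg[OF a]
 note ctx = s(1,5) jM kY
 note qp = q0_ptens[OF ctx] and ql = q0_lin[OF ctx] and qs = q0_surj[OF ctx] and qr = q0_ract[OF ctx]
 have VW: "rm K BA V" "bm K BA W" using jM kY by (simp_all add: ident_right_def ident_left_def)
 let ?Z = "resR (rtens BA V W)" and ?q = "(rtens R M Y, q0 M Y V W j k, resR (rtens BA V W))"
 have linZ: "lm K N ?Z = lm K N (tens BA V W)" "lm K ?Z N = lm K (tens BA V W) N" for N
 by (rule lm_cong; simp)+
 have Z: "rm K R ?Z" using VW by simp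
 have "q0 M Y V W j k : rlm K R (rtens R M Y) ?Z"
 proof (rule rlmI)
 show "q0 M Y V W j k : lm K (rtens R M Y) ?Z" using ql by (simp add: linZ)
 show "q0 M Y V W j k (ract (rtens R M Y) x b) = ract ?Z (q0 M Y V W j k x) b" if "x IN (rtens R M Y)" "b IN R" for x b
 using that qr lin_closed[OF ql] by simp
 qed
 moreover have "q0 M Y V W j k \<in> extensional (carrier (tens R M Y))"
 by (simp add: q0_def)
 ultimately have qa: "?q : Ar R.MR" using Z s by (simp add: D.ar_iff del: arrow_ob)
 have eq: "q0 M Y V W j k (pt R M Y (afun mu (pt R M A' m x)) y) = q0 M Y V W j k (pt R M Y m (afun l (pt R A' Y x y)))"
 if "m IN M" "x IN A'" "y IN Y" for m x y
 proof -
 have cl: "afun mu (pt R M A' m x) IN M" "afun l (pt R A' Y x y) IN Y"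
 "j (afun mu (pt R M A' m x)) = ract V (j m) x" "k (afun l (pt R A' Y x y)) = lact W x (k y)"
 "j m IN V" "k y IN W"
 using jM kY that lin_closed[of j K M V m] lin_closed[of k K Y W y] by (auto simp: ident_right_def ident_left_def)
 then show ?thesis using that VW by (simp add: qp Q.lin_simps)
 qed
 show ?thesis
 proof (rule D.is_coequalizerI)
 show "afun ?q (afun (bal_f mu Y) u) = afun ?q (afun (bal_g M Y l) u)" if "u IN (fst (bal_f mu Y))" for u
 by (rule bal_fg_ext[OF a qa]) (use eq that in simp_all, use s in simp)
 show "EX u:carrier (fst ?q). z = afun ?q u" if "z IN (cod ?q)" for z
 using qs that by simp
 next
 fix h assume h: "h : Ar R.MR" "fst h = cod (bal_f mu Y)" and
 e: "!!u. u IN (fst (bal_f mu Y)) ==> afun h (afun (bal_f mu Y) u) = afun h (afun (bal_g M Y l) u)"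
 have hb: "afun h (pt R M Y (afun mu (pt R M A' m x)) y) = afun h (pt R M Y m (afun l (pt R A' Y x y)))"
 if "m IN M" "x IN A'" "y IN Y" for m x y
 using e[of "pt R (rtens R M A') Y (pt R M A' m x) y"] fg that s by simp
 let ?N = "cod h"
 have N: "rm K R ?N" "module K ?N" using h(1) by simp_all
 have hl: "afun h : lm K (tens R M Y) ?N" using arrow_lin(2)[OF h(1)] h s by simp
 obtain u where u: "!!x. x IN (tens R M Y) ==> u (q0 M Y V W j k x) = afun h x"
 using induced[OF ctx N(2) hl hb] by blast
 have surj: "EX u:carrier (fst ?q). z = afun ?q u" if "z IN (cod ?q)" for z using qs that by simp
 show "EX u : Ar R.MR. fst u = cod ?q & cod u = ?N & (ALL x:carrier (fst ?q). afun u (afun ?q x) = afun h x)"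
 by (rule bexI[of _ "factor_through R.MR ?q h"]; (intro conjI ballI)?)
 (rule R.D_factor[OF qa surj h(1) _ inj_on_id2, where \<Phi> = u]; use h(2) s u in simp)+
 qed (use qa fg in simp_all)
qed


abbreviation "cbal_f mu Y \<equiv> TR mu (IR Y)"
abbreviation "cbal_g M Y l \<equiv> CR (TR (IR M) l) (Assoc R.RMR M A' Y)"

text \<open>In bimodules the quotient also carries a left R-action, so \<open>V\<close> is taken to
  be a bimodule and \<open>j\<close> to respect the left action of R.\<close>

lemma C_coequalizer:
 fixes M Y V W :: "('k, 'a univ) bimod"
 assumes M: "bm K R M" and mu: "mu : Ar R.RMR" "fst mu = btens R M A'" "cod mu = M"
 and a: "is_lact Y l" and V: "bm K BA V"
 and jM: "ident_right M (afun mu) V j" and kY: "ident_left Y (afun l) W k"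
 and jl: "!!m r. m IN M ==> r IN R ==> j (lact M r m) = lact V (eta r) (j m)"
 shows "is_coequalizer R.RMR (cbal_f mu Y) (cbal_g M Y l) (btens R M Y, q0 M Y V W j k, resB (btens BA V W))"
proof -
 note s = bm_rm[OF M] act_simps(5-8)[OF a]
 note ctx = s(1,2) jM kY
 note qp = q0_ptens[OF ctx] and ql = q0_lin[OF ctx] and qs = q0_surj[OF ctx] and qr = q0_ract[OF ctx]
 have VW: "rm K BA V" "bm K BA W" using jM kY by (simp_all add: ident_right_def ident_left_def)
 have fg: "cbal_f mu Y : Ar R.RMR" "cbal_g M Y l : Ar R.RMR" "fst (cbal_f mu Y) = btens R (btens R M A') Y"
 "fst (cbal_g M Y l) = btens R (btens R M A') Y"
 "cod (cbal_f mu Y) = btens R M Y" "cod (cbal_g M Y l) = btens R M Y"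
 using M mu s by simp_all
 have fgp: "afun (cbal_f mu Y) (pt R (btens R M A') Y (pt R M A' m x) y) = pt R M Y (afun mu (pt R M A' m x)) y"
 "afun (cbal_g M Y l) (pt R (btens R M A') Y (pt R M A' m x) y) = pt R M Y m (afun l (pt R A' Y x y))"
 if "m IN M" "x IN A'" "y IN Y" for m x y
 using M mu s that by simp_all
 let ?Z = "resB (btens BA V W)" and ?q = "(btens R M Y, q0 M Y V W j k, resB (btens BA V W))"
 have linZ: "lm K N ?Z = lm K N (tens BA V W)" "lm K ?Z N = lm K (tens BA V W) N" for N
 by (rule lm_cong; simp)+
 have Z: "bm K R ?Z" using V VW by simp
 have jk: "j m IN V" "k y IN W" if "m IN M" "y IN Y" for m y
 using jM kY that lin_closed[of j K M V m] lin_closed[of k K Y W y] by (auto simp: ident_right_def ident_left_def)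
 have qlact: "q0 M Y V W j k (lact (btens R M Y) r u) = lact (btens BA V W) (eta r) (q0 M Y V W j k u)"
 if r: "r IN R" and u: "u IN (tens R M Y)" for r u
 by (rule R.tens_ext[OF s(1,2) _ lin_comp[OF R.lact_lin[OF M s(2) r] ql] lin_comp[OF ql Q.lact_lin[OF V VW(2)]] _ u])
 (use r V VW M s jk jl in "simp_all add: qp")
 have "q0 M Y V W j k : blm K R (btens R M Y) ?Z"
 proof (rule blmI)
 show "q0 M Y V W j k : lm K (btens R M Y) ?Z" using ql by (simp add: linZ)
 show "q0 M Y V W j k (ract (btens R M Y) x b) = ract ?Z (q0 M Y V W j k x) b" if "x IN (btens R M Y)" "b IN R" for x b
 using that qr lin_closed[OF ql] by simp
 show "q0 M Y V W j k (lact (btens R M Y) b x) = lact ?Z b (q0 M Y V W j k x)" if "x IN (btens R M Y)" "b IN R" for x b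
 using that qlact lin_closed[OF ql] by simp
 qed
 moreover have "q0 M Y V W j k \<in> extensional (carrier (tens R M Y))"
 by (simp add: q0_def)
 ultimately have qa: "?q : Ar R.RMR" using Z s M by (simp add: C.ar_iff del: arrow_ob)
 have eq: "q0 M Y V W j k (pt R M Y (afun mu (pt R M A' m x)) y) = q0 M Y V W j k (pt R M Y m (afun l (pt R A' Y x y)))"
 if "m IN M" "x IN A'" "y IN Y" for m x y
 proof -
 have cl: "afun mu (pt R M A' m x) IN M" "afun l (pt R A' Y x y) IN Y"
 "j (afun mu (pt R M A' m x)) = ract V (j m) x" "k (afun l (pt R A' Y x y)) = lact W x (k y)"
 using jM kY that by (auto simp: ident_right_def ident_left_def)
 then show ?thesis using that VW jk by (simp add: qp Q.lin_simps)
 qed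
 have ext: "afun h (afun (cbal_f mu Y) u) = afun h (afun (cbal_g M Y l) u)"
 if h: "h : Ar R.RMR" "fst h = btens R M Y" and e: "!!m a y. m IN M ==> a IN A' ==> y IN Y ==>
 afun h (pt R M Y (afun mu (pt R M A' m a)) y) = afun h (pt R M Y m (afun l (pt R A' Y a y)))"
 and u: "u IN (tens R (btens R M A') Y)" for h u
 proof -
 have "CR h (cbal_f mu Y) = CR h (cbal_g M Y l)"
 by (rule R.C_ext3l[where L = M and M = A' and N = Y]) (use s h e M mu in simp_all)
 then have "afun (CR h (cbal_f mu Y)) u = afun (CR h (cbal_g M Y l)) u" by simp
 then show ?thesis using u fg h by (simp del: R.C_app)
 qed
 show ?thesis
 proof (rule C.is_coequalizerI)
 show "afun ?q (afun (cbal_f mu Y) u) = afun ?q (afun (cbal_g M Y l) u)" if "u IN (fst (cbal_f mu Y))" for u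
 by (rule ext[OF qa]) (use eq that M mu in simp_all)
 show "EX u:carrier (fst ?q). z = afun ?q u" if "z IN (cod ?q)" for z
 using qs that by simp
 next
 fix h assume h: "h : Ar R.RMR" "fst h = cod (cbal_f mu Y)" and
 e: "!!u. u IN (fst (cbal_f mu Y)) ==> afun h (afun (cbal_f mu Y) u) = afun h (afun (cbal_g M Y l) u)"
 have hb: "afun h (pt R M Y (afun mu (pt R M A' m x)) y) = afun h (pt R M Y m (afun l (pt R A' Y x y)))"
 if "m IN M" "x IN A'" "y IN Y" for m x y
 using e[of "pt R (btens R M A') Y (pt R M A' m x) y"] fgp that M mu s by simp
 let ?N = "cod h"
 have N: "bm K R ?N" "module K ?N" using h(1) by simp_all
 have hl: "afun h : lm K (tens R M Y) ?N" using arrow_lin(1)[OF h(1)] h M mu by simp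
 obtain u where u: "!!x. x IN (tens R M Y) ==> u (q0 M Y V W j k x) = afun h x"
 using induced[OF ctx N(2) hl hb] by blast
 have surj: "EX u:carrier (fst ?q). z = afun ?q u" if "z IN (cod ?q)" for z using qs that by simp
 show "EX u : Ar R.RMR. fst u = cod ?q & cod u = ?N & (ALL x:carrier (fst ?q). afun u (afun ?q x) = afun h x)"
 by (rule bexI[of _ "factor_through R.RMR ?q h"]; (intro conjI ballI)?)
 (rule R.C_factor[OF qa surj h(1) _ inj_on_id2, where \<Phi> = u]; use h(2) M mu u in simp)+
 qed (use qa fg in simp_all)
qed

text \<open>Coordinates on the chosen quotient: a preimage under \<open>q\<close> is projected to
  the tensor product over the algebra. The form with \<open>inv_into\<close> matches
  \<open>to_ord\<close>, with which it agrees when \<open>j\<close> and \<open>k\<close> are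
  identities.\<close>

definition "th M Y V W j k q z = q0 M Y V W j k (inv_into (carrier (tens R M Y)) (afun q) z)"

lemma th_props:
 fixes Y W :: "('k, 'a univ) bimod"
 assumes M: "rm K R M" and Y: "bm K R Y" and jM: "ident_right M mu V j" and kY: "ident_left Y l W k"
 and q: "!!u. u IN (tens R M Y) ==> afun q u \<in> T"
 and v: "bij_betw v T (carrier (tens BA V W))" "!!u. u IN (tens R M Y) ==> v (afun q u) = q0 M Y V W j k u"
 shows "z \<in> T ==> EX u:carrier (tens R M Y). z = afun q u"
 "z \<in> T ==> th M Y V W j k q z = v z" "u IN (tens R M Y) ==> th M Y V W j k q (afun q u) = q0 M Y V W j k u"
 "bij_betw (th M Y V W j k q) T (carrier (tens BA V W))"
proof -
 show surj: "EX u:carrier (tens R M Y). z = afun q u" if z: "z \<in> T" for z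
 proof -
 have "v z IN (tens BA V W)" using v z by (auto simp: bij_betw_def)
 then obtain u where u: "u IN (tens R M Y)" "v z = q0 M Y V W j k u" using q0_surj[OF M Y jM kY] by blast
 have "v z = v (afun q u)" using u v by simp
 then have "z = afun q u" using v(1) z q[OF u(1)] by (auto simp: bij_betw_def inj_on_def)
 then show ?thesis using u by blast
 qed
 show thv: "th M Y V W j k q z = v z" if z: "z \<in> T" for z
 proof -
 have z': "z \<in> afun q ` carrier (tens R M Y)" using surj[OF z] by blast
 show ?thesis unfolding th_def using v(2)[OF inv_into_into[OF z']] f_inv_into_f[OF z'] by simp
 qed
 show "th M Y V W j k q (afun q u) = q0 M Y V W j k u" if "u IN (tens R M Y)" for u
 using thv[OF q[OF that]] v that by simp
 show "bij_betw (th M Y V W j k q) T (carrier (tens BA V W))"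
 using v(1) thv bij_betw_cong[of T "th M Y V W j k q" v] by simp
qed

context
 fixes M mu V j Y l k and W :: "('k, 'a univ) bimod" and q
 assumes a: "is_act M mu" "is_lact Y l" and jM: "ident_right M (afun mu) V j" and kY: "ident_left Y (afun l) W k"
 and q_def: "q = balq R.RMR R.MR A' M mu Y l"
begin

text \<open>The choice in \<open>balq\<close> is legitimate because \<open>q0\<close> exhibits a
  coequalizer.\<close>

private lemma D_balq':
 "EX v : Ar R.MR. fst v = cod q & cod v = resR (rtens BA V W) &
 bij_betw (afun v) (carrier (cod q)) (carrier (tens BA V W)) & q : Ar R.MR & fst q = rtens R M Y &
 (ALL u:carrier (tens R M Y). afun v (afun q u) = q0 M Y V W j k u)"
proof -
 note D = D_coequalizer[OF a jM kY]
 have q: "is_coequalizer R.MR (bal_f mu Y) (bal_g M Y l) q"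
 unfolding q_def balq_def by (rule someI[of _ "(rtens R M Y, q0 M Y V W j k, resR (rtens BA V W))"], rule D)
 then have "q : Ar R.MR" "fst q = rtens R M Y"
 using bal_fg[OF a] by (auto simp: D.coequalizer_iff)
 with D.coequalizer_compare[OF q D] show ?thesis by simp
qed

lemma D_balq:
 shows "q : Ar R.MR" "fst q = rtens R M Y"
 "z IN (cod q) ==> EX u:carrier (tens R M Y). z = afun q u"
 "u IN (tens R M Y) ==> th M Y V W j k q (afun q u) = q0 M Y V W j k u"
 "bij_betw (th M Y V W j k q) (carrier (cod q)) (carrier (tens BA V W))"
 "th M Y V W j k q : lm K (cod q) (tens BA V W)"
 "z IN (cod q) ==> r IN R ==> th M Y V W j k q (ract (cod q) z r) = ract (rtens BA V W) (th M Y V W j k q z) (eta r)"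
proof -
 obtain v where v: "v : Ar R.MR" "fst v = cod q" "cod v = resR (rtens BA V W)"
 "bij_betw (afun v) (carrier (cod q)) (carrier (tens BA V W))" and q: "q : Ar R.MR" "fst q = rtens R M Y"
 and e: "!!u. u IN (tens R M Y) ==> afun v (afun q u) = q0 M Y V W j k u"
 using D_balq' by blast
 have qc: "afun q u IN (cod q)" if "u IN (tens R M Y)" for u using D.app_closed[OF q(1)] q that by simp
 note p = th_props[OF act_simps(1)[OF a(1)] act_simps(5)[OF a(2)] jM kY qc v(4) e]
 show "q : Ar R.MR" "fst q = rtens R M Y"
 "z IN (cod q) ==> EX u:carrier (tens R M Y). z = afun q u"
 "u IN (tens R M Y) ==> th M Y V W j k q (afun q u) = q0 M Y V W j k u"
 "bij_betw (th M Y V W j k q) (carrier (cod q)) (carrier (tens BA V W))"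
 using q p by blast+
 have "afun v : lm K (cod q) (resR (rtens BA V W))" using arrow_lin(2)[OF v(1)] v by simp
 also have "... = lm K (cod q) (tens BA V W)" by (rule lm_cong) simp_all
 finally have vl: "afun v : lm K (cod q) (tens BA V W)" .
 have rm: "rm K R (cod q)" using q(1) by simp
 show "th M Y V W j k q : lm K (cod q) (tens BA V W)"
 by (rule lin_cong[OF vl _ rm_module[OF rm]]) (simp add: p(2))
 show "th M Y V W j k q (ract (cod q) z r) = ract (rtens BA V W) (th M Y V W j k q z) (eta r)"
 if "z IN (cod q)" "r IN R"
 using that p(2) rm_closed[OF rm] arrow_equi(3)[OF v(1,2)] v(3) lin_closed[OF vl] by simp
qed

end

context
 fixes M V Y W :: "('k, 'a univ) bimod" and mu j l k q
 assumes M: "bm K R M" and mu: "mu : Ar R.RMR" "fst mu = btens R M A'" "cod mu = M"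
 and a: "is_lact Y l" and V: "bm K BA V"
 and jM: "ident_right M (afun mu) V j" and kY: "ident_left Y (afun l) W k"
 and jl: "!!m r. m IN M ==> r IN R ==> j (lact M r m) = lact V (eta r) (j m)"
 and q_def: "q = balq R.RMR (self_action R.RMR) A' M mu Y l"
begin

private lemma C_balq':
 "EX v : Ar R.RMR. fst v = cod q & cod v = resB (btens BA V W) &
 bij_betw (afun v) (carrier (cod q)) (carrier (tens BA V W)) & q : Ar R.RMR & fst q = btens R M Y &
 (ALL u:carrier (tens R M Y). afun v (afun q u) = q0 M Y V W j k u)"
proof -
 note D = C_coequalizer[OF M mu a V jM kY jl]
 have q: "is_coequalizer R.RMR (cbal_f mu Y) (cbal_g M Y l) q"
 unfolding q_def balq_def by (simp, rule someI[of _ "(btens R M Y, q0 M Y V W j k, resB (btens BA V W))"], rule D)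
 then have "q : Ar R.RMR" "fst q = btens R M Y"
 using mu by (auto simp: C.coequalizer_iff)
 with C.coequalizer_compare[OF q D] show ?thesis by simp
qed

lemma C_balq:
 shows "q : Ar R.RMR" "fst q = btens R M Y"
 "z IN (cod q) ==> EX u:carrier (tens R M Y). z = afun q u"
 "u IN (tens R M Y) ==> th M Y V W j k q (afun q u) = q0 M Y V W j k u"
 "bij_betw (th M Y V W j k q) (carrier (cod q)) (carrier (tens BA V W))"
 "th M Y V W j k q : lm K (cod q) (tens BA V W)"
 "z IN (cod q) ==> r IN R ==> th M Y V W j k q (ract (cod q) z r) = ract (btens BA V W) (th M Y V W j k q z) (eta r)"
 "z IN (cod q) ==> r IN R ==> th M Y V W j k q (lact (cod q) r z) = lact (btens BA V W) (eta r) (th M Y V W j k q z)"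
proof -
 obtain v where v: "v : Ar R.RMR" "fst v = cod q" "cod v = resB (btens BA V W)"
 "bij_betw (afun v) (carrier (cod q)) (carrier (tens BA V W))" and q: "q : Ar R.RMR" "fst q = btens R M Y"
 and e: "!!u. u IN (tens R M Y) ==> afun v (afun q u) = q0 M Y V W j k u"
 using C_balq' by blast
 have qc: "afun q u IN (cod q)" if "u IN (tens R M Y)" for u using C.app_closed[OF q(1)] q that by simp
 note p = th_props[OF bm_rm[OF M] act_simps(5)[OF a] jM kY qc v(4) e]
 show "q : Ar R.RMR" "fst q = btens R M Y"
 "z IN (cod q) ==> EX u:carrier (tens R M Y). z = afun q u"
 "u IN (tens R M Y) ==> th M Y V W j k q (afun q u) = q0 M Y V W j k u"
 "bij_betw (th M Y V W j k q) (carrier (cod q)) (carrier (tens BA V W))"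
 using q p by blast+
 have "afun v : lm K (cod q) (resB (btens BA V W))" using arrow_lin(1)[OF v(1)] v by simp
 also have "... = lm K (cod q) (tens BA V W)" by (rule lm_cong) simp_all
 finally have vl: "afun v : lm K (cod q) (tens BA V W)" .
 have bm: "bm K R (cod q)" using q(1) by simp
 show "th M Y V W j k q : lm K (cod q) (tens BA V W)"
 by (rule lin_cong[OF vl _ rm_module[OF bm_rm[OF bm]]]) (simp add: p(2))
 show "th M Y V W j k q (ract (cod q) z r) = ract (btens BA V W) (th M Y V W j k q z) (eta r)"
 "th M Y V W j k q (lact (cod q) r z) = lact (btens BA V W) (eta r) (th M Y V W j k q z)"
 if "z IN (cod q)" "r IN R"
 using that p(2) rm_closed[OF bm_rm[OF bm]] bm_closed[OF bm] arrow_equi(1,2)[OF v(1,2)] v(3) lin_closed[OF vl] by simp_all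
qed

end

end

section \<open>The coring \<open>A \<otimes> X\<close>\<close>

lemma (in k_alg) balanced_lin:
 assumes "rm K B M" "bm K B N" "balanced K B M N P F" "L : lm K P Q"
 "!!m n. m IN M ==> n IN N ==> F' m n = L (F m n)"
 shows "balanced K B M N Q F'"
 by (rule balancedI) (use assms in "simp_all add: lin_closed[OF assms(4)] lin_add[OF assms(4)] lin_smult[OF assms(4)]
 bal_closed[OF assms(3)] bal_addl[OF assms(3)] bal_addr[OF assms(3)] bal_bal[OF assms(3)] bal_smult[OF assms(3)]")

context dk
begin

abbreviation (input) "tX \<equiv> tens R A' X"
abbreviation (input) "pX \<equiv> ptens R A' X"

definition "CC = cowreath_coring R.RMR A' mm X psi \<delta> ff"
definition "YY = ord_cor_ob R A' CC"
definition "la a w = afun (cor_lact CC) (pt R A' AX a w)"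
definition "ra w b = afun (cor_ract CC) (pt R AX A' w b)"

lemma CC_simps [simp]:
 "cor_ob CC = AX" "cor_lact CC = absorb X"
 "cor_ract CC = CR (TR mm (IR X)) (CR (R.AssocI A' A' X)
 (CR (TR (IR A') psi) (Assoc R.RMR A' X A')))"
 by (simp_all add: CC_def cowreath_coring_def free_lact_def cowreath_ract_def R.inv_arrows)

lemma AX_simps [simp]: "bm K R AX" "rm K R AX" "module K (tX)"
 by simp_all

lemma cor_act_ar [simp]: "cor_lact CC : Ar R.RMR" "fst (cor_lact CC) = btens R A' AX" "cod (cor_lact CC) = AX"
 "cor_ract CC : Ar R.RMR" "fst (cor_ract CC) = btens R AX A'" "cod (cor_ract CC) = AX"
 by simp_all

lemma cor_act_lin: "afun (cor_lact CC) : lm K (tens R A' AX) (tX)"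
 "afun (cor_ract CC) : lm K (tens R AX A') (tX)"
 using ar_lin[OF cor_act_ar(1-3)] ar_lin[OF cor_act_ar(4-6)] by simp_all

lemma la_ra_closed [simp]: "a IN A' ==> w IN (tX) ==> la a w IN (tX)"
 "a IN A' ==> w IN (tX) ==> ra w a IN (tX)"
 unfolding la_def ra_def by (rule lin_closed[OF cor_act_lin(1)], simp) (rule lin_closed[OF cor_act_lin(2)], simp)

lemma la_lin: "a IN A' ==> (%w. la a w) : lm K (tX) (tX)"
 "w IN (tX) ==> (%a. la a w) : lm K A' (tX)"
 using lin_comp[OF ptens_right_lin[of A' AX a] cor_act_lin(1)] lin_comp[OF ptens_left_lin[of A' AX w] cor_act_lin(1)]
 by (simp_all add: la_def)

lemma ra_lin: "a IN A' ==> (%w. ra w a) : lm K (tX) (tX)"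
 "w IN (tX) ==> (%a. ra w a) : lm K A' (tX)"
 using lin_comp[OF ptens_left_lin[of AX A' a] cor_act_lin(2)] lin_comp[OF ptens_right_lin[of AX A' w] cor_act_lin(2)]
 by (simp_all add: ra_def)

lemma la_ptens [simp]: "a IN A' ==> b IN A' ==> x IN C ==> la a (pX b x) = pX (am a b) x"
 unfolding la_def CC_simps(2) by (rule absorb_ptens) simp_all

text \<open>The right action passes b through \<psi> and then multiplies, hence (a \<otimes> x) b =
  a b_0 \<otimes> x b_1.\<close>

lemma ra_ptens:
 assumes "a IN A'" "b IN A'" "x IN C"
 shows "ra (pX a x) b = tf (tX) (%b0 h. pX (am a b0) (ract C x h)) (rho b)"
proof -
 have "ra (pX a x) b = la a (afun psi (pt R X A' x b))"
 using assms by (simp add: ra_def la_def del: psi_app)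
 also have "... = tf (tX) (%b0 h. la a (pX b0 (ract C x h))) (rho b)"
 by (rule psi_fuse) (use la_lin assms in simp_all)
 also have "... = tf (tX) (%b0 h. pX (am a b0) (ract C x h)) (rho b)"
 by (rule rho_cong) (use assms in simp_all)
 finally show ?thesis .
qed

lemma ra_bal: "a IN A' ==> x IN C ==> balanced K R A' Hb (tX) (%b0 h. pX (am a b0) (ract C x h))"
 by (rule R.balanced_lin[OF A'_rm Hb_bm psi_inner_bal[of x] la_lin(1)[of a]]) simp_all

lemma AX_ext:
 assumes "f : lm K (tX) P" "g : lm K (tX) P" "module K P"
 "!!a x. a IN A' ==> x IN C ==> f (pX a x) = g (pX a x)" "w IN (tX)"
 shows "f w = g w"
 by (rule R.tens_ext[OF A'_rm X_bm assms(3,1,2)]) (use assms in simp_all)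

text \<open>The main case is associativity on the right: it is multiplicativity of the coaction of A
  together with associativity of the action of H on C.\<close>

lemma la_ra_action:
 assumes w: "w IN (tX)" and a: "a IN A'" and b: "b IN A'"
 shows "la (am a b) w = la a (la b w)" "la uno w = w" "ra w (am a b) = ra (ra w a) b" "ra w uno = w"
 "ra (la a w) b = la a (ra w b)"
proof -
 note m = AX_simps(3)
 show "la (am a b) w = la a (la b w)"
 by (rule AX_ext[OF la_lin(1) lin_comp[OF la_lin(1) la_lin(1)] m _ w]) (use a b in "simp_all add: am_assoc")
 show "la uno w = w"
 by (rule AX_ext[OF la_lin(1) lin_id m _ w]) simp_all
 show "ra (la a w) b = la a (ra w b)"
 proof (rule AX_ext[OF lin_comp[OF la_lin(1) ra_lin(1)] lin_comp[OF ra_lin(1) la_lin(1)] m _ w])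
 fix c x assume c: "c IN A'" "x IN C"
 have "la a (ra (pX c x) b) = tf (tX) (%b0 h. la a (pX (am c b0) (ract C x h))) (rho b)"
 unfolding ra_ptens[OF c(1) b c(2)] by (rule rho_fuse) (use a b c la_lin in simp_all)
 also have "... = tf (tX) (%b0 h. pX (am (am a c) b0) (ract C x h)) (rho b)"
 by (rule rho_cong) (use a b c in "simp_all add: am_assoc")
 finally show "ra (la a (pX c x)) b = la a (ra (pX c x) b)"
 using a b c by (simp add: ra_ptens)
 qed (use a b in simp_all)
 show "ra w uno = w"
 proof (rule AX_ext[OF ra_lin(1) lin_id m _ w])
 fix c x assume c: "c IN A'" "x IN C"
 then show "ra (pX c x) uno = pX c x"
 using ra_bal[OF c] Hb_bm by (simp add: ra_ptens rho_uno)
 qed simp_all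
 show "ra w (am a b) = ra (ra w a) b"
 proof (rule AX_ext[OF ra_lin(1) lin_comp[OF ra_lin(1) ra_lin(1)] m _ w])
 fix c x assume c: "c IN A'" "x IN C"
 have "ra (ra (pX c x) a) b = tf (tX) (%a0 h. ra (pX (am c a0) (ract C x h)) b) (rho a)"
 unfolding ra_ptens[OF c(1) a c(2)] by (rule rho_fuse) (use a b c ra_lin in simp_all)
 also have "... = tf (tX) (%a0 h. tf (tX) (%b0 g. pX (am c (am a0 b0)) (ract C x (h \<star> g))) (rho b)) (rho a)"
 proof (rule rho_cong[OF m a])
 fix a0 h assume h: "a0 IN A'" "h IN H"
 show "ra (pX (am c a0) (ract C x h)) b = tf (tX) (%b0 g. pX (am c (am a0 b0)) (ract C x (h \<star> g))) (rho b)"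
 using h c b by (simp add: ra_ptens, intro rho_cong[OF m]) (simp_all add: am_assoc rm_mult[OF C_rm])
 qed
 also have "... = ra (pX c x) (am a b)"
 using rho_am[OF m ra_bal[OF c] a b] a b c by (simp add: ra_ptens)
 finally show "ra (pX c x) (am a b) = ra (ra (pX c x) a) b" by simp
 qed (use a b in simp_all)
qed

abbreviation (input) "tYY \<equiv> tens BA YY YY"
abbreviation (input) "pYY \<equiv> ptens BA YY YY"

lemma YY_simps [simp]:
 "carrier YY = carrier (tX)" "add YY = add (tX)" "zero YY = zero (tX)" "smult YY = smult (tX)"
 "w IN (tX) ==> a IN A' ==> ract YY w a = ra w a"
 "w IN (tX) ==> a IN A' ==> lact YY a w = la a w"
 by (simp_all add: YY_def ord_cor_ob_def ord_bimod_def la_def ra_def del: CC_simps(2,3))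

lemma YY_lin: "lm K YY N = lm K (tX) N" "lm K N YY = lm K N (tX)"
 by (rule lm_cong; simp)+

lemma YY_bm [simp]: "bm K BA YY"
proof (rule bimoduleI[OF right_moduleI])
 show "module K YY" by (rule mod_cong[OF AX_simps(3)]) simp_all
 show "on_carriers (carrier YY) (carrier BA) (ract YY) = ract YY" "on_carriers (carrier BA) (carrier YY) (lact YY) = lact YY"
 by (simp_all add: YY_def ord_cor_ob_def ord_bimod_def)
qed (simp_all add: la_ra_action(1,3,5) la_ra_action(2,4)[OF _ uno_closed uno_closed] lin_add[OF la_lin(1)] lin_add[OF la_lin(2)] lin_add[OF ra_lin(1)] lin_add[OF ra_lin(2)]
 lin_smult[OF la_lin(1)] lin_smult[OF la_lin(2)] lin_smult[OF ra_lin(1)] lin_smult[OF ra_lin(2)])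

text \<open>Restricting the A-actions along i has to give back the R-bimodule A \<otimes> X, so that
  tensor products over R and over the algebra can be compared. On the right this is \<psi>(x
  \<otimes> i(r)) = 1 \<otimes> x r.\<close>

lemma la_ra_eta:
 assumes w: "w IN (tX)" and r: "r IN R"
 shows "ract AX w r = ra w (eta r)" "lact AX r w = la (eta r) w"
proof -
 note m = AX_simps(3)
 show "lact AX r w = la (eta r) w"
 by (rule AX_ext[OF R.lact_lin la_lin(1) m _ w]) (use r in "simp_all add: am_eta")
 have "ract (rtens R A' X) w r = ra w (eta r)"
 proof (rule AX_ext[OF R.ract_lin ra_lin(1) m _ w])
 fix a x assume a: "a IN A'" "x IN C"
 have "ra (pX a x) (eta r) = la a (afun psi (pt R X A' x (eta r)))"
 using a r by (simp add: ra_def la_def del: psi_app)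
 also have "... = pX a (ract X x r)"
 using a r rm_closed[OF X_rm, of x r] by (simp add: psi_eta del: psi_app hb_simps(7))
 finally show "ract (rtens R A' X) (pX a x) r = ra (pX a x) (eta r)"
 using a r by (simp del: hb_simps(7))
 qed (use r in simp_all)
 then show "ract AX w r = ra w (eta r)" by simp
qed

lemma ident_YY: "ident_left AX (afun (cor_lact CC)) YY (%y. y)" "ident_right AX (afun (cor_ract CC)) YY (%y. y)"
 using la_ra_eta lin_id[of K "tX"]
 by (simp_all add: ident_left_def ident_right_def YY_lin bij_betw_def flip: la_def ra_def del: CC_simps(2,3) btens_simps(5))

lemma ident_A: "ident_left A' (afun mm) (rg BA) (%y. y)"
proof -
 have "lm K A' (rg BA) = lm K A' A'" by (rule lm_cong) simp_all
 then show ?thesis using lin_id[of K A'] by (simp add: ident_left_def bij_betw_def am_eta)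
qed

lemma is_lact_CC: "is_lact AX (cor_lact CC)" "is_lact A' mm"
 by (simp_all add: is_lact_def del: CC_simps(2))

text \<open>From here the two actions are used only through the element rules for \<open>la\<close>
  and \<open>ra\<close>.\<close>

declare CC_simps(2,3) [simp del]

end

section \<open>Tensoring with A \<otimes> X over the algebra and tensoring with X over R\<close>

context dk
begin

text \<open>\<open>Up\<close> and \<open>Jp\<close> are the mutually inverse maps between \<open>V \<otimes>\<^sub>B (A \<otimes>\<^sub>R X)\<close> and \<open>V \<otimes>\<^sub>R X\<close>,
 where \<open>M\<close> is \<open>V\<close> with the scalars restricted to \<open>R\<close>.\<close>

definition "Up M V = tf (tens R M X) (%v y. tf (tens R M X) (%a x. pt R M X (ract V v a) x) y)"
definition "Jp V = tf (tens BA V YY) (%v x. pt BA V YY v (pX uno x))"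

text \<open>A relation rather than the equation \<open>M = resR V\<close>, so that it also covers
  \<open>AX\<close>, with its given bimodule record, over the ordinary module
  \<open>YY\<close>.\<close>

definition "res_eq M V \<longleftrightarrow> rm K R M & rm K BA V & carrier M = carrier V & add M = add V & smult M = smult V &
 (ALL m:carrier V. ALL r:carrier R. ract M m r = ract V m (eta r))"

context
 fixes M :: "('k, 'a univ, 'm) rmod_scheme" and V :: "('k, 'a univ, 'v) rmod_scheme"
 assumes MV: "res_eq M V"
begin

private lemma M [simp]: "rm K R M" "rm K BA V" "carrier M = carrier V" "add M = add V" "smult M = smult V"
 "m IN V ==> r IN R ==> ract M m r = ract V m (eta r)"
 using MV by (simp_all add: res_eq_def)

private lemma t [simp]: "module K (tens R M X)" "module K (tens BA V YY)"
 by simp_all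

private lemma actc [simp]: "v IN V ==> a IN A' ==> ract V v a IN V"
 using rm_closed[OF M(2)] by simp

private lemma Up_bal1: "v IN V ==> balanced K R A' X (tens R M X) (%a x. pt R M X (ract V v a) x)"
proof (rule balancedI)
 fix a r x assume "v IN V" "a IN A'" "r IN R" "x IN X"
 then show "pt R M X (ract V v (ract A' a r)) x = pt R M X (ract V v a) (lact X r x)"
 using rm_mult[OF M(2), of v a "eta r"] R.pt_bal[OF M(1) X_bm, of "ract V v a" r x] by (simp add: am_eta)
qed (simp_all add: R.lin_simps(1,2,4) Q.lin_simps(6))

private lemma Up_bal: "balanced K BA V YY (tens R M X) (%v y. tf (tens R M X) (%a x. pt R M X (ract V v a) x) y)"
proof (rule balancedI)
 fix v w y assume v: "v IN V" and w: "w IN V" and y: "y IN YY"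
 show "tf (tens R M X) (%a x. pt R M X (ract V (v \<oplus>\<^bsub>V\<^esub> w) a) x) y =
 tf (tens R M X) (%a x. pt R M X (ract V v a) x) y \<oplus>\<^bsub>tens R M X\<^esub> tf (tens R M X) (%a x. pt R M X (ract V w a) x) y"
 by (rule R.tlift_addI[OF A'_rm X_bm t(1)])
 (use v w y in "simp_all add: Q.lin_simps(5) R.lin_simps(1)")
next
 fix v b y assume v: "v IN V" and b: "b IN BA" and y: "y IN YY"
 show "tf (tens R M X) (%a x. pt R M X (ract V (ract V v b) a) x) y = tf (tens R M X) (%a x. pt R M X (ract V v a) x) (lact YY b y)"
 proof -
 note l = R.tlift_lin[OF A'_rm X_bm t(1) Up_bal1]
 have "tf (tens R M X) (%a x. pt R M X (ract V (ract V v b) a) x) y = (%y. tf (tens R M X) (%a x. pt R M X (ract V v a) x) (la b y)) y"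
 proof (rule AX_ext[OF l lin_comp[OF la_lin(1) l] t(1)])
 fix a x assume a: "a IN A'" "x IN C"
 have "ract V v (am b a) = ract V (ract V v b) a" using rm_mult[OF M(2) v, of b a] a b by simp
 then show "tf (tens R M X) (%a x. pt R M X (ract V (ract V v b) a) x) (pX a x)
 = tf (tens R M X) (%a x. pt R M X (ract V v a) x) (la b (pX a x))"
 using a b v Up_bal1[OF v] Up_bal1[of "ract V v b"] by simp
 qed (use v b y in simp_all)
 then show ?thesis using b y by simp
 qed
qed (use lin_closed[OF R.tlift_lin[OF A'_rm X_bm t(1) Up_bal1]] lin_add[OF R.tlift_lin[OF A'_rm X_bm t(1) Up_bal1]]
 lin_smult[OF R.tlift_lin[OF A'_rm X_bm t(1) Up_bal1]] in simp_all)

private lemma Jp_bal: "balanced K R M X (tens BA V YY) (%v x. pt BA V YY v (pX uno x))"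
proof (rule balancedI)
 fix v r x assume v: "v IN M" "r IN R" "x IN X"
 have "la (eta r) (pX uno x) = pX uno (lact X r x)"
 using v R.pt_bal[OF A'_rm X_bm, of uno r x] by (simp add: eta_eq(1)[symmetric])
 then show "pt BA V YY (ract M v r) (pX uno x) = pt BA V YY v (pX uno (lact X r x))"
 using v Q.pt_bal[OF M(2) YY_bm, of v "eta r" "pX uno x"] by simp
qed (simp_all add: Q.lin_simps(1,2,4) R.lin_simps(2,4))

lemma Up_lin: "Up M V : lm K (tens BA V YY) (tens R M X)"
 and Jp_lin: "Jp V : lm K (tens R M X) (tens BA V YY)"
 unfolding Up_def Jp_def by (rule Q.tlift_lin[OF _ _ _ Up_bal], simp_all) (rule R.tlift_lin[OF _ _ _ Jp_bal], simp_all)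

lemma Up_ptens: "v IN V ==> a IN A' ==> x IN C ==> Up M V (pt BA V YY v (pX a x)) = pt R M X (ract V v a) x"
 and Jp_ptens: "v IN V ==> x IN C ==> Jp V (pt R M X v x) = pt BA V YY v (pX uno x)"
 unfolding Up_def Jp_def using Up_bal Up_bal1 Jp_bal by simp_all

lemma VY_ext:
 assumes "f : lm K (tens BA V YY) P" "g : lm K (tens BA V YY) P" "module K P"
 "!!v a x. v IN V ==> a IN A' ==> x IN C ==>
 f (pt BA V YY v (pX a x)) = g (pt BA V YY v (pX a x))" "z IN (tens BA V YY)"
 shows "f z = g z"
proof (rule Q.tens_ext[OF M(2) YY_bm assms(3,1,2) _ assms(5)])
 fix v y assume v: "v IN V" and y: "y IN YY"
 have l: "pt BA V YY v : lm K (tX) (tens BA V YY)"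
 using Q.bal_lin_right[OF Q.ptens_bal[OF M(2) YY_bm] v] by (simp add: YY_lin)
 show "f (pt BA V YY v y) = g (pt BA V YY v y)"
 by (rule AX_ext[OF lin_comp[OF l assms(1)] lin_comp[OF l assms(2)] assms(3)]) (use v y assms(4) in simp_all)
qed

lemma Up_Jp: "w IN (tens R M X) ==> Up M V (Jp V w) = w"
 by (rule R.tens_ext[OF M(1) X_bm t(1) lin_comp[OF Jp_lin Up_lin] lin_id]) (simp_all add: Jp_ptens Up_ptens rm_one[OF M(2), simplified])

text \<open>Since a \<otimes> x = a (1 \<otimes> x), balancing over the algebra gives v \<otimes> (a
  \<otimes> x) = v a \<otimes> (1 \<otimes> x).\<close>

lemma Jp_Up: "z IN (tens BA V YY) ==> Jp V (Up M V z) = z"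
proof (rule VY_ext[OF lin_comp[OF Up_lin Jp_lin] lin_id t(2)])
 fix v a x assume v: "v IN V" "a IN A'" "x IN C"
 then show "Jp V (Up M V (pt BA V YY v (pX a x))) = pt BA V YY v (pX a x)"
 using Q.pt_bal[OF M(2) YY_bm, of v a "pX uno x"] by (simp add: Up_ptens Jp_ptens)
qed simp_all

declare M [simp del] t [simp del] actc [simp del]

end

lemma res_eq_YY: "res_eq AX YY"
 using la_ra_eta by (simp add: res_eq_def del: btens_simps(5))

lemma res_eq_resR: "rm K BA V ==> res_eq (resR V) V"
 by (simp add: res_eq_def)

section \<open>The square of the coring and its canonical isomorphism\<close>

abbreviation "SQ \<equiv> cor_sq R.RMR A' CC"
abbreviation "ths \<equiv> th AX AX YY YY (%y. y) (%y. y) SQ"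

lemma sq: "SQ : Ar R.RMR" "fst SQ = btens R AX AX"
 "z IN (cod SQ) ==> EX u:carrier (tens R AX AX). z = afun SQ u"
 "u IN (tens R AX AX) ==> ths (afun SQ u) = q0 AX AX YY YY (%y. y) (%y. y) u"
 "bij_betw ths (carrier (cod SQ)) (carrier (tYY))"
 "ths : lm K (cod SQ) (tYY)"
 "z IN (cod SQ) ==> r IN R ==> ths (ract (cod SQ) z r) = ract (btens BA YY YY) (ths z) (eta r)"
 "z IN (cod SQ) ==> r IN R ==> ths (lact (cod SQ) r z) = lact (btens BA YY YY) (eta r) (ths z)"
 by (rule C_balq[OF AX_simps(1) cor_act_ar(4-6) is_lact_CC(1) YY_bm ident_YY(2,1) la_ra_eta(2)[folded YY_simps(1), THEN trans]];
 simp add: cor_sq_def)+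

lemma q0_YY: "w IN (tX) ==> w' IN (tX) ==>
 q0 AX AX YY YY (%y. y) (%y. y) (pt R AX AX w w') = pYY w w'"
 "q0 AX AX YY YY (%y. y) (%y. y) : lm K (tens R AX AX) (tYY)"
 using q0_ptens[OF AX_simps(2,1) ident_YY(2,1)] q0_lin[OF AX_simps(2,1) ident_YY(2,1)] by simp_all

lemma sq_inj: "inj_on ths (carrier (cod SQ))"
 using sq(5) by (simp add: bij_betw_def)

abbreviation "Ups \<equiv> cowreath_upsilon R.RMR (self_action R.RMR) A' mm X AX (cor_ract CC)"
abbreviation "UpsI \<equiv> CR SQ (TR (IR AX) (CR (TR ee (IR X)) (R.LUnitI X)))"

text \<open>On the class of w \<otimes> (a \<otimes> x) the canonical map gives w a \<otimes> x,
  which is \<open>Up\<close>; the coordinates \<open>ths\<close> thus turn an abstract factorization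
  into an explicit map.\<close>

lemma Ups: "Ups : Ar R.RMR" "fst Ups = cod SQ" "cod Ups = btens R AX X"
 "z IN (cod SQ) ==> afun Ups z = Up AX YY (ths z)"
proof -
 let ?g = "CR (TR (cor_ract CC) (IR X)) (R.AssocI AX A' X)"
 have U: "Ups = factor_through R.RMR SQ ?g"
 by (simp add: cowreath_upsilon_def cor_sq_def R.inv_arrows free_lact_def CC_simps(2))
 have g: "?g : Ar R.RMR" "fst ?g = fst SQ" "cod ?g = btens R AX X" by (simp_all add: sq(2))
 have "afun ?g u = Up AX YY (ths (afun SQ u))" if u: "u IN (fst SQ)" for u
 proof -
 have u': "u IN (tens R AX AX)" using u by (simp add: sq(2))
 have "afun ?g u = Up AX YY (q0 AX AX YY YY (%y. y) (%y. y) u)"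
 by (rule R.tens3_right_ext[OF AX_simps(2) A'_bm X_bm _ _ lin_comp[OF q0_YY(2) Up_lin[OF res_eq_YY]] _ u'])
 (use ar_lin[OF g(1) refl g(3)] in "simp_all add: q0_YY Up_ptens[OF res_eq_YY] flip: ra_def")
 then show ?thesis using u' by (simp add: sq(4))
 qed
 from R.C_factor[where q = SQ and g = ?g and \<theta> = "%x. x", OF sq(1) _ g(1,2) _ this] g(3) sq(2,3)
 show "Ups : Ar R.RMR" "fst Ups = cod SQ" "cod Ups = btens R AX X"
 "z IN (cod SQ) ==> afun Ups z = Up AX YY (ths z)" unfolding U by simp_all
qed

text \<open>The inverse sends w \<otimes> x to the class of w \<otimes> (1 \<otimes> x), which is
  \<open>Jp\<close> in coordinates.\<close>

lemma UpsI: "UpsI : Ar R.RMR" "u IN (tens R AX X) ==> ths (afun UpsI u) = Jp YY u" "inv_arrow R.RMR Ups = UpsI"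
proof -
 show I: "UpsI : Ar R.RMR" using sq(1,2) by simp
 have l: "(%u. ths (afun UpsI u)) : lm K (tens R AX X) (tYY)"
 using lin_comp[OF arrow_lin(1)[OF I], of ths] sq(6) by simp
 show J: "ths (afun UpsI u) = Jp YY u" if u: "u IN (tens R AX X)" for u
 by (rule R.tens_ext[OF AX_simps(2) X_bm _ l Jp_lin[OF res_eq_YY] _ u])
 (use sq(1,2,4) in "simp_all add: q0_YY Jp_ptens[OF res_eq_YY] eta_simps")
 show "inv_arrow R.RMR Ups = UpsI"
 proof (rule C.inv_arrowI[OF C.is_inverseI])
 show "afun Ups (afun UpsI u) = u" if "u IN (cod Ups)" for u
 proof -
 have u: "u IN (tens R AX X)" using that Ups(3) by simp
 have "afun UpsI u IN (cod SQ)" using C.app_closed[OF I] u by simp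
 then show ?thesis using J[OF u] Up_Jp[OF res_eq_YY u] by (simp add: Ups)
 qed
 show "afun UpsI (afun Ups z) = z" if z: "z IN (fst Ups)" for z
 proof (rule inj_onD[OF sq_inj])
 have z': "z IN (cod SQ)" using z by (simp add: Ups)
 have c: "ths z IN (tYY)" "afun Ups z IN (tens R AX X)"
 using lin_closed[OF sq(6) z'] C.app_closed[OF Ups(1) z] Ups(3) by simp_all
 show "ths (afun UpsI (afun Ups z)) = ths z" using J[OF c(2)] Jp_Up[OF res_eq_YY c(1)] z' by (simp add: Ups)
 show "afun UpsI (afun Ups z) IN (cod SQ)" using C.app_closed[OF I] c by simp
 qed (use z in "simp add: Ups")
 qed (use I Ups in simp_all)
qed

end

section \<open>Comultiplication and counit of the coring in coordinates\<close>

context dk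
begin

text \<open>The A-linear extension of \<delta>, which sends a \<otimes> x to a \<otimes> x_1
  \<otimes> x_2.\<close>

abbreviation "free_delta \<equiv> CR (absorb XX) (TR (IR A') \<delta>)"

text \<open>Identifies A \<otimes> X \<otimes> X with the square of the coring: a \<otimes> x
  \<otimes> y goes to (a \<otimes> x) \<otimes> (1 \<otimes> y).\<close>

definition "dPhi w = Jp YY (afun (R.AssocI A' X X) w)"
definition "dY w = ths (afun (cor_comult CC) w)"

lemma cor_comult: "cor_comult CC : Ar R.RMR" "fst (cor_comult CC) = AX" "cod (cor_comult CC) = cod SQ"
 "w IN (tX) ==> dY w = dPhi (afun free_delta w)"
proof -
 let ?d = "CR (R.AssocI A' X X) free_delta"
 have "cor_comult CC = CR UpsI (CR (R.AssocI A' X X) (CR (TR mm (IR XX))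
 (CR (R.AssocI A' A' XX) (TR (IR A') \<delta>))))"
 using UpsI(3) by (simp add: CC_def cowreath_coring_def R.inv_arrows)
 also have "... = CR UpsI ?d"
 by (rule R.C_ext2[where M = A' and N = X]) (use UpsI(1) sq(1,2) in "simp_all")
 finally have c: "cor_comult CC = CR UpsI ?d" .
 show "cor_comult CC : Ar R.RMR" "fst (cor_comult CC) = AX" "cod (cor_comult CC) = cod SQ"
 unfolding c using UpsI(1) sq(1,2) by simp_all
 have d: "?d : Ar R.RMR" "fst ?d = AX" "cod ?d = btens R AX X" by simp_all
 show "dY w = dPhi (afun free_delta w)" if w: "w IN (tX)"
 proof -
 have "afun (cor_comult CC) w = afun UpsI (afun ?d w)" unfolding c by (rule C.cmp_app) (use w in simp)
 moreover have "afun ?d w IN (tens R AX X)" using C.app_closed[OF d(1), of w] w d by simp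
 moreover have "afun ?d w = afun (R.AssocI A' X X) (afun free_delta w)" by (rule C.cmp_app) (use w in simp)
 ultimately show ?thesis using UpsI(2) by (simp add: dY_def dPhi_def)
 qed
qed

lemma dPhi_lin: "dPhi : lm K (tens R A' XX) (tYY)"
proof -
 have "afun (R.AssocI A' X X) : lm K (tens R A' XX) (tens R AX X)" using ar_lin[of "R.AssocI A' X X", OF _ refl refl] by simp
 from lin_comp[OF this Jp_lin[OF res_eq_YY]] show ?thesis by (simp add: dPhi_def[abs_def])
qed

lemma dY_lin: "dY : lm K (tX) (tYY)"
 using lin_comp[OF ar_lin[OF cor_comult(1-3)] sq(6)] by (simp add: dY_def[abs_def])

lemma dPhi_ptens: "a IN A' ==> x IN C ==> y IN C ==>
 dPhi (pt R A' XX a (pt R X X x y)) = pYY (pX a x) (pX uno y)"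
 using Jp_ptens[OF res_eq_YY, of "pX a x" y] by (simp add: dPhi_def)

lemma YYYY_simps [simp]: "module K (tYY)" by simp

lemma YYYY_act: "a IN A' ==> (%z. lact (btens BA YY YY) a z) : lm K (tYY) (tYY)"
 "a IN A' ==> (%z. ract (rtens BA YY YY) z a) : lm K (tYY) (tYY)"
 using Q.lact_lin[of YY YY a] Q.ract_lin[of YY YY a] by simp_all

lemma dPhi_lact:
 assumes a: "a IN A'" and b: "b IN A'" and w: "w IN (tens R X X)"
 shows "dPhi (pt R A' XX (am a b) w) = lact (btens BA YY YY) a (dPhi (pt R A' XX b w))"
proof -
 have l: "(%w. dPhi (pt R A' XX c w)) : lm K (tens R X X) (tYY)" if "c IN A'" for c
 using lin_comp[OF ptens_right_lin[of A' XX c] dPhi_lin] that by simp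
 show ?thesis
 by (rule R.tens_ext[OF X_rm X_bm YYYY_simps l lin_comp[OF l YYYY_act(1)] _ w])
 (use a b in "simp_all add: dPhi_ptens")
qed

lemma dY_ptens: "a IN A' ==> x IN C ==> dY (pX a x) = dPhi (pt R A' XX a (\<delta>C x))"
 by (subst cor_comult(4)) simp_all

lemma dY_la:
 assumes a: "a IN A'" and w: "w IN (tX)"
 shows "dY (la a w) = lact (btens BA YY YY) a (dY w)"
 by (rule AX_ext[OF lin_comp[OF la_lin(1)[OF a] dY_lin] lin_comp[OF dY_lin YYYY_act(1)[OF a]] YYYY_simps _ w])
 (use a in "simp add: dY_ptens dPhi_lact")

text \<open>Carrying b leftwards through X \<otimes> X by \<psi> becomes right multiplication by b
  on the square. First b passes the right factor, which yields (1 \<otimes> y) b; the claim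
  \<open>e\<close> then says that moving its coefficient past the left factor is the balancing over
  the algebra.\<close>

lemma dPhi_deltaUV:
 assumes b: "b IN A'" and w: "w IN (tens R X X)"
 shows "dPhi (afun deltaU (afun deltaV (pt R XX A' w b))) = ract (rtens BA YY YY) (dPhi (pt R A' XX uno w)) b"
proof -
 have U: "deltaU : Ar R.RMR" "fst deltaU = btens R X AX" "cod deltaU = btens R A' XX"
 and V: "deltaV : Ar R.RMR" "fst deltaV = btens R XX A'" "cod deltaV = btens R X AX" by simp_all
 have Ul: "afun deltaU : lm K (tens R X AX) (tens R A' XX)" and Vl: "afun deltaV : lm K (tens R XX A') (tens R X AX)"
 and Al: "afun (Assoc R.RMR A' X X) : lm K (tens R AX X) (tens R A' XX)"
 using ar_lin[OF U] ar_lin[OF V] ar_lin[of "Assoc R.RMR A' X X", OF _ refl refl] by simp_all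
 have pl: "(%w. pt R XX A' w b) : lm K (tens R X X) (tens R XX A')" using ptens_left_lin[of XX A' b] b by simp
 have pr: "(%w. pt R A' XX uno w) : lm K (tens R X X) (tens R A' XX)" using ptens_right_lin[of A' XX uno] by simp
 have l1: "(%w. dPhi (afun deltaU (afun deltaV (pt R XX A' w b)))) : lm K (tens R X X) (tYY)"
 by (rule lin_comp[OF lin_comp[OF lin_comp[OF pl Vl] Ul] dPhi_lin])
 have l2: "(%w. ract (rtens BA YY YY) (dPhi (pt R A' XX uno w)) b) : lm K (tens R X X) (tYY)"
 by (rule lin_comp[OF lin_comp[OF pr dPhi_lin] YYYY_act(2)[OF b]])
 show ?thesis
 proof (rule R.tens_ext[OF X_rm X_bm YYYY_simps l1 l2 _ w])
 fix x y assume "x IN X" "y IN X"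
 then have xy: "x IN C" "y IN C" by simp_all
 have l3: "(%v. dPhi (afun deltaU (pt R X AX x v))) : lm K (tX) (tYY)"
 using lin_comp[OF _ lin_comp[OF Ul dPhi_lin], of "pt R X AX x" "tX"] ptens_right_lin[of X AX x] xy by simp
 have l4: "(%v. pYY (pX uno x) v) : lm K (tX) (tYY)"
 using Q.bal_lin_right[OF Q.ptens_bal[of YY YY], of "pX uno x"] xy by (simp add: YY_lin)
 have e: "dPhi (afun deltaU (pt R X AX x v)) = pYY (pX uno x) v" if v: "v IN (tX)" for v
 proof (rule AX_ext[OF l3 l4 YYYY_simps _ v])
 fix c z assume c: "c IN A'" "z IN C"
 \<comment> \<open>With coefficient 1 on the left, \<psi>(x \<otimes> c) is the right action of c on
   1 \<otimes> x.\<close>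
 have p: "afun psi (pt R X A' x c) = ra (pX uno x) c"
 using xy c la_ra_action(2)[OF _ uno_closed uno_closed, of "afun psi (pt R X A' x c)"] lin_closed[OF psi_lin, of "pt R X A' x c"]
 by (simp add: ra_def la_def CC_simps(2,3) del: psi_app)
 have l5: "(%u. dPhi (afun (Assoc R.RMR A' X X) (pt R AX X u z))) : lm K (tX) (tYY)"
 using lin_comp[OF _ lin_comp[OF Al dPhi_lin], of "%u. pt R AX X u z" "tX"] ptens_left_lin[of AX X z] c by simp
 have l6: "(%u. pYY u (pX uno z)) : lm K (tX) (tYY)"
 using Q.bal_lin_left[OF _ _ Q.ptens_bal[of YY YY], of "pX uno z"] c by (simp add: YY_lin)
 have "dPhi (afun deltaU (pt R X AX x (pX c z))) = dPhi (afun (Assoc R.RMR A' X X) (pt R AX X (ra (pX uno x) c) z))"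
 using xy c p by (simp del: psi_app)
 also have "... = pYY (ra (pX uno x) c) (pX uno z)"
 by (rule AX_ext[OF l5 l6 YYYY_simps]) (use c xy in "simp_all add: dPhi_ptens")
 also have "... = pYY (pX uno x) (pX c z)"
 using Q.pt_bal[of YY YY "pX uno x" c "pX uno z"] xy c by simp
 finally show "dPhi (afun deltaU (pt R X AX x (pX c z))) = pYY (pX uno x) (pX c z)" .
 qed
 have p: "afun psi (pt R X A' y b) = ra (pX uno y) b"
 using xy b la_ra_action(2)[OF _ uno_closed uno_closed, of "afun psi (pt R X A' y b)"] lin_closed[OF psi_lin, of "pt R X A' y b"]
 by (simp add: ra_def la_def CC_simps(2,3) del: psi_app)
 have "afun deltaV (pt R XX A' (pt R X X x y) b) = pt R X AX x (ra (pX uno y) b)"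
 using xy b p by (simp del: psi_app)
 then show "dPhi (afun deltaU (afun deltaV (pt R XX A' (pt R X X x y) b))) = ract (rtens BA YY YY) (dPhi (pt R A' XX uno (pt R X X x y))) b"
 using e[of "ra (pX uno y) b"] xy b by (simp add: dPhi_ptens)
 qed
qed

lemma ra_psi: "x IN C ==> b IN A' ==> a IN A' ==>
 ra (pX a x) b = la a (afun psi (pt R X A' x b))" "x IN C ==> b IN A' ==> afun psi (pt R X A' x b) IN (tX)"
 using lin_closed[OF psi_lin] by (simp_all add: ra_def la_def CC_simps(2,3) del: psi_app)

text \<open>The right linearity of the comultiplication is the cowreath law for \<delta> and \<psi>
  in element form.\<close>

lemma dY_ra:
 assumes b: "b IN A'" and w: "w IN (tX)"
 shows "dY (ra w b) = ract (rtens BA YY YY) (dY w) b"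
proof (rule AX_ext[OF lin_comp[OF ra_lin(1)[OF b] dY_lin] lin_comp[OF dY_lin YYYY_act(2)[OF b]] YYYY_simps _ w])
 fix a x assume a: "a IN A'" "x IN C"
 have "dY (afun psi (pt R X A' x b)) = dPhi (afun free_delta (afun psi (pt R X A' x b)))"
 using cor_comult(4) ra_psi(2) a b by simp
 also have "... = ract (rtens BA YY YY) (dPhi (pt R A' XX uno (\<delta>C x))) b"
 using delta_psi_element[OF a(2) b] dPhi_deltaUV[OF b, of "\<delta>C x"] a by simp
 finally have "dY (ra (pX a x) b) = lact (btens BA YY YY) a (ract (rtens BA YY YY) (dPhi (pt R A' XX uno (\<delta>C x))) b)"
 using a b ra_psi by (simp add: dY_la)
 also have "... = ract (rtens BA YY YY) (lact (btens BA YY YY) a (dPhi (pt R A' XX uno (\<delta>C x)))) b"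
 using Q.lin_simps(13)[OF Q.btens_bimodule[OF YY_bm YY_bm], of "dPhi (pt R A' XX uno (\<delta>C x))" a b]
 lin_closed[OF dPhi_lin] a b by simp
 also have "... = ract (rtens BA YY YY) (dY (pX a x)) b"
 using dPhi_lact[of a uno "\<delta>C x"] a by (simp add: dY_ptens)
 finally show "dY (ra (pX a x) b) = ract (rtens BA YY YY) (dY (pX a x)) b" .
qed

abbreviation "dOrd \<equiv> ord_cor_comult K R A' mm ee CC"
abbreviation "eOrd \<equiv> ord_cor_counit R A' mm ee CC"

lemma to_ord_th: "to_ord R M Y (afun q) BA V W z = th M Y V W (%y. y) (%y. y) q z" if "inv_into (carrier (tens R M Y)) (afun q) z IN (tens R M Y)"
 using that by (simp add: to_ord_def th_def q0_def)

lemma to_ord_eq: "z \<in> afun q ` carrier (tens R M Y) ==> to_ord R M Y (afun q) BA V W z = th M Y V W (%y. y) (%y. y) q z"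
 by (rule to_ord_th) (rule inv_into_into)

text \<open>\<open>ord_cor_comult\<close> is defined with \<open>to_ord\<close>, which here is the
  coordinate map \<open>ths\<close>; so its function is \<open>dY\<close> on the carrier.\<close>

lemma dOrd: "dOrd : Ar Q.RMR" "fst dOrd = YY" "cod dOrd = btens BA YY YY" "w IN (tX) ==> afun dOrd w = dY w"
proof -
 have d: "dOrd = (YY, restrict dY (carrier YY), btens BA YY YY)"
 proof -
 have "to_ord R AX AX (afun SQ) BA YY YY (afun (cor_comult CC) w) = dY w" if w: "w IN (tX)" for w
 unfolding dY_def by (rule to_ord_eq)
 (use sq(3)[of "afun (cor_comult CC) w"] C.app_closed[OF cor_comult(1), of w] cor_comult(2,3) w in auto)
 then show ?thesis
 by (auto simp: ord_cor_comult_def Let_def compose_def fun_eq_iff simp flip: YY_def BA_def)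
 qed
 have "dY : blm K BA YY (btens BA YY YY)"
 by (rule blmI) (simp_all add: YY_lin dY_lin dY_la dY_ra)
 from bl_conc(4)[OF YY_bm this] show "dOrd : Ar Q.RMR"
 by (simp add: d C.ar_iff del: arrow_ob)
 show "fst dOrd = YY" "cod dOrd = btens BA YY YY" "w IN (tX) ==> afun dOrd w = dY w"
 by (simp_all add: d)
qed

definition "cY = afun (cor_counit CC)"

lemma cor_counit: "cor_counit CC = CR mm (TR (IR A') ff)" "cor_counit CC : Ar R.RMR" "fst (cor_counit CC) = AX"
 "cod (cor_counit CC) = A'" "a IN A' ==> x IN C ==> cY (pX a x) = am a (eta (epsC x))"
 "cY : lm K (tX) A'"
proof -
 show c: "cor_counit CC = CR mm (TR (IR A') ff)" by (simp add: CC_def cowreath_coring_def)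
 show a: "cor_counit CC : Ar R.RMR" "fst (cor_counit CC) = AX" "cod (cor_counit CC) = A'" by (simp_all add: c)
 show "a IN A' ==> x IN C ==> cY (pX a x) = am a (eta (epsC x))" by (simp add: cY_def c)
 show "cY : lm K (tX) A'" using ar_lin[OF a] by (simp add: cY_def)
qed

lemma am_lin: "a IN A' ==> (%b. am a b) : lm K A' A'" "a IN A' ==> (%b. am b a) : lm K A' A'"
 by (rule lmI; simp add: am_simps)+

lemma cY_la:
 assumes a: "a IN A'" and w: "w IN (tX)"
 shows "cY (la a w) = am a (cY w)"
 by (rule AX_ext[OF lin_comp[OF la_lin(1)[OF a] cor_counit(6)] lin_comp[OF cor_counit(6) am_lin(1)[OF a]] A'_mod _ w])
 (use a in "simp add: cor_counit(5) am_assoc")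

text \<open>The right linearity of the counit is the cowreath law \<open>eq_f_psi\<close>.\<close>

lemma cY_ra:
 assumes b: "b IN A'" and w: "w IN (tX)"
 shows "cY (ra w b) = am (cY w) b"
proof (rule AX_ext[OF lin_comp[OF ra_lin(1)[OF b] cor_counit(6)] lin_comp[OF cor_counit(6) am_lin(2)[OF b]] A'_mod _ w])
 fix a x assume a: "a IN A'" "x IN C"
 have "cY (afun psi (pt R X A' x b)) = afun (CR mm (CR (TR (IR A') ff) psi)) (pt R X A' x b)"
 using a b ra_psi(2) by (simp add: cY_def cor_counit(1) del: psi_app)
 also have "... = am (eta (epsC x)) b" unfolding eq_f_psi using a b by simp
 finally show "cY (ra (pX a x) b) = am (cY (pX a x)) b"
 using a b by (simp add: ra_psi cY_la cor_counit(5) am_assoc del: psi_app)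
qed

lemma eOrd: "eOrd : Ar Q.RMR" "fst eOrd = YY" "cod eOrd = rg BA" "afun eOrd = cY"
proof -
 have e: "eOrd = (YY, cY, rg BA)" by (simp add: ord_cor_counit_def cY_def YY_def BA_def)
 have cl: "w IN (tX) ==> cY w IN A'" for w using lin_closed[OF cor_counit(6)] .
 have "lm K YY (rg BA) = lm K (tX) A'" by (rule lm_cong) simp_all
 then have "cY : blm K BA YY (rg BA)"
 by (intro blmI) (simp_all add: cor_counit(6) cY_la cY_ra cl)
 moreover have "cY \<in> extensional (carrier YY)" using cor_counit(2,3) by (simp add: cY_def C.ar_iff del: arrow_ob)
 ultimately show "eOrd : Ar Q.RMR" by (simp add: e C.ar_iff del: arrow_ob)
 show "fst eOrd = YY" "cod eOrd = rg BA" "afun eOrd = cY" by (simp_all add: e)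
qed

end

section \<open>Corepresentations and ordinary comodules\<close>

context dk
begin

abbreviation "rmodA \<equiv> right_module_in R.RMR R.MR A' mm ee"
abbreviation "ordM \<equiv> ord_rmod R A'"

lemma ordM_simps [simp]:
 "carrier (ordM M mu) = carrier M" "add (ordM M mu) = add M" "zero (ordM M mu) = zero M" "smult (ordM M mu) = smult M"
 "mult (ordM M mu) = mult M" "one (ordM M mu) = one M"
 "m IN M ==> a IN A' ==> ract (ordM M mu) m a = afun mu (pt R M A' m a)"
 by (simp_all add: ord_rmod_def)

text \<open>The unit axiom, evaluated at m \<otimes> r, says that R acts through A. The R-module
  structure is therefore determined by the A-action, which is why it can be forgotten without
  loss.\<close>

lemma rmodA_iff: "rmodA M mu \<longleftrightarrow> is_act M mu &
 (ALL m:carrier M. ALL a:carrier A'. ALL b:carrier A'.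
 afun mu (pt R M A' (afun mu (pt R M A' m a)) b) = afun mu (pt R M A' m (am a b))) &
 (ALL m:carrier M. ALL r:carrier R. afun mu (pt R M A' m (eta r)) = ract M m r)"
proof -
 let ?f = "CM mu (AM mu (IR A'))" and ?g = "CM mu (CM (AM (IM M) mm) (ActAssoc R.MR M A' A'))"
 and ?h = "CM mu (AM (IM M) ee)"
 have "(?f = ?g) = (ALL m:carrier M. ALL a:carrier A'. ALL b:carrier A'.
 afun mu (pt R M A' (afun mu (pt R M A' m a)) b) = afun mu (pt R M A' m (am a b)))" (is "_ = ?c1")
 and "(?h = ActUnit R.MR M) = (ALL m:carrier M. ALL r:carrier R. afun mu (pt R M A' m (eta r)) = ract M m r)" (is "_ = ?c2")
 if act: "is_act M mu"
 proof -
 note s [simp] = act_simps(1-4)[OF act]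
 have f: "afun ?f (pt R (rtens R M A') A' (pt R M A' m a) b) = afun mu (pt R M A' (afun mu (pt R M A' m a)) b)"
 "afun ?g (pt R (rtens R M A') A' (pt R M A' m a) b) = afun mu (pt R M A' m (am a b))"
 if "m IN M" "a IN A'" "b IN A'" for m a b using that by simp_all
 have h: "afun ?h (pt R M (rg R) m r) = afun mu (pt R M A' m (eta r))"
 "afun (ActUnit R.MR M) (pt R M (rg R) m r) = ract M m r"
 if "m IN M" "r IN R" for m r using that by simp_all
 show "(?f = ?g) = ?c1"
 proof
 assume "?f = ?g" then show ?c1 using f by metis
 next
 assume ?c1 then show "?f = ?g" by (intro R.D_ext3l[where L = M and M = A' and N = A']) (use f in simp_all)
 qed
 show "(?h = ActUnit R.MR M) = ?c2"
 proof
 assume "?h = ActUnit R.MR M" then show ?c2 using h by metis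
 next
 assume ?c2 then show "?h = ActUnit R.MR M" by (intro R.D_ext2[where M = M and N = "rg R"]) (use h in simp_all)
 qed
 qed
 then show ?thesis by (auto simp: right_module_in_def is_act_def D.hom_iff)
qed

lemma rmodA:
 assumes "rmodA M mu"
 shows "is_act M mu" "rm K BA (ordM M mu)" "res_eq M (ordM M mu)" "ident_right M (afun mu) (ordM M mu) (%m. m)"
proof -
 have act: "is_act M mu" and as: "!!m a b. m IN M ==> a IN A' ==> b IN A' ==>
 afun mu (pt R M A' (afun mu (pt R M A' m a)) b) = afun mu (pt R M A' m (am a b))"
 and un: "!!m r. m IN M ==> r IN R ==> afun mu (pt R M A' m (eta r)) = ract M m r"
 using assms by (simp_all add: rmodA_iff)
 show "is_act M mu" by fact
 note s [simp] = act_simps(1-4)[OF act]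
 have mul: "afun mu : lm K (tens R M A') M" using arrow_lin(2)[OF s(2)] by simp
 note l = lin_add[OF mul] lin_smult[OF mul] R.lin_simps(1-4)
 have cl [simp]: "afun mu (pt R M A' m a) IN M" if "m IN M" "a IN A'" for m a
 using lin_closed[OF mul] that by simp
 show V: "rm K BA (ordM M mu)"
 proof (rule right_moduleI)
 show "module K (ordM M mu)" by (rule mod_cong[OF rm_module[OF s(1)]]) simp_all
 show "on_carriers (carrier (ordM M mu)) (carrier BA) (ract (ordM M mu)) = ract (ordM M mu)" by (simp add: ord_rmod_def)
 qed (use un[of _ "\<one>\<^bsub>R\<^esub>"] in "simp_all add: l as eta_simps")
 show "res_eq M (ordM M mu)" using V un by (simp add: res_eq_def)
 have "lm K M (ordM M mu) = lm K M M" by (rule lm_cong) simp_all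
 then show "ident_right M (afun mu) (ordM M mu) (%m. m)"
 using V un lin_id[of K M] by (simp add: ident_right_def bij_betw_def)
qed

text \<open>Rebuilds the action arrow on the restricted R-module; inverse to
  \<open>ordM\<close>.\<close>

definition "actR V = (rtens R (resR V) A', \<lambda>u \<in> carrier (tens R (resR V) A'). tf V (ract V) u, resR V)"

lemma rmod_eqI:
 fixes M N :: "('k, 'u) rmod"
 assumes "carrier M = carrier N" "mult M = mult N" "one M = one N" "zero M = zero N" "add M = add N"
 "smult M = smult N" "ract M = ract N"
 shows "M = N"
 using assms by simp

lemma rmod_ract_eqI:
 assumes "rm K B M" "rm K B N" "carrier M = carrier N"
 "!!m b. m IN N ==> b IN B ==> ract M m b = ract N m b"
 shows "ract M = ract N"
proof -
 have "ract M = on_carriers (carrier M) (carrier B) (ract M)" "ract N = on_carriers (carrier N) (carrier B) (ract N)"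
 using assms(1,2) by (simp_all add: right_module_def)
 then show ?thesis using assms(3,4) by (simp add: on_carriers_def fun_eq_iff) metis
qed

lemma actR:
 assumes V: "rm K BA V"
 shows "rmodA (resR V) (actR V)" "ordM (resR V) (actR V) = V"
proof -
 have b: "balanced K R (resR V) A' V (ract V)"
 by (rule balancedI) (use V rm_mult[OF V] in "simp_all add: Q.lin_simps am_eta(1)[symmetric]")
 have lV: "lm K N (resR V) = lm K N V" for N by (rule lm_cong) simp_all
 have l: "tf V (ract V) : lm K (tens R (resR V) A') V" using V by (intro R.tlift_lin b) simp_all
 have p: "afun (actR V) (pt R (resR V) A' v a) = ract V v a" if "v IN V" "a IN A'" for v a
 using that b V by (simp add: actR_def)
 have "tf V (ract V) : rlm K R (rtens R (resR V) A') (resR V)"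
 proof (rule rlmI)
 show "tf V (ract V) (ract (rtens R (resR V) A') u r) = ract (resR V) (tf V (ract V) u) r"
 if "u IN (rtens R (resR V) A')" "r IN R" for u r
 proof -
 have lr: "(%v. ract V v (eta r)) : lm K V V"
 by (rule lmI) (use V that in "simp_all add: Q.lin_simps")
 have "tf V (ract V) (ract (rtens R (resR V) A') u r) = ract V (tf V (ract V) u) (eta r)"
 by (rule R.tens_ext[OF resR_right_module[OF V] A'_bm _ lin_comp[OF R.ract_lin l] lin_comp[OF l lr]])
 (use that V b rm_mult[OF V] in "simp_all add: am_eta(2)[symmetric]")
 then show ?thesis using that lin_closed[OF l] by simp
 qed
 qed (simp add: lV l)
 from rl_conc(4)[OF _ this] have act: "is_act (resR V) (actR V)"
 using V by (simp add: is_act_def actR_def D.ar_iff del: arrow_ob)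
 show "rmodA (resR V) (actR V)"
 using act V rm_mult[OF V] by (simp add: rmodA_iff p)
 then have "rm K BA (ordM (resR V) (actR V))" by (rule rmodA)
 then show "ordM (resR V) (actR V) = V"
 by (intro rmod_eqI rmod_ract_eqI[OF _ V]) (use p in simp_all)
qed

text \<open>An equality of records and not only an isomorphism: actions are \<open>undefined\<close>
  off the carriers and the functions in arrows are extensional, so both are recovered from their
  values on carriers.\<close>

lemma rmodA_eq:
 assumes "rmodA M mu"
 shows "M = resR (ordM M mu)" "mu = actR (ordM M mu)"
proof -
 note a = rmodA[OF assms]
 note s [simp] = act_simps(1-4)[OF a(1)]
 show M: "M = resR (ordM M mu)"
 by (intro rmod_eqI rmod_ract_eqI[where B = R]) (use a(2,3) in "simp_all add: res_eq_def")
 have act: "is_act M (actR (ordM M mu))" using rmodA(1)[OF actR(1)[OF a(2)]] M by simp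
 show "mu = actR (ordM M mu)"
 proof (rule R.D_ext2[where M = M and N = A'])
 fix m b assume m: "m IN M" "b IN A'"
 have "ract (ordM (resR (ordM M mu)) (actR (ordM M mu))) m b = ract (ordM M mu) m b" using actR(2)[OF a(2)] by simp
 then show "afun mu (pt R M A' m b) = afun (actR (ordM M mu)) (pt R M A' m b)"
 using m M by simp
 qed (use act_simps(1-4)[OF act] in simp_all)
qed

text \<open>\<open>j\<close> and \<open>k\<close> are arbitrary bijections because \<open>M\<close>
  or \<open>Y\<close> may itself be a chosen quotient, identified by its own coordinate map.\<close>

definition bal_data where
 "bal_data M mu V j Y l W k \<longleftrightarrow> is_act M mu & is_lact Y l & ident_right M (afun mu) V j & ident_left Y (afun l) W k"

abbreviation "bq \<equiv> balq R.RMR R.MR A'"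
abbreviation "bth M mu V j Y l W k \<equiv> th M Y V W j k (bq M mu Y l)"

lemma bq:
 fixes W :: "('k, 'a univ) bimod"
 assumes "bal_data M mu V j Y l W k"
 shows "bq M mu Y l : Ar R.MR" "fst (bq M mu Y l) = rtens R M Y"
 "z IN (cod (bq M mu Y l)) ==> EX u:carrier (tens R M Y). z = afun (bq M mu Y l) u"
 "u IN (tens R M Y) ==> bth M mu V j Y l W k (afun (bq M mu Y l) u) = q0 M Y V W j k u"
 "bij_betw (bth M mu V j Y l W k) (carrier (cod (bq M mu Y l))) (carrier (tens BA V W))"
 "bth M mu V j Y l W k : lm K (cod (bq M mu Y l)) (tens BA V W)"
 "z IN (cod (bq M mu Y l)) ==> r IN R ==>
 bth M mu V j Y l W k (ract (cod (bq M mu Y l)) z r) = ract (rtens BA V W) (bth M mu V j Y l W k z) (eta r)"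
 "q0 M Y V W j k : lm K (tens R M Y) (tens BA V W)"
 "m IN M ==> y IN Y ==> q0 M Y V W j k (pt R M Y m y) = pt BA V W (j m) (k y)"
 "rm K BA V" "bm K BA W" "rm K R M" "bm K R Y"
 "m IN M ==> j m IN V" "y IN Y ==> k y IN W"
proof -
 have a: "is_act M mu" "is_lact Y l" "ident_right M (afun mu) V j" "ident_left Y (afun l) W k"
 using assms by (simp_all add: bal_data_def)
 note D = D_balq[OF a refl]
 show "bq M mu Y l : Ar R.MR" "fst (bq M mu Y l) = rtens R M Y"
 "z IN (cod (bq M mu Y l)) ==> EX u:carrier (tens R M Y). z = afun (bq M mu Y l) u"
 "u IN (tens R M Y) ==> bth M mu V j Y l W k (afun (bq M mu Y l) u) = q0 M Y V W j k u"
 "bij_betw (bth M mu V j Y l W k) (carrier (cod (bq M mu Y l))) (carrier (tens BA V W))"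
 "bth M mu V j Y l W k : lm K (cod (bq M mu Y l)) (tens BA V W)"
 "z IN (cod (bq M mu Y l)) ==> r IN R ==>
 bth M mu V j Y l W k (ract (cod (bq M mu Y l)) z r) = ract (rtens BA V W) (bth M mu V j Y l W k z) (eta r)"
 by (fact D)+
 show M: "rm K R M" "bm K R Y" using act_simps a by blast+
 show "rm K BA V" "bm K BA W" "m IN M ==> j m IN V" "y IN Y ==> k y IN W"
 using a(3,4) lin_closed[of j K M V m] lin_closed[of k K Y W y] by (simp_all add: ident_right_def ident_left_def)
 show "q0 M Y V W j k : lm K (tens R M Y) (tens BA V W)"
 "m IN M ==> y IN Y ==> q0 M Y V W j k (pt R M Y m y) = pt BA V W (j m) (k y)"
 using q0_lin[OF M a(3,4)] q0_ptens[OF M a(3,4)] by auto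
qed

lemma bq_th_ptens:
 fixes W :: "('k, 'a univ) bimod"
 assumes "bal_data M mu V j Y l W k" "m IN M" "y IN Y"
 shows "bth M mu V j Y l W k (afun (bq M mu Y l) (pt R M Y m y)) = pt BA V W (j m) (k y)"
 "afun (bq M mu Y l) (pt R M Y m y) IN (cod (bq M mu Y l))"
 using bq(4,9)[OF assms(1)] assms(2,3) bq(12,13)[OF assms(1)] D.app_closed[OF bq(1)[OF assms(1)]] bq(2)[OF assms(1)] by simp_all

lemma bq_inj:
 fixes W :: "('k, 'a univ) bimod"
 assumes "bal_data M mu V j Y l W k"
 shows "inj_on (bth M mu V j Y l W k) (carrier (cod (bq M mu Y l)))"
 using bq(5)[OF assms] by (simp add: bij_betw_def)

text \<open>Both sides agree on classes of m \<otimes> y, so in coordinates the abstract induced map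
  is the ordinary tensor product of the maps \<open>F\<close> and \<open>G\<close> that
  \<open>f\<close> and \<open>g\<close> turn into.\<close>

lemma bal_map_th:
 fixes W W' :: "('k, 'a univ) bimod"
 assumes s: "bal_data M mu V j Y l W k" and s': "bal_data N nu V' j' Z l' W' k'"
 and f: "f : Ar R.MR" "fst f = M" "cod f = N" and g: "g : Ar R.RMR" "fst g = Y" "cod g = Z"
 and F: "F : rlm K BA V V'" "!!m. m IN M ==> F (j m) = j' (afun f m)"
 and G: "G : blm K BA W W'" "!!y. y IN Y ==> G (k y) = k' (afun g y)"
 defines "b \<equiv> bal_map R.RMR R.MR A' M mu Y l f N nu Z l' g"
 shows "b : Ar R.MR" "fst b = cod (bq M mu Y l)" "cod b = cod (bq N nu Z l')"
 "z IN (cod (bq M mu Y l)) ==>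
 bth N nu V' j' Z l' W' k' (afun b z) = tmap BA V W V' W' F G (bth M mu V j Y l W k z)"
proof -
 note q = bq[OF s] and q' = bq[OF s']
 let ?g = "CM (bq N nu Z l') (AM f g)"
 have ga: "AM f g : Ar R.MR" "fst (AM f g) = rtens R M Y" "cod (AM f g) = rtens R N Z"
 using f g by simp_all
 have gl: "afun (AM f g) : lm K (tens R M Y) (tens R N Z)" using arrow_lin(2)[OF ga(1)] f g by simp
 have g': "?g : Ar R.MR" "fst ?g = fst (bq M mu Y l)" using ga q q' by simp_all
 have e: "bth N nu V' j' Z l' W' k' (afun ?g u) = tmap BA V W V' W' F G (bth M mu V j Y l W k (afun (bq M mu Y l) u))"
 if u: "u IN (fst (bq M mu Y l))" for u
 proof -
 have u': "u IN (tens R M Y)" using u q(2) by simp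
 have "afun ?g u = afun (bq N nu Z l') (afun (AM f g) u)" by (rule D.cmp_app) (use u' ga in simp)
 then have "bth N nu V' j' Z l' W' k' (afun ?g u) = q0 N Z V' W' j' k' (afun (AM f g) u)"
 using q'(4) lin_closed[OF gl u'] by simp
 also have "... = tmap BA V W V' W' F G (q0 M Y V W j k u)"
 by (rule R.tens_ext[OF q(12,13) _ lin_comp[OF gl q'(8)] lin_comp[OF q(8) Q.tmap_lin[OF q(10,11) q'(10,11) F(1) G(1)]] _ u'])
 (use f g F(2) G(2) q q' in "simp_all add: Q.tmap_ptens[OF q(10,11) q'(10,11) F(1) G(1)]")
 finally show ?thesis using q(4) u' by simp
 qed
 have surj: "EX u:carrier (fst (bq M mu Y l)). z = afun (bq M mu Y l) u" if "z IN (cod (bq M mu Y l))" for z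
 using q(2,3) that by simp
 have inj: "inj_on (bth N nu V' j' Z l' W' k') (carrier (cod ?g))" using bq_inj[OF s'] by simp
 from R.D_factor[OF q(1) surj g' inj e] show "b : Ar R.MR" "fst b = cod (bq M mu Y l)" "cod b = cod (bq N nu Z l')"
 "z IN (cod (bq M mu Y l)) ==>
 bth N nu V' j' Z l' W' k' (afun b z) = tmap BA V W V' W' F G (bth M mu V j Y l W k z)"
 by (simp_all add: b_def bal_map_def)
qed

end

section \<open>Actions on iterated quotients and the associativity constraint\<close>

context dk
begin

abbreviation "Sq \<equiv> cod SQ"
abbreviation "sql \<equiv> cor_sq_lact R.RMR A' CC"
abbreviation "idf \<equiv> (%y. y)"

text \<open>The action is obtained by factoring through the tensor product of A with
  \<open>SQ\<close>, which is onto; in coordinates it acts on the left factor.\<close>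

lemma sql: "sql : Ar R.RMR" "fst sql = btens R A' Sq" "cod sql = Sq"
 "a IN A' ==> z IN Sq ==> ths (afun sql (pt R A' Sq a z)) = lact (btens BA YY YY) a (ths z)"
proof -
 let ?q = "TR (IR A') SQ" and ?g = "CR SQ (CR (TR (cor_lact CC) (IR AX)) (R.AssocI A' AX AX))"
 have S: "bm K R Sq" using sq(1) by simp
 have q: "?q : Ar R.RMR" "fst ?q = btens R A' (btens R AX AX)" "cod ?q = btens R A' Sq" using sq(1,2) by simp_all
 have g: "?g : Ar R.RMR" "fst ?g = fst ?q" "cod ?g = Sq" using sq(1,2) by simp_all
 have sb: "afun SQ : blm K R (btens R AX AX) Sq" using sq(1,2) by (simp add: C.ar_iff del: arrow_ob)
 have surj: "EX u:carrier (fst ?q). z = afun ?q u" if "z IN (cod ?q)" for z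
 proof -
 have ib: "afun (IR A') : rlm K R A' A'"
 using rl_conc(4)[OF A'_rm rl_conc(2)] by (simp add: R.Idn_app)
 have "EX u:carrier (tens R A' (btens R AX AX)). z = tmap R A' (btens R AX AX) A' Sq (afun (IR A')) (afun SQ) u"
 by (rule tmap_surj[OF A'_rm _ A'_rm S ib sb]) (use that q sq(3) in auto)
 then show ?thesis by (simp add: TenA_simps(3) sq(2))
 qed
 let ?Phi = "tf (tYY) (%a z. lact (btens BA YY YY) a (ths z))"
 note tl = sq(6)
 have tb: "balanced K R A' Sq (tYY) (%a z. lact (btens BA YY YY) a (ths z))"
 by (rule balancedI) (use S in "simp_all add: lin_closed[OF tl] lin_add[OF tl] lin_smult[OF tl] sq(8) Q.lin_simps lin_closed[OF YYYY_act(1)]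
 bm_mult[of K BA, symmetric] am_eta(2)[symmetric]")
 have Pl: "?Phi : lm K (tens R A' Sq) (tYY)" by (rule R.tlift_lin[OF _ S _ tb]) simp_all
 have e: "ths (afun ?g u) = ?Phi (afun ?q u)" if u: "u IN (fst ?q)" for u
 proof (rule R.tens3_right_ext[OF A'_rm AX_simps(1,1) _ _ _ _ u[unfolded q(2) btens_simps(1)]])
 show "(%u. ths (afun ?g u)) : lm K (tens R A' (btens R AX AX)) (tYY)"
 using lin_comp[OF ar_lin[OF g(1) refl g(3)] tl] sq(2) by simp
 show "(%u. ?Phi (afun ?q u)) : lm K (tens R A' (btens R AX AX)) (tYY)"
 using lin_comp[OF ar_lin[OF q(1) refl q(3)], of ?Phi] Pl sq(2) by simp
 fix a x y assume a: "a IN A'" "x IN AX" "y IN AX"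
 then have "afun ?g (pt R A' (btens R AX AX) a (pt R AX AX x y)) = afun SQ (pt R AX AX (la a x) y)"
 using sq(1,2) by (simp add: la_def)
 moreover have "afun ?q (pt R A' (btens R AX AX) a (pt R AX AX x y)) = pt R A' Sq a (afun SQ (pt R AX AX x y))"
 using a sq(1,2) by simp
 moreover have "afun SQ (pt R AX AX x y) IN Sq" using C.app_closed[OF sq(1)] a sq(2) by simp
 ultimately show "ths (afun ?g (pt R A' (btens R AX AX) a (pt R AX AX x y))) = ?Phi (afun ?q (pt R A' (btens R AX AX) a (pt R AX AX x y)))"
 using a tb S by (simp add: sq(4) q0_YY)
 qed simp
 have inj: "inj_on ths (carrier (cod ?g))" using sq_inj by simp
 have f: "sql = factor_through R.RMR ?q ?g"
 by (simp add: cor_sq_lact_def bal_lact_def cor_sq_def R.inv_arrows)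
 from R.C_factor[OF q(1) surj g(1,2) inj e] g(3) q(3) tb S
 show "sql : Ar R.RMR" "fst sql = btens R A' Sq" "cod sql = Sq"
 "a IN A' ==> z IN Sq ==> ths (afun sql (pt R A' Sq a z)) = lact (btens BA YY YY) a (ths z)" unfolding f by simp_all
qed

text \<open>Lets the square of the coring take the place of \<open>Y\<close>, with
  \<open>ths\<close> as identification.\<close>

lemma ident_Sq: "is_lact Sq sql" "ident_left Sq (afun sql) (btens BA YY YY) ths"
proof -
 have S: "bm K R Sq" using sq(1) by simp
 then show "is_lact Sq sql" using sql by (simp add: is_lact_def)
 show "ident_left Sq (afun sql) (btens BA YY YY) ths"
 unfolding ident_left_def using sql sq(5-8) C.app_closed[OF sql(1)] S by simp
qed

context
 fixes M mu assumes M: "rmodA M mu"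
begin

abbreviation (input) "oM \<equiv> ordM M mu"
abbreviation (input) "qM \<equiv> bq M mu AX (cor_lact CC)"
abbreviation (input) "TM \<equiv> cod qM"
abbreviation (input) "thM \<equiv> bth M mu oM idf AX (cor_lact CC) YY idf"
abbreviation (input) "tauM \<equiv> cor_act R.RMR R.MR A' CC M mu"

lemma data_AX: "bal_data M mu oM idf AX (cor_lact CC) YY idf"
 and data_A: "bal_data M mu oM idf A' mm (rg BA) idf"
 and data_Sq: "bal_data M mu oM idf Sq sql (btens BA YY YY) ths"
 using rmodA[OF M] is_lact_CC ident_YY(1) ident_A ident_Sq by (simp_all add: bal_data_def)

private lemmas qs = bq[OF data_AX] and qp = bq_th_ptens[OF data_AX]

private lemma TM: "rm K R TM" using qs(1) by simp
private lemma R': "rm K BA (rtens BA oM YY)" using qs(10) by simp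

lemma tau: "tauM : Ar R.MR" "fst tauM = rtens R TM A'" "cod tauM = TM"
 "v IN TM ==> a IN A' ==> thM (afun tauM (pt R TM A' v a)) = ract (rtens BA oM YY) (thM v) a"
proof -
 let ?q = "AM qM (IR A')" and ?g = "CM qM (CM (AM (IM M) (cor_ract CC)) (ActAssoc R.MR M AX A'))"
 have q: "?q : Ar R.MR" "fst ?q = rtens R (rtens R M AX) A'" "cod ?q = rtens R TM A'" using qs(1,2) by simp_all
 have g: "?g : Ar R.MR" "fst ?g = fst ?q" "cod ?g = TM" using qs by simp_all
 have sb: "afun qM : rlm K R (rtens R M AX) TM" using qs(1,2) by (simp add: D.ar_iff del: arrow_ob)
 have surj: "EX u:carrier (fst ?q). z = afun ?q u" if "z IN (cod ?q)" for z
 proof -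
 have ib: "afun (IR A') : blm K R A' A'"
 using bl_conc(4)[OF A'_bm bl_conc(2)] by (simp add: R.Idn_app)
 have "EX u:carrier (tens R (rtens R M AX) A'). z = tmap R (rtens R M AX) A' TM A' (afun qM) (afun (IR A')) u"
 by (rule tmap_surj[OF _ A'_bm TM A'_bm sb ib]) (use that q qs(3,12) in auto)
 then show ?thesis by (simp add: ActA_simps(3) qs(2))
 qed
 let ?Phi = "tf (tens BA oM YY) (%v a. ract (rtens BA oM YY) (thM v) a)"
 note tl = qs(6)
 have tb: "balanced K R TM A' (tens BA oM YY) (%v a. ract (rtens BA oM YY) (thM v) a)"
 by (rule balancedI) (use TM R' rm_closed[OF R'] in "simp_all add: lin_closed[OF tl] lin_add[OF tl] lin_smult[OF tl] qs(7) Q.lin_simps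
 rm_mult[OF R', symmetric, simplified] am_eta(1)[symmetric]")
 have tn: "module K (tens BA oM YY)" using qs(10) by simp
 have Pl: "?Phi : lm K (tens R TM A') (tens BA oM YY)" by (rule R.tlift_lin[OF TM _ tn tb]) simp_all
 have gl: "afun ?g : lm K (tens R (rtens R M AX) A') TM" and ql: "afun ?q : lm K (tens R (rtens R M AX) A') (tens R TM A')"
 using arrow_lin(2)[OF g(1)] arrow_lin(2)[OF q(1)] qs(2) by simp_all
 have e: "thM (afun ?g u) = ?Phi (afun ?q u)" if u: "u IN (fst ?q)" for u
 proof (rule R.tens3_left_ext[OF qs(12) AX_simps(1) A'_bm tn lin_comp[OF gl tl] lin_comp[OF ql Pl] _ u[unfolded q(2) rtens_simps(1)]])
 fix m y a assume a: "m IN M" "y IN AX" "a IN A'"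
 then have "afun ?g (pt R (rtens R M AX) A' (pt R M AX m y) a) = afun qM (pt R M AX m (ra y a))"
 using qs(1,2,12) by (simp add: ra_def)
 moreover have "afun ?q (pt R (rtens R M AX) A' (pt R M AX m y) a) = pt R TM A' (afun qM (pt R M AX m y)) a"
 using a qs(1,2,12) by simp
 ultimately show "thM (afun ?g (pt R (rtens R M AX) A' (pt R M AX m y) a)) = ?Phi (afun ?q (pt R (rtens R M AX) A' (pt R M AX m y) a))"
 using a tb TM tn qp qs(10) by simp
 qed
 have inj: "inj_on thM (carrier (cod ?g))" using bq_inj[OF data_AX] g(3) by simp
 have f: "tauM = factor_through R.MR ?q ?g"
 by (simp add: cor_act_def bal_ract_def)
 from R.D_factor[OF q(1) surj g(1,2) inj e] g(3) q(3) tb TM tn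
 show "tauM : Ar R.MR" "fst tauM = rtens R TM A'" "cod tauM = TM"
 "v IN TM ==> a IN A' ==> thM (afun tauM (pt R TM A' v a)) = ract (rtens BA oM YY) (thM v) a" unfolding f by simp_all
qed

text \<open>The quotient, with its own coordinates as identification, takes the place of
  \<open>M\<close>; this iterates the construction to two factors of the coring.\<close>

lemma data_T: "bal_data TM tauM (rtens BA oM YY) thM AX (cor_lact CC) YY idf"
proof -
 have "lm K TM (rtens BA oM YY) = lm K TM (tens BA oM YY)" by simp
 then have "ident_right TM (afun tauM) (rtens BA oM YY) thM"
 unfolding ident_right_def using R' qs(5-7) tau D.app_closed[OF tau(1)] TM by simp
 then show ?thesis using tau TM is_lact_CC ident_YY by (simp add: bal_data_def is_act_def)
qed

private lemmas ts = bq[OF data_T] and tp = bq_th_ptens[OF data_T]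
private lemmas ss = bq[OF data_Sq] and sp = bq_th_ptens[OF data_Sq]

abbreviation (input) "qT \<equiv> bq TM tauM AX (cor_lact CC)"
abbreviation (input) "qS \<equiv> bq M mu Sq sql"
abbreviation (input) "thT \<equiv> bth TM tauM (rtens BA oM YY) thM AX (cor_lact CC) YY idf"
abbreviation (input) "thS \<equiv> bth M mu oM idf Sq sql (btens BA YY YY) ths"

text \<open>The constraint sends the class of (m \<otimes> x) \<otimes> y to that of m \<otimes> (x
  \<otimes> y), so in coordinates it is the ordinary associator over the algebra.\<close>

lemma bal_assoc: "bal_assoc R.RMR R.MR A' CC M mu : Ar R.MR" "fst (bal_assoc R.RMR R.MR A' CC M mu) = cod qT"
 "cod (bal_assoc R.RMR R.MR A' CC M mu) = cod qS"
 "z IN (cod qT) ==> thS (afun (bal_assoc R.RMR R.MR A' CC M mu) z) = tassoc BA oM YY YY (thT z)"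
proof -
 let ?p = "AM qM (IR AX)" and ?r = "AM (IM M) SQ"
 let ?q = "CM qT ?p" and ?g = "CM qS (CM ?r (ActAssoc R.MR M AX AX))"
 have p: "?p : Ar R.MR" "fst ?p = rtens R (rtens R M AX) AX" "cod ?p = rtens R TM AX" using qs(1,2) by simp_all
 have q: "?q : Ar R.MR" "fst ?q = rtens R (rtens R M AX) AX" "cod ?q = cod qT" using p ts by simp_all
 have g: "?g : Ar R.MR" "fst ?g = fst ?q" "cod ?g = cod qS" using ss qs(1,2,12) sq(1,2) by simp_all
 have sb: "afun qM : rlm K R (rtens R M AX) TM" using qs(1,2) by (simp add: D.ar_iff del: arrow_ob)
 have surj: "EX u:carrier (fst ?q). z = afun ?q u" if z: "z IN (cod ?q)" for z
 proof -
 obtain v where v: "v IN (tens R TM AX)" "z = afun qT v" using ts(3) z q(3) by auto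
 have ib: "afun (IR AX) : blm K R AX AX"
 using bl_conc(4)[OF AX_simps(1) bl_conc(2)] by (simp add: R.Idn_app)
 have "EX u:carrier (tens R (rtens R M AX) AX). v = tmap R (rtens R M AX) AX TM AX (afun qM) (afun (IR AX)) u"
 by (rule tmap_surj[OF _ AX_simps(1) TM AX_simps(1) sb ib]) (use v qs(3,12) in auto)
 then obtain u where "u IN (tens R (rtens R M AX) AX)" "v = afun ?p u" by (auto simp: ActA_simps(3) qs(2))
 then show ?thesis using v D.cmp_app[where u = u and f = ?p and g = qT] p(2) q(2) by auto
 qed
 have tn: "module K (tens BA oM (btens BA YY YY))" using qs(10) by simp
 have gl: "afun ?g : lm K (tens R (rtens R M AX) AX) (cod qS)" and ql: "afun ?q : lm K (tens R (rtens R M AX) AX) (cod qT)"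
 using arrow_lin(2)[OF g(1)] arrow_lin(2)[OF q(1)] qs(2) by simp_all
 have e: "thS (afun ?g u) = tassoc BA oM YY YY (thT (afun ?q u))" if u: "u IN (fst ?q)" for u
 proof (rule R.tens3_left_ext[OF qs(12) AX_simps(1,1) tn lin_comp[OF gl ss(6)]
 lin_comp[OF lin_comp[OF ql ts(6)] Q.tassoc_lin[OF qs(10) YY_bm YY_bm]] _ u[unfolded q(2) rtens_simps(1)]])
 fix m x y assume a: "m IN M" "x IN AX" "y IN AX"
 have "afun ?g (pt R (rtens R M AX) AX (pt R M AX m x) y) = afun qS (pt R M Sq m (afun SQ (pt R AX AX x y)))"
 using a qs(12) sq(1,2) by simp
 moreover have "afun SQ (pt R AX AX x y) IN Sq" "ths (afun SQ (pt R AX AX x y)) = pYY x y"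
 using C.app_closed[OF sq(1)] a sq(2) by (simp_all add: sq(4) q0_YY)
 moreover have "afun ?q (pt R (rtens R M AX) AX (pt R M AX m x) y) = afun qT (pt R TM AX (afun qM (pt R M AX m x)) y)"
 using a qs(1,2,12) by simp
 ultimately show "thS (afun ?g (pt R (rtens R M AX) AX (pt R M AX m x) y)) = tassoc BA oM YY YY (thT (afun ?q (pt R (rtens R M AX) AX (pt R M AX m x) y)))"
 using a qp tp sp Q.tassoc_ptens[OF qs(10) YY_bm YY_bm, of m x y] by simp
 qed
 have inj: "inj_on thS (carrier (cod ?g))" using bq_inj[OF data_Sq] g(3) by simp
 have f: "bal_assoc R.RMR R.MR A' CC M mu = factor_through R.MR ?q ?g"
 by (simp add: bal_assoc_def Let_def C.c_simps(4) D.c_simps(4))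
 from R.D_factor[OF q(1) surj g(1,2) inj e] g(3) q(3)
 show "bal_assoc R.RMR R.MR A' CC M mu : Ar R.MR" "fst (bal_assoc R.RMR R.MR A' CC M mu) = cod qT"
 "cod (bal_assoc R.RMR R.MR A' CC M mu) = cod qS"
 "z IN (cod qT) ==> thS (afun (bal_assoc R.RMR R.MR A' CC M mu) z) = tassoc BA oM YY YY (thT z)" unfolding f by simp_all
qed

end

end

lemma (in concrete_category) ar_eq_iff:
 assumes "f : Ar C" "g : Ar C" "fst f = x" "fst g = x" "cod f = cod g"
 shows "f = g \<longleftrightarrow> (ALL u:car x. afun f u = afun g u)"
 using ar_eqI[of f g] assms by auto

section \<open>The axioms of a corepresentation in coordinates\<close>

context dk
begin

context
 fixes M mu assumes M: "rmodA M mu"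
begin

abbreviation (input) "coord r \<equiv> compose (carrier (oM M mu)) (thM M mu) (afun r)"

private lemmas act = rmodA[OF M]
private lemmas ac [simp] = act_simps(1-4)[OF act(1)]
private lemmas qs9 = bq[OF data_AX[OF M]] and qp9 = bq_th_ptens[OF data_AX[OF M]]
private lemmas ta = tau[OF M]

abbreviation (input) "balcounit \<equiv> factor_through R.MR (bq M mu A' mm) mu"

lemma balcounit: "balcounit : Ar R.MR" "fst balcounit = cod (bq M mu A' mm)" "cod balcounit = M"
 "z IN (cod (bq M mu A' mm)) ==>
 afun balcounit z = tf (oM M mu) (ract (oM M mu)) (bth M mu (oM M mu) idf A' mm (rg BA) idf z)"
proof -
 note as = bq[OF data_A[OF M]]
 let ?Phi = "%z. tf (oM M mu) (ract (oM M mu)) (bth M mu (oM M mu) idf A' mm (rg BA) idf z)"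
 have b: "balanced K BA (oM M mu) (rg BA) (oM M mu) (ract (oM M mu))" by (rule Q.runit_bal[OF act(2)])
 have l: "tf (oM M mu) (ract (oM M mu)) : lm K (tens BA (oM M mu) (rg BA)) (oM M mu)" using Q.tlift_lin[OF act(2) _ _ b] act(2) by simp
 have NM: "lm K P (oM M mu) = lm K P M" for P by (rule lm_cong) simp_all
 have mul: "afun mu : lm K (tens R M A') (oM M mu)" using arrow_lin(2)[OF ac(2)] by (simp add: NM)
 have e: "afun mu u = ?Phi (afun (bq M mu A' mm) u)" if u: "u IN (fst (bq M mu A' mm))" for u
 proof -
 have u': "u IN (tens R M A')" using u as(2) by simp
 have "afun mu u = tf (oM M mu) (ract (oM M mu)) (q0 M A' (oM M mu) (rg BA) idf idf u)"
 by (rule R.tens_ext[OF ac(1) A'_bm _ mul lin_comp[OF as(8) l] _ u']) (use act(2) as(9) in simp_all)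
 then show ?thesis using as(4) u' by simp
 qed
 have surj: "EX u:carrier (fst (bq M mu A' mm)). z = afun (bq M mu A' mm) u" if "z IN (cod (bq M mu A' mm))" for z
 using as(2,3) that by simp
 from R.D_factor[where q = "bq M mu A' mm" and g = mu and \<theta> = "%x. x", OF as(1) surj ac(2) _ _ e] as(2)
 show "balcounit : Ar R.MR" "fst balcounit = cod (bq M mu A' mm)" "cod balcounit = M"
 "z IN (cod (bq M mu A' mm)) ==>
 afun balcounit z = tf (oM M mu) (ract (oM M mu)) (bth M mu (oM M mu) idf A' mm (rg BA) idf z)" by simp_all
qed

context
 fixes r assumes r: "r : Ar R.MR" "fst r = M" "cod r = (TM M mu)"
begin

private lemma rl: "afun r : lm K M (TM M mu)" using arrow_lin(2)[OF r(1)] r by simp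
private lemma rc: "m IN M ==> afun r m IN (TM M mu)" using lin_closed[OF rl] .
private lemma NM: "lm K (oM M mu) P = lm K M P" by (rule lm_cong) simp_all

lemma coord_app: "m IN M ==> coord r m = (thM M mu) (afun r m)"
 by (simp add: compose_def)

lemma coord_lin: "coord r : lm K (oM M mu) (tens BA (oM M mu) YY)"
 unfolding NM by (rule lin_cong[OF lin_comp[OF rl qs9(6)]]) (simp_all add: compose_def)

text \<open>Coordinates are injective, so the two arrows may be compared after applying them; they
  turn the action on the quotient into the ordinary one.\<close>

lemma corep_linear_iff: "CM r mu = CM (tauM M mu) (AM r (IR A')) \<longleftrightarrow>
 coord r : rlm K BA (oM M mu) (rtens BA (oM M mu) YY)"
proof -
 let ?f = "CM r mu" and ?g = "CM (tauM M mu) (AM r (IR A'))"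
 have fg: "?f : Ar R.MR" "?g : Ar R.MR" "fst ?f = rtens R M A'" "fst ?g = rtens R M A'" "cod ?f = cod ?g"
 using r ta by simp_all
 have e: "afun ?f (pt R M A' m a) = afun ?g (pt R M A' m a) \<longleftrightarrow> coord r (ract (oM M mu) m a) = ract (rtens BA (oM M mu) YY) (coord r m) a"
 if ma: "m IN M" "a IN A'" for m a
 proof -
 have m: "ract (oM M mu) m a IN M" using rm_closed[OF act(2), of m a] ma by simp
 have t: "afun (tauM M mu) (pt R (TM M mu) A' (afun r m) a) IN (TM M mu)" using D.app_closed[OF ta(1)] ta(2,3) rc ma by simp
 have "afun ?f (pt R M A' m a) = afun r (ract (oM M mu) m a)" "afun ?g (pt R M A' m a) = afun (tauM M mu) (pt R (TM M mu) A' (afun r m) a)"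
 using ma r by simp_all
 moreover have "(afun r (ract (oM M mu) m a) = afun (tauM M mu) (pt R (TM M mu) A' (afun r m) a)) =
 ((thM M mu) (afun r (ract (oM M mu) m a)) = (thM M mu) (afun (tauM M mu) (pt R (TM M mu) A' (afun r m) a)))"
 using inj_on_eq_iff[OF bq_inj[OF data_AX[OF M]] rc[OF m] t] by simp
 ultimately show ?thesis using ta(4)[OF rc[OF ma(1)] ma(2)] coord_app m ma by simp
 qed
 have "?f = ?g \<longleftrightarrow> (ALL m:carrier M. ALL a:carrier A'. afun ?f (pt R M A' m a) = afun ?g (pt R M A' m a))"
 using R.D_ext2[OF fg(1,2,5,3,4) ac(1) A'_bm] by metis
 also have "... = (ALL m:carrier M. ALL a:carrier A'. coord r (ract (oM M mu) m a) = ract (rtens BA (oM M mu) YY) (coord r m) a)"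
 using e by blast
 also have "... \<longleftrightarrow> coord r : rlm K BA (oM M mu) (rtens BA (oM M mu) YY)"
 using coord_lin by (simp add: right_linear_maps_def)
 finally show ?thesis .
qed

private lemma idN: "(idc (oM M mu)) : rlm K BA (oM M mu) (oM M mu)"
 by (rule rl_conc(4)[OF act(2) rl_conc(2)])
private lemma idY: "(idc YY) : blm K BA YY YY"
 by (rule bl_conc(4)[OF YY_bm bl_conc(2)])
private lemma de: "afun dOrd : blm K BA YY (btens BA YY YY)" "afun eOrd : blm K BA YY (rg BA)"
 using dOrd(1-3) eOrd(1-3) by (simp_all add: C.ar_iff del: arrow_ob)

text \<open>Linearity comes first: for a linear \<open>coord r\<close> the map that \<open>r\<close>
  and the identity induce on the quotient is an ordinary tensor product of maps over the
  algebra.\<close>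

lemma corep_coassoc_iff:
 assumes lin: "coord r : rlm K BA (oM M mu) (rtens BA (oM M mu) YY)"
 shows "CM (bal_assoc R.RMR R.MR A' CC M mu) (CM
 (bal_map R.RMR R.MR A' M mu AX (cor_lact CC) r (TM M mu) (tauM M mu) AX (cor_lact CC) (IR AX)) r)
 = CM (bal_map R.RMR R.MR A' M mu AX (cor_lact CC) (IM M) M mu Sq sql (cor_comult CC)) r
 \<longleftrightarrow> Q.coassoc_on (oM M mu) YY (coord r) (afun dOrd)"
proof -
 let ?b1 = "bal_map R.RMR R.MR A' M mu AX (cor_lact CC) r (TM M mu) (tauM M mu) AX (cor_lact CC) (IR AX)"
 and ?b2 = "bal_map R.RMR R.MR A' M mu AX (cor_lact CC) (IM M) M mu Sq sql (cor_comult CC)"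
 let ?f = "CM (bal_assoc R.RMR R.MR A' CC M mu) (CM ?b1 r)" and ?g = "CM ?b2 r"
 let ?th = "bth M mu (oM M mu) idf Sq sql (btens BA YY YY) ths"
 have b1: "?b1 : Ar R.MR" "fst ?b1 = (TM M mu)" "cod ?b1 = cod (bq (TM M mu) (tauM M mu) AX (cor_lact CC))"
 "z IN (TM M mu) ==> bth (TM M mu) (tauM M mu) (rtens BA (oM M mu) YY) (thM M mu) AX (cor_lact CC) YY idf (afun ?b1 z) =
 tmap BA (oM M mu) YY (rtens BA (oM M mu) YY) YY (coord r) (idc YY) ((thM M mu) z)" for z
 by (rule bal_map_th[OF data_AX[OF M] data_T[OF M] r _ _ _ lin _ idY]; simp add: compose_def)+
 have b2: "?b2 : Ar R.MR" "fst ?b2 = (TM M mu)" "cod ?b2 = cod (bq M mu Sq sql)"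
 "z IN (TM M mu) ==> ?th (afun ?b2 z) = tmap BA (oM M mu) YY (oM M mu) (btens BA YY YY) (idc (oM M mu)) (afun dOrd) ((thM M mu) z)" for z
 by (rule bal_map_th[OF data_AX[OF M] data_Sq[OF M] _ _ _ cor_comult(1-3) idN _ de(1)];
 simp add: dOrd(4) dY_def)+
 note as = bal_assoc[OF M]
 have fg: "?f : Ar R.MR" "?g : Ar R.MR" "fst ?f = M" "fst ?g = M" "cod ?f = cod (bq M mu Sq sql)" "cod ?g = cod (bq M mu Sq sql)"
 using r b1(1-3) b2(1-3) as(1-3) by simp_all
 have e: "afun ?f m = afun ?g m \<longleftrightarrow> tassoc BA (oM M mu) YY YY (tmap BA (oM M mu) YY (rtens BA (oM M mu) YY) YY (coord r) (idc YY) (coord r m))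
 = tmap BA (oM M mu) YY (oM M mu) (btens BA YY YY) (idc (oM M mu)) (afun dOrd) (coord r m)" if m: "m IN M" for m
 proof -
 have c: "afun ?b1 (afun r m) IN (cod (bq (TM M mu) (tauM M mu) AX (cor_lact CC)))"
 using D.app_closed[OF b1(1)] b1(2,3) rc[OF m] by simp
 have a: "afun ?f m = afun (bal_assoc R.RMR R.MR A' CC M mu) (afun ?b1 (afun r m))" "afun ?g m = afun ?b2 (afun r m)"
 using m r(2) by simp_all
 have "(afun ?f m = afun ?g m) = (?th (afun ?f m) = ?th (afun ?g m))"
 by (rule inj_on_eq_iff[OF bq_inj[OF data_Sq[OF M]], symmetric]) (use D.app_closed[OF fg(1)] D.app_closed[OF fg(2)] fg m in simp_all)
 also have "?th (afun ?f m) = tassoc BA (oM M mu) YY YY (tmap BA (oM M mu) YY (rtens BA (oM M mu) YY) YY (coord r) (idc YY) ((thM M mu) (afun r m)))"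
 unfolding a by (simp only: as(4)[OF c] b1(4)[OF rc[OF m]])
 also have "?th (afun ?g m) = tmap BA (oM M mu) YY (oM M mu) (btens BA YY YY) (idc (oM M mu)) (afun dOrd) ((thM M mu) (afun r m))"
 unfolding a by (simp only: b2(4)[OF rc[OF m]])
 finally show ?thesis by (simp only: coord_app[OF m])
 qed
 have "?f = ?g \<longleftrightarrow> (ALL m:carrier M. afun ?f m = afun ?g m)"
 by (rule D.ar_eq_iff[OF fg(1-4)]) (simp only: fg(5,6))
 then show ?thesis using e by (simp add: Q.coassoc_on_def)
qed

lemma corep_counit_iff:
 "CM balcounit (CM
 (bal_map R.RMR R.MR A' M mu AX (cor_lact CC) (IM M) M mu A' mm (cor_counit CC)) r) = IM M
 \<longleftrightarrow> Q.counit_on (oM M mu) YY (coord r) (afun eOrd)"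
proof -
 let ?b = "bal_map R.RMR R.MR A' M mu AX (cor_lact CC) (IM M) M mu A' mm (cor_counit CC)"
 let ?f = "CM balcounit (CM ?b r)"
 have b: "?b : Ar R.MR" "fst ?b = (TM M mu)" "cod ?b = cod (bq M mu A' mm)"
 "z IN (TM M mu) ==> bth M mu (oM M mu) idf A' mm (rg BA) idf (afun ?b z) =
 tmap BA (oM M mu) YY (oM M mu) (rg BA) (idc (oM M mu)) (afun eOrd) ((thM M mu) z)" for z
 by (rule bal_map_th[OF data_AX[OF M] data_A[OF M] _ _ _ cor_counit(2-4) idN _ de(2)]; simp add: eOrd(4) cY_def)+
 have f: "?f : Ar R.MR" "fst ?f = M" "cod ?f = M"
 using r b(1-3) balcounit(1-3) by simp_all
 have e: "afun ?f m = tf (oM M mu) (%m x. ract (oM M mu) m (afun eOrd x)) (coord r m)" if m: "m IN M" for m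
 proof -
 have c: "afun ?b (afun r m) IN (cod (bq M mu A' mm))"
 using D.app_closed[OF b(1)] b(2,3) rc[OF m] by simp
 have "afun ?f m = afun balcounit (afun ?b (afun r m))" using m r(2) by simp
 also have "... = tf (oM M mu) (ract (oM M mu)) (tmap BA (oM M mu) YY (oM M mu) (rg BA) (idc (oM M mu)) (afun eOrd) ((thM M mu) (afun r m)))"
 by (simp only: balcounit(4)[OF c] b(4)[OF rc[OF m]])
 also have "... = tf (oM M mu) (%m x. ract (oM M mu) m (afun eOrd x)) ((thM M mu) (afun r m))"
 by (rule Q.counit_expand[OF act(2) YY_bm de(2)]) (rule lin_closed[OF qs9(6) rc[OF m]])
 finally show ?thesis by (simp only: coord_app[OF m])
 qed
 have "?f = IM M \<longleftrightarrow> (ALL m:carrier M. afun ?f m = afun (IM M) m)"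
 by (rule D.ar_eq_iff[OF f(1)]) (use f in simp_all)
 moreover have "afun (IM M) m = m" if "m IN M" for m using that by simp
 ultimately have "?f = IM M \<longleftrightarrow> (ALL m:carrier M. afun ?f m = m)" by simp
 then show ?thesis using e by (simp add: Q.counit_on_def)
qed

end

lemma corep_iff: "right_corep_in R.RMR R.MR A' mm ee CC (M, mu, r) \<longleftrightarrow> r : Ar R.MR & fst r = M & cod r = (TM M mu) &
 right_comodule_in Q.RMR Q.MR YY dOrd eOrd ((oM M mu), ((oM M mu), coord r, rtens BA (oM M mu) YY))"
proof -
 have "coord r \<in> extensional (carrier (oM M mu))" by simp
 then have ar: "((oM M mu), coord r, rtens BA (oM M mu) YY) : Ar Q.MR \<longleftrightarrow> coord r : rlm K BA (oM M mu) (rtens BA (oM M mu) YY)"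
 using act(2) by (simp add: D.ar_iff del: arrow_ob)
 show ?thesis
 unfolding Q.comodule_iff[OF YY_bm dOrd(1-3) eOrd(1-3)]
 using corep_linear_iff[of r] corep_coassoc_iff[of r] corep_counit_iff[of r] M ar
 by (auto simp: right_corep_in_def Let_def D.c_simps(4) C.c_simps(4) D.hom_iff)
qed

end

end

section \<open>Ordinary comodules and Doi-Koppinen modules\<close>

context dk
begin

lemma C_bilinear_idX: "(idc C) : blm K R X X"
 using bl_conc(4)[OF X_bm bl_conc(2)] by simp

lemma idYY: "(idc YY) : blm K BA YY YY"
 by (rule bl_conc(4)[OF YY_bm bl_conc(2)])

text \<open>The right-hand side of the compatibility condition as an operation, (m \<otimes> x) a =
  m a_0 \<otimes> x a_1.\<close>

definition "dk_act V w a = tf (tens R (resR V) X) (%m0 m1.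
 tf (tens R (resR V) X) (%a0 a1. pt R (resR V) X (ract V m0 a0) (ract C m1 a1)) (rho a)) w"

context
 fixes V :: "('k, 'a univ) rmod"
 assumes V: "rm K BA V"
begin

private lemma rs: "res_eq (resR V) V" by (rule res_eq_resR[OF V])
private lemma Mr: "rm K R (resR V)" using V by simp
private lemma cl: "v IN V ==> a IN A' ==> ract V v a IN V" using rm_closed[OF V] by simp
private lemma mods: "module K (tens BA V YY)" "module K (tens R (resR V) X)" "module K (resR V)" using V by simp_all

private lemma linM: "lm K (resR V) P = lm K V P" "lm K P (resR W) = lm K P W"
 by (rule lm_cong; simp)+
private lemma linM': "lm K (resR W) P = lm K W P"
 by (rule lm_cong; simp)+

private lemma pl: "v IN V ==> pt BA V YY v : lm K (tX) (tens BA V YY)"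
 using Q.bal_lin_right[OF Q.ptens_bal[OF V YY_bm]] by (simp add: YY_lin)

private lemmas Upl = lin_comp[OF pl Up_lin[OF rs]]

text \<open>For the balancing, the Takeuchi property of the coaction carries r from m r a_0 to t(r)
  a_1, and x t(r) is r x.\<close>

lemma dk_act_bal:
 assumes a: "a IN A'"
 shows "balanced K R (resR V) X (tens R (resR V) X) (%m0 m1.
 tf (tens R (resR V) X) (%a0 a1. pt R (resR V) X (ract V m0 a0) (ract C m1 a1)) (rho a))"
proof (rule balancedI)
 fix m y assume m: "m IN (resR V)" and y: "y IN X"
 show "tf (tens R (resR V) X) (%a0 a1. pt R (resR V) X (ract V m a0) (ract C y a1)) (rho a) IN (tens R (resR V) X)"
 by (rule tlift_rho_closed[OF mods(2) a]) (use m y cl in simp_all)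
 fix m' assume m': "m' IN (resR V)"
 show "tf (tens R (resR V) X) (%a0 a1. pt R (resR V) X (ract V (m \<oplus>\<^bsub>resR V\<^esub> m') a0) (ract C y a1)) (rho a) =
 tf (tens R (resR V) X) (%a0 a1. pt R (resR V) X (ract V m a0) (ract C y a1)) (rho a) \<oplus>\<^bsub>tens R (resR V) X\<^esub>
 tf (tens R (resR V) X) (%a0 a1. pt R (resR V) X (ract V m' a0) (ract C y a1)) (rho a)"
 by (rule R.tlift_addI[OF A'_rm Hb_bm mods(2) rho_closed_A'[OF a]])
 (use m m' y cl V Mr in "simp_all add: Q.lin_simps(5) R.lin_simps(1)")
 next
 fix m y y' assume m: "m IN (resR V)" and y: "y IN X" "y' IN X"
 show "tf (tens R (resR V) X) (%a0 a1. pt R (resR V) X (ract V m a0) (ract C (y \<oplus>\<^bsub>X\<^esub> y') a1)) (rho a) =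
 tf (tens R (resR V) X) (%a0 a1. pt R (resR V) X (ract V m a0) (ract C y a1)) (rho a) \<oplus>\<^bsub>tens R (resR V) X\<^esub>
 tf (tens R (resR V) X) (%a0 a1. pt R (resR V) X (ract V m a0) (ract C y' a1)) (rho a)"
 by (rule R.tlift_addI[OF A'_rm Hb_bm mods(2) rho_closed_A'[OF a]])
 (use m y cl V Mr in "simp_all add: rm_addl[OF C_rm] R.lin_simps(2)")
 next
 fix m y kk assume m: "m IN (resR V)" and y: "y IN X" "kk IN K"
 show "tf (tens R (resR V) X) (%a0 a1. pt R (resR V) X (ract V m a0) (ract C (kk \<odot>\<^bsub>X\<^esub> y) a1)) (rho a) =
 kk \<odot>\<^bsub>tens R (resR V) X\<^esub> tf (tens R (resR V) X) (%a0 a1. pt R (resR V) X (ract V m a0) (ract C y a1)) (rho a)"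
 by (rule R.tlift_smultI[OF A'_rm Hb_bm mods(2) rho_closed_A'[OF a] y(2)])
 (use m y cl V Mr in "simp_all add: H.lin_simps(7) R.lin_simps(4)")
 next
 fix m y r assume m: "m IN (resR V)" and y: "y IN X" "r IN R"
 have bh: "balanced K R A' Hb (tens R (resR V) X) (%a0 a1. pt R (resR V) X (ract V m a0) (ract C y a1))"
 proof -
 show ?thesis
 by (rule R.balanced_lin[OF A'_rm Hb_bm psi_inner_bal Upl[of m]]) (use m y in simp_all, simp add: Up_ptens[OF rs])
 qed
 have "tf (tens R (resR V) X) (%a0 a1. pt R (resR V) X (ract V (ract V m (eta r)) a0) (ract C y a1)) (rho a)
 = tf (tens R (resR V) X) (%a0 a1. pt R (resR V) X (ract V m (lact A' r a0)) (ract C y a1)) (rho a)"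
 by (rule rho_cong[OF mods(2) a]) (use m y rm_mult[OF V, symmetric, simplified] in "simp_all add: am_eta")
 also have "... = tf (tens R (resR V) X) (%a0 a1. pt R (resR V) X (ract V m a0) (ract C y (t r \<star> a1))) (rho a)"
 using rho_lact_A'(3)[OF mods(2) bh a y(2)] .
 also have "... = tf (tens R (resR V) X) (%a0 a1. pt R (resR V) X (ract V m a0) (ract C (lact X r y) a1)) (rho a)"
 by (rule rho_cong[OF mods(2) a]) (use m y C_lin_simps(3) in "simp_all del: hb_simps(8)")
 finally show "tf (tens R (resR V) X) (%a0 a1. pt R (resR V) X (ract V (ract (resR V) m r) a0) (ract C y a1)) (rho a) =
 tf (tens R (resR V) X) (%a0 a1. pt R (resR V) X (ract V m a0) (ract C (lact X r y) a1)) (rho a)"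
 using m y by (simp del: hb_simps(8))
 qed

lemma dk_act_ptens: "v IN V ==> x IN C ==> a IN A' ==>
 dk_act V (pt R (resR V) X v x) a = tf (tens R (resR V) X) (%a0 a1. pt R (resR V) X (ract V v a0) (ract C x a1)) (rho a)"
 using dk_act_bal Mr by (simp add: dk_act_def)

lemma dk_act_lin: "a IN A' ==> (%w. dk_act V w a) : lm K (tens R (resR V) X) (tens R (resR V) X)"
 unfolding dk_act_def by (rule R.tlift_lin[OF Mr X_bm mods(2) dk_act_bal])

text \<open>On v \<otimes> (b \<otimes> x) both sides are v b a_0 \<otimes> x a_1. Transported along
  \<open>Up\<close>, right linearity of a coaction thereby turns into the compatibility
  condition.\<close>

lemma Up_act:
 assumes z: "z IN (tens BA V YY)" and a: "a IN A'"
 shows "Up (resR V) V (ract (rtens BA V YY) z a) = dk_act V (Up (resR V) V z) a"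
proof (rule VY_ext[OF rs lin_comp[OF _ Up_lin[OF rs]] lin_comp[OF Up_lin[OF rs] dk_act_lin[OF a]] mods(2) _ z])
 show "(%z. ract (rtens BA V YY) z a) : lm K (tens BA V YY) (tens BA V YY)"
 using Q.ract_lin[OF V YY_bm, of a] a by simp
 fix v b x assume v: "v IN V" "b IN A'" "x IN C"
 have "Up (resR V) V (ract (rtens BA V YY) (pt BA V YY v (pX b x)) a) = Up (resR V) V (pt BA V YY v (ra (pX b x) a))"
 using v a V by simp
 also have "... = tf (tens R (resR V) X) (%a0 h. Up (resR V) V (pt BA V YY v (pX (am b a0) (ract C x h)))) (rho a)"
 unfolding ra_ptens[OF v(2) a v(3)] by (rule rho_fuse[OF Upl[OF v(1)] AX_simps(3) mods(2) a]) (use v in simp_all)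
 also have "... = tf (tens R (resR V) X) (%a0 h. pt R (resR V) X (ract V (ract V v b) a0) (ract C x h)) (rho a)"
 by (rule rho_cong[OF mods(2) a]) (use v rm_mult[OF V] in "simp_all add: Up_ptens[OF rs]")
 also have "... = dk_act V (Up (resR V) V (pt BA V YY v (pX b x))) a"
 using v a cl by (simp add: Up_ptens[OF rs] dk_act_ptens)
 finally show "Up (resR V) V (ract (rtens BA V YY) (pt BA V YY v (pX b x)) a) = dk_act V (Up (resR V) V (pt BA V YY v (pX b x))) a" .
qed

lemma Jp_ract: "w IN (tens R (resR V) X) ==> r IN R ==>
 Jp V (ract (rtens R (resR V) X) w r) = ract (rtens BA V YY) (Jp V w) (eta r)"
proof (rule R.tens_ext[OF Mr X_bm mods(1) lin_comp[OF R.ract_lin[OF Mr X_bm] Jp_lin[OF rs]]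
 lin_comp[OF Jp_lin[OF rs] Q.ract_lin[OF V YY_bm]]])
 fix v x assume r: "r IN R" and v: "v IN (resR V)" "x IN X"
 have "ra (pX uno x) (eta r) = pX uno (ract X x r)"
 using la_ra_eta(1)[of "pX uno x" r] v r by (simp del: hb_simps(7))
 then show "Jp V (ract (rtens R (resR V) X) (pt R (resR V) X v x) r) = ract (rtens BA V YY) (Jp V (pt R (resR V) X v x)) (eta r)"
 using v r V Mr rm_closed[OF X_rm, of x r] by (simp add: Jp_ptens[OF rs] del: hb_simps(7))
qed simp_all

lemma Jp_right_linear: "Jp V : rlm K R (rtens R (resR V) X) (resR (rtens BA V YY))"
 by (rule rlmI) (use Jp_lin[OF rs] lin_closed[OF Jp_lin[OF rs]] in "simp_all add: linM Jp_ract")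

lemma Up_right_linear: "Up (resR V) V : rlm K R (resR (rtens BA V YY)) (rtens R (resR V) X)"
proof (rule rlmI)
 fix z r assume z: "z IN (resR (rtens BA V YY))" and r: "r IN R"
 then have z: "z IN (tens BA V YY)" by simp
 note w = lin_closed[OF Up_lin[OF rs] z]
 have "Up (resR V) V (Jp V (ract (rtens R (resR V) X) (Up (resR V) V z) r)) = ract (rtens R (resR V) X) (Up (resR V) V z) r"
 by (rule Up_Jp[OF rs]) (use rm_closed[OF R.rtens_right_module[OF Mr X_bm]] w r in simp)
 then show "Up (resR V) V (ract (resR (rtens BA V YY)) z r) = ract (rtens R (resR V) X) (Up (resR V) V z) r"
 using Jp_ract[OF w r] z r Jp_Up[OF rs z] by simp
qed (use Up_lin[OF rs] in "simp add: linM'")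

private abbreviation "W \<equiv> rtens BA V YY"
private abbreviation "RX \<equiv> rtens R (resR V) X"

private lemma Wm: "rm K BA W" "rm K R (resR W)" "rm K R RX" "res_eq (resR W) W"
 using V Mr res_eq_resR[of W] by simp_all

text \<open>\<open>Jp\<close> at both levels, from V \<otimes> X \<otimes> X to V tensored twice
  with the coring. Its injectivity lets the two coassociativity laws be compared.\<close>

private definition "J2 u = Jp W (tmap R RX X (resR W) X (Jp V) (idc C) u)"

private lemmas jt = R.tmap_ptens[OF Wm(3) X_bm Wm(2) X_bm Jp_right_linear C_bilinear_idX, unfolded hb_simps(1)]
private lemmas jl = R.tmap_lin[OF Wm(3) X_bm Wm(2) X_bm Jp_right_linear C_bilinear_idX, unfolded hb_simps(1)]
private lemmas ut = R.tmap_ptens[OF Wm(2) X_bm Wm(3) X_bm Up_right_linear C_bilinear_idX, unfolded hb_simps(1)]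
private lemmas ul = R.tmap_lin[OF Wm(2) X_bm Wm(3) X_bm Up_right_linear C_bilinear_idX, unfolded hb_simps(1)]

private lemma J2_lin: "J2 : lm K (tens R RX X) (tens BA W YY)"
 unfolding J2_def[abs_def] by (rule lin_comp[OF jl Jp_lin[OF Wm(4)]])

private lemma J2_inj: "inj_on J2 (carrier (tens R RX X))"
proof (rule inj_on_inverseI[where g = "%z. tmap R (resR W) X RX X (Up (resR V) V) (idc C) (Up (resR W) W z)"])
 fix u assume u: "u IN (tens R RX X)"
 have "tmap R (resR W) X RX X (Up (resR V) V) (idc C) (tmap R RX X (resR W) X (Jp V) (idc C) u) = u"
 by (rule R.tens_ext[OF Wm(3) X_bm _ lin_comp[OF jl ul] lin_id _ u])
 (use Wm lin_closed[OF Jp_lin[OF rs]] Up_Jp[OF rs] in "simp_all add: jt ut del: rt_left")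
 then show "tmap R (resR W) X RX X (Up (resR V) V) (idc C) (Up (resR W) W (J2 u)) = u"
 unfolding J2_def using Up_Jp[OF Wm(4) lin_closed[OF jl u]] by simp
qed

text \<open>Both sides send v \<otimes> x to v \<otimes> ((1 \<otimes> x_1) \<otimes> (1 \<otimes>
  x_2)), since the comultiplication of the coring on 1 \<otimes> x is that of C.\<close>

private lemma J2_comult:
 assumes u: "u IN (tens R (resR V) X)"
 shows "tmap BA V YY V (btens BA YY YY) (idc V) (afun dOrd) (Jp V u)
 = tassoc BA V YY YY (J2 (tassoc_inv R (resR V) X X (tmap R (resR V) X (resR V) XX (idc V) \<delta>C u)))"
proof -
 have idV: "(idc V) : rlm K BA V V" by (rule rl_conc(4)[OF V rl_conc(2)])
 have idM: "(idc V) : rlm K R (resR V) (resR V)"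
 using rl_conc(4)[OF Mr rl_conc(2)] by simp
 have d: "afun dOrd : blm K BA YY (btens BA YY YY)" using dOrd(1-3) by (simp add: C.ar_iff del: arrow_ob)
 note dt = Q.tmap_ptens[OF V YY_bm V _ idV d] and dl = Q.tmap_lin[OF V YY_bm V _ idV d]
 note ct = R.tmap_ptens[OF Mr X_bm Mr _ idM \<delta>C_bilinear] and cl = R.tmap_lin[OF Mr X_bm Mr _ idM \<delta>C_bilinear]
 note al = lin_comp[OF lin_comp[OF R.tassoc_inv_lin[OF Mr X_bm X_bm] J2_lin] Q.tassoc_lin[OF V YY_bm YY_bm]]
 show ?thesis
 proof (rule R.tens_ext[OF Mr X_bm _ lin_comp[OF Jp_lin[OF rs] dl] lin_comp[OF cl al] _ u])
 fix v x assume "v IN (resR V)" "x IN X"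
 then have v: "v IN V" "x IN C" by simp_all
 have l1: "(%w. pt BA V (btens BA YY YY) v (dPhi (pt R A' XX uno w))) : lm K (tens R X X) (tens BA V (btens BA YY YY))"
 using lin_comp[OF lin_comp[OF _ dPhi_lin] Q.bal_lin_right[OF Q.ptens_bal[OF V], of "btens BA YY YY" v, simplified], of "pt R A' XX uno" "tens R X X"]
 ptens_right_lin[of A' XX uno] v by simp
 have l2: "(%w. tassoc BA V YY YY (J2 (tassoc_inv R (resR V) X X (pt R (resR V) XX v w)))) : lm K (tens R X X) (tens BA V (btens BA YY YY))"
 using lin_comp[OF _ al, of "pt R (resR V) XX v" "tens R X X"] R.bal_lin_right[OF R.ptens_bal[OF Mr], of XX v] v by simp
 have e: "pt BA V (btens BA YY YY) v (dPhi (pt R A' XX uno w)) = tassoc BA V YY YY (J2 (tassoc_inv R (resR V) X X (pt R (resR V) XX v w)))"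
 if w: "w IN (tens R X X)" for w
 proof (rule R.tens_ext[OF X_rm X_bm _ l1 l2 _ w])
 fix y z assume "y IN X" "z IN X"
 then show "pt BA V (btens BA YY YY) v (dPhi (pt R A' XX uno (pt R X X y z)))
 = tassoc BA V YY YY (J2 (tassoc_inv R (resR V) X X (pt R (resR V) XX v (pt R X X y z))))"
 using v R.tassoc_inv_ptens[OF Mr X_bm X_bm] Q.tassoc_ptens[OF V YY_bm YY_bm] Jp_ptens[OF Wm(4)] Wm V
 by (simp add: dPhi_ptens J2_def jt Jp_ptens[OF rs] del: rt_left)
 qed (use V in simp)
 show "tmap BA V YY V (btens BA YY YY) (idc V) (afun dOrd) (Jp V (pt R (resR V) X v x))
 = tassoc BA V YY YY (J2 (tassoc_inv R (resR V) X X (tmap R (resR V) X (resR V) XX (idc V) \<delta>C (pt R (resR V) X v x))))"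
 using v e[of "\<delta>C x"] dOrd(4) by (simp add: Jp_ptens[OF rs] dt ct dY_ptens)
 qed (use V in simp_all)
qed

text \<open>Linearity of \<open>r\<close> over A already makes \<open>g\<close> linear over R; under
  it the two coassociativity laws are carried into each other by the injective
  \<open>J2\<close>.\<close>

lemma ord_dk_iff:
 assumes r: "r : lm K V (tens BA V YY)" and g: "!!m. m IN V ==> g m = Up (resR V) V (r m)"
 shows "r : rlm K BA V W & Q.coassoc_on V YY r (afun dOrd) & Q.counit_on V YY r (afun eOrd) \<longleftrightarrow>
 g : rlm K R (resR V) RX & R.coassoc_on (resR V) X g \<delta>C & R.counit_on (resR V) X g epsC &
 (ALL m:carrier V. ALL a:carrier A'. g (ract V m a) = dk_act V (g m) a)"
proof -
 have rc: "r m IN (tens BA V YY)" and gc: "g m IN (tens R (resR V) X)" and rJ: "r m = Jp V (g m)" if "m IN V" for m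
 using lin_closed[OF r that] lin_closed[OF Up_lin[OF rs]] Jp_Up[OF rs] g[OF that] by simp_all
 have gl: "g : lm K (resR V) (tens R (resR V) X)" unfolding linM
 by (rule lin_cong[OF lin_comp[OF r Up_lin[OF rs]]]) (use V g in simp_all)
 \<comment> \<open>\<open>Up\<close> is injective because \<open>Jp\<close> inverts it; applied to
   the linearity equation of \<open>r\<close> it gives the compatibility condition of
   \<open>g\<close>.\<close>
 have inj: "(r (ract V m a) = ract W (r m) a) = (g (ract V m a) = dk_act V (g m) a)" if "m IN V" "a IN A'" for m a
 proof -
 have c: "ract W (r m) a IN (tens BA V YY)" using rm_closed[OF Wm(1)] rc that by simp
 have "(r (ract V m a) = ract W (r m) a) = (Up (resR V) V (r (ract V m a)) = Up (resR V) V (ract W (r m) a))"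
 using Jp_Up[OF rs c] Jp_Up[OF rs rc[OF cl[OF that]]] by metis
 then show ?thesis using Up_act[OF rc[OF that(1)] that(2)] g that cl by simp
 qed
 have lin: "r : rlm K BA V W \<longleftrightarrow> (ALL m:carrier V. ALL a:carrier A'. g (ract V m a) = dk_act V (g m) a)"
 using r inj by (simp add: right_linear_maps_def)
 have glin: "g : rlm K R (resR V) RX" if rl: "r : rlm K BA V W"
 proof (rule rlmI)
 fix m b assume m: "m IN (resR V)" "b IN R"
 then have "r (ract V m (eta b)) = ract W (r m) (eta b)" using rl_ract[OF rl, of m "eta b"] by simp
 then show "g (ract (resR V) m b) = ract RX (g m) b"
 using rl_ract[OF Up_right_linear, of "r m" b] m cl g rc by simp
 qed (use gl in simp)
 have coassoc: "Q.coassoc_on V YY r (afun dOrd) \<longleftrightarrow> R.coassoc_on (resR V) X g \<delta>C" if rl: "r : rlm K BA V W"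
 proof -
 note rt = Q.tmap_ptens[OF V YY_bm Wm(1) YY_bm rl idYY] and rtl = Q.tmap_lin[OF V YY_bm Wm(1) YY_bm rl idYY]
 note gt = R.tmap_ptens[OF Mr X_bm Wm(3) X_bm glin[OF rl] C_bilinear_idX] and gtl = R.tmap_lin[OF Mr X_bm Wm(3) X_bm glin[OF rl] C_bilinear_idX]
 \<comment> \<open>Applying \<open>r\<close> to the left leg corresponds to applying
   \<open>g\<close> there and then passing to the coring at both levels.\<close>
 have 1: "tmap BA V YY W YY r (idc YY) (Jp V u) = J2 (tmap R (resR V) X RX X g (idc C) u)"
 if u: "u IN (tens R (resR V) X)" for u
 proof (rule R.tens_ext[OF Mr X_bm _ lin_comp[OF Jp_lin[OF rs] rtl] lin_comp[OF gtl J2_lin] _ u])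
 fix v x assume "v IN (resR V)" "x IN X"
 then have v: "v IN V" "x IN C" by simp_all
 have "tmap BA V YY W YY r (idc YY) (Jp V (pt R (resR V) X v x)) = pt BA W YY (r v) (pX uno x)"
 using rt[of v "pX uno x"] v by (simp add: Jp_ptens[OF rs] del: rt_left)
 also have "... = J2 (tmap R (resR V) X RX X g (idc C) (pt R (resR V) X v x))"
 using gt[of v x] jt[of "g v" x] v gc rc rJ Jp_ptens[OF Wm(4), of "r v" x] by (simp add: J2_def del: rt_left)
 finally show "tmap BA V YY W YY r (idc YY) (Jp V (pt R (resR V) X v x)) = ..." .
 qed (use Wm in simp)
 have idM: "(idc V) : rlm K R (resR V) (resR V)"
 using rl_conc(4)[OF Mr rl_conc(2)] by simp
 have "(tassoc BA V YY YY (tmap BA V YY W YY r (idc YY) (r m)) = tmap BA V YY V (btens BA YY YY) (idc V) (afun dOrd) (r m))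
 = (tassoc R (resR V) X X (tmap R (resR V) X RX X g (idc C) (g m)) = tmap R (resR V) X (resR V) XX (idc V) \<delta>C (g m))"
 (is "?l = ?r") if m: "m IN V" for m
 proof -
 let ?a = "tmap R (resR V) X RX X g (idc C) (g m)" and ?b = "tmap R (resR V) X (resR V) XX (idc V) \<delta>C (g m)"
 let ?c = "tassoc_inv R (resR V) X X ?b"
 have a: "?a IN (tens R RX X)" by (rule lin_closed[OF gtl gc[OF m]])
 have b: "?b IN (tens R (resR V) XX)"
 by (rule lin_closed[OF R.tmap_lin[OF Mr X_bm Mr _ idM \<delta>C_bilinear] gc[OF m]]) simp
 have c: "?c IN (tens R RX X)" by (rule lin_closed[OF R.tassoc_inv_lin[OF Mr X_bm X_bm] b])
 have "?l = (tassoc BA V YY YY (J2 ?a) = tassoc BA V YY YY (J2 ?c))"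
 unfolding rJ[OF m] by (simp only: 1[OF gc[OF m]] J2_comult[OF gc[OF m]])
 also have "... = (J2 ?a = J2 ?c)"
 using Q.tassoc_inv1[OF V YY_bm YY_bm lin_closed[OF J2_lin a]] Q.tassoc_inv1[OF V YY_bm YY_bm lin_closed[OF J2_lin c]] by metis
 also have "... = (?a = ?c)" by (rule inj_on_eq_iff[OF J2_inj a c])
 also have "... = ?r" using R.tassoc_inv1[OF Mr X_bm X_bm a] R.tassoc_inv2[OF Mr X_bm X_bm b] by metis
 finally show ?thesis .
 qed
 then show ?thesis by (simp add: Q.coassoc_on_def R.coassoc_on_def cong: ball_cong)
 qed
 have counit: "Q.counit_on V YY r (afun eOrd) \<longleftrightarrow> R.counit_on (resR V) X g epsC"
 proof -
 have e: "afun eOrd : blm K BA YY (rg BA)" using eOrd(1-3) by (simp add: C.ar_iff del: arrow_ob)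
 have lV: "lm K P (resR V) = lm K P V" for P by (rule lm_cong) simp_all
 note b1 = Q.counit_bal[OF V YY_bm e] and b2 = R.counit_bal[OF Mr X_bm epsC_bilinear]
 have l2: "tf (resR V) (%m x. ract (resR V) m (epsC x)) : lm K (tens R (resR V) X) V"
 using R.tlift_lin[OF Mr X_bm mods(3) b2] by (simp only: lV)
 have vm: "module K V" using V by simp
 have "tf V (%m x. ract V m (afun eOrd x)) (Jp V u) = tf (resR V) (%m x. ract (resR V) m (epsC x)) u"
 if u: "u IN (tens R (resR V) X)" for u
 by (rule R.tens_ext[OF Mr X_bm vm lin_comp[OF Jp_lin[OF rs] Q.tlift_lin[OF V YY_bm vm b1]] l2 _ u])
 (use V Mr vm mods b1 b2 in "simp add: Jp_ptens[OF rs] eOrd(4) cor_counit(5)")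
 then show ?thesis using gc rJ by (simp add: Q.counit_on_def R.counit_on_def)
 qed
 show ?thesis using lin glin coassoc counit by blast
qed

end

end

section \<open>Isomorphisms of categories of structured objects\<close>

context concrete_category
begin

text \<open>Associativity and unit laws are inherited from \<open>C\<close>; what remains is that
  \<open>P\<close> holds for identities and is closed under composition.\<close>

lemma structured_category_iff:
 assumes U: "!!x. x \<in> S ==> U x \<in> Obs"
 shows "category (structured_cat C S U P) \<longleftrightarrow> (ALL x:S. P x (Idn C (U x)) x) &
 (ALL x:S. ALL y:S. ALL z:S. ALL f. f \<in> Hom C (U x) (U y) \<longrightarrow> (ALL g. g \<in> Hom C (U y) (U z) \<longrightarrow>
 P x f y \<longrightarrow> P y g z \<longrightarrow> P x (Cmp C g f) z))" (is "category ?S \<longleftrightarrow> ?c")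
proof
 assume "category ?S"
 then interpret S: category ?S .
 have "P x (Idn C (U x)) x" if "x \<in> S" for x
 using S.id_hom[of x] that by (simp add: structured_cat_Hom)
 moreover have "P x (Cmp C g f) z" if "x \<in> S" "y \<in> S" "z \<in> S" "f \<in> Hom C (U x) (U y)" "g \<in> Hom C (U y) (U z)" "P x f y" "P y g z" for x y z f g
 using S.cmp_hom[of "(x, f, y)" x y "(y, g, z)" z] that by (simp add: structured_cat_Hom)
 ultimately show ?c by blast
next
 assume c: ?c
 interpret C: category C by (rule category)
 have Ob: "Ob C = Obs" by (simp add: c_simps)
 show "category ?S"
 proof
 show "Idn ?S x \<in> Hom ?S x x" if "x \<in> Ob ?S" for x
 using that c U C.id_hom[of "U x"] by (simp add: structured_cat_Hom Ob)
 show "Cmp ?S g f \<in> Hom ?S x z" if "f \<in> Hom ?S x y" "g \<in> Hom ?S y z" for f g x y z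
 using that c C.cmp_hom[of "afun f" "U x" "U y" "afun g" "U z"]
 by (simp add: structured_cat_Hom del: split_paired_All) blast
 show "Cmp ?S f (Idn ?S x) = f" "Cmp ?S (Idn ?S y) f = f" if "f \<in> Hom ?S x y" for f x y
 using that C.id_right[of "afun f" "U x" "U y"] C.id_left[of "afun f" "U x" "U y"]
 by (cases f; simp add: structured_cat_Hom)+
 show "Cmp ?S (Cmp ?S h g) f = Cmp ?S h (Cmp ?S g f)" if "f \<in> Hom ?S w x" "g \<in> Hom ?S x y" "h \<in> Hom ?S y z" for f g h w x y z
 using that C.cmp_assoc[of "afun f" "U w" "U x" "afun g" "U y" "afun h" "U z"] by (simp add: structured_cat_Hom)
 qed simp_all
qed

text \<open>The criterion in terms of bare functions, so that it can be compared literally for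
  structures over two different base categories.\<close>

lemma structured_category_iff':
 fixes P
 assumes U: "!!x. x \<in> S ==> U x \<in> Obs"
 defines "Q \<equiv> %x f y. (U x, f, U y) : Ar C & P x (U x, f, U y) y"
 shows "category (structured_cat C S U P) \<longleftrightarrow> (ALL x:S. Q x (\<lambda>u \<in> car (U x). u) x) &
 (ALL x:S. ALL y:S. ALL z:S. ALL f g. Q x f y \<longrightarrow> Q y g z \<longrightarrow> Q x (compose (car (U x)) g f) z)"
proof -
 have hom: "(ALL f. f \<in> Hom C a b \<longrightarrow> R f) \<longleftrightarrow> (ALL h. (a, h, b) : Ar C \<longrightarrow> R (a, h, b))" for a b R
 by (auto simp: hom_iff)
 have idn: "Idn C a = (a, \<lambda>u \<in> car a. u, a)" and cmp: "Cmp C (b, g, c) (a, f, b) = (a, compose (car a) g f, c)" for a b c f g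
 by (simp_all add: c_simps)
 have idAr: "(U x, \<lambda>u \<in> car (U x). u, U x) : Ar C" if "x \<in> S" for x
 using ar_idn[OF U[OF that]] idn by simp
 have cmpAr: "(a, compose (car a) g f, c) : Ar C" if "(a, f, b) : Ar C" "(b, g, c) : Ar C" for a b c f g
 using ar_cmp[OF that] cmp by simp
 show ?thesis
 by (subst structured_category_iff[where P = P], erule U, unfold hom idn cmp Q_def) (use idAr cmpAr in blast)
qed

end

text \<open>Being a category is a condition on structured arrows, which \<open>arr\<close> matches
  on both sides; hence it is enough that one of the two is known to be a category.\<close>

lemma structured_iso:
 assumes c: "concrete_category C Obs car H" "concrete_category C' Obs' car' H'"
 and U: "!!x. x \<in> S ==> U x \<in> Obs" "!!y. y \<in> S' ==> U' y \<in> Obs'"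
 and F: "bij_betw F S S'" and car: "!!x. x \<in> S ==> car' (U' (F x)) = car (U x)"
 and arr: "!!x y f. x \<in> S ==> y \<in> S ==>
 (U x, f, U y) : Ar C & P x (U x, f, U y) y \<longleftrightarrow> (U' (F x), f, U' (F y)) : Ar C' & P' (F x) (U' (F x), f, U' (F y)) (F y)"
 and cat: "category (structured_cat C S U P) \<or> category (structured_cat C' S' U' P')"
 shows "category_isomorphism (structured_cat C S U P) (structured_cat C' S' U' P') F
 (%(x, g, y). (F x, (U' (F x), afun g, U' (F y)), F y))"
proof -
 interpret C: concrete_category C Obs car H by (rule c)
 interpret D: concrete_category C' Obs' car' H' by (rule c)
 let ?S = "structured_cat C S U P" and ?T = "structured_cat C' S' U' P'"
 let ?F = "%(x, g, y). (F x, (U' (F x), afun g, U' (F y)), F y)"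
 have FS: "F x \<in> S'" if "x \<in> S" for x using F that by (auto simp: bij_betw_def)
 have Fs: "EX x:S. y = F x" if "y \<in> S'" for y using F that by (auto simp: bij_betw_def)
 have hom: "f \<in> Hom C (U x) (U y) \<longleftrightarrow> f = (U x, afun f, U y) & (U x, afun f, U y) : Ar C" for f x y
 by (cases f) (auto simp: C.hom_iff)
 have hom': "f \<in> Hom C' (U' x) (U' y) \<longleftrightarrow> f = (U' x, afun f, U' y) & (U' x, afun f, U' y) : Ar C'" for f x y
 by (cases f) (auto simp: D.hom_iff)
 have Ar: "t : Ar ?S \<longleftrightarrow> (EX x y f. t = (x, (U x, f, U y), y) & x \<in> S & y \<in> S & (U x, f, U y) : Ar C & P x (U x, f, U y) y)" for t
 by (cases t) (auto simp: hom)
 have Ar': "t : Ar ?T \<longleftrightarrow> (EX x y f. t = (x, (U' x, f, U' y), y) & x \<in> S' & y \<in> S' & (U' x, f, U' y) : Ar C' & P' x (U' x, f, U' y) y)" for t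
 by (cases t) (auto simp: hom')
 have idn: "Idn C (U x) = (U x, \<lambda>u \<in> car (U x). u, U x)" "Idn C' (U' (F x)) = (U' (F x), \<lambda>u \<in> car (U x). u, U' (F x))" if "x \<in> S" for x
 using that car by (simp_all add: C.c_simps D.c_simps)
 have cmp: "Cmp C (U y, g, U z) (U x, f, U y) = (U x, compose (car (U x)) g f, U z)"
 "Cmp C' (U' (F y), g, U' (F z)) (U' (F x), f, U' (F y)) = (U' (F x), compose (car (U x)) g f, U' (F z))" if "x \<in> S" for x y z f g
 using that car by (simp_all add: C.c_simps D.c_simps)
 have all: "(ALL y:S'. Q y) \<longleftrightarrow> (ALL x:S. Q (F x))" for Q using FS Fs by blast
 have "category ?S \<longleftrightarrow> category ?T"
 unfolding C.structured_category_iff'[where S = S and U = U and P = P, OF U(1), simplified]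
 D.structured_category_iff'[where S = S' and U = U' and P = P', OF U(2), simplified] all
 using arr car by (simp cong: ball_cong)
 then have S: "category ?S" and T: "category ?T" using cat by auto
 have FAr: "?F t : Ar ?T" if tS: "t : Ar ?S" for t
 proof -
 obtain x y f where t: "t = (x, (U x, f, U y), y)" "x \<in> S" "y \<in> S" "(U x, f, U y) : Ar C" "P x (U x, f, U y) y"
 using iffD1[OF Ar tS] by (elim exE conjE)
 then show ?thesis using arr[of x y f] FS unfolding Ar' by simp
 qed
 have "functor_on ?S ?T F ?F"
 unfolding functor_on_def
 proof (intro conjI S T ballI impI)
 show "F x \<in> Ob ?T" if "x \<in> Ob ?S" for x using that FS by simp
 show "?F t \<in> Hom ?T (F (Dom ?S t)) (F (Cod ?S t))" if "t : Ar ?S" for t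
 using FAr[OF that] by (cases t) (simp add: Hom_def)
 show "?F (Idn ?S x) = Idn ?T (F x)" if "x \<in> Ob ?S" for x using that idn by simp
 show "?F (Cmp ?S t' t) = Cmp ?T (?F t') (?F t)" if "t : Ar ?S" "t' : Ar ?S" "Cod ?S t = Dom ?S t'" for t t'
 using that cmp unfolding Ar by auto
 qed
 moreover have "bij_betw ?F (Ar ?S) (Ar ?T)"
 unfolding bij_betw_def
 proof
 have Fi: "x = y" if "F x = F y" "x \<in> S" "y \<in> S" for x y using F that by (auto simp: bij_betw_def inj_on_def)
 show "inj_on ?F (Ar ?S)"
 proof (rule inj_onI)
 fix s t assume s: "s : Ar ?S" and t: "t : Ar ?S" and e: "?F s = ?F t"
 obtain x y f where s': "s = (x, (U x, f, U y), y)" "x \<in> S" "y \<in> S" using iffD1[OF Ar s] by (elim exE conjE)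
 obtain x' y' g where t': "t = (x', (U x', g, U y'), y')" "x' \<in> S" "y' \<in> S" using iffD1[OF Ar t] by (elim exE conjE)
 show "s = t" using e s' t' Fi[of x x'] Fi[of y y'] by simp
 qed
 have "EX s : Ar ?S. t = ?F s" if tT: "t : Ar ?T" for t
 proof -
 obtain x y f where t: "t = (x, (U' x, f, U' y), y)" "x \<in> S'" "y \<in> S'" "(U' x, f, U' y) : Ar C'" "P' x (U' x, f, U' y) y"
 using iffD1[OF Ar' tT] by (elim exE conjE)
 obtain x0 y0 where x: "x0 \<in> S" "x = F x0" "y0 \<in> S" "y = F y0" using Fs t by meson
 then have "(x0, (U x0, f, U y0), y0) : Ar ?S" using arr[of x0 y0 f] t by (intro iffD2[OF Ar]) blast
 then show ?thesis using t x by (intro bexI[of _ "(x0, (U x0, f, U y0), y0)"]) simp_all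
 qed
 then show "?F ` Ar ?S = Ar ?T" using FAr by blast
 qed
 ultimately show ?thesis using F by (simp add: category_isomorphism_def)
qed

section \<open>Morphisms of comodules in element form\<close>

context k_alg
begin

lemma comodule_arrow_iff:
 assumes X: "bm K B X" and f: "f : Ar MR" "fst f = M" "cod f = N"
 and r: "r : Ar MR" "fst r = M" "cod r = rtens B M X" and s: "s : Ar MR" "fst s = N" "cod s = rtens B N X"
 shows "Cmp MR s f = Cmp MR (ActA MR f (Idn RMR X)) r \<longleftrightarrow>
 (ALL m:carrier M. afun s (afun f m) = tmap B M X N X (afun f) (idc X) (afun r m))"
proof -
 have "Cmp MR s f = Cmp MR (ActA MR f (Idn RMR X)) r \<longleftrightarrow>
 (ALL m:carrier M. afun (Cmp MR s f) m = afun (Cmp MR (ActA MR f (Idn RMR X)) r) m)"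
 by (rule D.ar_eq_iff[where K = K and B = B]) (use X f r s in simp_all)
 moreover have "afun (Cmp MR s f) m = afun s (afun f m)"
 "afun (Cmp MR (ActA MR f (Idn RMR X)) r) m = tmap B M X N X (afun f) (idc X) (afun r m)" if "m IN M" for m
 using that f r by (simp_all add: ActA_simps(3) Idn_app)
 ultimately show ?thesis by simp
qed

text \<open>Functoriality of the action, (g \<otimes> X)(f \<otimes> X) = gf \<otimes> X, gives
  closure under composition. The categories of corepresentations and of Doi-Koppinen modules get the
  category laws by transport from this one.\<close>

lemma comodule_category:
 assumes X: "bm K B X"
 shows "category (comodule_cat RMR MR X d e)"
proof -
 interpret rc: right_category RMR MR by (rule right_cat)
 have ob: "right_comodule_in RMR MR X d e (M, r) ==> M \<in> Ob MR & r \<in> Hom MR M (ActO MR M X)" for M r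
 by (simp add: right_comodule_in_def)
 have XO: "X \<in> Ob RMR" using X by simp
 note iX = rc.C.id_hom[OF XO]
 have 1: "Cmp MR r (Idn MR M) = Cmp MR (ActA MR (Idn MR M) (Idn RMR X)) r" if "right_comodule_in RMR MR X d e (M, r)" for M r
 using ob[OF that] rc.act_id[OF _ XO, of M] rc.D.id_right[of r M "ActO MR M X"] rc.D.id_left[of r M "ActO MR M X"] by simp
 have 2: "Cmp MR u (Cmp MR g f) = Cmp MR (ActA MR (Cmp MR g f) (Idn RMR X)) r"
 if "right_comodule_in RMR MR X d e (M, r)" "right_comodule_in RMR MR X d e (N, s)" "right_comodule_in RMR MR X d e (P, u)"
 and f: "f \<in> Hom MR M N" and g: "g \<in> Hom MR N P"
 and e: "Cmp MR s f = Cmp MR (ActA MR f (Idn RMR X)) r" "Cmp MR u g = Cmp MR (ActA MR g (Idn RMR X)) s" for M r N s P u f g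
 proof -
 note r = ob[OF that(1), THEN conjunct2] and s = ob[OF that(2), THEN conjunct2] and u = ob[OF that(3), THEN conjunct2]
 note fX = rc.act_hom[OF f iX] and gX = rc.act_hom[OF g iX]
 have "Cmp MR u (Cmp MR g f) = Cmp MR (ActA MR g (Idn RMR X)) (Cmp MR (ActA MR f (Idn RMR X)) r)"
 using rc.D.cmp_assoc[OF f g u] rc.D.cmp_assoc[OF f s gX] e by simp
 also have "... = Cmp MR (ActA MR (Cmp MR g f) (Idn RMR X)) r"
 using rc.D.cmp_assoc[OF r fX gX] rc.act_cmp[OF f g iX iX] rc.C.id_left[OF iX] by simp
 finally show ?thesis .
 qed
 show ?thesis
 unfolding comodule_cat_def
 proof (subst D.structured_category_iff)
 show "fst x \<in> {M. rm K B M}" if "x \<in> {M. right_comodule_in RMR MR X d e M}" for x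
 using that ob by (cases x) simp
 qed (use 1 2 in "auto split: prod.splits")
qed

end

section \<open>The functor that forgets the R-structure\<close>

context dk
begin

abbreviation "corep \<equiv> right_corep_in R.RMR R.MR A' mm ee CC"
abbreviation "ordcom \<equiv> right_comodule_in Q.RMR Q.MR YY dOrd eOrd"
abbreviation "FF \<equiv> forget_R_ob K R A' mm ee CC"
abbreviation "GG \<equiv> to_dk_ob K R A' mm X"

lemma rep:
 assumes "corep (M, mu, r)"
 shows "rmodA M mu" "r : Ar R.MR" "fst r = M" "cod r = TM M mu"
 "ordcom (oM M mu, (oM M mu, coord M mu r, rtens BA (oM M mu) YY))"
 "FF (M, mu, r) = (oM M mu, (oM M mu, coord M mu r, rtens BA (oM M mu) YY))"
 "m IN M ==> afun r m IN (TM M mu)"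
proof -
 show a: "rmodA M mu" using assms by (simp add: right_corep_in_def Let_def)
 then show b: "r : Ar R.MR" "fst r = M" "cod r = TM M mu" "ordcom (oM M mu, (oM M mu, coord M mu r, rtens BA (oM M mu) YY))"
 using assms by (simp_all add: corep_iff)
 show c: "afun r m IN (TM M mu)" if "m IN M" for m using D.app_closed[OF b(1)] b(2,3) that by simp
 have "to_ord R M AX (afun (qM M mu)) BA (oM M mu) YY (afun r m) = thM M mu (afun r m)" if "m IN M" for m
 by (rule to_ord_eq) (use bq(3)[OF data_AX[OF a] c[OF that]] in auto)
 then show "FF (M, mu, r) = (oM M mu, (oM M mu, coord M mu r, rtens BA (oM M mu) YY))"
 by (simp add: forget_R_ob_def Let_def compose_def fun_eq_iff flip: YY_def BA_def)
qed

lemma ordcom_iff: "ordcom (V, r) \<longleftrightarrow> r : Ar Q.MR & fst r = V & cod r = rtens BA V YY &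
 Q.coassoc_on V YY (afun r) (afun dOrd) & Q.counit_on V YY (afun r) (afun eOrd)"
 by (rule Q.comodule_iff[OF YY_bm dOrd(1-3) eOrd(1-3)])

text \<open>For injectivity, the A-module determines M and its action by \<open>rmodA_eq\<close>,
  and the coordinates determine the coaction. For surjectivity, scalars are restricted and the
  coaction is pulled back along the coordinates.\<close>

lemma FF_bij: "bij_betw FF {x. corep x} {y. ordcom y}"
 unfolding bij_betw_def
proof
 show "inj_on FF {x. corep x}"
 proof (rule inj_onI)
 fix x y assume xy: "x \<in> {x. corep x}" "y \<in> {x. corep x}" "FF x = FF y"
 obtain M mu r N nu s where x: "x = (M, mu, r)" "y = (N, nu, s)" by (cases x; cases y) blast
 have c: "corep (M, mu, r)" "corep (N, nu, s)" and e: "FF (M, mu, r) = FF (N, nu, s)" using xy x by auto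
 note r = rep[OF c(1)] and s = rep[OF c(2)]
 have "oM M mu = oM N nu" using e r(6) s(6) by simp
 then have MN: "M = N" "mu = nu" using rmodA_eq[OF r(1)] rmodA_eq[OF s(1)] by auto
 note s' = s[folded MN]
 have "coord M mu r = coord M mu s" using e r(6) s(6) MN by simp
 then have th: "thM M mu (afun r m) = thM M mu (afun s m)" if "m IN M" for m
 using coord_app[OF r(1-4) that] coord_app[OF s'(1-4) that] by metis
 have "afun r m = afun s m" if "m IN M" for m
 by (rule inj_onD[OF bq_inj[OF data_AX[OF r(1)]] th[OF that] r(7)[OF that] s'(7)[OF that]])
 then have "r = s" by (intro D.ar_eqI[where K = K and B = R]) (simp_all only: r(2-4) s'(2-4))
 then show "x = y" using MN x by simp
 qed
 have "EX x. corep x & FF x = y" if y: "ordcom y" for y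
 proof -
 obtain V p where p: "y = (V, p)" by (cases y)
 note c = y[unfolded p ordcom_iff]
 have V: "rm K BA V" using c by (auto dest: arrow_ob)
 define M mu where "M = resR V" and "mu = actR V"
 have a: "rmodA M mu" "oM M mu = V" using actR[OF V] by (simp_all add: M_def mu_def)
 note q = bq[OF data_AX[OF a(1)], unfolded a(2)]
 let ?T = "TM M mu" and ?th = "bth M mu V (%y. y) AX (cor_lact CC) YY (%y. y)"
 \<comment> \<open>The coaction is read back through the inverse of the coordinate bijection of the
   chosen quotient.\<close>
 define r where "r = (M, \<lambda>m \<in> carrier M. the_inv_into (carrier ?T) ?th (afun p m), ?T)"
 have pl: "afun p : rlm K BA V (rtens BA V YY)" using c by (auto simp: D.ar_iff simp del: arrow_ob)
 have inj: "inj_on ?th (carrier ?T)" and im: "?th ` carrier ?T = carrier (tens BA V YY)" using q(5) by (simp_all add: bij_betw_def)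
 have cM [simp]: "carrier M = carrier V" "add M = add V" "smult M = smult V" "rm K R M"
 "m IN V ==> b IN R ==> ract M m b = ract V m (eta b)" for m b using V by (simp_all add: M_def)
 have rp: "afun r m IN ?T" "?th (afun r m) = afun p m" if m: "m IN V" for m
 proof -
 have "afun p m \<in> ?th ` carrier ?T" using rl_conc(1)[OF pl m] im by simp
 then show "afun r m IN ?T" "?th (afun r m) = afun p m"
 using m inj the_inv_into_into[OF inj _ order_refl] f_the_inv_into_f[OF inj] by (simp_all add: r_def)
 qed
 have T: "rm K R ?T" using q(1) by simp
 have eq: "afun r m = z" if "m IN V" "z IN ?T" "afun p m = ?th z" for m z
 using inj_onD[OF inj _ rp(1) that(2)] rp(2) that by simp
 note pL = rl_lin[OF pl] and pr = rl_ract[OF pl]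
 have "afun r : lm K M ?T"
 by (rule lmI) (use V T in "auto simp: rp lin_add[OF pL] lin_smult[OF pL] lin_add[OF q(6)] lin_smult[OF q(6)] intro!: eq")
 moreover have "afun r (ract M m b) = ract ?T (afun r m) b" if "m IN M" "b IN R" for m b
 using that rp pr[of m "eta b"] q(7) rm_closed[OF V, of m "eta b"] rm_closed[OF T] by (simp, intro eq) simp_all
 ultimately have "afun r : rlm K R M ?T" by (rule rlmI)
 then have ra: "r : Ar R.MR" "fst r = M" "cod r = ?T"
 using V T by (simp_all add: r_def D.ar_iff del: arrow_ob)
 have "coord M mu r = afun p"
 proof
 fix m show "coord M mu r m = afun p m"
 proof (cases "m IN V")
 case False
 then show ?thesis using c a(2) by (auto simp: compose_def D.ar_iff extensional_def simp del: arrow_ob)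
 qed (use a(2) rp in "simp add: compose_def")
 qed
 then have "(oM M mu, (oM M mu, coord M mu r, rtens BA (oM M mu) YY)) = y"
 using c p a(2) by (cases p) auto
 then show ?thesis using corep_iff[OF a(1), of r] ra y rep(6)[of M mu r] by metis
 qed
 then show "FF ` {x. corep x} = {y. ordcom y}" using rep(5,6) by (auto simp: image_iff) metis
qed

text \<open>R acts through A on both modules, so an A-linear map is automatically R-linear.\<close>

lemma rmodA_arrow:
 assumes M: "rmodA M mu" and N: "rmodA N nu"
 shows "(M, f, N) : Ar R.MR & CM (M, f, N) mu = CM nu (AM (M, f, N) (IR A')) \<longleftrightarrow> (oM M mu, f, oM N nu) : Ar Q.MR"
proof -
 note m = rmodA[OF M] and n = rmodA[OF N]
 note am = act_simps(1-4)[OF m(1)] and an = act_simps(1-4)[OF n(1)]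
 have lin: "lm K (oM M mu) (oM N nu) = lm K M N" by (rule lm_cong) simp_all
 have e: "CM (M, f, N) mu = CM nu (AM (M, f, N) (IR A')) \<longleftrightarrow>
 (ALL x:carrier M. ALL a:carrier A'. f (ract (oM M mu) x a) = ract (oM N nu) (f x) a)" (is "?l = ?r \<longleftrightarrow> ?c")
 if f: "(M, f, N) : Ar R.MR"
 proof -
 have fc: "x IN M ==> f x IN N" for x using D.app_closed[OF f] by simp
 have app: "afun ?l (pt R M A' x a) = f (ract (oM M mu) x a)" "afun ?r (pt R M A' x a) = ract (oM N nu) (f x) a"
 if "x IN M" "a IN A'" for x a using that f am an fc by simp_all
 show ?thesis
 proof
 assume "?l = ?r" then show ?c using app by metis
 next
 assume ?c then show "?l = ?r" by (intro R.D_ext2[where M = M and N = A']) (use app f am an in "simp_all only:", use f am an in simp_all)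
 qed
 qed
 have "f : rlm K R M N" if "f : lm K M N" "ALL x:carrier M. ALL a:carrier A'. f (ract (oM M mu) x a) = ract (oM N nu) (f x) a"
 proof (rule rlmI)
 fix x b assume "x IN M" "b IN R"
 then show "f (ract M x b) = ract N (f x) b"
 using that m(3) n(3) lin_closed[OF that(1)] by (simp add: res_eq_def del: ordM_simps(7))
 qed (fact that(1))
 then have "(M, f, N) : Ar R.MR & (ALL x:carrier M. ALL a:carrier A'. f (ract (oM M mu) x a) = ract (oM N nu) (f x) a) \<longleftrightarrow> (oM M mu, f, oM N nu) : Ar Q.MR"
 using m(2) n(2) am(1) an(1) by (auto simp: D.ar_iff right_linear_maps_def lin simp del: arrow_ob ordM_simps(7))
 then show ?thesis using e by blast
qed

text \<open>Colinearity is compared after applying the injective coordinates of the target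
  quotient.\<close>

lemma corep_arrow:
 assumes c: "corep (M, mu, r)" "corep (N, nu, p)"
 shows "(M, f, N) : Ar R.MR & CM (M, f, N) mu = CM nu (AM (M, f, N) (IR A')) &
 CM p (M, f, N) = CM (bal_map R.RMR R.MR A' M mu AX (cor_lact CC) (M, f, N) N nu AX (cor_lact CC) (IR AX)) r
 \<longleftrightarrow> (oM M mu, f, oM N nu) : Ar Q.MR &
 (ALL m:carrier M. coord N nu p (f m) = tmap BA (oM M mu) YY (oM N nu) YY f (idc YY) (coord M mu r m))"
proof -
 note r = rep[OF c(1)] and s = rep[OF c(2)]
 let ?f = "(M, f, N)"
 let ?b = "bal_map R.RMR R.MR A' M mu AX (cor_lact CC) ?f N nu AX (cor_lact CC) (IR AX)"
 have "CM p ?f = CM ?b r \<longleftrightarrow>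
 (ALL m:carrier M. coord N nu p (f m) = tmap BA (oM M mu) YY (oM N nu) YY f (idc YY) (coord M mu r m))"
 if f: "?f : Ar R.MR" and fQ: "(oM M mu, f, oM N nu) : Ar Q.MR"
 proof -
 have fl: "f : rlm K BA (oM M mu) (oM N nu)" using fQ by (simp add: D.ar_iff del: arrow_ob)
 have fc: "m IN M ==> f m IN N" for m using D.app_closed[OF f] by simp
 have b: "?b : Ar R.MR" "fst ?b = TM M mu" "cod ?b = TM N nu"
 "z IN (TM M mu) ==> thM N nu (afun ?b z) = tmap BA (oM M mu) YY (oM N nu) YY f (idc YY) (thM M mu z)" for z
 by (rule bal_map_th[OF data_AX[OF r(1)] data_AX[OF s(1)] f _ _ _ _ _ fl _ idYY]; simp)+
 have "CM p ?f = CM ?b r \<longleftrightarrow> (ALL m:carrier M. afun (CM p ?f) m = afun (CM ?b r) m)"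
 by (rule D.ar_eq_iff[where K = K and B = R]) (use f r(2-4) s(2-4) b(1-3) in simp_all)
 also have "... = (ALL m:carrier M. coord N nu p (f m) = tmap BA (oM M mu) YY (oM N nu) YY f (idc YY) (coord M mu r m))"
 proof (rule ball_cong[OF refl])
 fix m assume m: "m IN M"
 have "(afun p (f m) = afun ?b (afun r m)) = (thM N nu (afun p (f m)) = thM N nu (afun ?b (afun r m)))"
 by (rule inj_on_eq_iff[OF bq_inj[OF data_AX[OF s(1)]], symmetric])
 (use s(7)[OF fc[OF m]] D.app_closed[OF b(1)] b(2,3) r(7)[OF m] in simp_all)
 also have "... = (coord N nu p (f m) = tmap BA (oM M mu) YY (oM N nu) YY f (idc YY) (coord M mu r m))"
 by (simp only: b(4)[OF r(7)[OF m]] coord_app[OF s(1-4) fc[OF m]] coord_app[OF r(1-4) m])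
 finally show "(afun (CM p ?f) m = afun (CM ?b r) m) =
 (coord N nu p (f m) = tmap BA (oM M mu) YY (oM N nu) YY f (idc YY) (coord M mu r m))"
 using m r(3) by simp
 qed
 finally show ?thesis .
 qed
 then show ?thesis using rmodA_arrow[OF r(1) s(1), of f] by blast
qed

lemma ordcom_arrow:
 assumes "ordcom (V, p)" "ordcom (W, q)"
 shows "(V, f, W) : Ar Q.MR & Cmp Q.MR q (V, f, W) = Cmp Q.MR (ActA Q.MR (V, f, W) (Idn Q.RMR YY)) p \<longleftrightarrow>
 (V, f, W) : Ar Q.MR & (ALL m:carrier V. afun q (f m) = tmap BA V YY W YY f (idc YY) (afun p m))"
 using Q.comodule_arrow_iff[OF YY_bm, of "(V, f, W)" V W p q] assms by (auto simp: ordcom_iff)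

theorem FF_iso:
 "category_isomorphism (corep_cat R.RMR R.MR A' mm ee CC) (ord_comodule_cat K R A' mm ee CC) FF (%(x, g, y). same_map FF x g y)"
proof -
 have ob: "fst x \<in> {M. rm K R M}" if "x \<in> {x. corep x}" for x
 using that by (cases x) (auto dest: rep(1) rmodA(1) act_simps(1))
 have ob': "fst y \<in> {M. rm K BA M}" if "y \<in> {y. ordcom y}" for y
 using that by (cases y) (auto simp: ordcom_iff dest: arrow_ob)
 \<comment> \<open>Ordinary comodules form a category; \<open>structured_iso\<close> then gives the
   same for corepresentations.\<close>
 have "category (structured_cat Q.MR {y. ordcom y} fst (%(M, r) f (N, \<sigma>). Cmp Q.MR \<sigma> f = Cmp Q.MR (ActA Q.MR f (Idn Q.RMR YY)) r))"
 using Q.comodule_category[OF YY_bm, of dOrd eOrd] by (simp add: comodule_cat_def)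
 then have "category_isomorphism (corep_cat R.RMR R.MR A' mm ee CC) (structured_cat Q.MR {y. ordcom y} fst (%(M, r) f (N, \<sigma>). Cmp Q.MR \<sigma> f = Cmp Q.MR (ActA Q.MR f (Idn Q.RMR YY)) r))
 FF (%(x, g, y). (FF x, (fst (FF x), afun g, fst (FF y)), FF y))"
 unfolding corep_cat_def
 proof (intro structured_iso[OF D.concrete_category_axioms D.concrete_category_axioms ob ob' FF_bij])
 fix x y f assume xy: "x \<in> {x. corep x}" "y \<in> {x. corep x}"
 obtain M mu r N nu s where e: "x = (M, mu, r)" "y = (N, nu, s)" by (cases x; cases y) blast
 have c: "corep (M, mu, r)" "corep (N, nu, s)" using xy e by auto
 show "(fst x, f, fst y) : Ar R.MR & (case x of (M, mu, r) \<Rightarrow> %f (N, nu, \<sigma>). CM f mu = CM nu (AM f (IR A')) &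
 CM \<sigma> f = CM (bal_map R.RMR R.MR A' M mu (cor_ob CC) (cor_lact CC) f N nu (cor_ob CC) (cor_lact CC) (IR (cor_ob CC))) r)
 (fst x, f, fst y) y \<longleftrightarrow>
 (fst (FF x), f, fst (FF y)) : Ar Q.MR & (case FF x of (M, r) \<Rightarrow> %f (N, \<sigma>). Cmp Q.MR \<sigma> f = Cmp Q.MR (ActA Q.MR f (Idn Q.RMR YY)) r)
 (fst (FF x), f, fst (FF y)) (FF y)"
 using corep_arrow[OF c, of f] ordcom_arrow[OF rep(5)[OF c(1)] rep(5)[OF c(2)], of f] rep(6)[OF c(1)] rep(6)[OF c(2)] e by simp
 next
 show "carrier (fst (FF x)) = carrier (fst x)" if "x \<in> {x. corep x}" for x
 using that rep(6) by (cases x) simp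
 qed simp_all
 then show ?thesis
 by (simp add: ord_comodule_cat_def Let_def comodule_cat_def same_map_def[abs_def] flip: BA_def YY_def)
qed

end

section \<open>The functor to Doi-Koppinen modules\<close>

context dk
begin

text \<open>On the class of m \<otimes> (a \<otimes> x) the canonical map gives m a \<otimes> x,
  which is \<open>Up\<close> in coordinates.\<close>

lemma upsilon:
 assumes a: "rmodA M mu"
 defines "U \<equiv> cowreath_upsilon R.RMR R.MR A' mm X M mu"
 shows "U : Ar R.MR" "fst U = TM M mu" "cod U = rtens R M X"
 "z IN (TM M mu) ==> afun U z = Up M (oM M mu) (thM M mu z)"
proof -
 note m = rmodA[OF a] and q = bq[OF data_AX[OF a]]
 note am = act_simps(1-4)[OF m(1)]
 let ?g = "CM (AM mu (IR X)) (R.ActAssocI M A' X)"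
 have U: "U = factor_through R.MR (qM M mu) ?g"
 using am by (simp add: U_def cowreath_upsilon_def R.inv_arrows free_lact_def CC_simps(2))
 have g: "?g : Ar R.MR" "fst ?g = fst (qM M mu)" "cod ?g = rtens R M X" using am q(2) by simp_all
 have gl: "afun ?g : lm K (tens R M AX) (tens R M X)" using arrow_lin(2)[OF g(1)] g(3) am by simp
 have "afun ?g u = Up M (oM M mu) (thM M mu (afun (qM M mu) u))" if u: "u IN (fst (qM M mu))" for u
 proof -
 have u': "u IN (tens R M AX)" using u q(2) by simp
 have "afun ?g u = Up M (oM M mu) (q0 M AX (oM M mu) YY (%y. y) (%y. y) u)"
 by (rule R.tens3_right_ext[OF am(1) A'_bm X_bm _ gl lin_comp[OF q(8) Up_lin[OF m(3)]] _ u'])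
 (use am q(9) in "simp_all add: Up_ptens[OF m(3)]")
 then show ?thesis using q(4) u' by simp
 qed
 from R.D_factor[where q = "qM M mu" and g = ?g and \<theta> = "%x. x", OF q(1) _ g(1,2) _ this] g(3) q(2,3)
 show "U : Ar R.MR" "fst U = TM M mu" "cod U = rtens R M X"
 "z IN (TM M mu) ==> afun U z = Up M (oM M mu) (thM M mu z)" unfolding U by simp_all
qed

abbreviation "dcom \<equiv> right_comodule_in R.RMR R.MR X (dk_comult R H C dC) (dk_counit R H C eC)"

definition "dkob = {(V, p). rm K BA V & dcom (resR V, p) &
 (ALL m:carrier V. ALL a:carrier A'. afun p (ract V m a) = dk_act V (afun p m) a)}"

lemma dcom_iff: "dcom (M, p) \<longleftrightarrow> p : Ar R.MR & fst p = M & cod p = rtens R M X &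
 R.coassoc_on M X (afun p) \<delta>C & R.counit_on M X (afun p) epsC"
proof -
 have "dk_comult R H C dC : Ar R.RMR" "dk_counit R H C eC : Ar R.RMR"
 using \<delta>C_bilinear epsC_bilinear \<delta>C_H(3,4) by (simp_all add: dk_comult_def dk_counit_def C.ar_iff Let_def del: arrow_ob)
 then show ?thesis
 by (subst R.comodule_iff[OF X_bm]) (simp_all add: dk_comult_def dk_counit_def Let_def)
qed

lemma D_triple: "p : Ar (mod_actcat K B) & fst p = x & cod p = y \<longleftrightarrow>
 rm K B x & rm K B y & p = (x, afun p, y) & afun p : rlm K B x y & afun p \<in> extensional (carrier x)"
 by (cases p) (auto simp: D.ar_iff simp del: arrow_ob)

lemma ordcom_iff': "ordcom (V, p) \<longleftrightarrow> rm K BA V & p = (V, afun p, rtens BA V YY) & afun p \<in> extensional (carrier V) &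
 (afun p : rlm K BA V (rtens BA V YY) & Q.coassoc_on V YY (afun p) (afun dOrd) & Q.counit_on V YY (afun p) (afun eOrd))"
 using D_triple[of p BA V "rtens BA V YY"] unfolding ordcom_iff by auto

lemma dkob_iff: "(V, p) \<in> dkob \<longleftrightarrow> rm K BA V & p = (resR V, afun p, rtens R (resR V) X) & afun p \<in> extensional (carrier V) &
 (afun p : rlm K R (resR V) (rtens R (resR V) X) & R.coassoc_on (resR V) X (afun p) \<delta>C & R.counit_on (resR V) X (afun p) epsC &
 (ALL m:carrier V. ALL a:carrier A'. afun p (ract V m a) = dk_act V (afun p m) a))"
 using D_triple[of p R "resR V" "rtens R (resR V) X"] unfolding dkob_def dcom_iff by auto

text \<open>The passage is routed through ordinary comodules: \<open>EE\<close> and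
  \<open>EI\<close> apply \<open>Up\<close> and \<open>Jp\<close> to the coaction and are inverse to
  each other on objects.\<close>

definition "EE = (%(V, p). (V, (resR V, \<lambda>m \<in> carrier V. Up (resR V) V (afun p m), rtens R (resR V) X)))"
definition "EI = (%(V, p). (V, (V, \<lambda>m \<in> carrier V. Jp V (afun p m), rtens BA V YY)))"

lemma lin_resR: "lm K (resR V) P = lm K V P"
 by (rule lm_cong) simp_all

lemma ordcom_closed: "ordcom (V, p) ==> m IN V ==> afun p m IN (tens BA V YY)"
 unfolding ordcom_iff' using lin_closed[OF rl_lin] by fastforce

lemma dkob_closed: "(V, p) \<in> dkob ==> m IN V ==> afun p m IN (tens R (resR V) X)"
 unfolding dkob_iff using lin_closed[OF rl_lin, of "afun p" K R "resR V" "rtens R (resR V) X" m] by simp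

lemma EE_dkob: "ordcom (V, p) ==> EE (V, p) \<in> dkob"
proof -
 assume p: "ordcom (V, p)"
 then have V: "rm K BA V" and "afun p : lm K V (rtens BA V YY)"
 unfolding ordcom_iff' by (auto dest: rl_lin)
 then have pl: "afun p : lm K V (tens BA V YY)" by simp
 from ord_dk_iff[OF V pl, where g = "afun (snd (EE (V, p)))"] show "EE (V, p) \<in> dkob"
 using p V by (simp add: EE_def dkob_iff ordcom_iff')
qed

lemma EI_ordcom: "(V, p) \<in> dkob ==> ordcom (EI (V, p))"
proof -
 assume p: "(V, p) \<in> dkob"
 then have V: "rm K BA V" and "afun p : lm K (resR V) (rtens R (resR V) X)"
 unfolding dkob_iff by (auto dest: rl_lin)
 then have pl: "afun p : lm K V (tens R (resR V) X)" by (simp add: lin_resR)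
 note rs = res_eq_resR[OF V]
 have "(\<lambda>m \<in> carrier V. Jp V (afun p m)) : lm K V (tens BA V YY)"
 by (rule lin_cong[OF lin_comp[OF pl Jp_lin[OF rs]]]) (use V in simp_all)
 from ord_dk_iff[OF V this, where g = "afun p"] show "ordcom (EI (V, p))"
 using p V Up_Jp[OF rs dkob_closed[OF p]] by (simp add: EI_def ordcom_iff' dkob_iff)
qed

lemma EE_bij: "bij_betw EE {y. ordcom y} dkob"
proof (rule bij_betw_byWitness[where f' = EI])
 show "ALL y:{y. ordcom y}. EI (EE y) = y"
 proof clarify
 fix V p assume p: "ordcom (V, p)"
 then have V: "rm K BA V" and e: "p = (V, afun p, rtens BA V YY)" "afun p \<in> extensional (carrier V)" by (simp_all add: ordcom_iff')
 have "(\<lambda>m \<in> carrier V. Jp V (afun (snd (EE (V, p))) m)) = afun p"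
 by (rule ext) (use e(2) Jp_Up[OF res_eq_resR[OF V] ordcom_closed[OF p]] in "auto simp: EE_def extensional_def")
 then show "EI (EE (V, p)) = (V, p)" using e(1) by (simp add: EI_def EE_def)
 qed
 show "ALL y:dkob. EE (EI y) = y"
 proof clarify
 fix V p assume p: "(V, p) \<in> dkob"
 then have V: "rm K BA V" and e: "p = (resR V, afun p, rtens R (resR V) X)" "afun p \<in> extensional (carrier V)" by (simp_all add: dkob_iff)
 have "(\<lambda>m \<in> carrier V. Up (resR V) V (afun (snd (EI (V, p))) m)) = afun p"
 by (rule ext) (use e(2) Up_Jp[OF res_eq_resR[OF V] dkob_closed[OF p]] in "auto simp: EI_def extensional_def")
 then show "EE (EI (V, p)) = (V, p)" using e(1) by (simp add: EI_def EE_def)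
 qed
 show "EE ` {y. ordcom y} \<subseteq> dkob" "EI ` dkob \<subseteq> {y. ordcom y}" using EE_dkob EI_ordcom by auto
qed

text \<open>The canonical isomorphism is \<open>Up\<close> in coordinates, so the functor splits
  into the two comparisons; its bijectivity follows from those of \<open>FF\<close> and
  \<open>EE\<close>.\<close>

lemma GG_eq:
 assumes c: "corep x"
 shows "GG x = EE (FF x)"
proof -
 obtain M mu r where x: "x = (M, mu, r)" by (cases x)
 note r = rep[OF c[unfolded x]]
 note u = upsilon[OF r(1)] and M = rmodA_eq(1)[OF r(1)]
 have tm: "rtens R (resR (oM M mu)) X = rtens R M X" using M by simp
 have up: "Up (resR (oM M mu)) (oM M mu) = Up M (oM M mu)" using M by simp
 have "(\<lambda>m \<in> carrier M. afun (cowreath_upsilon R.RMR R.MR A' mm X M mu) (afun r m)) =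
 (\<lambda>m \<in> carrier M. Up M (oM M mu) (coord M mu r m))"
 by (rule restrict_ext) (use u(4) r(7) coord_app[OF r(1-4)] in simp)
 then show ?thesis using r u M[symmetric] tm up x by (simp add: to_dk_ob_def EE_def D.c_simps(6) compose_def)
qed

text \<open>\<open>Jp\<close> is natural in the A-module, so it carries f \<otimes> id over R to f
  \<otimes> id over the algebra; its invertibility then transports colinearity.\<close>

lemma EE_arrow:
 assumes p: "ordcom (V, p)" and q: "ordcom (W, q)"
 shows "(V, f, W) : Ar Q.MR & (ALL m:carrier V. afun q (f m) = tmap BA V YY W YY f (idc YY) (afun p m)) \<longleftrightarrow>
 (V, f, W) : Ar Q.MR & (resR V, f, resR W) : Ar R.MR &
 CM (snd (EE (W, q))) (resR V, f, resR W) = CM (AM (resR V, f, resR W) (IR X)) (snd (EE (V, p)))"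
proof (rule conj_cong[OF refl])
 assume f: "(V, f, W) : Ar Q.MR"
 have V: "rm K BA V" and W: "rm K BA W" using p q by (simp_all add: ordcom_iff')
 have fl: "f : rlm K BA V W" and fe: "f \<in> extensional (carrier V)" using f by (simp_all add: D.ar_iff del: arrow_ob)
 note fc = lin_closed[OF rl_lin[OF fl]]
 have lr: "lm K (resR V) (resR W) = lm K V W" by (rule lm_cong) simp_all
 have fR: "f : rlm K R (resR V) (resR W)"
 by (rule rlmI) (use rl_lin[OF fl] rl_ract[OF fl] fc in "simp_all add: lr")
 have fA: "(resR V, f, resR W) : Ar R.MR" using fR fe V W by (simp add: D.ar_iff del: arrow_ob)
 have rV: "rm K R (resR V)" "rm K R (resR W)" using V W by simp_all
 note vs = res_eq_resR[OF V] and ws = res_eq_resR[OF W]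
 note ft = Q.tmap_ptens[OF V YY_bm W YY_bm fl idYY] and flin = Q.tmap_lin[OF V YY_bm W YY_bm fl idYY]
 note rt = R.tmap_ptens[OF rV(1) X_bm rV(2) X_bm fR C_bilinear_idX] and rlin = R.tmap_lin[OF rV(1) X_bm rV(2) X_bm fR C_bilinear_idX]
 have t: "tmap BA V YY W YY f (idc YY) (Jp V w) = Jp W (tmap R (resR V) X (resR W) X f (idc C) w)"
 if w: "w IN (tens R (resR V) X)" for w
 proof (rule R.tens_ext[OF rV(1) X_bm _ lin_comp[OF Jp_lin[OF vs] flin] lin_comp[OF rlin Jp_lin[OF ws]] _ w])
 fix v x assume "v IN (resR V)" "x IN X"
 then show "tmap BA V YY W YY f (idc YY) (Jp V (pt R (resR V) X v x)) =
 Jp W (tmap R (resR V) X (resR W) X f (idc C) (pt R (resR V) X v x))"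
 using ft[of v "pX uno x"] rt[of v x] Jp_ptens[OF vs, of v x] Jp_ptens[OF ws, of "f v" x] fc by simp
 qed (use W in simp)
 let ?p = "snd (EE (V, p))" and ?q = "snd (EE (W, q))"
 have d: "EE (V, p) \<in> dkob" "EE (W, q) \<in> dkob" using EE_dkob p q by auto
 have pq: "?p : Ar R.MR" "fst ?p = resR V" "cod ?p = rtens R (resR V) X"
 "?q : Ar R.MR" "fst ?q = resR W" "cod ?q = rtens R (resR W) X"
 using d by (simp_all add: EE_def dkob_def dcom_iff)
 have e: "(afun q (f m) = tmap BA V YY W YY f (idc YY) (afun p m)) =
 (afun ?q (f m) = tmap R (resR V) X (resR W) X f (idc X) (afun ?p m))" if m: "m IN V" for m
 proof -
 have a: "afun ?p m = Up (resR V) V (afun p m)" "afun ?q (f m) = Up (resR W) W (afun q (f m))" using m fc by (simp_all add: EE_def)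
 note c = ordcom_closed[OF p m] ordcom_closed[OF q fc[OF m]]
 have pc: "afun ?p m IN (tens R (resR V) X)" unfolding a by (rule lin_closed[OF Up_lin[OF vs] c(1)])
 note tc = lin_closed[OF rlin pc]
 have "tmap BA V YY W YY f (idc YY) (afun p m) = Jp W (tmap R (resR V) X (resR W) X f (idc C) (afun ?p m))"
 using t[OF pc] Jp_Up[OF vs c(1)] a by simp
 then show ?thesis using Up_Jp[OF ws tc] Jp_Up[OF ws c(2)] a by (metis hb_simps(1))
 qed
 have "CM ?q (resR V, f, resR W) = CM (AM (resR V, f, resR W) (IR X)) ?p \<longleftrightarrow>
 (ALL m:carrier (resR V). afun ?q (f m) = tmap R (resR V) X (resR W) X f (idc X) (afun ?p m))"
 using R.comodule_arrow_iff[OF X_bm fA _ _ pq, of] by simp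
 then show "(ALL m:carrier V. afun q (f m) = tmap BA V YY W YY f (idc YY) (afun p m)) \<longleftrightarrow>
 (resR V, f, resR W) : Ar R.MR & CM ?q (resR V, f, resR W) = CM (AM (resR V, f, resR W) (IR X)) ?p"
 using fA e by simp
qed

lemma dk_module_cat_eq: "dk_module_cat K R H A mA uA C dC eC = structured_cat (mod_cat K BA) dkob fst
 (%(M, r) f (N, \<sigma>). ((resR M, r), (resR M, afun f, resR N), (resR N, \<sigma>)) \<in>
 Ar (comodule_cat R.RMR R.MR X (dk_comult R H C dC) (dk_counit R H C eC)))"
proof -
 have "Ob (mod_cat K BA) = {M. rm K BA M}" by (simp add: M.c_simps)
 moreover have "Ob (comodule_cat R.RMR R.MR X (dk_comult R H C dC) (dk_counit R H C eC)) = {x. dcom x}" by (simp add: comodule_cat_def)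
 moreover have "tens R (resR V) X = tens R (resR V) X" for V ..
 ultimately show ?thesis
 by (simp add: dk_module_cat_def Let_def dkob_def dk_act_def[abs_def] flip: BA_def resR_def)
qed

theorem GG_iso:
 "category_isomorphism (corep_cat R.RMR R.MR A' mm ee CC) (dk_module_cat K R H A mA uA C dC eC) GG (%(x, g, y). same_map GG x g y)"
proof -
 have ob: "fst x \<in> {M. rm K R M}" if "x \<in> {x. corep x}" for x
 using that by (cases x) (auto dest: rep(1) rmodA(1) act_simps(1))
 have ob': "fst y \<in> {M. rm K BA M}" if "y \<in> dkob" for y
 using that by (cases y) (auto simp: dkob_def)
 have bij: "bij_betw GG {x. corep x} dkob"
 using bij_betw_trans[OF FF_bij EE_bij] bij_betw_cong[of "{x. corep x}" GG "EE \<circ> FF"] GG_eq by simp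
 \<comment> \<open>This time the corepresentations are the side already known to be a
   category.\<close>
 have cat: "category (corep_cat R.RMR R.MR A' mm ee CC)"
 using FF_iso by (simp add: category_isomorphism_def functor_on_def)
 have "category_isomorphism (corep_cat R.RMR R.MR A' mm ee CC) (dk_module_cat K R H A mA uA C dC eC)
 GG (%(x, g, y). (GG x, (fst (GG x), afun g, fst (GG y)), GG y))"
 using cat unfolding corep_cat_def dk_module_cat_eq
 proof (intro structured_iso[OF D.concrete_category_axioms M.concrete_category_axioms ob ob' bij])
 fix x y f assume xy: "x \<in> {x. corep x}" "y \<in> {x. corep x}"
 obtain M mu r N nu p where e: "x = (M, mu, r)" "y = (N, nu, p)" by (cases x; cases y) blast
 have c: "corep (M, mu, r)" "corep (N, nu, p)" using xy e by auto
 note o = rep(5)[OF c(1)] rep(5)[OF c(2)]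
 have g: "GG x = EE (FF x)" "GG y = EE (FF y)" using GG_eq xy by auto
 have d: "GG x \<in> dkob" "GG y \<in> dkob" using bij xy by (auto simp: bij_betw_def)
 define P where "P = snd (EE (oM M mu, (oM M mu, coord M mu r, rtens BA (oM M mu) YY)))"
 define P' where "P' = snd (EE (oM N nu, (oM N nu, coord N nu p, rtens BA (oM N nu) YY)))"
 have xP: "GG x = (oM M mu, P)" "GG y = (oM N nu, P')"
 using g unfolding P_def P'_def e rep(6)[OF c(1)] rep(6)[OF c(2)] by (simp_all add: EE_def)
 have MQ: "(V, f, W) : Ar (mod_cat K BA) \<longleftrightarrow> (V, f, W) : Ar Q.MR" for V W
 by (simp add: M.ar_iff D.ar_iff del: arrow_ob)
 have d': "dcom (resR (oM M mu), P)" "dcom (resR (oM N nu), P')"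
 using d xP by (auto simp: dkob_def)
 have m: "((resR (oM M mu), P), (resR (oM M mu), f, resR (oM N nu)), (resR (oM N nu), P')) \<in>
 Ar (comodule_cat R.RMR R.MR X (dk_comult R H C dC) (dk_counit R H C eC)) \<longleftrightarrow>
 (resR (oM M mu), f, resR (oM N nu)) : Ar R.MR &
 CM P' (resR (oM M mu), f, resR (oM N nu)) = CM (AM (resR (oM M mu), f, resR (oM N nu)) (IR X)) P"
 using d' by (simp add: comodule_cat_def D.hom_iff)
 note chain = trans[OF corep_arrow[OF c, of f, unfolded ordM_simps(1) afun_triple] EE_arrow[OF o, of f, folded P_def P'_def, unfolded ordM_simps(1) afun_triple]]
 show "(fst x, f, fst y) : Ar R.MR & (case x of (M, mu, r) \<Rightarrow> %f (N, nu, \<sigma>). CM f mu = CM nu (AM f (IR A')) &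
 CM \<sigma> f = CM (bal_map R.RMR R.MR A' M mu (cor_ob CC) (cor_lact CC) f N nu (cor_ob CC) (cor_lact CC) (IR (cor_ob CC))) r)
 (fst x, f, fst y) y \<longleftrightarrow>
 (fst (GG x), f, fst (GG y)) : Ar (mod_cat K BA) & (case GG x of (M, r) \<Rightarrow> %f (N, \<sigma>). ((resR M, r), (resR M, afun f, resR N), (resR N, \<sigma>)) \<in>
 Ar (comodule_cat R.RMR R.MR X (dk_comult R H C dC) (dk_counit R H C eC))) (fst (GG x), f, fst (GG y)) (GG y)"
 unfolding e xP[unfolded e] MQ prod.case fst_conv CC_simps(1) afun_triple m by (rule chain)
 next
 show "carrier (fst (GG x)) = carrier (fst x)" if "x \<in> {x. corep x}" for x
 using that rep(6) GG_eq by (cases x) (simp add: EE_def)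
 qed simp_all
 then show ?thesis by (simp add: same_map_def[abs_def])
qed

end

theorem proposition5p13:
  fixes K :: "('k, 'x) ring_scheme"
    and R :: "('k, 'a univ) module"
    and H :: "('k, 'a univ) bialgebroid"
    and A :: "('k, 'a univ) rcomod" and mA uA :: "('k, 'a univ) carr"
    and C :: "('k, 'a univ) rmod" and dC eC :: "('k, 'a univ) rarr"
  assumes datum: "doi_koppinen_datum K R H A mA uA C dC eC"
  shows
    "let RMR = bimod_moncat K R; MR = mod_actcat K R;
         A' = comod_bimod R H A; m = dk_mult R H A mA; \<eta> = dk_unit R H A uA;
         X = hmod_bimod R H C;
         \<psi> = dk_psi R H A C; \<delta> = dk_delta R H A uA C dC; f = dk_f R H A uA C eC;
         \<CC> = cowreath_coring RMR A' m X \<psi> \<delta> f;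
         Corep = corep_cat RMR MR A' m \<eta> \<CC>;
         F = forget_R_ob K R A' m \<eta> \<CC>;
         G = to_dk_ob K R A' m X
     in (\<forall>r \<in> carrier R. lact A' r (dk_one R uA) = ract A' (dk_one R uA) r) \<and>
        cowreath RMR A' m \<eta> X \<psi> \<delta> f \<and>
        right_category RMR MR \<and>
        category_isomorphism Corep (ord_comodule_cat K R A' m \<eta> \<CC>)
          F (\<lambda>(x, g, y). same_map F x g y) \<and>
        category_isomorphism Corep (dk_module_cat K R H A mA uA C dC eC)
          G (\<lambda>(x, g, y). same_map G x g y)"
proof -
 interpret d: doi_koppinen_datum K R H A mA uA C dC eC by (rule datum)
 interpret dk K R H A mA uA C dC eC
 by (intro dk.intro bgd.intro dk_axioms.intro) (rule d.base_field d.base_algebra d.bialgebroid d.comodule_algebra d.module_coalgebra)+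
 \<comment> \<open>Both actions of r on 1_A equal \<eta>(r), so the two formulas for i(r)
   agree.\<close>
 have "ALL r:carrier R. lact A' r uno = ract A' uno r" using eta_eq by metis
 then show ?thesis
 using cowreath_A_C R.right_cat FF_iso GG_iso by (simp only: Let_def CC_def simp_thms)
qed

end
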